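(* Let $n\ge1$. For every group $G=G(m,p,n)$, the invariant subring $O_q(\mathsf{k}^{2n})^G$ of the quantum affine space is a Galois order over $\Gamma=\mathsf{k}[x_1,\dots,x_n]^G$. Moreover, $O_q(\mathsf{k}^{2n})^G$ is free as a left $\Gamma$-module and free as a right $\Gamma$-module.
   Context: $\mathsf{k}$ is an algebraically closed field of characteristic $0$; all rings are $\mathsf{k}$-algebras; $q\in\mathsf{k}$ is nonzero and not a root of unity. Quantum affine space: the quantum plane is $\mathsf{k}_q[x,y]=\mathsf{k}\langle x,y\mid yx=qxy\rangle$, and $O_q(\mathsf{k}^{2n})=\mathsf{k}_q[x_1,y_1]\otimes_{\mathsf{k}}\cdots\otimes_{\mathsf{k}}\mathsf{k}_q[x_n,y_n]$; $\mathsf{k}[x_1,\dots,x_n]$ is its subalgebra generated by the $x_i$. Group and action: $G_m\subset\mathsf{k}^*$ is the group of $m$-th roots of unity. For $m\ge1$, $n\ge1$, $p>0$ with $p\mid m$, $A(m,p,n)=\{(h_1,\dots,h_n)\in G_m^{n}\mid(h_1\cdots h_n)^{m/p}=1\}$ and $G(m,p,n)=A(m,p,n)\rtimes S_n$, with $S_n$ permuting the entries. An element $h=(g,\pi)$ acts on $O_q(\mathsf{k}^{2n})$ by algebra automorphisms with $h(x_i)=g_ix_{\pi(i)}$, $h(y_i)=y_{\pi(i)}$. Galois orders: Let $\Gamma$ be a commutative domain with field of fractions $K$, $L$ a finite Galois extension of $K$ with Galois group $H=\mathrm{Gal}(L/K)$, and $\mathfrak{M}\subset\mathrm{Aut}_{\mathsf{k}}L$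 a monoid such that any $m,m'\in\mathfrak{M}$ with the same restriction to $K$ are equal, and on which $H$ acts by conjugation. $L*\mathfrak{M}$ is the skew monoid ring ($m\ell=m(\ell)m$), with $H$ acting by $h(\ell m)=h(\ell)\,(hmh^{-1})$. A finitely generated $\Gamma$-ring $U$ with $\Gamma\subset U\subset(L*\mathfrak{M})^H$ is a Galois ring over $\Gamma$ if $KU=UK=(L*\mathfrak{M})^H$. It is a right (left) Galois order over $\Gamma$ if moreover for every finite-dimensional right (left) $K$-subspace $W\subset(L*\mathfrak{M})^H$, $W\cap U$ is a finitely generated right (left) $\Gamma$-module; it is a Galois order if it is both a left and a right Galois order. An algebra containing $\Gamma$ is called a Galois order over $\Gamma$ if it is isomorphic, over $\Gamma$, to such a $U$ for some choice of $L$ and $\mathfrak{M}$. *)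

theory Defs
  imports
    "HOL-Library.Poly_Mapping"
    "HOL-Combinatorics.Permutations"
    "HOL-Computational_Algebra.Polynomial"
    "HOL-Computational_Algebra.Fraction_Field"
    "HOL-Algebra.Algebra"
begin

section \<open>Algebras over a field\<close>

text \<open>
  The base field is a type \<open>'k\<close>. An algebra over it is a \<^type>\<open>module_ext\<close> record: a ring
  together with a scalar multiplication.
\<close>

definition monoid_algebra :: "('m, 'b) monoid_scheme \<Rightarrow> ('k::field, 'm \<Rightarrow>\<^sub>0 'k) module" where
  "monoid_algebra M =
    \<lparr>carrier = {f. Poly_Mapping.keys f \<subseteq> carrier M},
     monoid.mult = (\<lambda>f g. \<Sum>a\<in>Poly_Mapping.keys f. \<Sum>b\<in>Poly_Mapping.keys g.
       Poly_Mapping.single (a \<otimes>\<^bsub>M\<^esub> b) (Poly_Mapping.lookup f a * Poly_Mapping.lookup g b)),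
     monoid.one = Poly_Mapping.single \<one>\<^bsub>M\<^esub> 1,
     ring.zero = 0,
     ring.add = (+),
     module.smult = (\<lambda>c. Poly_Mapping.map ((*) c))\<rparr>"

definition free_monoid :: "'a set \<Rightarrow> 'a list monoid" where
  "free_monoid S = \<lparr>carrier = lists S, monoid.mult = (@), one = []\<rparr>"

text \<open>\<^const>\<open>FactRing\<close> with the induced scalar multiplication.\<close>

definition quotient_algebra :: "('k, 'a, 'b) module_scheme \<Rightarrow> 'a set \<Rightarrow> ('k, 'a set) module" where
  "quotient_algebra A I =
    ring.extend (A Quot I) (module.fields (\<lambda>c C. \<Union>a\<in>C. I +>\<^bsub>A\<^esub> (c \<odot>\<^bsub>A\<^esub> a)))"

definition scalars :: "('k, 'a, 'b) module_scheme \<Rightarrow> 'a set" where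
  "scalars A = range (\<lambda>c. c \<odot>\<^bsub>A\<^esub> \<one>\<^bsub>A\<^esub>)"

definition algebra_auts :: "('k, 'a, 'b) module_scheme \<Rightarrow> ('a \<Rightarrow> 'a) set" where
  "algebra_auts A =
    {\<phi> \<in> Bij (carrier A) \<inter> ring_hom A A. \<forall>c. \<forall>a\<in>carrier A. \<phi> (c \<odot>\<^bsub>A\<^esub> a) = c \<odot>\<^bsub>A\<^esub> \<phi> a}"

definition subalgebra_generated :: "('k, 'a, 'b) module_scheme \<Rightarrow> 'a set \<Rightarrow> 'a set" where
  "subalgebra_generated A S = generate_ring A (scalars A \<union> S)"

text \<open>
  The tensor product of a finite family of algebras: the vector space spanned by the tuples
  (the pure tensors), modulo multilinearity. Tuples are multiplied entry by entry, so that this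
  space is the monoid algebra of the product of the multiplicative monoids, in which the
  multilinearity relations already span a two-sided ideal.
\<close>

definition tensor_relations ::
  "'i set \<Rightarrow> ('i \<Rightarrow> ('k::field, 'a) module) \<Rightarrow> (('i \<Rightarrow> 'a) \<Rightarrow>\<^sub>0 'k) set" where
  "tensor_relations I A =
    {Poly_Mapping.single (t(i := a \<oplus>\<^bsub>A i\<^esub> b)) 1
       - Poly_Mapping.single (t(i := a)) 1 - Poly_Mapping.single (t(i := b)) 1
     | t i a b. t \<in> (\<Pi>\<^sub>E j\<in>I. carrier (A j)) \<and> i \<in> I \<and> a \<in> carrier (A i) \<and> b \<in> carrier (A i)} \<union>
    {Poly_Mapping.single (t(i := c \<odot>\<^bsub>A i\<^esub> a)) 1 - Poly_Mapping.single (t(i := a)) c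
     | t i a c. t \<in> (\<Pi>\<^sub>E j\<in>I. carrier (A j)) \<and> i \<in> I \<and> a \<in> carrier (A i)}"

definition tensor_ideal ::
  "'i set \<Rightarrow> ('i \<Rightarrow> ('k::field, 'a) module) \<Rightarrow> (('i \<Rightarrow> 'a) \<Rightarrow>\<^sub>0 'k) set" where
  "tensor_ideal I A = genideal (monoid_algebra (product_group I A)) (tensor_relations I A)"

definition tensor_algebra ::
  "'i set \<Rightarrow> ('i \<Rightarrow> ('k::field, 'a) module) \<Rightarrow> ('k, (('i \<Rightarrow> 'a) \<Rightarrow>\<^sub>0 'k) set) module" where
  "tensor_algebra I A = quotient_algebra (monoid_algebra (product_group I A)) (tensor_ideal I A)"

text \<open>The \<open>i\<close>-th canonical map: \<open>a\<close> goes to \<open>1 \<otimes> \<dots> \<otimes> a \<otimes> \<dots> \<otimes> 1\<close>.\<close>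

definition tensor_inj ::
  "'i set \<Rightarrow> ('i \<Rightarrow> ('k::field, 'a) module) \<Rightarrow> 'i \<Rightarrow> 'a \<Rightarrow> (('i \<Rightarrow> 'a) \<Rightarrow>\<^sub>0 'k) set" where
  "tensor_inj I A i a = tensor_ideal I A +>\<^bsub>monoid_algebra (product_group I A)\<^esub>
     Poly_Mapping.single (\<lambda>j\<in>I. if j = i then a else \<one>\<^bsub>A j\<^esub>) 1"


section \<open>Quantum affine space\<close>

datatype plane_gen = PX | PY

definition plane_ideal :: "'k::field \<Rightarrow> (plane_gen list \<Rightarrow>\<^sub>0 'k) set" where
  "plane_ideal q = genideal (monoid_algebra (free_monoid UNIV))
     {Poly_Mapping.single [PY, PX] 1 - Poly_Mapping.single [PX, PY] q}"

definition quantum_plane :: "'k::field \<Rightarrow> ('k, (plane_gen list \<Rightarrow>\<^sub>0 'k) set) module" where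
  "quantum_plane q = quotient_algebra (monoid_algebra (free_monoid UNIV)) (plane_ideal q)"

definition plane_var :: "'k::field \<Rightarrow> plane_gen \<Rightarrow> (plane_gen list \<Rightarrow>\<^sub>0 'k) set" where
  "plane_var q v = plane_ideal q +>\<^bsub>monoid_algebra (free_monoid UNIV)\<^esub> Poly_Mapping.single [v] 1"

type_synonym 'k quantum_elt = "((nat \<Rightarrow> (plane_gen list \<Rightarrow>\<^sub>0 'k) set) \<Rightarrow>\<^sub>0 'k) set"

text \<open>The variables are numbered \<open>0, \<dots>, n - 1\<close>.\<close>

definition quantum_affine_space :: "'k::field \<Rightarrow> nat \<Rightarrow> ('k, 'k quantum_elt) module" where
  "quantum_affine_space q n = tensor_algebra {..<n} (\<lambda>_. quantum_plane q)"

definition xvar :: "'k::field \<Rightarrow> nat \<Rightarrow> nat \<Rightarrow> 'k quantum_elt" where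
  "xvar q n i = tensor_inj {..<n} (\<lambda>_. quantum_plane q) i (plane_var q PX)"

definition yvar :: "'k::field \<Rightarrow> nat \<Rightarrow> nat \<Rightarrow> 'k quantum_elt" where
  "yvar q n i = tensor_inj {..<n} (\<lambda>_. quantum_plane q) i (plane_var q PY)"


section \<open>The groups $G(m,p,n)$ and their invariants\<close>

definition A_group :: "nat \<Rightarrow> nat \<Rightarrow> nat \<Rightarrow> (nat \<Rightarrow> 'k::field) set" where
  "A_group m p n = {h \<in> {..<n} \<rightarrow>\<^sub>E {z. z ^ m = 1}. (\<Prod>i<n. h i) ^ (m div p) = 1}"

text \<open>
  Only the underlying set of the semidirect product is needed: the fixed elements depend on
  the set of automorphisms by which it acts, not on how pairs are multiplied.
\<close>

definition G_group :: "nat \<Rightarrow> nat \<Rightarrow> nat \<Rightarrow> ((nat \<Rightarrow> 'k::field) \<times> (nat \<Rightarrow> nat)) set" where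
  "G_group m p n = A_group m p n \<times> {\<pi>. \<pi> permutes {..<n}}"

definition G_act ::
  "'k::field \<Rightarrow> nat \<Rightarrow> (nat \<Rightarrow> 'k) \<times> (nat \<Rightarrow> nat) \<Rightarrow> 'k quantum_elt \<Rightarrow> 'k quantum_elt" where
  "G_act q n = (\<lambda>(g, \<pi>). THE \<phi>. \<phi> \<in> algebra_auts (quantum_affine_space q n) \<and>
     (\<forall>i<n. \<phi> (xvar q n i) = g i \<odot>\<^bsub>quantum_affine_space q n\<^esub> xvar q n (\<pi> i) \<and>
            \<phi> (yvar q n i) = yvar q n (\<pi> i)))"

definition invariants ::
  "'k::field \<Rightarrow> nat \<Rightarrow> nat \<Rightarrow> nat \<Rightarrow> 'k quantum_elt set \<Rightarrow> 'k quantum_elt set" where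
  "invariants q m p n S = {a \<in> S. \<forall>h\<in>G_group m p n. G_act q n h a = a}"

definition quantum_invariant_ring ::
  "'k::field \<Rightarrow> nat \<Rightarrow> nat \<Rightarrow> nat \<Rightarrow> ('k, 'k quantum_elt) module" where
  "quantum_invariant_ring q m p n = (quantum_affine_space q n)
     \<lparr>carrier := invariants q m p n (carrier (quantum_affine_space q n))\<rparr>"

definition polynomial_invariants ::
  "'k::field \<Rightarrow> nat \<Rightarrow> nat \<Rightarrow> nat \<Rightarrow> 'k quantum_elt set" where
  "polynomial_invariants q m p n =
     invariants q m p n (subalgebra_generated (quantum_affine_space q n) (xvar q n ` {..<n}))"


section \<open>Left and right modules over a subring\<close>

text \<open>
  The additive subgroups \<open>AB\<close> and \<open>BA\<close>; for a subring \<open>A\<close>, these are the left and the right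
  \<open>A\<close>-submodule generated by \<open>B\<close>.
\<close>

definition left_span :: "('a, 'b) ring_scheme \<Rightarrow> 'a set \<Rightarrow> 'a set \<Rightarrow> 'a set" where
  "left_span R A B = generate (add_monoid R) (A <#>\<^bsub>R\<^esub> B)"

definition right_span :: "('a, 'b) ring_scheme \<Rightarrow> 'a set \<Rightarrow> 'a set \<Rightarrow> 'a set" where
  "right_span R A B = generate (add_monoid R) (B <#>\<^bsub>R\<^esub> A)"

definition fin_gen_left :: "('a, 'b) ring_scheme \<Rightarrow> 'a set \<Rightarrow> 'a set \<Rightarrow> bool" where
  "fin_gen_left R A N \<longleftrightarrow> (\<exists>B. finite B \<and> B \<subseteq> N \<and> N = left_span R A B)"

definition fin_gen_right :: "('a, 'b) ring_scheme \<Rightarrow> 'a set \<Rightarrow> 'a set \<Rightarrow> bool" where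
  "fin_gen_right R A N \<longleftrightarrow> (\<exists>B. finite B \<and> B \<subseteq> N \<and> N = right_span R A B)"

text \<open>Finitely supported families of coefficients in \<open>A\<close>, indexed by \<open>B\<close> and zero elsewhere.\<close>

definition coefficients :: "('a, 'b) ring_scheme \<Rightarrow> 'a set \<Rightarrow> 'a set \<Rightarrow> ('a \<Rightarrow> 'a) set" where
  "coefficients R A B =
     {c. c \<in> B \<rightarrow> A \<and> (\<forall>b. b \<notin> B \<longrightarrow> c b = \<zero>\<^bsub>R\<^esub>) \<and> finite {b. c b \<noteq> \<zero>\<^bsub>R\<^esub>}}"

definition left_free :: "('a, 'b) ring_scheme \<Rightarrow> 'a set \<Rightarrow> bool" where
  "left_free R A \<longleftrightarrow> (\<exists>B\<subseteq>carrier R. \<forall>u\<in>carrier R.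
     \<exists>!c. c \<in> coefficients R A B \<and> u = (\<Oplus>\<^bsub>R\<^esub>b\<in>{b. c b \<noteq> \<zero>\<^bsub>R\<^esub>}. c b \<otimes>\<^bsub>R\<^esub> b))"

definition right_free :: "('a, 'b) ring_scheme \<Rightarrow> 'a set \<Rightarrow> bool" where
  "right_free R A \<longleftrightarrow> (\<exists>B\<subseteq>carrier R. \<forall>u\<in>carrier R.
     \<exists>!c. c \<in> coefficients R A B \<and> u = (\<Oplus>\<^bsub>R\<^esub>b\<in>{b. c b \<noteq> \<zero>\<^bsub>R\<^esub>}. b \<otimes>\<^bsub>R\<^esub> c b))"


section \<open>Galois extensions and skew monoid rings\<close>

definition fraction_subfield :: "('l, 'b) ring_scheme \<Rightarrow> 'l set \<Rightarrow> 'l set" where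
  "fraction_subfield L \<Gamma> = {a \<otimes>\<^bsub>L\<^esub> inv\<^bsub>L\<^esub> b | a b. a \<in> \<Gamma> \<and> b \<in> \<Gamma> - {\<zero>\<^bsub>L\<^esub>}}"

definition field_auts :: "('l, 'b) ring_scheme \<Rightarrow> 'l set \<Rightarrow> ('l \<Rightarrow> 'l) set" where
  "field_auts L K = {\<sigma> \<in> Bij (carrier L) \<inter> ring_hom L L. \<forall>x\<in>K. \<sigma> x = x}"

text \<open>Galois in Artin's sense: the automorphisms over \<open>K\<close> fix nothing outside \<open>K\<close>.\<close>

definition finite_galois_extension :: "('l, 'b) ring_scheme \<Rightarrow> 'l set \<Rightarrow> bool" where
  "finite_galois_extension L K \<longleftrightarrow> field L \<and> subfield K L \<and>
     ring.finite_dimension L K (carrier L) \<and>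
     {x \<in> carrier L. \<forall>\<sigma>\<in>field_auts L K. \<sigma> x = x} = K"

text \<open>
  An element \<open>\<Sum>\<^sub>m \<ell>\<^sub>m m\<close> of the skew monoid ring is the finitely supported function
  \<open>m \<mapsto> \<ell>\<^sub>m\<close>, and \<open>(\<ell> a)(\<ell>' b) = \<ell> a(\<ell>') ab\<close>.
\<close>

definition skew_monoid_ring ::
  "('l, 'b) ring_scheme \<Rightarrow> ('l \<Rightarrow> 'l) set \<Rightarrow> (('l \<Rightarrow> 'l) \<Rightarrow> 'l) ring" where
  "skew_monoid_ring L M =
    \<lparr>carrier = {f. range f \<subseteq> carrier L \<and> finite {a. f a \<noteq> \<zero>\<^bsub>L\<^esub>} \<and> {a. f a \<noteq> \<zero>\<^bsub>L\<^esub>} \<subseteq> M},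
     monoid.mult = (\<lambda>f g c. finsum L (\<lambda>(a, b). f a \<otimes>\<^bsub>L\<^esub> a (g b))
       {(a, b). f a \<noteq> \<zero>\<^bsub>L\<^esub> \<and> g b \<noteq> \<zero>\<^bsub>L\<^esub> \<and> a \<otimes>\<^bsub>BijGroup (carrier L)\<^esub> b = c}),
     monoid.one = (\<lambda>a. if a = \<one>\<^bsub>BijGroup (carrier L)\<^esub> then \<one>\<^bsub>L\<^esub> else \<zero>\<^bsub>L\<^esub>),
     ring.zero = (\<lambda>_. \<zero>\<^bsub>L\<^esub>),
     ring.add = (\<lambda>f g a. f a \<oplus>\<^bsub>L\<^esub> g a)\<rparr>"

definition skew_embed :: "('l, 'b) ring_scheme \<Rightarrow> 'l \<Rightarrow> ('l \<Rightarrow> 'l) \<Rightarrow> 'l" where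
  "skew_embed L x = (\<lambda>a. if a = \<one>\<^bsub>BijGroup (carrier L)\<^esub> then x else \<zero>\<^bsub>L\<^esub>)"

definition aut_conj :: "('l, 'b) ring_scheme \<Rightarrow> ('l \<Rightarrow> 'l) \<Rightarrow> ('l \<Rightarrow> 'l) \<Rightarrow> 'l \<Rightarrow> 'l" where
  "aut_conj L h a = h \<otimes>\<^bsub>BijGroup (carrier L)\<^esub> a \<otimes>\<^bsub>BijGroup (carrier L)\<^esub> inv\<^bsub>BijGroup (carrier L)\<^esub> h"

text \<open>
  \<open>h(\<Sum>\<^sub>a \<ell>\<^sub>a a) = \<Sum>\<^sub>a h(\<ell>\<^sub>a) (h a h\<inverse>)\<close>: the coefficient at \<open>a\<close> of the image is
  \<open>h\<close> applied to the coefficient at \<open>h\<inverse> a h\<close>.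
\<close>

definition skew_act ::
  "('l, 'b) ring_scheme \<Rightarrow> ('l \<Rightarrow> 'l) set \<Rightarrow> ('l \<Rightarrow> 'l) \<Rightarrow> (('l \<Rightarrow> 'l) \<Rightarrow> 'l) \<Rightarrow> ('l \<Rightarrow> 'l) \<Rightarrow> 'l" where
  "skew_act L M h f =
     (\<lambda>a. if a \<in> M then h (f (aut_conj L (inv\<^bsub>BijGroup (carrier L)\<^esub> h) a)) else \<zero>\<^bsub>L\<^esub>)"

definition skew_invariants ::
  "('l, 'b) ring_scheme \<Rightarrow> ('l \<Rightarrow> 'l) set \<Rightarrow> ('l \<Rightarrow> 'l) set \<Rightarrow> (('l \<Rightarrow> 'l) \<Rightarrow> 'l) set" where
  "skew_invariants L M H =
     {f \<in> carrier (skew_monoid_ring L M). \<forall>h\<in>H. skew_act L M h f = f}"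


section \<open>Galois rings and Galois orders\<close>

text \<open>
  \<open>F\<close> is the copy of the base field in \<open>\<Gamma>\<close>; it is what makes all rings in sight algebras over
  the base field.
\<close>

definition galois_setting ::
  "('l, 'b) ring_scheme \<Rightarrow> 'l set \<Rightarrow> 'l set \<Rightarrow> ('l \<Rightarrow> 'l) set \<Rightarrow> bool" where
  "galois_setting L F \<Gamma> M \<longleftrightarrow>
     field L \<and> subfield F L \<and> F \<subseteq> \<Gamma> \<and> subdomain \<Gamma> L \<and>
     finite_galois_extension L (fraction_subfield L \<Gamma>) \<and>
     submonoid M (BijGroup (carrier L)) \<and> M \<subseteq> field_auts L F \<and>
     (\<forall>a\<in>M. \<forall>b\<in>M. (\<forall>x\<in>fraction_subfield L \<Gamma>. a x = b x) \<longrightarrow> a = b) \<and>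
     (\<forall>h\<in>field_auts L (fraction_subfield L \<Gamma>). \<forall>a\<in>M. aut_conj L h a \<in> M)"

definition embedded_galois_ring ::
  "('l, 'b) ring_scheme \<Rightarrow> 'l set \<Rightarrow> ('l \<Rightarrow> 'l) set \<Rightarrow> (('l \<Rightarrow> 'l) \<Rightarrow> 'l) set \<Rightarrow> bool" where
  "embedded_galois_ring L \<Gamma> M U \<longleftrightarrow>
    (let R = skew_monoid_ring L M;
         K = fraction_subfield L \<Gamma>;
         \<K> = skew_invariants L M (field_auts L K)
     in subring U R \<and> skew_embed L ` \<Gamma> \<subseteq> U \<and> U \<subseteq> \<K> \<and>
        (\<exists>S. finite S \<and> S \<subseteq> U \<and> U = generate_ring R (skew_embed L ` \<Gamma> \<union> S)) \<and>
        left_span R (skew_embed L ` K) U = \<K> \<and>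
        right_span R (skew_embed L ` K) U = \<K>)"

definition embedded_left_galois_order ::
  "('l, 'b) ring_scheme \<Rightarrow> 'l set \<Rightarrow> ('l \<Rightarrow> 'l) set \<Rightarrow> (('l \<Rightarrow> 'l) \<Rightarrow> 'l) set \<Rightarrow> bool" where
  "embedded_left_galois_order L \<Gamma> M U \<longleftrightarrow> embedded_galois_ring L \<Gamma> M U \<and>
    (let R = skew_monoid_ring L M;
         K = fraction_subfield L \<Gamma>
     in \<forall>W \<subseteq> skew_invariants L M (field_auts L K).
          fin_gen_left R (skew_embed L ` K) W \<longrightarrow> fin_gen_left R (skew_embed L ` \<Gamma>) (W \<inter> U))"

definition embedded_right_galois_order ::
  "('l, 'b) ring_scheme \<Rightarrow> 'l set \<Rightarrow> ('l \<Rightarrow> 'l) set \<Rightarrow> (('l \<Rightarrow> 'l) \<Rightarrow> 'l) set \<Rightarrow> bool" where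
  "embedded_right_galois_order L \<Gamma> M U \<longleftrightarrow> embedded_galois_ring L \<Gamma> M U \<and>
    (let R = skew_monoid_ring L M;
         K = fraction_subfield L \<Gamma>
     in \<forall>W \<subseteq> skew_invariants L M (field_auts L K).
          fin_gen_right R (skew_embed L ` K) W \<longrightarrow> fin_gen_right R (skew_embed L ` \<Gamma>) (W \<inter> U))"

text \<open>
  \<open>A\<close> is a ring with subrings \<open>F \<subseteq> \<Gamma>\<close>, where \<open>F\<close> is the base field. The field \<open>L\<close> ranges over all
  fields whose underlying set lies in the type \<open>'l\<close>, since one cannot quantify over types; being a
  finite extension of the fraction field of \<open>\<Gamma>\<close>, it has the cardinality of \<open>\<Gamma>\<close> if \<open>\<Gamma>\<close> is infinite,
  so no choice is lost, up to isomorphism, if \<open>'l\<close> has at least that many elements.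
\<close>

definition galois_order ::
  "'l itself \<Rightarrow> 'a set \<Rightarrow> 'a set \<Rightarrow> ('a, 'b) ring_scheme \<Rightarrow> bool" where
  "galois_order _ F \<Gamma> A \<longleftrightarrow> ring A \<and> subring F A \<and> subring \<Gamma> A \<and> F \<subseteq> \<Gamma> \<and>
     (\<exists>(L :: 'l ring) M U \<iota> \<phi>.
        \<iota> \<in> ring_hom (A\<lparr>carrier := \<Gamma>\<rparr>) L \<and> inj_on \<iota> \<Gamma> \<and>
        galois_setting L (\<iota> ` F) (\<iota> ` \<Gamma>) M \<and>
        embedded_left_galois_order L (\<iota> ` \<Gamma>) M U \<and> embedded_right_galois_order L (\<iota> ` \<Gamma>) M U \<and>
        \<phi> \<in> ring_iso A ((skew_monoid_ring L M)\<lparr>carrier := U\<rparr>) \<and>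
        (\<forall>\<gamma>\<in>\<Gamma>. \<phi> \<gamma> = skew_embed L (\<iota> \<gamma>)))"

end

theory Submission
  imports Defs "HOL-Library.Product_Lexorder"
begin

text \<open>
  The quantum affine space is a polynomial ring in disguise. Ordering monomials as \<open>x\<^sup>a y\<^sup>\<beta>\<close>
  identifies it with the polynomials in the \<open>y\<^sub>i\<close> over \<open>P = k[x\<^sub>1, \<dots>, x\<^sub>n]\<close>, multiplied by the rule
  \<open>y\<^sup>\<beta> f = \<sigma>\<^sub>\<beta>(f) y\<^sup>\<beta>\<close>, where the dilation \<open>\<sigma>\<^sub>\<beta>\<close> multiplies \<open>x\<^sub>i\<close> by the \<open>\<beta>\<^sub>i\<close>-th power of \<open>q\<close>
  (\<open>qas_of_eval\<close>, \<open>qas_eval_of\<close>, \<open>qas_eval_mult\<close>). The same set also carries the commutative product of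
  \<open>P[y\<^sub>1, \<dots>, y\<^sub>n]\<close>. Both products have the same left multiplication by elements of \<open>P\<close> and the same
  right multiplication by polynomials in the \<open>y\<^sub>i\<close> alone, and \<open>G\<close> acts by automorphisms of both. So the left
  \<open>\<Gamma>\<close>-module of invariants can be studied with commutative algebra. The right module is no different: the
  map \<open>twist\<close>, which applies \<open>\<sigma>\<^sub>\<beta>\<close> inverse to the coefficient of \<open>y\<^sup>\<beta>\<close>, commutes with \<open>G\<close> and turns
  right multiplication by \<open>P\<close> into left multiplication.

  For the embedding, let \<open>L\<close> be the fraction field of \<open>P\<close>, let \<open>\<Gamma> = P\<^sup>G\<close> and let \<open>M\<close> be the monoid of all dilations
  \<open>\<sigma>\<^sub>\<beta>\<close>. Norms make denominators invariant, so \<open>K = L\<^sup>G\<close> is the fraction field of \<open>\<Gamma>\<close>, and the Galois group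
  is \<open>G\<close> itself (\<open>field_auts_K\<close>): an automorphism over \<open>K\<close> permutes the roots \<open>x\<^sub>i\<^sup>m\<close> of a polynomial
  with invariant coefficients, and it fixes the invariant \<open>(x\<^sub>1 \<dots> x\<^sub>n)\<close> to the power \<open>m / p\<close>. Since \<open>q\<close> is
  not a root of unity, the invariant \<open>\<Sum> x\<^sub>i\<^sup>m\<close> separates the dilations (\<open>dil_separated\<close>). Then
  \<open>f y\<^sup>\<beta> \<mapsto> f \<sigma>\<^sub>\<beta>\<close> is an injective, \<open>G\<close>-equivariant homomorphism into the skew monoid ring (\<open>phi_mult\<close>), and an
  invariant element of that ring comes from an invariant of the quantum space precisely if its coefficients are
  polynomials (\<open>phi_surj\<close>). Clearing an invariant common denominator gives \<open>KU = UK\<close>, all invariants.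

  The order condition is a finiteness statement. A finite-dimensional subspace \<open>W\<close> involves finitely many dilations. So \<open>W \<inter> U\<close> consists of
  vectors of polynomials of bounded length; by Dickson's lemma it lies in the \<open>P\<close>-span of finitely many of
  its elements, and the Reynolds operator turns the coefficients from \<open>P\<close> into coefficients from \<open>\<Gamma>\<close>
  (\<open>qinv_noetherian\<close>, \<open>fin_gen_intersection\<close>).

  The invariants are finitely generated as a ring because \<open>P\<close> is a finitely generated module over \<open>\<Gamma>\<close>, and \<open>k[y\<^sub>1, \<dots>, y\<^sub>n]\<close> over its symmetric polynomials.
  Averaging products of the two finite sets of generators yields, together with the elementary symmetric
  polynomials of the \<open>y\<^sub>i\<close>, ring generators over \<open>\<Gamma>\<close> (\<open>reynolds_span\<close>).

  Freeness uses the grading by the degree in the \<open>x\<^sub>i\<close>. Homogeneous invariants that form a basis modulo \<open>\<Gamma>\<^sub>+ U\<close> span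
  by the graded Nakayama lemma (\<open>basis_spans\<close>). They are independent because the coefficients of an invariant
  lie in the invariants of the abelian group \<open>A\<close>, which are free over \<open>\<Gamma>\<close> on the staircase monomials
  in the \<open>x\<^sub>i\<^sup>m\<close>. The part of lowest degree of a relation therefore expresses a combination with scalar
  coefficients as an element of \<open>\<Gamma>\<^sub>+ P[y\<^sub>1, \<dots>, y\<^sub>n]\<close>; the Reynolds operator moves it to \<open>\<Gamma>\<^sub>+ U\<close>, against
  the choice of the basis (\<open>basis_independent\<close>).
\<close>

abbreviation supp :: "('a \<Rightarrow>\<^sub>0 'b::zero) \<Rightarrow> 'a set" where "supp \<equiv> Poly_Mapping.keys"
abbreviation coef :: "('a \<Rightarrow>\<^sub>0 'b::zero) \<Rightarrow> 'a \<Rightarrow> 'b" where "coef \<equiv> Poly_Mapping.lookup"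
abbreviation mon :: "'a \<Rightarrow> 'b \<Rightarrow> ('a \<Rightarrow>\<^sub>0 'b::zero)" where "mon \<equiv> Poly_Mapping.single"

section \<open>Linear extension and skew convolution\<close>

definition lin_ext :: "('a \<Rightarrow> 'r::zero \<Rightarrow> 's::comm_monoid_add) \<Rightarrow> ('a \<Rightarrow>\<^sub>0 'r) \<Rightarrow> 's" where
  "lin_ext \<phi> f = (\<Sum>a\<in>supp f. \<phi> a (coef f a))"

lemma lin_ext_superset:
  assumes "finite A" "supp f \<subseteq> A" "\<And>a. \<phi> a 0 = 0"
  shows "lin_ext \<phi> f = (\<Sum>a\<in>A. \<phi> a (coef f a))"
  unfolding lin_ext_def
  by (rule sum.mono_neutral_left) (use assms in \<open>auto simp: in_keys_iff\<close>)

lemma lin_ext_zero [simp]: "lin_ext \<phi> 0 = 0"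
  by (simp add: lin_ext_def)

lemma lin_ext_mon: "\<phi> a 0 = 0 \<Longrightarrow> lin_ext \<phi> (mon a x) = \<phi> a x"
  by (simp add: lin_ext_def)

lemma lin_ext_add:
  fixes \<phi> :: "'a \<Rightarrow> 'r::ab_group_add \<Rightarrow> 's::ab_group_add"
  assumes "\<And>a. additive (\<phi> a)"
  shows "lin_ext \<phi> (f + g) = lin_ext \<phi> f + lin_ext \<phi> g"
proof -
  let ?A = "supp f \<union> supp g"
  have z: "\<phi> a 0 = 0" for a using assms[of a] by (rule additive.zero)
  have k: "supp (f + g) \<subseteq> ?A" by (rule keys_add)
  have "lin_ext \<phi> h = (\<Sum>a\<in>?A. \<phi> a (coef h a))" if "supp h \<subseteq> ?A" for h
    by (rule lin_ext_superset) (use that z in auto)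
  with k show ?thesis
    by (simp add: lookup_add additive.add[OF assms] sum.distrib)
qed

lemma additive_lin_ext:
  fixes \<phi> :: "'a \<Rightarrow> 'r::ab_group_add \<Rightarrow> 's::ab_group_add"
  assumes "\<And>a. additive (\<phi> a)"
  shows "additive (lin_ext \<phi>)"
  by unfold_locales (rule lin_ext_add[OF assms])

lemma lin_ext_mon_id: "lin_ext mon f = f"
proof (rule poly_mapping_eqI)
  fix k show "coef (lin_ext mon f) k = coef f k"
    by (auto simp: lin_ext_def lookup_sum lookup_single when_def in_keys_iff)
qed

lemma supp_add_subset: "supp f \<subseteq> S \<Longrightarrow> supp g \<subseteq> S \<Longrightarrow> supp (f + g) \<subseteq> S"
  by (rule order_trans[OF keys_add Un_least])

lemma pm_expand: "f = (\<Sum>a\<in>supp f. mon a (coef f a))"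
  using lin_ext_mon_id[of f] by (simp add: lin_ext_def)

lemma pm_induct [consumes 1, case_names zero mon add]:
  fixes f :: "'a \<Rightarrow>\<^sub>0 'r::comm_monoid_add"
  assumes S: "supp f \<subseteq> S" and zero: "P 0" and mon: "\<And>a x. a \<in> S \<Longrightarrow> P (mon a x)"
    and add: "\<And>f g. supp f \<subseteq> S \<Longrightarrow> supp g \<subseteq> S \<Longrightarrow> P f \<Longrightarrow> P g \<Longrightarrow> P (f + g)"
  shows "P f"
proof -
  have "P (\<Sum>a\<in>A. mon a (coef f a)) \<and> supp (\<Sum>a\<in>A. mon a (coef f a)) \<subseteq> S" if "finite A" "A \<subseteq> S" for A
    using that
  proof (induction A rule: finite_induct)
    case empty
    then show ?case using zero by simp
  next
    case (insert x F)
    let ?s = "\<Sum>a\<in>F. mon a (coef f a)"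
    have s: "P ?s" "supp ?s \<subseteq> S" using insert.IH insert.prems by blast+
    have x: "supp (mon x (coef f x)) \<subseteq> S" using insert.prems by (auto simp: in_keys_iff lookup_single when_def)
    have "P (mon x (coef f x) + ?s)" using insert.prems by (intro add x s mon) auto
    moreover have "supp (mon x (coef f x) + ?s) \<subseteq> S"
      by (rule supp_add_subset[OF x s(2)])
    ultimately show ?case unfolding sum.insert[OF insert.hyps] by (rule conjI)
  qed
  from this[of "supp f", OF finite_keys S] have "P (\<Sum>a\<in>supp f. mon a (coef f a))" by (rule conjunct1)
  then show ?thesis by (rule subst[OF pm_expand[symmetric], of P])
qed

lemma pm_induct_all [case_names mon add]:
  fixes f :: "'a \<Rightarrow>\<^sub>0 'r::comm_monoid_add"
  assumes mon: "\<And>a x. P (mon a x)" and add: "\<And>f g. P f \<Longrightarrow> P g \<Longrightarrow> P (f + g)"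
  shows "P f"
proof (rule pm_induct[of f UNIV])
  show "P 0" using mon[of undefined 0] by simp
qed (simp, rule mon, rule add)

text \<open>The product of a skew monoid ring; with the trivial action it is the product of a monoid algebra.\<close>

definition conv :: "('m \<Rightarrow> 'm \<Rightarrow> 'm) \<Rightarrow> ('m \<Rightarrow> 'r \<Rightarrow> 'r) \<Rightarrow>
    ('m \<Rightarrow>\<^sub>0 'r::comm_ring_1) \<Rightarrow> ('m \<Rightarrow>\<^sub>0 'r) \<Rightarrow> ('m \<Rightarrow>\<^sub>0 'r)" where
  "conv mul act f g = lin_ext (\<lambda>a x. lin_ext (\<lambda>b y. mon (mul a b) (x * act a y)) g) f"

lemma additive_mon_mult: "additive act \<Longrightarrow> additive (\<lambda>y. mon c (x * act y) :: 'm \<Rightarrow>\<^sub>0 'r::comm_ring_1)"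
  by (auto simp: additive_def distrib_left single_add)

locale skew_conv =
  fixes mul :: "'m \<Rightarrow> 'm \<Rightarrow> 'm" and act :: "'m \<Rightarrow> 'r \<Rightarrow> 'r::comm_ring_1"
  assumes act_additive: "\<And>a. additive (act a)"
begin

lemma act_zero: "act a 0 = 0"
  using act_additive by (rule additive.zero)

lemma conv_add_right: "conv mul act f (g + h) = conv mul act f g + conv mul act f h"
  unfolding conv_def
  by (simp add: lin_ext_add additive_mon_mult act_additive) (simp add: lin_ext_def sum.distrib)

lemma conv_add_left: "conv mul act (f + g) h = conv mul act f h + conv mul act g h"
  unfolding conv_def
  by (rule lin_ext_add)
    (auto simp: additive_def distrib_right single_add lin_ext_def sum.distrib)

lemma conv_zero [simp]: "conv mul act 0 f = 0" "conv mul act f 0 = 0"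
  by (simp_all add: conv_def) (simp add: lin_ext_def)

lemma conv_mon: "conv mul act (mon a x) (mon b y) = mon (mul a b) (x * act a y)"
  by (simp add: conv_def lin_ext_mon act_zero)

lemma supp_conv:
  assumes "supp f \<subseteq> S" "supp g \<subseteq> S" "\<And>a b. a \<in> S \<Longrightarrow> b \<in> S \<Longrightarrow> mul a b \<in> S"
  shows "supp (conv mul act f g) \<subseteq> S"
  using assms(1)
proof (induction f rule: pm_induct)
  case (mon a x)
  show ?case using assms(2)
  proof (induction g rule: pm_induct)
    case (mon b y)
    then show ?case using \<open>a \<in> S\<close> assms(3) by (auto simp: conv_mon in_keys_iff lookup_single when_def)
  next
    case (add f g)
    then show ?case unfolding conv_add_right by (intro supp_add_subset)
  qed simp
next
  case (add f g)
  then show ?case unfolding conv_add_left by (intro supp_add_subset)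
qed simp

lemma conv_assoc:
  assumes S: "supp f \<subseteq> S" "supp g \<subseteq> S" "supp h \<subseteq> S"
    and assoc: "\<And>a b c. a \<in> S \<Longrightarrow> b \<in> S \<Longrightarrow> c \<in> S \<Longrightarrow> mul (mul a b) c = mul a (mul b c)"
    and act: "\<And>a x y. act a (x * y) = act a x * act a y"
      "\<And>a b x. a \<in> S \<Longrightarrow> b \<in> S \<Longrightarrow> act (mul a b) x = act a (act b x)"
  shows "conv mul act (conv mul act f g) h = conv mul act f (conv mul act g h)"
  using S(1)
proof (induction f rule: pm_induct)
  case (mon a x)
  show ?case using S(2)
  proof (induction g rule: pm_induct)
    case (mon b y)
    show ?case using S(3)
    proof (induction h rule: pm_induct)
      case (mon c z)
      show ?case using mon \<open>a \<in> S\<close> \<open>b \<in> S\<close> by (simp add: conv_mon assoc act mult.assoc)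
    qed (simp_all add: conv_add_right conv_add_left)
  qed (simp_all add: conv_add_right conv_add_left)
qed (simp_all add: conv_add_right conv_add_left)

end

lemma ring_skew_conv:
  fixes R :: "('m \<Rightarrow>\<^sub>0 'r::comm_ring_1, 'z) ring_scheme" and M :: "('m, 'y) monoid_scheme"
  assumes "Group.monoid M" and add: "\<And>a. additive (act a)"
    and act: "\<And>a x y. act a (x * y) = act a x * act a y"
      "\<And>a b x. a \<in> carrier M \<Longrightarrow> b \<in> carrier M \<Longrightarrow> act (a \<otimes>\<^bsub>M\<^esub> b) x = act a (act b x)"
      "\<And>a. act a 1 = 1" "\<And>x. act \<one>\<^bsub>M\<^esub> x = x"
    and R: "carrier R = {f. supp f \<subseteq> carrier M}" "monoid.mult R = conv (monoid.mult M) act"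
      "monoid.one R = mon \<one>\<^bsub>M\<^esub> 1" "ring.zero R = 0" "ring.add R = (+)"
  shows "Ring.ring R"
proof -
  interpret M: Group.monoid M by fact
  interpret skew_conv "monoid.mult M" act by unfold_locales (rule add[unfolded additive_def, rule_format])
  have k_add: "supp (f + g) \<subseteq> carrier M" if "supp f \<subseteq> carrier M" "supp g \<subseteq> carrier M" for f g :: "'m \<Rightarrow>\<^sub>0 'r"
    using that by (rule supp_add_subset)
  have one: "supp (mon \<one>\<^bsub>M\<^esub> (1::'r)) \<subseteq> carrier M"
    by (auto simp: in_keys_iff lookup_single when_def)
  show ?thesis
  proof (intro ringI abelian_groupI monoidI)
    fix f assume "f \<in> carrier R"
    then have k: "supp f \<subseteq> carrier M" by (simp add: R)
    then show "\<exists>g\<in>carrier R. g \<oplus>\<^bsub>R\<^esub> f = \<zero>\<^bsub>R\<^esub>"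
      by (intro bexI[of _ "- f"]) (auto simp: R in_keys_iff)
    show "\<one>\<^bsub>R\<^esub> \<otimes>\<^bsub>R\<^esub> f = f"
      using k unfolding R by (induction f rule: pm_induct) (auto simp: conv_mon conv_add_right act)
    show "f \<otimes>\<^bsub>R\<^esub> \<one>\<^bsub>R\<^esub> = f"
      using k unfolding R by (induction f rule: pm_induct) (auto simp: conv_mon conv_add_left act)
  next
    fix f g h assume "f \<in> carrier R" "g \<in> carrier R" "h \<in> carrier R"
    then show "f \<otimes>\<^bsub>R\<^esub> g \<otimes>\<^bsub>R\<^esub> h = f \<otimes>\<^bsub>R\<^esub> (g \<otimes>\<^bsub>R\<^esub> h)"
      unfolding R by (intro conv_assoc[where S = "carrier M"]) (auto simp: act M.m_assoc)
  qed (use k_add one supp_conv[of _ "carrier M"] in \<open>auto simp: R conv_add_left conv_add_right algebra_simps\<close>)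
qed

lemma skew_conv_trivial: "skew_conv (\<lambda>_ x. x)"
  by unfold_locales (simp add: additive_def)

lemma monoid_algebra_simps:
  "carrier (monoid_algebra M) = {f. supp f \<subseteq> carrier M}"
  "monoid.mult (monoid_algebra M) = conv (monoid.mult M) (\<lambda>_ x. x)"
  "monoid.one (monoid_algebra M) = mon \<one>\<^bsub>M\<^esub> 1"
  "ring.zero (monoid_algebra M) = 0" "ring.add (monoid_algebra M) = (+)"
  "module.smult (monoid_algebra M) = (\<lambda>c. Poly_Mapping.map ((*) c))"
  by (auto simp: monoid_algebra_def conv_def lin_ext_def fun_eq_iff)

lemma ring_monoid_algebra:
  assumes "Group.monoid M"
  shows "Ring.ring (monoid_algebra M :: ('k::field, 'm \<Rightarrow>\<^sub>0 'k) module)"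
  by (rule ring_skew_conv[OF assms, of "\<lambda>_ x. x"]) (auto simp: monoid_algebra_simps additive_def)

section \<open>Monomial substitutions\<close>

text \<open>
  An element \<open>mon \<beta> (mon a c)\<close> of \<open>'k qspace\<close> stands for \<open>c x\<^sup>a y\<^sup>\<beta>\<close>: the outer exponents belong to the
  \<open>y\<^sub>i\<close>, the inner ones to the \<open>x\<^sub>i\<close>. Variables are indexed by all natural numbers, so that a single type serves
  all \<open>n\<close>. The product of the type is the commutative one.
\<close>

type_synonym exps = "nat \<Rightarrow>\<^sub>0 nat"
type_synonym 'k mpoly = "exps \<Rightarrow>\<^sub>0 'k"
type_synonym 'k qspace = "exps \<Rightarrow>\<^sub>0 exps \<Rightarrow>\<^sub>0 'k"

definition relabel :: "(nat \<Rightarrow> nat) \<Rightarrow> exps \<Rightarrow> exps" where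
  "relabel \<pi> a = (\<Sum>i\<in>supp a. mon (\<pi> i) (coef a i))"

lemma coef_relabel: "bij \<pi> \<Longrightarrow> coef (relabel \<pi> a) i = coef a (inv_into UNIV \<pi> i)"
proof -
  assume \<pi>: "bij \<pi>"
  have eq: "\<pi> j = i \<longleftrightarrow> j = inv_into UNIV \<pi> i" for j
    using surj_f_inv_f[OF bij_is_surj[OF \<pi>]] inv_f_f[OF bij_is_inj[OF \<pi>]] by metis
  have "coef (relabel \<pi> a) i = (\<Sum>j\<in>supp a. if j = inv_into UNIV \<pi> i then coef a j else 0)"
    unfolding relabel_def lookup_sum lookup_single when_def eq by simp
  then show ?thesis by (simp add: in_keys_iff)
qed

lemma coef_relabel_image [simp]: "bij \<pi> \<Longrightarrow> coef (relabel \<pi> a) (\<pi> i) = coef a i"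
  by (simp add: coef_relabel bij_is_inj)

lemma relabel_add: "bij \<pi> \<Longrightarrow> relabel \<pi> (a + b) = relabel \<pi> a + relabel \<pi> b"
  by (rule poly_mapping_eqI) (simp add: coef_relabel lookup_add)

lemma relabel_zero [simp]: "relabel \<pi> 0 = 0"
  by (simp add: relabel_def)

lemma relabel_id [simp]: "relabel id a = a" "relabel (\<lambda>x. x) a = a"
  by (rule poly_mapping_eqI, simp add: coef_relabel[OF bij_id], rule poly_mapping_eqI,
    simp add: coef_relabel[OF bij_id, unfolded id_def])

lemma relabel_comp: "bij \<pi> \<Longrightarrow> bij \<rho> \<Longrightarrow> relabel \<pi> (relabel \<rho> a) = relabel (\<pi> \<circ> \<rho>) a"
  by (rule poly_mapping_eqI) (simp add: coef_relabel bij_comp o_inv_distrib)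

lemma inj_relabel: "bij \<pi> \<Longrightarrow> relabel \<pi> a = relabel \<pi> b \<longleftrightarrow> a = b"
  by (metis poly_mapping_eqI coef_relabel_image)

lemma supp_relabel:
  assumes "bij \<pi>" shows "supp (relabel \<pi> a) = \<pi> ` supp a"
proof (intro subset_antisym subsetI)
  fix i assume "i \<in> supp (relabel \<pi> a)"
  then have "inv_into UNIV \<pi> i \<in> supp a" "i = \<pi> (inv_into UNIV \<pi> i)"
    by (simp_all add: assms in_keys_iff coef_relabel bij_is_surj surj_f_inv_f)
  then show "i \<in> \<pi> ` supp a" by blast
qed (auto simp: assms in_keys_iff)

lemma relabel_mon: "bij \<pi> \<Longrightarrow> relabel \<pi> (mon i d) = mon (\<pi> i) d"
  by (rule poly_mapping_eqI) (auto simp: coef_relabel lookup_single when_def bij_inv_eq_iff)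

definition weight :: "(nat \<Rightarrow> 'k::comm_monoid_mult) \<Rightarrow> exps \<Rightarrow> 'k" where
  "weight c a = (\<Prod>i\<in>supp a. c i ^ coef a i)"

lemma weight_superset: "finite A \<Longrightarrow> supp a \<subseteq> A \<Longrightarrow> weight c a = (\<Prod>i\<in>A. c i ^ coef a i)"
  unfolding weight_def by (rule prod.mono_neutral_left) (auto simp: in_keys_iff)

lemma weight_zero [simp]: "weight c 0 = 1"
  by (simp add: weight_def)

lemma weight_mon [simp]: "weight c (mon i d) = c i ^ d"
  by (simp add: weight_def)

lemma weight_one [simp]: "weight (\<lambda>i. 1) a = 1"
  by (simp add: weight_def)

lemma weight_add: "weight c (a + b) = weight c a * weight c b"
proof -
  let ?A = "supp a \<union> supp b"
  have "weight c x = (\<Prod>i\<in>?A. c i ^ coef x i)" if "supp x \<subseteq> ?A" for x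
    by (rule weight_superset) (use that in auto)
  with keys_add[of a b] show ?thesis
    by (simp add: lookup_add power_add prod.distrib)
qed

lemma weight_mult: "weight (\<lambda>i. c i * d i) a = weight c a * weight d a"
  by (simp add: weight_def power_mult_distrib prod.distrib)

lemma weight_relabel: "bij \<pi> \<Longrightarrow> weight c (relabel \<pi> a) = weight (\<lambda>i. c (\<pi> i)) a"
  unfolding weight_def
  by (simp add: supp_relabel prod.reindex bij_is_inj inj_on_subset[OF bij_is_inj])

lemma weight_nonzero: "(\<And>i. c i \<noteq> 0) \<Longrightarrow> weight c a \<noteq> (0 :: 'k::field)"
  by (simp add: weight_def)

lemma weight_cong: "(\<And>i. i \<in> supp a \<Longrightarrow> c i = d i) \<Longrightarrow> weight c a = weight d a"
  by (simp add: weight_def)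

text \<open>The endomorphism of the polynomial ring given by \<open>x\<^sub>i \<mapsto> c\<^sub>i x\<^bsub>\<pi>(i)\<^esub>\<close>.\<close>

definition msub :: "(nat \<Rightarrow> 'k) \<Rightarrow> (nat \<Rightarrow> nat) \<Rightarrow> 'k::field mpoly \<Rightarrow> 'k mpoly" where
  "msub c \<pi> = lin_ext (\<lambda>a x. mon (relabel \<pi> a) (x * weight c a))"

lemma additive_msub: "additive (msub c \<pi>)"
  unfolding msub_def by (rule additive_lin_ext) (auto simp: additive_def distrib_right single_add)

lemmas msub_add = additive.add[OF additive_msub]
  and msub_zero [simp] = additive.zero[OF additive_msub]
  and msub_minus = additive.minus[OF additive_msub]
  and msub_diff = additive.diff[OF additive_msub]
  and msub_sum = additive.sum[OF additive_msub]

lemma msub_mon: "msub c \<pi> (mon a x) = mon (relabel \<pi> a) (x * weight c a)"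
  by (simp add: msub_def lin_ext_mon)

lemma msub_mult: "bij \<pi> \<Longrightarrow> msub c \<pi> (f * g) = msub c \<pi> f * msub c \<pi> g"
proof (induction f rule: pm_induct_all)
  case (mon a x)
  then show ?case
    by (induction g rule: pm_induct_all)
      (auto simp: msub_mon mult_single relabel_add weight_add ac_simps distrib_left distrib_right msub_add)
qed (auto simp: distrib_right msub_add)

lemma msub_const [simp]: "msub c \<pi> (mon 0 x) = mon 0 x"
  by (simp add: msub_mon)

lemma msub_one [simp]: "msub c \<pi> 1 = 1"
  using msub_const[of c \<pi> 1] by simp

lemma msub_power: "bij \<pi> \<Longrightarrow> msub c \<pi> (f ^ d) = msub c \<pi> f ^ d"
  by (induction d) (auto simp: msub_mult)

lemma msub_prod: "bij \<pi> \<Longrightarrow> msub c \<pi> (\<Prod>i\<in>I. f i) = (\<Prod>i\<in>I. msub c \<pi> (f i))"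
  by (induction I rule: infinite_finite_induct) (auto simp: msub_mult)

lemma msub_comp: "bij \<pi> \<Longrightarrow> bij \<rho> \<Longrightarrow>
    msub d \<rho> (msub c \<pi> f) = msub (\<lambda>i. c i * d (\<pi> i)) (\<rho> \<circ> \<pi>) f"
  by (induction f rule: pm_induct_all)
    (auto simp: msub_mon msub_add relabel_comp weight_relabel weight_mult ac_simps)

lemma msub_id [simp]: "msub (\<lambda>i. 1) id f = f"
  by (induction f rule: pm_induct_all) (auto simp: msub_mon msub_add)

lemma coef_msub: "bij \<pi> \<Longrightarrow> coef (msub c \<pi> f) (relabel \<pi> a) = coef f a * weight c a"
  by (induction f rule: pm_induct_all)
    (auto simp: msub_mon msub_add lookup_add lookup_single inj_relabel when_def algebra_simps)

lemma inj_msub: "bij \<pi> \<Longrightarrow> (\<And>i. c i \<noteq> 0) \<Longrightarrow> msub c \<pi> f = msub c \<pi> g \<longleftrightarrow> f = g"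
  by (metis coef_msub weight_nonzero mult_right_cancel poly_mapping_eqI)

text \<open>The dilation by which \<open>y\<^sup>\<beta>\<close> acts when it is moved past a polynomial in the \<open>x\<^sub>i\<close>.\<close>

abbreviation qshift :: "'k \<Rightarrow> exps \<Rightarrow> 'k::field mpoly \<Rightarrow> 'k mpoly" where
  "qshift q \<beta> \<equiv> msub (\<lambda>i. q ^ coef \<beta> i) id"

lemma qshift_add: "qshift q (\<alpha> + \<beta>) f = qshift q \<alpha> (qshift q \<beta> f)"
  by (simp add: msub_comp lookup_add power_add mult.commute)

lemma weight_commute: "weight (\<lambda>i. q ^ coef \<beta> i) a = (weight (\<lambda>i. q ^ coef a i) \<beta> :: 'k::comm_monoid_mult)"
proof -
  let ?A = "supp a \<union> supp \<beta>"
  have "weight (\<lambda>i. q ^ coef \<beta> i) a = (\<Prod>i\<in>?A. (q ^ coef \<beta> i) ^ coef a i)"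
    by (rule weight_superset) auto
  also have "\<dots> = (\<Prod>i\<in>?A. (q ^ coef a i) ^ coef \<beta> i)"
    by (simp add: power_mult[symmetric] mult.commute)
  also have "\<dots> = weight (\<lambda>i. q ^ coef a i) \<beta>"
    by (rule weight_superset[symmetric]) auto
  finally show ?thesis .
qed

lemma msub_qshift: "bij \<pi> \<Longrightarrow> msub c \<pi> (qshift q \<beta> f) = qshift q (relabel \<pi> \<beta>) (msub c \<pi> f)"
  by (simp add: msub_comp mult.commute)

section \<open>The twisted polynomial ring\<close>

text \<open>The rule \<open>(f y\<^sup>\<beta>) (g y\<^sup>\<gamma>) = f \<sigma>\<^sub>\<beta>(g) y\<^bsup>\<beta> + \<gamma>\<^esup>\<close> of the iterated Ore extension.\<close>

definition qmul :: "'k \<Rightarrow> 'k::field qspace \<Rightarrow> 'k qspace \<Rightarrow> 'k qspace" where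
  "qmul q = conv (+) (qshift q)"

interpretation qm: skew_conv "(+)" "qshift q" for q :: "'k::field"
  by unfold_locales (rule msub_add)

lemmas qmul_add_left = qm.conv_add_left[folded qmul_def]
  and qmul_add_right = qm.conv_add_right[folded qmul_def]
  and qmul_zero [simp] = qm.conv_zero[folded qmul_def]
  and qmul_mon = qm.conv_mon[folded qmul_def]

definition twisted_ring :: "'k::field \<Rightarrow> 'k qspace ring" where
  "twisted_ring q = \<lparr>carrier = UNIV, monoid.mult = qmul q, monoid.one = 1, ring.zero = 0, ring.add = (+)\<rparr>"

lemma ring_twisted: "Ring.ring (twisted_ring q)"
proof (rule ring_skew_conv)
  show "Group.monoid (\<lparr>carrier = UNIV, monoid.mult = (+), monoid.one = 0\<rparr> :: exps monoid)"
    by (rule monoidI) (auto simp: add.assoc)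
qed (auto simp: twisted_ring_def qmul_def additive_msub msub_mult qshift_add)

lemma qmul_assoc: "qmul q (qmul q u v) w = qmul q u (qmul q v w)"
  using ring.ring_simprules(11)[OF ring_twisted[of q], of u v w] by (simp add: twisted_ring_def)

lemma qmul_one [simp]: "qmul q 1 u = u" "qmul q u 1 = u"
  using monoid.l_one[OF ring.is_monoid[OF ring_twisted[of q]], of u]
    monoid.r_one[OF ring.is_monoid[OF ring_twisted[of q]], of u] by (simp_all add: twisted_ring_def)

lemma qspace_induct [case_names mon add]:
  assumes "\<And>\<beta> a x. P (mon \<beta> (mon a x))" "\<And>u v. P u \<Longrightarrow> P v \<Longrightarrow> P (u + v)"
  shows "P (u :: 'k::field qspace)"
proof (induction u rule: pm_induct_all)
  case (mon \<beta> f)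
  show ?case
  proof (induction f rule: pm_induct_all)
    case (mon a x)
    show ?case by (rule assms(1))
  next
    case (add f g)
    then show ?case unfolding single_add by (rule assms(2))
  qed
qed (rule assms(2))

text \<open>The twist is invisible if the left factor is a polynomial in the \<open>x\<^sub>i\<close> or the right factor
  is a polynomial in the \<open>y\<^sub>i\<close>.\<close>

lemma qmul_x_left: "qmul q (mon 0 f) u = mon 0 f * u"
  by (induction u rule: pm_induct_all) (auto simp: qmul_mon mult_single qmul_add_right distrib_left)

lemma qmul_y_right:
  assumes "\<And>\<beta>. \<exists>c. coef v \<beta> = mon 0 c"
  shows "qmul q u v = u * v"
proof -
  have "qmul q u v = (\<Sum>\<beta>\<in>supp v. qmul q u (mon \<beta> (coef v \<beta>)))"
    by (subst (1) pm_expand[of v], rule additive.sum) (simp add: additive_def qmul_add_right)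
  also have "\<dots> = (\<Sum>\<beta>\<in>supp v. u * mon \<beta> (coef v \<beta>))"
  proof (rule sum.cong[OF refl])
    fix \<beta>
    obtain c where c: "coef v \<beta> = mon 0 c" using assms by blast
    show "qmul q u (mon \<beta> (coef v \<beta>)) = u * mon \<beta> (coef v \<beta>)" unfolding c
      by (induction u rule: pm_induct_all) (auto simp: qmul_mon mult_single qmul_add_left distrib_right)
  qed
  also have "\<dots> = u * v" by (simp add: sum_distrib_left[symmetric] pm_expand[symmetric])
  finally show ?thesis .
qed

definition tsub :: "(nat \<Rightarrow> 'k) \<Rightarrow> (nat \<Rightarrow> nat) \<Rightarrow> 'k::field qspace \<Rightarrow> 'k qspace" where
  "tsub c \<pi> = lin_ext (\<lambda>\<beta> f. mon (relabel \<pi> \<beta>) (msub c \<pi> f))"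

lemma additive_tsub: "additive (tsub c \<pi>)"
  unfolding tsub_def by (rule additive_lin_ext) (auto simp: additive_def single_add msub_add)

lemmas tsub_add = additive.add[OF additive_tsub]
  and tsub_zero [simp] = additive.zero[OF additive_tsub]
  and tsub_sum = additive.sum[OF additive_tsub]

lemma tsub_mon: "tsub c \<pi> (mon \<beta> f) = mon (relabel \<pi> \<beta>) (msub c \<pi> f)"
  by (simp add: tsub_def lin_ext_mon)

text \<open>Dilating by \<open>\<beta>\<close> and then relabelling is relabelling and then dilating by the relabelled \<open>\<beta>\<close>, so the
  substitutions respect the twist.\<close>

lemma tsub_qmul: "bij \<pi> \<Longrightarrow> tsub c \<pi> (qmul q u v) = qmul q (tsub c \<pi> u) (tsub c \<pi> v)"
proof (induction u rule: pm_induct_all)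
  case (mon \<alpha> f)
  then show ?case
    by (induction v rule: pm_induct_all)
      (auto simp: tsub_mon tsub_add qmul_mon qmul_add_right relabel_add msub_mult msub_qshift)
qed (auto simp: tsub_add qmul_add_left)

lemma tsub_mult: "bij \<pi> \<Longrightarrow> tsub c \<pi> (u * v) = tsub c \<pi> u * tsub c \<pi> v"
proof (induction u rule: pm_induct_all)
  case (mon \<alpha> f)
  then show ?case
    by (induction v rule: pm_induct_all)
      (auto simp: tsub_mon tsub_add mult_single distrib_left relabel_add msub_mult)
qed (auto simp: tsub_add distrib_right)

lemma tsub_one [simp]: "tsub c \<pi> 1 = 1"
  using tsub_mon[of c \<pi> 0 1] by simp

lemma tsub_comp: "bij \<pi> \<Longrightarrow> bij \<rho> \<Longrightarrow>
    tsub d \<rho> (tsub c \<pi> u) = tsub (\<lambda>i. c i * d (\<pi> i)) (\<rho> \<circ> \<pi>) u"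
  by (induction u rule: pm_induct_all) (auto simp: tsub_mon tsub_add relabel_comp msub_comp)

lemma tsub_id [simp]: "tsub (\<lambda>i. 1) id u = u"
  by (induction u rule: pm_induct_all) (auto simp: tsub_mon tsub_add id_def[symmetric])

lemma coef_tsub: "bij \<pi> \<Longrightarrow> coef (tsub c \<pi> u) (relabel \<pi> \<beta>) = msub c \<pi> (coef u \<beta>)"
  by (induction u rule: pm_induct_all)
    (auto simp: tsub_mon tsub_add msub_add lookup_add lookup_single inj_relabel when_def)

section \<open>Quotients of monoid algebras\<close>

lemma ring_cong:
  assumes "Ring.ring R" "carrier S = carrier R" "monoid.mult S = monoid.mult R" "monoid.one S = monoid.one R"
    "ring.zero S = ring.zero R" "ring.add S = ring.add R"
  shows "Ring.ring S"
proof -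
  interpret ring R by fact
  show ?thesis
  proof (intro ringI abelian_groupI monoidI, unfold assms(2-))
    fix x assume "x \<in> carrier R"
    then show "\<exists>y\<in>carrier R. y \<oplus>\<^bsub>R\<^esub> x = \<zero>\<^bsub>R\<^esub>" by (rule add.l_inv_ex)
  qed (simp_all add: a_ac m_assoc l_distr r_distr)
qed

definition cscale :: "'k::field \<Rightarrow> ('m \<Rightarrow>\<^sub>0 'k) \<Rightarrow> ('m \<Rightarrow>\<^sub>0 'k)" where
  "cscale c = Poly_Mapping.map ((*) c)"

lemma coef_cscale: "coef (cscale c f) a = c * coef f a"
  by (simp add: cscale_def map.rep_eq when_def)

lemma cscale_add: "cscale c (f + g) = cscale c f + cscale c g"
  by (rule poly_mapping_eqI) (simp add: coef_cscale lookup_add distrib_left)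

lemma cscale_mon: "cscale c (mon a x) = mon a (c * x)"
  by (rule poly_mapping_eqI) (simp add: coef_cscale lookup_single when_def)

lemma supp_cscale: "supp (cscale c f) \<subseteq> supp f"
  by (auto simp: in_keys_iff coef_cscale)

locale monoid_algebra_quotient =
  fixes M :: "('m, 'z) monoid_scheme" and I :: "('m \<Rightarrow>\<^sub>0 'k::field) set"
  assumes M: "Group.monoid M" and I: "ideal I (monoid_algebra M)"
begin

abbreviation "A \<equiv> monoid_algebra M :: ('k, 'm \<Rightarrow>\<^sub>0 'k) module"
abbreviation "Q \<equiv> quotient_algebra A I"
abbreviation "cls f \<equiv> I +>\<^bsub>A\<^esub> f"

interpretation ideal I "monoid_algebra M" by (rule I)

lemma carrier_A: "carrier A = {f. supp f \<subseteq> carrier M}"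
  by (simp add: monoid_algebra_simps)

lemma quotient_simps:
  "carrier Q = carrier (A Quot I)" "monoid.mult Q = monoid.mult (A Quot I)"
  "monoid.one Q = monoid.one (A Quot I)" "ring.zero Q = ring.zero (A Quot I)" "ring.add Q = ring.add (A Quot I)"
  by (simp_all add: quotient_algebra_def FactRing_def ring.defs module.defs)

lemma ring_Q: "Ring.ring Q"
  by (rule ring_cong[OF quotient_is_ring]) (simp_all only: quotient_simps)

lemma carrier_Q: "carrier Q = cls ` carrier A"
  by (auto simp: quotient_simps FactRing_def A_RCOSETS_def')

lemma cls_closed: "f \<in> carrier A \<Longrightarrow> cls f \<in> carrier Q"
  by (simp add: carrier_Q)

lemma cls_add: "f \<in> carrier A \<Longrightarrow> g \<in> carrier A \<Longrightarrow> cls f \<oplus>\<^bsub>Q\<^esub> cls g = cls (f + g)"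
  using ring_hom_add[OF rcos_ring_hom] by (simp add: quotient_simps monoid_algebra_simps(5))

lemma cls_mult: "f \<in> carrier A \<Longrightarrow> g \<in> carrier A \<Longrightarrow>
    cls f \<otimes>\<^bsub>Q\<^esub> cls g = cls (conv (monoid.mult M) (\<lambda>_ x. x) f g)"
  using ring_hom_mult[OF rcos_ring_hom] by (simp add: quotient_simps monoid_algebra_simps(2))

lemma cls_one: "\<one>\<^bsub>Q\<^esub> = cls (mon \<one>\<^bsub>M\<^esub> 1)"
  by (simp add: quotient_simps FactRing_def monoid_algebra_simps(3))

lemma cls_eq: "f \<in> carrier A \<Longrightarrow> g \<in> carrier A \<Longrightarrow> cls f = cls g \<longleftrightarrow> f - g \<in> I"
proof -
  assume fg: "f \<in> carrier A" "g \<in> carrier A"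
  have "\<ominus>\<^bsub>A\<^esub> g = - g"
    by (rule minus_equality) (use fg in \<open>auto simp: monoid_algebra_simps in_keys_iff\<close>)
  then have "f \<ominus>\<^bsub>A\<^esub> g = f - g"
    by (simp add: a_minus_def monoid_algebra_simps(5))
  with quotient_eq_iff_same_a_r_cos[OF I fg] show ?thesis by simp
qed

lemma mon_closed: "a \<in> carrier M \<Longrightarrow> mon a x \<in> carrier A"
  by (simp add: carrier_A)

lemma cscale_closed: "f \<in> carrier A \<Longrightarrow> cscale c f \<in> carrier A"
  using supp_cscale[of c f] by (auto simp: carrier_A)

text \<open>Scalar multiplication is multiplication by an element of the algebra, hence compatible with cosets of an ideal.\<close>

lemma cscale_conv: "f \<in> carrier A \<Longrightarrow> cscale c f = conv (monoid.mult M) (\<lambda>_ x. x) (mon \<one>\<^bsub>M\<^esub> c) f"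
proof -
  interpret M: Group.monoid M by (rule M)
  interpret skew_conv "monoid.mult M" "\<lambda>_ x. x :: 'k" by (rule skew_conv_trivial)
  assume "f \<in> carrier A"
  then have "supp f \<subseteq> carrier M" by (simp add: carrier_A)
  then show ?thesis
  proof (induction f rule: pm_induct)
    case zero
    show ?case by (rule poly_mapping_eqI) (simp add: coef_cscale)
  next
    case (mon a x)
    then show ?case by (simp add: conv_mon cscale_mon)
  next
    case (add f g)
    show ?case unfolding cscale_add conv_add_right add.IH ..
  qed
qed

lemma cls_smult: "f \<in> carrier A \<Longrightarrow> c \<odot>\<^bsub>Q\<^esub> cls f = cls (cscale c f)"
proof -
  interpret M: Group.monoid M by (rule M)
  assume f: "f \<in> carrier A"
  have "cls (cscale c g) = cls (cscale c f)" if "g \<in> cls f" for g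
  proof -
    have g: "g \<in> carrier A" using that a_r_coset_subset_G[OF a_subset f] by blast
    have "cls g = cls f" using that f a_repr_independence[OF that f] a_subgroup by auto
    then have "g - f \<in> I" using cls_eq[OF g f] by simp
    then have "mon \<one>\<^bsub>M\<^esub> c \<otimes>\<^bsub>A\<^esub> (g - f) \<in> I"
      by (intro I_l_closed mon_closed) auto
    moreover have "mon \<one>\<^bsub>M\<^esub> c \<otimes>\<^bsub>A\<^esub> (g - f) = cscale c (g - f)"
      using cscale_conv[of "g - f" c] Icarr[OF \<open>g - f \<in> I\<close>] by (simp add: monoid_algebra_simps(2))
    moreover have "cscale c (g - f) = cscale c g - cscale c f"
      by (rule poly_mapping_eqI) (simp add: coef_cscale lookup_minus right_diff_distrib)
    ultimately show ?thesis using cls_eq[OF cscale_closed[OF g] cscale_closed[OF f]] by simp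
  qed
  moreover have "f \<in> cls f" using a_rcos_self[OF f] .
  ultimately have "(\<Union>g\<in>cls f. cls (cscale c g)) = cls (cscale c f)" by blast
  then show ?thesis
    by (simp add: quotient_algebra_def FactRing_def ring.defs module.defs monoid_algebra_simps cscale_def)
qed

lemma Q_cases: "u \<in> carrier Q \<Longrightarrow> (\<And>f. f \<in> carrier A \<Longrightarrow> u = cls f \<Longrightarrow> P) \<Longrightarrow> P"
  by (auto simp: carrier_Q)

lemma zero_closed_A: "0 \<in> carrier A" by (simp add: carrier_A)

lemma add_closed_A: "f \<in> carrier A \<Longrightarrow> g \<in> carrier A \<Longrightarrow> f + g \<in> carrier A"
  unfolding carrier_A using supp_add_subset by blast

lemma smult_closed_Q: "u \<in> carrier Q \<Longrightarrow> c \<odot>\<^bsub>Q\<^esub> u \<in> carrier Q"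
  by (erule Q_cases) (simp add: cls_smult cls_closed cscale_closed)

lemma cls_mon_smult: "a \<in> carrier M \<Longrightarrow> cls (mon a x) = x \<odot>\<^bsub>Q\<^esub> cls (mon a 1)"
  by (simp add: cls_smult mon_closed cscale_mon)

lemma cls_mon_mult: "a \<in> carrier M \<Longrightarrow> b \<in> carrier M \<Longrightarrow>
    cls (mon a x) \<otimes>\<^bsub>Q\<^esub> cls (mon b y) = cls (mon (a \<otimes>\<^bsub>M\<^esub> b) (x * y))"
  by (simp add: cls_mult mon_closed skew_conv.conv_mon[OF skew_conv_trivial])

lemma smult_eq_mult: "u \<in> carrier Q \<Longrightarrow> c \<odot>\<^bsub>Q\<^esub> u = (c \<odot>\<^bsub>Q\<^esub> \<one>\<^bsub>Q\<^esub>) \<otimes>\<^bsub>Q\<^esub> u"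
proof (erule Q_cases)
  interpret M: Group.monoid M by (rule M)
  fix f assume "f \<in> carrier A" "u = cls f"
  then show ?thesis
    by (simp add: cls_one cls_smult mon_closed cscale_closed cls_mult cscale_conv cscale_mon)
qed

lemma Q_induct [consumes 1, case_names mon add]:
  assumes u: "u \<in> carrier Q"
    and mon: "\<And>a x. a \<in> carrier M \<Longrightarrow> P (cls (mon a x))"
    and add: "\<And>u v. u \<in> carrier Q \<Longrightarrow> v \<in> carrier Q \<Longrightarrow> P u \<Longrightarrow> P v \<Longrightarrow> P (u \<oplus>\<^bsub>Q\<^esub> v)"
  shows "P u"
proof -
  interpret M: Group.monoid M by (rule M)
  obtain f where f: "supp f \<subseteq> carrier M" "u = cls f" using Q_cases[OF u] by (auto simp: carrier_A)
  from f(1) have "P (cls f)"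
  proof (induction f rule: pm_induct)
    case zero
    show ?case using mon[of "\<one>\<^bsub>M\<^esub>" 0] by simp
  next
    case (add f g)
    then have c: "f \<in> carrier A" "g \<in> carrier A" by (simp_all add: carrier_A)
    show ?case using assms(3)[OF cls_closed[OF c(1)] cls_closed[OF c(2)] add.IH] cls_add[OF c] by simp
  qed (rule mon)
  with f show ?thesis by simp
qed

end

text \<open>An additive map that vanishes on the ideal takes a single value on each coset, which \<open>the_elem\<close> extracts.\<close>

definition descend :: "('a \<Rightarrow> 's) \<Rightarrow> 'a set \<Rightarrow> 's" where
  "descend h C = the_elem (h ` C)"

lemma (in monoid_algebra_quotient) descend_cls:
  assumes add: "\<And>f g. h (f + g) = h f + (h g :: 's::ab_group_add)" and zero: "\<And>f. f \<in> I \<Longrightarrow> h f = 0"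
    and f: "f \<in> carrier A"
  shows "descend h (cls f) = h f"
proof -
  interpret ideal I "monoid_algebra M" by (rule I)
  have "h g = h f" if "g \<in> cls f" for g
  proof -
    have g: "g \<in> carrier A" using that a_r_coset_subset_G[OF a_subset f] by blast
    have "cls g = cls f" using that f a_repr_independence[OF that f] a_subgroup by auto
    then have "g - f \<in> I" using cls_eq[OF g f] by simp
    then have "h (g - f) = 0" by (rule assms(2))
    then show ?thesis using assms(1)[of "g - f" f] by simp
  qed
  then have "h ` cls f = {h f}" using a_rcos_self[OF f] by blast
  then show ?thesis by (simp add: descend_def)
qed

section \<open>Evaluation of monoid algebras in the twisted polynomial ring\<close>

definition cst :: "'k::field \<Rightarrow> 'k qspace" where "cst c = mon 0 (mon 0 c)"

lemma cst_add: "cst (c + d) = cst c + cst d" by (simp add: cst_def single_add)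
lemma cst_mult: "cst (c * d) = cst c * cst d" by (simp add: cst_def mult_single)
lemma cst_one [simp]: "cst 1 = 1" by (simp add: cst_def)
lemma cst_zero [simp]: "cst 0 = 0" by (simp add: cst_def)
lemma qmul_cst_left: "qmul q (cst c * u) v = cst c * qmul q u v"
  using qmul_assoc[of q "cst c" u v] by (simp add: cst_def qmul_x_left)

lemma qmul_cst_right: "qmul q u (cst c * v) = cst c * qmul q u v"
proof -
  have "qmul q u (cst c) = u * cst c"
    by (rule qmul_y_right) (auto simp: cst_def lookup_single when_def intro: exI[of _ 0])
  also have "\<dots> = qmul q (cst c) u" by (simp add: cst_def qmul_x_left mult.commute)
  finally show ?thesis
    using qmul_assoc[of q u "cst c" v] qmul_assoc[of q "cst c" u v] by (simp add: cst_def qmul_x_left)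
qed

definition eval_algebra :: "('m \<Rightarrow> 'k::field qspace) \<Rightarrow> ('m \<Rightarrow>\<^sub>0 'k) \<Rightarrow> 'k qspace" where
  "eval_algebra \<psi> = lin_ext (\<lambda>a c. cst c * \<psi> a)"

lemma additive_eval_algebra: "additive (eval_algebra \<psi>)"
  unfolding eval_algebra_def by (rule additive_lin_ext) (auto simp: additive_def cst_add distrib_right)

lemmas eval_algebra_add = additive.add[OF additive_eval_algebra]
  and eval_algebra_zero [simp] = additive.zero[OF additive_eval_algebra]
  and eval_algebra_diff = additive.diff[OF additive_eval_algebra]

lemma eval_algebra_mon: "eval_algebra \<psi> (mon a c) = cst c * \<psi> a"
  by (simp add: eval_algebra_def lin_ext_mon)

lemma eval_algebra_cscale: "eval_algebra \<psi> (cscale c f) = cst c * eval_algebra \<psi> f"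
  by (induction f rule: pm_induct_all)
    (auto simp: cscale_mon cscale_add eval_algebra_mon eval_algebra_add cst_mult distrib_left mult.assoc)

lemma eval_algebra_conv:
  fixes f :: "'m \<Rightarrow>\<^sub>0 'k::field" and M :: "('m, 'z) monoid_scheme"
  assumes "supp f \<subseteq> carrier M" "supp g \<subseteq> carrier M"
    and "\<And>a b. a \<in> carrier M \<Longrightarrow> b \<in> carrier M \<Longrightarrow> \<psi> (a \<otimes>\<^bsub>M\<^esub> b) = qmul q (\<psi> a) (\<psi> b)"
  shows "eval_algebra \<psi> (conv (monoid.mult M) (\<lambda>_ x. x) f g) = qmul q (eval_algebra \<psi> f) (eval_algebra \<psi> g)"
proof -
  interpret skew_conv "monoid.mult M" "\<lambda>_ x. x :: 'k" by (rule skew_conv_trivial)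
  show ?thesis using assms(1)
  proof (induction f rule: pm_induct)
    case (mon a x)
    show ?case using assms(2)
    proof (induction g rule: pm_induct)
      case (mon b y)
      then show ?case using \<open>a \<in> carrier M\<close>
        by (simp add: conv_mon eval_algebra_mon assms(3) cst_mult qmul_cst_left qmul_cst_right mult.assoc)
    qed (auto simp: conv_add_right eval_algebra_add qmul_add_right)
  qed (auto simp: conv_add_left eval_algebra_add qmul_add_left)
qed

text \<open>The kernel of a ring homomorphism is an ideal, so it suffices to check the relations.\<close>

lemma eval_algebra_genideal:
  fixes M :: "('m, 'z) monoid_scheme" and \<psi> :: "'m \<Rightarrow> 'k::field qspace"
  assumes M: "Group.monoid M"
    and \<psi>: "\<And>a b. a \<in> carrier M \<Longrightarrow> b \<in> carrier M \<Longrightarrow> \<psi> (a \<otimes>\<^bsub>M\<^esub> b) = qmul q (\<psi> a) (\<psi> b)" "\<psi> \<one>\<^bsub>M\<^esub> = 1"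
    and R: "R \<subseteq> carrier (monoid_algebra M)" "\<And>r. r \<in> R \<Longrightarrow> eval_algebra \<psi> r = 0"
    and f: "f \<in> genideal (monoid_algebra M) R"
  shows "eval_algebra \<psi> f = 0"
proof -
  let ?A = "monoid_algebra M :: ('k, 'm \<Rightarrow>\<^sub>0 'k) module"
  have "eval_algebra \<psi> \<in> ring_hom ?A (twisted_ring q)"
  proof (rule ring_hom_memI)
    fix f g assume "f \<in> carrier ?A" "g \<in> carrier ?A"
    then show "eval_algebra \<psi> (f \<otimes>\<^bsub>?A\<^esub> g) = eval_algebra \<psi> f \<otimes>\<^bsub>twisted_ring q\<^esub> eval_algebra \<psi> g"
      by (simp add: monoid_algebra_simps twisted_ring_def eval_algebra_conv[where M = M] \<psi>)
  qed (auto simp: twisted_ring_def monoid_algebra_simps eval_algebra_add eval_algebra_mon \<psi>)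
  then have hom: "ring_hom_ring ?A (twisted_ring q) (eval_algebra \<psi>)"
    by (intro ring_hom_ringI2 ring_monoid_algebra M ring_twisted)
  have ker: "a_kernel ?A (twisted_ring q) (eval_algebra \<psi>) = {x \<in> carrier ?A. eval_algebra \<psi> x = 0}"
    by (simp add: a_kernel_def' twisted_ring_def)
  have "genideal ?A R \<subseteq> a_kernel ?A (twisted_ring q) (eval_algebra \<psi>)"
    by (rule ring.genideal_minimal[OF ring_monoid_algebra[OF M] ring_hom_ring.kernel_is_ideal[OF hom]])
      (use R in \<open>unfold ker, blast\<close>)
  with f show ?thesis unfolding ker by blast
qed

section \<open>Polynomials in restricted variables\<close>

definition exps_on :: "nat set \<Rightarrow> exps set" where "exps_on A = {a. supp a \<subseteq> A}"
definition mpoly_on :: "nat set \<Rightarrow> 'k::field mpoly set" where "mpoly_on A = {f. supp f \<subseteq> exps_on A}"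
definition qspace_on :: "nat set \<Rightarrow> 'k::field qspace set" where
  "qspace_on A = {u. supp u \<subseteq> exps_on A \<and> (\<forall>\<beta>. coef u \<beta> \<in> mpoly_on A)}"

lemma exps_on_zero [simp]: "0 \<in> exps_on A" by (simp add: exps_on_def)
lemma exps_on_add: "a \<in> exps_on A \<Longrightarrow> b \<in> exps_on A \<Longrightarrow> a + b \<in> exps_on A"
  unfolding exps_on_def using supp_add_subset by blast
lemma exps_on_mon: "i \<in> A \<Longrightarrow> mon i d \<in> exps_on A" by (simp add: exps_on_def)

lemma mpoly_on_zero [simp]: "0 \<in> mpoly_on A" by (simp add: mpoly_on_def)
lemma mpoly_on_add: "f \<in> mpoly_on A \<Longrightarrow> g \<in> mpoly_on A \<Longrightarrow> f + g \<in> mpoly_on A"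
  unfolding mpoly_on_def using supp_add_subset by blast
lemma mpoly_on_mon: "a \<in> exps_on A \<Longrightarrow> mon a x \<in> mpoly_on A" by (simp add: mpoly_on_def)

lemma mpoly_on_induct [consumes 1, case_names mon add]:
  assumes "f \<in> mpoly_on A" "\<And>a x. a \<in> exps_on A \<Longrightarrow> P (mon a x)"
    "\<And>f g. f \<in> mpoly_on A \<Longrightarrow> g \<in> mpoly_on A \<Longrightarrow> P f \<Longrightarrow> P g \<Longrightarrow> P (f + g)"
  shows "P f"
proof (rule pm_induct[of f "exps_on A" P])
  show "supp f \<subseteq> exps_on A" using assms(1) by (simp add: mpoly_on_def)
  show "P 0" using assms(2)[of 0 0] by simp
qed (use assms(2,3) in \<open>auto simp: mpoly_on_def\<close>)

lemma mpoly_on_sum: "(\<And>i. i \<in> I \<Longrightarrow> f i \<in> mpoly_on A) \<Longrightarrow> sum f I \<in> mpoly_on A"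
  by (induction I rule: infinite_finite_induct) (auto intro: mpoly_on_add)

lemma mpoly_on_mult:
  fixes f :: "'k::field mpoly"
  assumes "f \<in> mpoly_on A" "g \<in> mpoly_on A" shows "f * g \<in> mpoly_on A"
  using assms(1)
proof (induction f rule: mpoly_on_induct)
  case (mon a x)
  show ?case using assms(2)
    by (induction g rule: mpoly_on_induct)
      (use mon in \<open>auto simp: mult_single distrib_left intro: mpoly_on_mon mpoly_on_add exps_on_add\<close>)
qed (auto simp: distrib_right intro: mpoly_on_add)

lemma mpoly_on_one [simp]: "(1 :: 'k::field mpoly) \<in> mpoly_on A"
  using mpoly_on_mon[of 0 A "1::'k"] by simp

lemma mpoly_on_minus: "(f :: 'k::field mpoly) \<in> mpoly_on A \<Longrightarrow> - f \<in> mpoly_on A"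
  by (simp add: mpoly_on_def)

lemma mpoly_on_prod: "(\<And>i. i \<in> I \<Longrightarrow> f i \<in> mpoly_on A) \<Longrightarrow> prod f I \<in> (mpoly_on A :: 'k::field mpoly set)"
  by (induction I rule: infinite_finite_induct) (auto intro: mpoly_on_mult)

lemma mpoly_on_power: "(f :: 'k::field mpoly) \<in> mpoly_on A \<Longrightarrow> f ^ d \<in> mpoly_on A"
  by (induction d) (auto intro: mpoly_on_mult)

lemma exps_on_relabel: "bij \<pi> \<Longrightarrow> \<pi> ` A \<subseteq> A \<Longrightarrow> a \<in> exps_on A \<Longrightarrow> relabel \<pi> a \<in> exps_on A"
  by (auto simp: exps_on_def supp_relabel)

lemma mpoly_on_msub:
  assumes "bij \<pi>" "\<pi> ` A \<subseteq> A" "f \<in> mpoly_on A" shows "msub c \<pi> f \<in> mpoly_on A"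
  using assms(3)
  by (induction f rule: mpoly_on_induct)
    (auto simp: msub_mon msub_add intro: mpoly_on_add mpoly_on_mon exps_on_relabel[OF assms(1,2)])

lemma qspace_on_zero [simp]: "0 \<in> qspace_on A" by (simp add: qspace_on_def)

lemma qspace_on_add: "u \<in> qspace_on A \<Longrightarrow> v \<in> qspace_on A \<Longrightarrow> u + v \<in> qspace_on A"
  unfolding qspace_on_def by (auto simp: lookup_add intro: mpoly_on_add dest!: subsetD[OF keys_add])

lemma qspace_on_mon: "\<beta> \<in> exps_on A \<Longrightarrow> f \<in> mpoly_on A \<Longrightarrow> mon \<beta> f \<in> qspace_on A"
  by (auto simp: qspace_on_def lookup_single when_def)

lemma qspace_on_induct_poly [consumes 1, case_names mon add]:
  assumes "u \<in> qspace_on A" "\<And>\<beta> f. \<beta> \<in> exps_on A \<Longrightarrow> f \<in> mpoly_on A \<Longrightarrow> P (mon \<beta> f)"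
    "\<And>u v. u \<in> qspace_on A \<Longrightarrow> v \<in> qspace_on A \<Longrightarrow> P u \<Longrightarrow> P v \<Longrightarrow> P (u + v)"
  shows "P u"
proof -
  have "P (\<Sum>\<beta>\<in>B. mon \<beta> (coef u \<beta>)) \<and> (\<Sum>\<beta>\<in>B. mon \<beta> (coef u \<beta>)) \<in> qspace_on A"
    if "finite B" "B \<subseteq> exps_on A" for B
    using that
  proof (induction B rule: finite_induct)
    case empty
    show ?case using assms(2)[of 0 0] by simp
  next
    case (insert \<beta> B)
    have f: "coef u \<beta> \<in> mpoly_on A" using assms(1) by (simp add: qspace_on_def)
    have \<beta>: "\<beta> \<in> exps_on A" using insert by blast
    show ?case unfolding sum.insert[OF insert.hyps]
      using insert assms(2)[OF \<beta> f] assms(3)[OF qspace_on_mon[OF \<beta> f]] qspace_on_add[OF qspace_on_mon[OF \<beta> f]]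
      by blast
  qed
  from this[of "supp u"] have "P (\<Sum>\<beta>\<in>supp u. mon \<beta> (coef u \<beta>))" using assms(1) by (simp add: qspace_on_def)
  then show ?thesis by (rule subst[OF pm_expand[symmetric], of P])
qed

lemma qspace_on_induct [consumes 1, case_names mon add]:
  assumes u: "u \<in> qspace_on A" and mon: "\<And>\<beta> a x. \<beta> \<in> exps_on A \<Longrightarrow> a \<in> exps_on A \<Longrightarrow> P (mon \<beta> (mon a x))"
    and add: "\<And>u v. u \<in> qspace_on A \<Longrightarrow> v \<in> qspace_on A \<Longrightarrow> P u \<Longrightarrow> P v \<Longrightarrow> P (u + v)"
  shows "P u"
  using u
proof (induction u rule: qspace_on_induct_poly)
  case (mon \<beta> f)
  from mon(2) show ?case
  proof (induction f rule: mpoly_on_induct)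
    case (mon a x)
    show ?case by (rule assms(2)) fact+
  next
    case (add f g)
    show ?case unfolding single_add
      by (rule assms(3)) (use add \<open>\<beta> \<in> exps_on A\<close> in \<open>auto intro: qspace_on_mon\<close>)
  qed
qed (rule add)

lemma qspace_on_qmul:
  assumes "u \<in> qspace_on A" "v \<in> qspace_on A" shows "qmul q u v \<in> qspace_on A"
  using assms(1)
proof (induction u rule: qspace_on_induct_poly)
  case (mon \<beta> f)
  show ?case using assms(2)
    by (induction v rule: qspace_on_induct_poly)
      (use mon in \<open>auto simp: qmul_mon qmul_add_right intro!: qspace_on_mon qspace_on_add exps_on_add mpoly_on_mult mpoly_on_msub\<close>)
qed (auto simp: qmul_add_left intro: qspace_on_add)

lemma qspace_on_mult:
  assumes "u \<in> qspace_on A" "v \<in> qspace_on A" shows "(u :: 'k::field qspace) * v \<in> qspace_on A"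
  using assms(1)
proof (induction u rule: qspace_on_induct_poly)
  case (mon \<beta> f)
  show ?case using assms(2)
    by (induction v rule: qspace_on_induct_poly)
      (use mon in \<open>auto simp: mult_single distrib_left intro!: qspace_on_mon qspace_on_add exps_on_add mpoly_on_mult\<close>)
qed (auto simp: distrib_right intro: qspace_on_add)

lemma qspace_on_one [simp]: "(1 :: 'k::field qspace) \<in> qspace_on A"
  using qspace_on_mon[of 0 A "1::'k mpoly"] by simp

lemma qspace_on_cst [simp]: "cst c \<in> qspace_on A"
  by (simp add: cst_def qspace_on_mon mpoly_on_mon)

lemma qspace_on_minus: "u \<in> qspace_on A \<Longrightarrow> - u \<in> (qspace_on A :: 'k::field qspace set)"
  by (auto simp: qspace_on_def intro: mpoly_on_minus)

lemma qspace_on_sum: "(\<And>i. i \<in> I \<Longrightarrow> f i \<in> qspace_on A) \<Longrightarrow> sum f I \<in> qspace_on A"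
  by (induction I rule: infinite_finite_induct) (auto intro: qspace_on_add)

lemma qspace_on_prod: "(\<And>i. i \<in> I \<Longrightarrow> f i \<in> qspace_on A) \<Longrightarrow> prod f I \<in> (qspace_on A :: 'k::field qspace set)"
  by (induction I rule: infinite_finite_induct) (auto intro: qspace_on_mult)

lemma qspace_on_mono: "A \<subseteq> B \<Longrightarrow> qspace_on A \<subseteq> qspace_on B"
proof -
  assume "A \<subseteq> B"
  then have "exps_on A \<subseteq> exps_on B" by (auto simp: exps_on_def)
  then show ?thesis unfolding qspace_on_def mpoly_on_def by blast
qed

lemma qspace_on_tsub:
  assumes "bij \<pi>" "\<pi> ` A \<subseteq> A" "u \<in> qspace_on A" shows "tsub c \<pi> u \<in> qspace_on A"
  using assms(3)
  by (induction u rule: qspace_on_induct_poly)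
    (auto simp: tsub_mon tsub_add intro: qspace_on_add qspace_on_mon exps_on_relabel[OF assms(1,2)] mpoly_on_msub[OF assms(1,2)])

lemma weight_disjoint:
  assumes "a \<in> exps_on A" "b \<in> exps_on B" "A \<inter> B = {}"
  shows "weight (\<lambda>i. q ^ coef a i) b = (1 :: 'k::field)"
proof -
  have "weight (\<lambda>i. q ^ coef a i) b = weight (\<lambda>i. 1) b"
  proof (rule weight_cong)
    fix i assume "i \<in> supp b"
    then have "i \<notin> supp a" using assms by (auto simp: exps_on_def)
    then show "q ^ coef a i = 1" by (simp add: in_keys_iff)
  qed
  then show ?thesis by simp
qed

text \<open>Dilations in some variables fix the other variables, so elements with disjoint variables commute past each
  other and the tensor product becomes the product of the type.\<close>

lemma qmul_disjoint:
  assumes "u \<in> qspace_on A" "v \<in> qspace_on A" "u' \<in> qspace_on B" "v' \<in> qspace_on B" "A \<inter> B = {}"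
  shows "qmul q (u * u') (v * v') = qmul q u v * qmul q u' v'"
  using assms(1)
proof (induction u rule: qspace_on_induct)
  case (mon \<beta> a x)
  note ua = mon
  from assms(2) show ?case
  proof (induction v rule: qspace_on_induct)
    case (mon \<delta> d y)
    note va = mon
    from assms(3) show ?case
    proof (induction u' rule: qspace_on_induct)
      case (mon \<beta>' a' x')
      note ub = mon
      from assms(4) show ?case
      proof (induction v' rule: qspace_on_induct)
        case (mon \<delta>' d' y')
        have w: "weight (\<lambda>i. q ^ coef \<beta> i) d' = 1" "weight (\<lambda>i. q ^ coef \<beta>' i) d = 1"
          by (rule weight_disjoint[where A = A and B = B], fact+,
            rule weight_disjoint[where A = B and B = A]) (use va ub assms(5) in auto)
        show ?case
          by (simp add: mult_single qmul_mon msub_mon weight_add lookup_add power_add weight_mult w ac_simps)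
      qed (simp add: distrib_left qmul_add_right)
    qed (simp add: distrib_left distrib_right qmul_add_left)
  qed (simp add: distrib_left distrib_right qmul_add_right)
qed (simp add: distrib_left distrib_right qmul_add_left)

lemma qmul_prod_disjoint:
  assumes "finite I" "\<And>i. i \<in> I \<Longrightarrow> u i \<in> qspace_on {i}" "\<And>i. i \<in> I \<Longrightarrow> v i \<in> qspace_on {i}"
  shows "qmul q (\<Prod>i\<in>I. u i) (\<Prod>i\<in>I. v i) = (\<Prod>i\<in>I. qmul q (u i) (v i))"
  using assms
proof (induction I rule: finite_induct)
  case (insert j I)
  have "qmul q (u j * prod u I) (v j * prod v I) = qmul q (u j) (v j) * qmul q (prod u I) (prod v I)"
    by (rule qmul_disjoint[where A = "{j}" and B = I])
      (use insert qspace_on_mono[of "{_}" I] in \<open>auto intro!: qspace_on_prod\<close>)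
  then show ?case using insert by simp
qed simp

section \<open>Evaluation of the quantum plane\<close>

definition xgen :: "nat \<Rightarrow> 'k::field qspace" where "xgen i = mon 0 (mon (mon i 1) 1)"
definition ygen :: "nat \<Rightarrow> 'k::field qspace" where "ygen i = mon (mon i 1) 1"

lemma xygen_on: "i \<in> A \<Longrightarrow> xgen i \<in> qspace_on A" "i \<in> A \<Longrightarrow> ygen i \<in> qspace_on A"
  by (simp_all add: xgen_def ygen_def qspace_on_mon mpoly_on_mon exps_on_mon)

fun word_eval :: "'k::field \<Rightarrow> nat \<Rightarrow> plane_gen list \<Rightarrow> 'k qspace" where
  "word_eval q i [] = 1"
| "word_eval q i (PX # w) = qmul q (xgen i) (word_eval q i w)"
| "word_eval q i (PY # w) = qmul q (ygen i) (word_eval q i w)"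

lemma word_eval_append: "word_eval q i (v @ w) = qmul q (word_eval q i v) (word_eval q i w)"
proof (induction v)
  case (Cons g v)
  then show ?case by (cases g) (simp_all add: qmul_assoc)
qed simp

lemma word_eval_on: "word_eval q i w \<in> qspace_on {i}"
proof (induction w)
  case (Cons g w)
  then show ?case by (cases g) (auto intro: qspace_on_qmul xygen_on)
qed simp

lemma word_eval_ordered:
  "word_eval q i (replicate a PX @ replicate b PY) = mon (mon i b) (mon (mon i a) 1)"
proof (induction a)
  case 0
  show ?case
    by (induction b) (simp_all add: ygen_def qmul_mon msub_id mult_single single_add[symmetric])
next
  case (Suc a)
  then show ?case by (simp add: xgen_def qmul_x_left mult_single single_add[symmetric])
qed

abbreviation "word_monoid \<equiv> free_monoid (UNIV :: plane_gen set)"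

lemma monoid_word: "Group.monoid word_monoid"
  by (rule monoidI) (auto simp: free_monoid_def)

lemma word_monoid_simps: "carrier word_monoid = UNIV" "monoid.mult word_monoid = (@)" "\<one>\<^bsub>word_monoid\<^esub> = []"
  by (simp_all add: free_monoid_def)

interpretation word_ring: ring "monoid_algebra word_monoid :: ('k::field, plane_gen list \<Rightarrow>\<^sub>0 'k) module"
  by (rule ring_monoid_algebra[OF monoid_word])

interpretation plane: monoid_algebra_quotient word_monoid "plane_ideal q" for q :: "'k::field"
  by (rule monoid_algebra_quotient.intro[OF monoid_word], unfold plane_ideal_def,
    rule word_ring.genideal_ideal) (simp add: monoid_algebra_simps word_monoid_simps)

lemma quantum_plane_eq: "quantum_plane q = quotient_algebra (monoid_algebra word_monoid) (plane_ideal q)"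
  by (simp add: quantum_plane_def)

definition pword :: "'k::field \<Rightarrow> plane_gen list \<Rightarrow> (plane_gen list \<Rightarrow>\<^sub>0 'k) set" where
  "pword q w = plane_ideal q +>\<^bsub>monoid_algebra word_monoid\<^esub> mon w 1"

definition plane_eval :: "'k::field \<Rightarrow> nat \<Rightarrow> (plane_gen list \<Rightarrow>\<^sub>0 'k) set \<Rightarrow> 'k qspace" where
  "plane_eval q i = descend (eval_algebra (word_eval q i))"

text \<open>The only relation to check is \<open>y x = q x y\<close>.\<close>

lemma plane_eval_cls:
  "plane_eval q i (plane_ideal q +>\<^bsub>monoid_algebra word_monoid\<^esub> f) = eval_algebra (word_eval q i) f"
  unfolding plane_eval_def
proof (rule plane.descend_cls)
  fix f assume "f \<in> plane_ideal q"
  then show "eval_algebra (word_eval q i) f = 0" unfolding plane_ideal_def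
  proof (rule eval_algebra_genideal[OF monoid_word, rotated 4])
    fix r :: "plane_gen list \<Rightarrow>\<^sub>0 'a"
    assume "r \<in> {mon [PY, PX] 1 - mon [PX, PY] q}"
    then show "eval_algebra (word_eval q i) r = 0"
      by (simp add: eval_algebra_diff eval_algebra_mon xgen_def ygen_def qmul_mon msub_mon cst_def mult_single)
  qed (auto simp: word_monoid_simps word_eval_append monoid_algebra_simps)
qed (auto simp: eval_algebra_add monoid_algebra_simps word_monoid_simps)

lemma pcarrier: "f \<in> carrier (monoid_algebra word_monoid)"
  by (simp add: monoid_algebra_simps word_monoid_simps)

lemma plane_eval_add: "a \<in> carrier (quantum_plane q) \<Longrightarrow> b \<in> carrier (quantum_plane q) \<Longrightarrow>
    plane_eval q i (a \<oplus>\<^bsub>quantum_plane q\<^esub> b) = plane_eval q i a + plane_eval q i b"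
  unfolding quantum_plane_eq plane.carrier_Q
  by (auto simp: plane.cls_add plane_eval_cls eval_algebra_add)

lemma plane_eval_mult: "a \<in> carrier (quantum_plane q) \<Longrightarrow> b \<in> carrier (quantum_plane q) \<Longrightarrow>
    plane_eval q i (a \<otimes>\<^bsub>quantum_plane q\<^esub> b) = qmul q (plane_eval q i a) (plane_eval q i b)"
  unfolding quantum_plane_eq plane.carrier_Q
  by (auto simp: plane.cls_mult plane_eval_cls word_eval_append word_monoid_simps
      intro!: eval_algebra_conv[where M = word_monoid, unfolded word_monoid_simps])

lemma plane_eval_smult: "a \<in> carrier (quantum_plane q) \<Longrightarrow>
    plane_eval q i (c \<odot>\<^bsub>quantum_plane q\<^esub> a) = cst c * plane_eval q i a"
  unfolding quantum_plane_eq plane.carrier_Q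
  by (auto simp: plane.cls_smult plane_eval_cls eval_algebra_cscale)

lemma plane_eval_pword: "plane_eval q i (pword q w) = word_eval q i w"
  by (simp add: pword_def plane_eval_cls eval_algebra_mon)

lemma plane_eval_one: "plane_eval q i \<one>\<^bsub>quantum_plane q\<^esub> = 1"
  by (simp add: quantum_plane_eq plane.cls_one plane_eval_cls eval_algebra_mon word_monoid_simps)

lemma plane_eval_on: "a \<in> carrier (quantum_plane q) \<Longrightarrow> plane_eval q i a \<in> qspace_on {i}"
  unfolding quantum_plane_eq
proof (induction a rule: plane.Q_induct)
  case (mon a x)
  show ?case by (simp add: plane_eval_cls eval_algebra_mon qspace_on_mult word_eval_on)
next
  case (add u v)
  then show ?case by (simp add: plane_eval_add[unfolded quantum_plane_eq] qspace_on_add)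
qed

lemma pword_closed [simp]: "pword q w \<in> carrier (quantum_plane q)"
  by (simp add: pword_def quantum_plane_eq plane.cls_closed monoid_algebra_simps word_monoid_simps)

lemma pword_mult: "pword q v \<otimes>\<^bsub>quantum_plane q\<^esub> pword q w = pword q (v @ w)"
  unfolding pword_def quantum_plane_eq
  by (subst plane.cls_mon_mult) (simp_all add: word_monoid_simps)

lemma pword_Nil: "pword q [] = \<one>\<^bsub>quantum_plane q\<^esub>"
  by (simp add: pword_def quantum_plane_eq plane.cls_one word_monoid_simps)

lemma ring_plane: "Ring.ring (quantum_plane q)"
  unfolding quantum_plane_eq by (rule plane.ring_Q)

interpretation plane: ring "quantum_plane q" for q :: "'k::field" by (rule ring_plane)

lemma plane_relation: "pword q [PY, PX] = q \<odot>\<^bsub>quantum_plane q\<^esub> pword q [PX, PY]"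
proof -
  have "mon [PY, PX] 1 - mon [PX, PY] q \<in> plane_ideal q"
    unfolding plane_ideal_def by (rule word_ring.genideal_self') (simp add: monoid_algebra_simps word_monoid_simps)
  then have "pword q [PY, PX] = plane_ideal q +>\<^bsub>monoid_algebra word_monoid\<^esub> mon [PX, PY] q"
    unfolding pword_def by (subst plane.cls_eq) (auto simp: pcarrier)
  also have "\<dots> = q \<odot>\<^bsub>quantum_plane q\<^esub> pword q [PX, PY]"
    unfolding pword_def quantum_plane_eq by (rule plane.cls_mon_smult) (simp add: word_monoid_simps)
  finally show ?thesis .
qed

section \<open>Quantum affine space as a twisted polynomial ring\<close>

definition tuples :: "'k::field \<Rightarrow> nat \<Rightarrow> (nat \<Rightarrow> (plane_gen list \<Rightarrow>\<^sub>0 'k) set) monoid" where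
  "tuples q n = product_group {..<n} (\<lambda>_. quantum_plane q)"

lemma tuples_simps:
  "carrier (tuples q n) = (\<Pi>\<^sub>E i\<in>{..<n}. carrier (quantum_plane q))"
  "s \<otimes>\<^bsub>tuples q n\<^esub> t = (\<lambda>i\<in>{..<n}. s i \<otimes>\<^bsub>quantum_plane q\<^esub> t i)"
  "\<one>\<^bsub>tuples q n\<^esub> = (\<lambda>i\<in>{..<n}. \<one>\<^bsub>quantum_plane q\<^esub>)"
  by (simp_all add: tuples_def)

lemma monoid_tuples: "Group.monoid (tuples q n)"
proof (rule monoidI)
  fix x assume "x \<in> carrier (tuples q n)"
  then have x: "x i \<in> carrier (quantum_plane q)" "\<And>i. \<not> i < n \<Longrightarrow> x i = undefined" if "i < n" for i
    using that by (auto simp: tuples_simps PiE_def extensional_def)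
  show "\<one>\<^bsub>tuples q n\<^esub> \<otimes>\<^bsub>tuples q n\<^esub> x = x" "x \<otimes>\<^bsub>tuples q n\<^esub> \<one>\<^bsub>tuples q n\<^esub> = x"
    using \<open>x \<in> carrier (tuples q n)\<close> x(1) by (auto simp: tuples_simps fun_eq_iff restrict_def PiE_def extensional_def)
qed (auto simp: tuples_simps PiE_iff fun_eq_iff plane.m_assoc)

definition tensor_rel_ideal :: "'k::field \<Rightarrow> nat \<Rightarrow> ((nat \<Rightarrow> (plane_gen list \<Rightarrow>\<^sub>0 'k) set) \<Rightarrow>\<^sub>0 'k) set" where
  "tensor_rel_ideal q n = tensor_ideal {..<n} (\<lambda>_. quantum_plane q)"

lemma update_tuple:
  "t \<in> carrier (tuples q n) \<Longrightarrow> i < n \<Longrightarrow> a \<in> carrier (quantum_plane q) \<Longrightarrow> t(i := a) \<in> carrier (tuples q n)"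
  by (auto simp: tuples_simps PiE_def extensional_def)

lemma tensor_relations_subset:
  "tensor_relations {..<n} (\<lambda>_. quantum_plane q) \<subseteq> carrier (monoid_algebra (tuples q n))"
proof
  fix r assume "r \<in> tensor_relations {..<n} (\<lambda>_. quantum_plane q)"
  have diff: "f - g \<in> carrier (monoid_algebra (tuples q n))"
    if "f \<in> carrier (monoid_algebra (tuples q n))" "g \<in> carrier (monoid_algebra (tuples q n))" for f g
    using that supp_add_subset[of f "carrier (tuples q n)" "- g"] by (simp add: monoid_algebra_simps)
  have mon: "mon t c \<in> carrier (monoid_algebra (tuples q n))" if "t \<in> carrier (tuples q n)" for t c
    using that by (simp add: monoid_algebra_simps)
  have smult: "c \<odot>\<^bsub>quantum_plane q\<^esub> a \<in> carrier (quantum_plane q)" if "a \<in> carrier (quantum_plane q)" for c a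
    using that unfolding quantum_plane_eq by (rule plane.smult_closed_Q)
  from \<open>r \<in> _\<close> show "r \<in> carrier (monoid_algebra (tuples q n))"
    unfolding tensor_relations_def tuples_simps(1)[symmetric]
    by (elim UnE CollectE exE conjE) (simp_all add: diff mon update_tuple smult)
qed

interpretation tuple_ring: ring "monoid_algebra (tuples q n)" for q :: "'k::field" and n
  by (rule ring_monoid_algebra[OF monoid_tuples])

interpretation qas: monoid_algebra_quotient "tuples q n" "tensor_rel_ideal q n" for q :: "'k::field" and n
  by (rule monoid_algebra_quotient.intro[OF monoid_tuples],
    unfold tensor_rel_ideal_def tensor_ideal_def tuples_def[symmetric],
    rule tuple_ring.genideal_ideal, rule tensor_relations_subset)

lemma qas_eq: "quantum_affine_space q n = quotient_algebra (monoid_algebra (tuples q n)) (tensor_rel_ideal q n)"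
  by (simp add: quantum_affine_space_def tensor_algebra_def tuples_def tensor_rel_ideal_def)

definition tuple_eval :: "'k::field \<Rightarrow> nat \<Rightarrow> (nat \<Rightarrow> (plane_gen list \<Rightarrow>\<^sub>0 'k) set) \<Rightarrow> 'k qspace" where
  "tuple_eval q n t = (\<Prod>i<n. plane_eval q i (t i))"

lemma tuple_eval_mult: "s \<in> carrier (tuples q n) \<Longrightarrow> t \<in> carrier (tuples q n) \<Longrightarrow>
    tuple_eval q n (s \<otimes>\<^bsub>tuples q n\<^esub> t) = qmul q (tuple_eval q n s) (tuple_eval q n t)"
  unfolding tuple_eval_def
  by (subst qmul_prod_disjoint) (auto simp: tuples_simps plane_eval_mult PiE_iff intro!: prod.cong plane_eval_on)

lemma tuple_eval_one: "tuple_eval q n \<one>\<^bsub>tuples q n\<^esub> = 1"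
  by (simp add: tuple_eval_def tuples_simps plane_eval_one)

lemma tuple_eval_update:
  "i < n \<Longrightarrow> tuple_eval q n (t(i := a)) = plane_eval q i a * (\<Prod>j\<in>{..<n} - {i}. plane_eval q j (t j))"
  unfolding tuple_eval_def by (subst prod.remove[of _ i]) (auto intro!: prod.cong)

lemma tuple_eval_on: "t \<in> carrier (tuples q n) \<Longrightarrow> tuple_eval q n t \<in> qspace_on {..<n}"
  unfolding tuple_eval_def
  by (intro qspace_on_prod subsetD[OF qspace_on_mono plane_eval_on]) (auto simp: tuples_simps)

text \<open>A pure tensor is sent to the product of the values of its entries, the \<open>i\<close>-th one computed with \<open>x\<^sub>i\<close> and \<open>y\<^sub>i\<close>.\<close>

definition qas_eval :: "'k::field \<Rightarrow> nat \<Rightarrow> 'k quantum_elt \<Rightarrow> 'k qspace" where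
  "qas_eval q n = descend (eval_algebra (tuple_eval q n))"

abbreviation tcls :: "'k::field \<Rightarrow> nat \<Rightarrow> ((nat \<Rightarrow> (plane_gen list \<Rightarrow>\<^sub>0 'k) set) \<Rightarrow>\<^sub>0 'k) \<Rightarrow> 'k quantum_elt" where
  "tcls q n f \<equiv> tensor_rel_ideal q n +>\<^bsub>monoid_algebra (tuples q n)\<^esub> f"

lemma qas_eval_cls:
  assumes "f \<in> carrier (monoid_algebra (tuples q n))"
  shows "qas_eval q n (tcls q n f) = eval_algebra (tuple_eval q n) f"
  unfolding qas_eval_def
proof (rule qas.descend_cls)
  fix f assume "f \<in> tensor_rel_ideal q n"
  then show "eval_algebra (tuple_eval q n) f = 0"
    unfolding tensor_rel_ideal_def tensor_ideal_def tuples_def[symmetric]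
  proof (rule eval_algebra_genideal[OF monoid_tuples, rotated 4])
    fix r assume "r \<in> tensor_relations {..<n} (\<lambda>_. quantum_plane q)"
    then show "eval_algebra (tuple_eval q n) r = 0"
      unfolding tensor_relations_def
      by (auto simp: eval_algebra_diff eval_algebra_mon tuple_eval_update plane_eval_add plane_eval_smult
          distrib_right mult.assoc)
  qed (auto simp: tuple_eval_mult tuple_eval_one intro: subsetD[OF tensor_relations_subset])
qed (auto simp: eval_algebra_add assms)

lemma ring_qas: "Ring.ring (quantum_affine_space q n)"
  unfolding qas_eq by (rule qas.ring_Q)

interpretation qas: ring "quantum_affine_space q n" for q :: "'k::field" and n by (rule ring_qas)

lemma qas_eval_add: "a \<in> carrier (quantum_affine_space q n) \<Longrightarrow> b \<in> carrier (quantum_affine_space q n) \<Longrightarrow>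
    qas_eval q n (a \<oplus>\<^bsub>quantum_affine_space q n\<^esub> b) = qas_eval q n a + qas_eval q n b"
  unfolding qas_eq qas.carrier_Q
  by (auto simp: qas.cls_add qas_eval_cls eval_algebra_add qas.add_closed_A)

lemma conv_closed: "f \<in> carrier (monoid_algebra (tuples q n)) \<Longrightarrow> g \<in> carrier (monoid_algebra (tuples q n)) \<Longrightarrow>
    conv (monoid.mult (tuples q n)) (\<lambda>_ x. x) f g \<in> carrier (monoid_algebra (tuples q n))"
  using tuple_ring.m_closed[of f q n g] by (simp add: monoid_algebra_simps)

lemma qas_eval_mult: "a \<in> carrier (quantum_affine_space q n) \<Longrightarrow> b \<in> carrier (quantum_affine_space q n) \<Longrightarrow>
    qas_eval q n (a \<otimes>\<^bsub>quantum_affine_space q n\<^esub> b) = qmul q (qas_eval q n a) (qas_eval q n b)"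
  unfolding qas_eq qas.carrier_Q
proof (elim imageE, hypsubst)
  fix f g :: "(nat \<Rightarrow> (plane_gen list \<Rightarrow>\<^sub>0 'a) set) \<Rightarrow>\<^sub>0 'a"
  assume f: "f \<in> carrier (monoid_algebra (tuples q n))" and g: "g \<in> carrier (monoid_algebra (tuples q n))"
  have "eval_algebra (tuple_eval q n) (conv (monoid.mult (tuples q n)) (\<lambda>_ x. x) f g) =
      qmul q (eval_algebra (tuple_eval q n) f) (eval_algebra (tuple_eval q n) g)"
    by (rule eval_algebra_conv) (use f g tuple_eval_mult in \<open>auto simp: qas.carrier_A\<close>)
  then show "qas_eval q n (tcls q n f \<otimes>\<^bsub>quotient_algebra (monoid_algebra (tuples q n)) (tensor_rel_ideal q n)\<^esub> tcls q n g) =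
      qmul q (qas_eval q n (tcls q n f)) (qas_eval q n (tcls q n g))"
    by (simp only: qas.cls_mult[OF f g] qas_eval_cls[OF f] qas_eval_cls[OF g] qas_eval_cls[OF conv_closed[OF f g]])
qed

lemma qas_eval_smult: "a \<in> carrier (quantum_affine_space q n) \<Longrightarrow>
    qas_eval q n (c \<odot>\<^bsub>quantum_affine_space q n\<^esub> a) = cst c * qas_eval q n a"
  unfolding qas_eq qas.carrier_Q
  by (auto simp: qas.cls_smult qas_eval_cls qas.cscale_closed eval_algebra_cscale)

lemma qas_eval_one: "qas_eval q n \<one>\<^bsub>quantum_affine_space q n\<^esub> = 1"
  unfolding qas_eq qas.cls_one
  by (subst qas_eval_cls)
    (simp_all add: qas.mon_closed monoid.one_closed[OF monoid_tuples] eval_algebra_mon tuple_eval_one)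

lemma qas_eval_on: "a \<in> carrier (quantum_affine_space q n) \<Longrightarrow> qas_eval q n a \<in> qspace_on {..<n}"
  unfolding qas_eq
proof (induction a rule: qas.Q_induct)
  case (mon a x)
  then show ?case by (simp add: qas_eval_cls qas.mon_closed eval_algebra_mon qspace_on_mult tuple_eval_on)
next
  case (add u v)
  then show ?case by (simp add: qas_eval_add[unfolded qas_eq] qspace_on_add)
qed

definition single_tuple :: "'k::field \<Rightarrow> nat \<Rightarrow> nat \<Rightarrow> (plane_gen list \<Rightarrow>\<^sub>0 'k) set \<Rightarrow>
    nat \<Rightarrow> (plane_gen list \<Rightarrow>\<^sub>0 'k) set" where
  "single_tuple q n i a = (\<lambda>j\<in>{..<n}. if j = i then a else \<one>\<^bsub>quantum_plane q\<^esub>)"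

lemma single_tuple_closed: "a \<in> carrier (quantum_plane q) \<Longrightarrow> single_tuple q n i a \<in> carrier (tuples q n)"
  by (simp add: tuples_simps single_tuple_def)

lemma tensor_inj_eq: "tensor_inj {..<n} (\<lambda>_. quantum_plane q) i a = tcls q n (mon (single_tuple q n i a) 1)"
  by (simp add: tensor_inj_def tensor_rel_ideal_def tuples_def single_tuple_def)

lemma plane_var_eq: "plane_var q g = pword q [g]"
  by (simp add: plane_var_def pword_def)

lemma xvar_eq: "xvar q n i = tcls q n (mon (single_tuple q n i (pword q [PX])) 1)"
  and yvar_eq: "yvar q n i = tcls q n (mon (single_tuple q n i (pword q [PY])) 1)"
  by (simp_all add: xvar_def yvar_def tensor_inj_eq plane_var_eq)

lemma xvar_closed: "xvar q n i \<in> carrier (quantum_affine_space q n)"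
  and yvar_closed: "yvar q n i \<in> carrier (quantum_affine_space q n)"
  unfolding qas_eq xvar_eq yvar_eq
  by (auto intro!: qas.cls_closed qas.mon_closed single_tuple_closed)

lemma tuple_eval_single: "i < n \<Longrightarrow> tuple_eval q n (single_tuple q n i a) = plane_eval q i a"
  unfolding tuple_eval_def single_tuple_def
  by (subst prod.remove[of _ i]) (auto simp: plane_eval_one)

lemma qas_eval_xvar: "i < n \<Longrightarrow> qas_eval q n (xvar q n i) = xgen i"
  and qas_eval_yvar: "i < n \<Longrightarrow> qas_eval q n (yvar q n i) = ygen i"
  unfolding xvar_eq yvar_eq
  by (simp_all add: qas_eval_cls qas.mon_closed single_tuple_closed eval_algebra_mon
      tuple_eval_single plane_eval_pword)

lemma tuple_add_relation:
  fixes q :: "'k::field"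
  assumes "t \<in> carrier (tuples q n)" "i < n" "a \<in> carrier (quantum_plane q)" "b \<in> carrier (quantum_plane q)"
  shows "tcls q n (mon (t(i := a \<oplus>\<^bsub>quantum_plane q\<^esub> b)) 1) =
    tcls q n (mon (t(i := a)) 1) \<oplus>\<^bsub>quantum_affine_space q n\<^esub> tcls q n (mon (t(i := b)) 1)"
proof -
  let ?f = "mon (t(i := a \<oplus>\<^bsub>quantum_plane q\<^esub> b)) (1 :: 'k)" and ?g = "mon (t(i := a)) (1 :: 'k)"
    and ?h = "mon (t(i := b)) (1 :: 'k)"
  have c: "?f \<in> carrier (monoid_algebra (tuples q n))" "?g \<in> carrier (monoid_algebra (tuples q n))"
    "?h \<in> carrier (monoid_algebra (tuples q n))"
    using assms by (auto intro!: qas.mon_closed update_tuple)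
  have "?f - ?g - ?h \<in> tensor_relations {..<n} (\<lambda>_. quantum_plane q)"
    using assms unfolding tensor_relations_def tuples_simps by blast
  then have "?f - (?g + ?h) \<in> tensor_rel_ideal q n"
    using subsetD[OF tuple_ring.genideal_self[OF tensor_relations_subset[of n q]]]
    by (simp add: tensor_rel_ideal_def tensor_ideal_def tuples_def diff_diff_eq)
  then have "tcls q n ?f = tcls q n (?g + ?h)"
    using qas.cls_eq[OF c(1) qas.add_closed_A[OF c(2,3)]] by simp
  then show ?thesis by (simp add: qas_eq qas.cls_add c)
qed

lemma tuple_smult_relation:
  fixes q :: "'k::field"
  assumes "t \<in> carrier (tuples q n)" "i < n" "a \<in> carrier (quantum_plane q)"
  shows "tcls q n (mon (t(i := c \<odot>\<^bsub>quantum_plane q\<^esub> a)) 1) = tcls q n (mon (t(i := a)) c)"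
proof -
  let ?f = "mon (t(i := c \<odot>\<^bsub>quantum_plane q\<^esub> a)) (1 :: 'k)" and ?g = "mon (t(i := a)) c"
  have a: "c \<odot>\<^bsub>quantum_plane q\<^esub> a \<in> carrier (quantum_plane q)"
    using assms(3) unfolding quantum_plane_eq by (rule plane.smult_closed_Q)
  have c: "?f \<in> carrier (monoid_algebra (tuples q n))" "?g \<in> carrier (monoid_algebra (tuples q n))"
    using assms a by (auto intro!: qas.mon_closed update_tuple)
  have "?f - ?g \<in> tensor_relations {..<n} (\<lambda>_. quantum_plane q)"
    using assms unfolding tensor_relations_def tuples_simps by blast
  then have "?f - ?g \<in> tensor_rel_ideal q n"
    using subsetD[OF tuple_ring.genideal_self[OF tensor_relations_subset[of n q]]]
    by (simp add: tensor_rel_ideal_def tensor_ideal_def tuples_def)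
  then show ?thesis using qas.cls_eq[OF c] by simp
qed

subsection \<open>Generation by the variables\<close>

text \<open>A pure tensor is a product of tensors with a single nontrivial entry, and that entry is a combination of words
  in the two generators of the quantum plane.\<close>

lemma qas_generated [consumes 1, case_names add mult scalar xvar yvar]:
  fixes q :: "'k::field"
  assumes u: "u \<in> carrier (quantum_affine_space q n)"
    and add: "\<And>u v. u \<in> carrier (quantum_affine_space q n) \<Longrightarrow> v \<in> carrier (quantum_affine_space q n) \<Longrightarrow>
        P u \<Longrightarrow> P v \<Longrightarrow> P (u \<oplus>\<^bsub>quantum_affine_space q n\<^esub> v)"
    and mult: "\<And>u v. u \<in> carrier (quantum_affine_space q n) \<Longrightarrow> v \<in> carrier (quantum_affine_space q n) \<Longrightarrow>
        P u \<Longrightarrow> P v \<Longrightarrow> P (u \<otimes>\<^bsub>quantum_affine_space q n\<^esub> v)"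
    and scalar: "\<And>c. P (c \<odot>\<^bsub>quantum_affine_space q n\<^esub> \<one>\<^bsub>quantum_affine_space q n\<^esub>)"
    and gens: "\<And>i. i < n \<Longrightarrow> P (xvar q n i)" "\<And>i. i < n \<Longrightarrow> P (yvar q n i)"
  shows "P u"
proof -
  let ?E = "quantum_affine_space q n" and ?S = "\<lambda>i a. tcls q n (mon (single_tuple q n i a) 1)"
  have smult: "P (c \<odot>\<^bsub>?E\<^esub> v)" if "v \<in> carrier ?E" "P v" for c v
  proof -
    have "c \<odot>\<^bsub>?E\<^esub> \<one>\<^bsub>?E\<^esub> \<in> carrier ?E"
      using qas.one_closed[of q n] unfolding qas_eq by (rule qas.smult_closed_Q)
    then show ?thesis
      using mult[OF _ that(1) scalar that(2)] qas.smult_eq_mult[of v q n c] that(1) unfolding qas_eq by simp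
  qed
  have S_closed: "?S i a \<in> carrier ?E" if "a \<in> carrier (quantum_plane q)" for i a
    unfolding qas_eq using that by (intro qas.cls_closed qas.mon_closed single_tuple_closed)
  have one: "P \<one>\<^bsub>?E\<^esub>"
    using scalar[of 1] qas.cls_smult[of "mon \<one>\<^bsub>tuples q n\<^esub> 1" q n 1]
    by (simp add: qas_eq qas.cls_one qas.mon_closed tuples_simps cscale_mon)
  have upd: "single_tuple q n i a = (single_tuple q n i \<one>\<^bsub>quantum_plane q\<^esub>)(i := a)" if "i < n" for i a
    using that by (auto simp: single_tuple_def fun_eq_iff)
  have S_mult: "?S i (a \<otimes>\<^bsub>quantum_plane q\<^esub> b) = ?S i a \<otimes>\<^bsub>?E\<^esub> ?S i b"
    if "a \<in> carrier (quantum_plane q)" "b \<in> carrier (quantum_plane q)" for i a b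
  proof -
    have "single_tuple q n i (a \<otimes>\<^bsub>quantum_plane q\<^esub> b) = single_tuple q n i a \<otimes>\<^bsub>tuples q n\<^esub> single_tuple q n i b"
      by (auto simp: tuples_simps(2) single_tuple_def fun_eq_iff restrict_def)
    then show ?thesis using that unfolding qas_eq
      by (subst qas.cls_mon_mult) (simp_all add: single_tuple_closed)
  qed
  have S_add: "?S i (a \<oplus>\<^bsub>quantum_plane q\<^esub> b) = ?S i a \<oplus>\<^bsub>?E\<^esub> ?S i b"
    if "i < n" "a \<in> carrier (quantum_plane q)" "b \<in> carrier (quantum_plane q)" for i a b
    unfolding upd[OF that(1), of a] upd[OF that(1), of b] upd[OF that(1), of "a \<oplus>\<^bsub>quantum_plane q\<^esub> b"]
    by (rule tuple_add_relation[OF single_tuple_closed[OF plane.one_closed] that])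
  have S_smult: "?S i (c \<odot>\<^bsub>quantum_plane q\<^esub> a) = c \<odot>\<^bsub>?E\<^esub> ?S i a"
    if "i < n" "a \<in> carrier (quantum_plane q)" for i a c
  proof -
    have t: "single_tuple q n i \<one>\<^bsub>quantum_plane q\<^esub> \<in> carrier (tuples q n)"
      by (intro single_tuple_closed plane.one_closed)
    show ?thesis
      unfolding upd[OF that(1), of a] upd[OF that(1), of "c \<odot>\<^bsub>quantum_plane q\<^esub> a"]
        tuple_smult_relation[OF t that] qas_eq by (rule qas.cls_mon_smult[OF update_tuple[OF t that]])
  qed
  have word: "P (?S i (pword q w))" if "i < n" for i w
  proof (induction w)
    case Nil
    have "single_tuple q n i \<one>\<^bsub>quantum_plane q\<^esub> = \<one>\<^bsub>tuples q n\<^esub>"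
      by (auto simp: single_tuple_def tuples_simps)
    then show ?case using one by (simp add: pword_Nil qas_eq qas.cls_one)
  next
    case (Cons g w)
    have "P (?S i (pword q [g]))"
      using gens[OF that] by (cases g) (simp_all add: xvar_eq yvar_eq)
    then have "P (?S i (pword q [g]) \<otimes>\<^bsub>?E\<^esub> ?S i (pword q w))"
      using Cons.IH S_closed by (intro mult) auto
    then show ?case using S_mult[of "pword q [g]" "pword q w" i] by (simp add: pword_mult)
  qed
  have plane: "P (?S i a)" if "i < n" "a \<in> carrier (quantum_plane q)" for i a
    using that(2) unfolding quantum_plane_eq
  proof (induction a rule: plane.Q_induct)
    case (mon w x)
    have "plane_ideal q +>\<^bsub>monoid_algebra word_monoid\<^esub> mon w x = x \<odot>\<^bsub>quantum_plane q\<^esub> pword q w"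
      unfolding pword_def quantum_plane_eq using mon by (rule plane.cls_mon_smult)
    then show ?case
      using smult[OF S_closed[OF pword_closed] word[OF that(1)]] by (simp add: S_smult[OF that(1) pword_closed])
  next
    case (add a b)
    then show ?case
      using assms(2)[of "?S i a" "?S i b"] S_closed S_add[OF that(1)] unfolding quantum_plane_eq by simp
  qed
  have tuple: "P (tcls q n (mon t 1))" if t: "t \<in> carrier (tuples q n)" for t
  proof -
    \<comment> \<open>the tensor whose entries from position \<open>k\<close> on are replaced by 1\<close>
    define tk where "tk k = (\<lambda>j\<in>{..<n}. if j < k then t j else \<one>\<^bsub>quantum_plane q\<^esub>)" for k
    have tj: "t j \<in> carrier (quantum_plane q)" if "j < n" for j using t that by (auto simp: tuples_simps)
    have tk: "tk k \<in> carrier (tuples q n)" for k using tj by (auto simp: tuples_simps tk_def)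
    have "P (tcls q n (mon (tk k) 1))" if "k \<le> n" for k
      using that
    proof (induction k)
      case 0
      have "tk 0 = \<one>\<^bsub>tuples q n\<^esub>" by (simp add: tk_def tuples_simps)
      then show ?case using one by (simp add: qas_eq qas.cls_one)
    next
      case (Suc k)
      have "tk (Suc k) = tk k \<otimes>\<^bsub>tuples q n\<^esub> single_tuple q n k (t k)"
        using tj by (auto simp: tk_def tuples_simps single_tuple_def fun_eq_iff restrict_def less_Suc_eq)
      then have "tcls q n (mon (tk (Suc k)) 1) = tcls q n (mon (tk k) 1) \<otimes>\<^bsub>?E\<^esub> ?S k (t k)"
        unfolding qas_eq using tk tj Suc.prems by (subst qas.cls_mon_mult) (auto intro: single_tuple_closed)
      moreover have "tcls q n (mon (tk k) 1) \<in> carrier ?E"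
        unfolding qas_eq by (intro qas.cls_closed qas.mon_closed tk)
      ultimately show ?case using Suc tj plane[of k "t k"] S_closed by (simp add: mult)
    qed
    moreover have "tk n = t" using t by (auto simp: tk_def tuples_simps fun_eq_iff PiE_def extensional_def)
    ultimately show ?thesis by blast
  qed
  from u show ?thesis unfolding qas_eq
  proof (induction u rule: qas.Q_induct)
    case (mon t x)
    have "tcls q n (mon t 1) \<in> carrier ?E" unfolding qas_eq by (intro qas.cls_closed qas.mon_closed mon)
    then show ?case using smult tuple[OF mon] qas.cls_mon_smult[OF mon, of x] unfolding qas_eq by simp
  next
    case (add u v)
    then show ?case using assms(2) unfolding qas_eq by blast
  qed
qed

subsection \<open>The inverse\<close>

definition monomial_tuple :: "'k::field \<Rightarrow> nat \<Rightarrow> exps \<Rightarrow> exps \<Rightarrow> nat \<Rightarrow> (plane_gen list \<Rightarrow>\<^sub>0 'k) set" where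
  "monomial_tuple q n a \<beta> = (\<lambda>j\<in>{..<n}. pword q (replicate (coef a j) PX @ replicate (coef \<beta> j) PY))"

definition pure_tensors :: "'k::field \<Rightarrow> nat \<Rightarrow> 'k qspace \<Rightarrow> ((nat \<Rightarrow> (plane_gen list \<Rightarrow>\<^sub>0 'k) set) \<Rightarrow>\<^sub>0 'k)" where
  "pure_tensors q n = lin_ext (\<lambda>\<beta>. lin_ext (\<lambda>a. mon (monomial_tuple q n a \<beta>)))"

text \<open>The candidate inverse writes each monomial as a tensor of ordered words \<open>x\<^sup>a y\<^sup>b\<close>.\<close>

definition qas_of :: "'k::field \<Rightarrow> nat \<Rightarrow> 'k qspace \<Rightarrow> 'k quantum_elt" where
  "qas_of q n w = tcls q n (pure_tensors q n w)"

lemma monomial_tuple_closed [simp]: "monomial_tuple q n a \<beta> \<in> carrier (tuples q n)"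
  by (simp add: monomial_tuple_def tuples_simps)

lemma pure_tensors_add: "pure_tensors q n (u + v) = pure_tensors q n u + pure_tensors q n v"
  unfolding pure_tensors_def
  by (rule lin_ext_add, rule additive_lin_ext) (auto simp: additive_def single_add)

lemma pure_tensors_mon: "pure_tensors q n (mon \<beta> (mon a c)) = mon (monomial_tuple q n a \<beta>) c"
  by (simp add: pure_tensors_def lin_ext_mon)

lemma pure_tensors_closed: "pure_tensors q n u \<in> carrier (monoid_algebra (tuples q n))"
  by (induction u rule: qspace_induct) (auto simp: pure_tensors_add pure_tensors_mon qas.mon_closed intro: qas.add_closed_A)

lemma qas_of_add: "qas_of q n (u + v) = qas_of q n u \<oplus>\<^bsub>quantum_affine_space q n\<^esub> qas_of q n v"
  unfolding qas_of_def qas_eq pure_tensors_add by (rule qas.cls_add[symmetric]) (rule pure_tensors_closed)+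

lemma qas_of_closed: "qas_of q n u \<in> carrier (quantum_affine_space q n)"
  unfolding qas_of_def qas_eq by (rule qas.cls_closed) (rule pure_tensors_closed)

lemma qas_of_mon: "qas_of q n (mon \<beta> (mon a c)) = tcls q n (mon (monomial_tuple q n a \<beta>) c)"
  by (simp add: qas_of_def pure_tensors_mon)

lemma qas_of_cst: "qas_of q n (cst c * w) = c \<odot>\<^bsub>quantum_affine_space q n\<^esub> qas_of q n w"
proof -
  have "pure_tensors q n (cst c * w) = cscale c (pure_tensors q n w)"
    by (induction w rule: qspace_induct)
      (auto simp: cst_def mult_single pure_tensors_mon pure_tensors_add distrib_left cscale_add cscale_mon)
  then show ?thesis unfolding qas_of_def qas_eq by (simp add: qas.cls_smult pure_tensors_closed)
qed

lemma qas_of_one: "qas_of q n 1 = \<one>\<^bsub>quantum_affine_space q n\<^esub>"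
proof -
  have "qas_of q n (mon 0 (mon 0 1)) = \<one>\<^bsub>quantum_affine_space q n\<^esub>"
    unfolding qas_of_mon qas_eq qas.cls_one by (simp add: monomial_tuple_def tuples_simps pword_Nil)
  then show ?thesis by simp
qed

lemma xvar_qas_of: "i < n \<Longrightarrow> xvar q n i \<otimes>\<^bsub>quantum_affine_space q n\<^esub> qas_of q n w = qas_of q n (qmul q (xgen i) w)"
proof (induction w rule: qspace_induct)
  case (mon \<beta> a c)
  have *: "single_tuple q n i (pword q [PX]) \<otimes>\<^bsub>tuples q n\<^esub> monomial_tuple q n a \<beta> = monomial_tuple q n (mon i 1 + a) \<beta>"
    by (auto simp: tuples_simps single_tuple_def monomial_tuple_def fun_eq_iff restrict_def pword_mult
        lookup_add lookup_single when_def)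
  show ?case
    unfolding xvar_eq qas_of_mon xgen_def qmul_x_left mult_single qas_eq
    by (subst qas.cls_mon_mult) (simp_all add: * single_tuple_closed qas_of_mon)
qed (simp add: qas_of_add qmul_add_right qas.r_distr xvar_closed qas_of_closed)

lemma PY_past_PX: "pword q (PY # replicate a PX @ w) = q ^ a \<odot>\<^bsub>quantum_plane q\<^esub> pword q (replicate a PX @ PY # w)"
proof (induction a)
  case 0
  show ?case
    unfolding pword_def quantum_plane_eq
    by (subst plane.cls_mon_smult[symmetric]) (simp_all add: word_monoid_simps)
next
  case (Suc a)
  have smult_mult: "c \<odot>\<^bsub>quantum_plane q\<^esub> u \<otimes>\<^bsub>quantum_plane q\<^esub> v = c \<odot>\<^bsub>quantum_plane q\<^esub> (u \<otimes>\<^bsub>quantum_plane q\<^esub> v)"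
    if "u \<in> carrier (quantum_plane q)" "v \<in> carrier (quantum_plane q)" for c u v
    using that unfolding quantum_plane_eq
    by (subst (1 2) plane.smult_eq_mult)
      (auto simp: plane.m_assoc[unfolded quantum_plane_eq] plane.m_closed[unfolded quantum_plane_eq]
        plane.smult_closed_Q plane.one_closed[unfolded quantum_plane_eq])
  have mon_smult: "c \<odot>\<^bsub>quantum_plane q\<^esub> pword q w = plane_ideal q +>\<^bsub>monoid_algebra word_monoid\<^esub> mon w c" for c w
    unfolding pword_def quantum_plane_eq by (rule plane.cls_mon_smult[symmetric]) (simp add: word_monoid_simps)
  have "pword q (PY # replicate (Suc a) PX @ w) = pword q [PY, PX] \<otimes>\<^bsub>quantum_plane q\<^esub> pword q (replicate a PX @ w)"
    by (simp add: pword_mult)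
  also have "\<dots> = q \<odot>\<^bsub>quantum_plane q\<^esub> (pword q [PX] \<otimes>\<^bsub>quantum_plane q\<^esub> pword q (PY # replicate a PX @ w))"
    by (simp add: plane_relation smult_mult pword_mult)
  also have "\<dots> = q ^ Suc a \<odot>\<^bsub>quantum_plane q\<^esub> pword q (replicate (Suc a) PX @ PY # w)"
    unfolding Suc.IH mon_smult unfolding pword_def quantum_plane_eq
    by (simp add: plane.cls_mon_mult plane.cls_smult word_monoid_simps pcarrier cscale_mon)
  finally show ?case .
qed

lemma yvar_qas_of: "i < n \<Longrightarrow> yvar q n i \<otimes>\<^bsub>quantum_affine_space q n\<^esub> qas_of q n w = qas_of q n (qmul q (ygen i) w)"
proof (induction w rule: qspace_induct)
  case (mon \<beta> a c)
  let ?t = "monomial_tuple q n a (mon i 1 + \<beta>)"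
  have *: "single_tuple q n i (pword q [PY]) \<otimes>\<^bsub>tuples q n\<^esub> monomial_tuple q n a \<beta> =
      ?t(i := q ^ coef a i \<odot>\<^bsub>quantum_plane q\<^esub> ?t i)"
  proof
    fix j
    have "replicate (coef \<beta> i) PY @ [PY] = PY # replicate (coef \<beta> i) PY" by (simp add: replicate_app_Cons_same)
    then show "(single_tuple q n i (pword q [PY]) \<otimes>\<^bsub>tuples q n\<^esub> monomial_tuple q n a \<beta>) j =
      (?t(i := q ^ coef a i \<odot>\<^bsub>quantum_plane q\<^esub> ?t i)) j"
      using mon by (cases "j = i") (auto simp: tuples_simps single_tuple_def monomial_tuple_def restrict_def pword_mult
        lookup_add lookup_single when_def PY_past_PX)
  qed
  have "yvar q n i \<otimes>\<^bsub>quantum_affine_space q n\<^esub> qas_of q n (mon \<beta> (mon a c)) =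
     tcls q n (mon (?t(i := q ^ coef a i \<odot>\<^bsub>quantum_plane q\<^esub> ?t i)) c)"
    unfolding yvar_eq qas_of_mon qas_eq
    by (subst qas.cls_mon_mult) (simp_all add: * single_tuple_closed)
  also have "\<dots> = c \<odot>\<^bsub>quantum_affine_space q n\<^esub> tcls q n (mon (?t(i := q ^ coef a i \<odot>\<^bsub>quantum_plane q\<^esub> ?t i)) 1)"
    unfolding qas_eq *[symmetric]
    by (rule qas.cls_mon_smult) (rule monoid.m_closed[OF monoid_tuples], auto intro: single_tuple_closed)
  also have "\<dots> = c \<odot>\<^bsub>quantum_affine_space q n\<^esub> tcls q n (mon ?t (q ^ coef a i))"
  proof -
    have "?t i \<in> carrier (quantum_plane q)" using mon by (simp add: monomial_tuple_def)
    from tuple_smult_relation[OF monomial_tuple_closed mon this] show ?thesis by (simp only: fun_upd_triv)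
  qed
  also have "\<dots> = qas_of q n (qmul q (ygen i) (mon \<beta> (mon a c)))"
  proof -
    have "weight (\<lambda>j. q ^ coef (mon i (Suc 0)) j) a = q ^ coef a i" by (subst weight_commute) simp
    then show ?thesis
      unfolding qas_eq by (simp add: qas.cls_smult qas.mon_closed cscale_mon ygen_def qmul_mon msub_mon qas_of_mon)
  qed
  finally show ?case .
qed (simp add: qas_of_add qmul_add_right qas.r_distr yvar_closed qas_of_closed)

text \<open>The map \<open>qas_of\<close> intertwines left multiplication by \<open>u\<close> with left multiplication by the value of \<open>u\<close>. It is
  enough to check this on the variables, where it is the reordering of a word; no description of the ideal of
  relations is involved. Applied to \<open>1\<close> it shows that \<open>qas_eval\<close> is injective.\<close>

lemma qas_mult_of:
  assumes "u \<in> carrier (quantum_affine_space q n)"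
  shows "u \<otimes>\<^bsub>quantum_affine_space q n\<^esub> qas_of q n w = qas_of q n (qmul q (qas_eval q n u) w)"
  using assms
proof (induction u arbitrary: w rule: qas_generated[where q = q and n = n])
  case (scalar c w)
  have "c \<odot>\<^bsub>quantum_affine_space q n\<^esub> \<one>\<^bsub>quantum_affine_space q n\<^esub> \<otimes>\<^bsub>quantum_affine_space q n\<^esub> qas_of q n w
      = c \<odot>\<^bsub>quantum_affine_space q n\<^esub> qas_of q n w"
    using qas.smult_eq_mult[of "qas_of q n w" q n c] qas_of_closed[of q n w] unfolding qas_eq by simp
  then show ?case by (simp add: qas_eval_smult qas_eval_one qas_of_cst[symmetric] qmul_cst_left[of q c 1, simplified])
qed (simp_all add: assms qas.l_distr qas_of_closed qas_eval_add qas_of_add qmul_add_left qas.m_assoc qas_eval_mult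
    qmul_assoc qas_eval_xvar qas_eval_yvar xvar_qas_of yvar_qas_of)

lemma qas_of_eval: "u \<in> carrier (quantum_affine_space q n) \<Longrightarrow> qas_of q n (qas_eval q n u) = u"
  using qas_mult_of[of u q n 1] by (simp add: qas_of_one)

lemma prod_mon: "finite I \<Longrightarrow> (\<Prod>i\<in>I. mon (f i) (g i)) = mon (sum f I) (prod g I :: 'r::comm_ring_1)"
  by (induction I rule: finite_induct) (simp_all add: mult_single)

lemma sum_mon_exps: "a \<in> exps_on {..<n} \<Longrightarrow> (\<Sum>i<n. mon i (coef a i)) = a"
  by (rule poly_mapping_eqI) (auto simp: lookup_sum lookup_single when_def exps_on_def in_keys_iff)

lemma qas_eval_of: "w \<in> qspace_on {..<n} \<Longrightarrow> qas_eval q n (qas_of q n w) = w"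
proof (induction w rule: qspace_on_induct)
  case (mon \<beta> a x)
  have "tuple_eval q n (monomial_tuple q n a \<beta>) = (\<Prod>i<n. mon (mon i (coef \<beta> i)) (mon (mon i (coef a i)) 1))"
    by (simp add: tuple_eval_def monomial_tuple_def plane_eval_pword word_eval_ordered)
  also have "\<dots> = mon \<beta> (mon a 1)" using mon by (simp add: prod_mon sum_mon_exps)
  finally show ?case
    by (simp add: qas_of_mon qas_eval_cls qas.mon_closed eval_algebra_mon cst_def mult_single)
qed (simp add: qas_of_add qas_eval_add qas_of_closed)

section \<open>Spans over subrings and adjunction of the roots of a polynomial\<close>

definition subring_set :: "'r::comm_ring_1 set \<Rightarrow> bool" where
  "subring_set S \<longleftrightarrow> 0 \<in> S \<and> 1 \<in> S \<and> (\<forall>a\<in>S. \<forall>b\<in>S. a + b \<in> S \<and> a * b \<in> S) \<and> (\<forall>a\<in>S. - a \<in> S)"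

lemma subring_setD:
  assumes "subring_set S"
  shows "0 \<in> S" "1 \<in> S" "a \<in> S \<Longrightarrow> b \<in> S \<Longrightarrow> a + b \<in> S" "a \<in> S \<Longrightarrow> b \<in> S \<Longrightarrow> a * b \<in> S"
    "a \<in> S \<Longrightarrow> - a \<in> S" "a \<in> S \<Longrightarrow> a ^ k \<in> S" "(\<And>i. i \<in> I \<Longrightarrow> f i \<in> S) \<Longrightarrow> sum f I \<in> S"
    "(\<And>i. i \<in> I \<Longrightarrow> f i \<in> S) \<Longrightarrow> prod f I \<in> S"
proof -
  show *: "0 \<in> S" "1 \<in> S" "a \<in> S \<Longrightarrow> b \<in> S \<Longrightarrow> a + b \<in> S" "a \<in> S \<Longrightarrow> b \<in> S \<Longrightarrow> a * b \<in> S"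
    "a \<in> S \<Longrightarrow> - a \<in> S" for a b
    using assms by (auto simp: subring_set_def)
  show "a \<in> S \<Longrightarrow> a ^ k \<in> S" by (induction k) (auto intro: *)
  show "(\<And>i. i \<in> I \<Longrightarrow> f i \<in> S) \<Longrightarrow> sum f I \<in> S"
    by (induction I rule: infinite_finite_induct) (auto intro: *)
  show "(\<And>i. i \<in> I \<Longrightarrow> f i \<in> S) \<Longrightarrow> prod f I \<in> S"
    by (induction I rule: infinite_finite_induct) (auto intro: *)
qed

inductive_set gspan :: "'r::comm_ring_1 set \<Rightarrow> 'r set \<Rightarrow> 'r set" for S B where
  gspan_zero: "0 \<in> gspan S B"
| gspan_step: "s \<in> S \<Longrightarrow> b \<in> B \<Longrightarrow> u \<in> gspan S B \<Longrightarrow> s * b + u \<in> gspan S B"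

lemma gspan_scaled: "s \<in> S \<Longrightarrow> b \<in> B \<Longrightarrow> s * b \<in> gspan S B"
  using gspan_step[OF _ _ gspan_zero, of s S b B] by simp

lemma gspan_base: "1 \<in> S \<Longrightarrow> b \<in> B \<Longrightarrow> b \<in> gspan S B"
  using gspan_scaled[of 1 S b B] by simp

lemma gspan_add: "u \<in> gspan S B \<Longrightarrow> v \<in> gspan S B \<Longrightarrow> u + v \<in> gspan S B"
  by (induction u rule: gspan.induct) (auto simp: add.assoc intro: gspan_step)

lemma gspan_sum: "(\<And>i. i \<in> I \<Longrightarrow> f i \<in> gspan S B) \<Longrightarrow> sum f I \<in> gspan S B"
  by (induction I rule: infinite_finite_induct) (auto intro: gspan_add gspan_zero)

lemma gspan_mult_right:
  assumes "u \<in> gspan S B" "\<And>s b. s \<in> S \<Longrightarrow> b \<in> B \<Longrightarrow> s * b * x \<in> gspan S' B'"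
  shows "u * x \<in> gspan S' B'"
  using assms(1) by induction (auto simp: distrib_right intro: gspan_add gspan_zero assms)

lemma gspan_mult: "(\<And>a b. a \<in> S \<Longrightarrow> b \<in> S \<Longrightarrow> a * b \<in> S) \<Longrightarrow> s \<in> S \<Longrightarrow> u \<in> gspan S B \<Longrightarrow> s * u \<in> gspan S B"
proof -
  assume a: "\<And>a b. a \<in> S \<Longrightarrow> b \<in> S \<Longrightarrow> a * b \<in> S" "s \<in> S" "u \<in> gspan S B"
  have "u * s \<in> gspan S B" using a(3)
  proof (rule gspan_mult_right)
    fix r b assume "r \<in> S" "b \<in> B"
    then have "s * r * b \<in> gspan S B" using a by (intro gspan_scaled) auto
    then show "r * b * s \<in> gspan S B" by (simp add: ac_simps)
  qed
  then show ?thesis by (simp add: mult.commute)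
qed

lemma gspan_subset: "u \<in> gspan S B \<Longrightarrow> (\<And>s b. s \<in> S \<Longrightarrow> b \<in> B \<Longrightarrow> s * b \<in> gspan S' B') \<Longrightarrow> u \<in> gspan S' B'"
  using gspan_mult_right[of u S B 1 S' B'] by simp

lemma gspan_finite:
  assumes "u \<in> gspan S B" "subring_set S"
  shows "\<exists>B' c. finite B' \<and> B' \<subseteq> B \<and> (\<forall>b. c b \<in> S) \<and> u = (\<Sum>b\<in>B'. c b * b)"
  using assms(1)
proof induction
  case gspan_zero
  show ?case using subring_setD(1)[OF assms(2)] by (intro exI[of _ "{}"] exI[of _ "\<lambda>_. 0"]) auto
next
  case (gspan_step s b u)
  then obtain B' c where B': "finite B'" "B' \<subseteq> B" "\<forall>b. c b \<in> S" "u = (\<Sum>b\<in>B'. c b * b)" by blast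
  let ?c = "\<lambda>x. (if x \<in> B' then c x else 0) + (if x = b then s else 0)"
  have "(\<Sum>x\<in>insert b B'. ?c x * x) = (\<Sum>x\<in>insert b B'. (if x \<in> B' then c x else 0) * x) + (\<Sum>x\<in>insert b B'. (if x = b then s else 0) * x)"
    by (simp only: distrib_right sum.distrib)
  also have "(\<Sum>x\<in>insert b B'. (if x \<in> B' then c x else 0) * x) = u"
    unfolding B'(4) by (rule sum.mono_neutral_cong_right) (use B'(1) in auto)
  also have "(\<Sum>x\<in>insert b B'. (if x = b then s else 0) * x) = s * b"
    using B'(1) by (simp add: if_distrib[of "\<lambda>t. t * _"] cong: if_cong)
  finally have "s * b + u = (\<Sum>x\<in>insert b B'. ?c x * x)" by (simp add: add.commute)
  moreover have "?c x \<in> S" for x using B'(3) gspan_step subring_setD[OF assms(2)] by auto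
  ultimately show ?case using B' gspan_step
    by (intro exI[of _ "insert b B'"] exI[of _ ?c]) auto
qed

text \<open>Artin's basis: if \<open>S\<close> contains the elementary symmetric functions of the \<open>z\<^sub>l\<close>, then \<open>S[z\<^sub>0, \<dots>, z\<^sub>n\<^sub>-\<^sub>1]\<close> is
  spanned over \<open>S\<close> by the monomials in which \<open>z\<^sub>l\<close> has degree at most \<open>l\<close>.\<close>

definition staircase_monomials :: "(nat \<Rightarrow> 'r::comm_ring_1) \<Rightarrow> nat \<Rightarrow> nat \<Rightarrow> 'r set" where
  "staircase_monomials z n i = {\<Prod>l\<in>{i..<n}. z l ^ b l | b. \<forall>l. b l \<le> l}"

lemma staircase_step:
  assumes "i < n"
  shows "staircase_monomials z n i = {t * z i ^ k | t k. t \<in> staircase_monomials z n (Suc i) \<and> k \<le> i}"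
proof -
  have iv: "{i..<n} = insert i {Suc i..<n}" using assms by auto
  show ?thesis
  proof (intro subset_antisym subsetI)
    fix x assume "x \<in> staircase_monomials z n i"
    then obtain b where "\<forall>l. b l \<le> l" "x = (\<Prod>l\<in>{i..<n}. z l ^ b l)" by (auto simp: staircase_monomials_def)
    then show "x \<in> {t * z i ^ k | t k. t \<in> staircase_monomials z n (Suc i) \<and> k \<le> i}"
      unfolding iv staircase_monomials_def
      by (intro CollectI exI[of _ "\<Prod>l\<in>{Suc i..<n}. z l ^ b l"] exI[of _ "b i"]) (auto simp: mult.commute)
  next
    fix x assume "x \<in> {t * z i ^ k | t k. t \<in> staircase_monomials z n (Suc i) \<and> k \<le> i}"
    then obtain b k where b: "\<forall>l. b l \<le> l" "k \<le> i" "x = (\<Prod>l\<in>{Suc i..<n}. z l ^ b l) * z i ^ k"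
      by (auto simp: staircase_monomials_def)
    have "(\<Prod>l\<in>{Suc i..<n}. z l ^ b l) = (\<Prod>l\<in>{Suc i..<n}. z l ^ (b(i := k)) l)" by (rule prod.cong) auto
    then have "x = (\<Prod>l\<in>{i..<n}. z l ^ (b(i := k)) l)" unfolding iv b(3) by (simp add: mult.commute)
    then show "x \<in> staircase_monomials z n i" unfolding staircase_monomials_def using b
      by (intro CollectI exI[of _ "b(i := k)"]) auto
  qed
qed

text \<open>Adjoin the roots from the last to the first. When \<open>z\<^sub>n\<^sub>-\<^sub>1, \<dots>, z\<^sub>i\<^sub>+\<^sub>1\<close> have been adjoined, the product of the
  remaining linear factors has coefficients in the ring \<open>V\<close> obtained so far; it is monic of degree \<open>i + 1\<close> with
  root \<open>z\<^sub>i\<close>. So \<open>1, \<dots>, z\<^sub>i\<^sup>i\<close> span \<open>V[z\<^sub>i]\<close>, and dividing by the linear factor of \<open>z\<^sub>i\<close> keeps the invariant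
  of the induction.\<close>

lemma staircase_span_subring:
  fixes z :: "nat \<Rightarrow> 'r::comm_ring_1"
  assumes S: "subring_set S" and P: "\<And>k. Polynomial.coeff (\<Prod>i<n. [:- z i, 1:]) k \<in> S" and "i \<le> n"
  shows "subring_set (gspan S (staircase_monomials z n i)) \<and> S \<subseteq> gspan S (staircase_monomials z n i) \<and>
    (\<forall>l\<in>{i..<n}. z l \<in> gspan S (staircase_monomials z n i)) \<and>
    (\<forall>k. Polynomial.coeff (\<Prod>l<i. [:- z l, 1:]) k \<in> gspan S (staircase_monomials z n i))"
  using assms(3)
proof (induction i rule: inc_induct)
  case base
  have "staircase_monomials z n n = {1}" by (auto simp: staircase_monomials_def)
  moreover have "gspan S {1} = S"
  proof (intro subset_antisym subsetI)
    fix x assume "x \<in> gspan S {1}"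
    then show "x \<in> S" by induction (auto intro: subring_setD[OF S])
  qed (use gspan_scaled[of _ S 1 "{1}"] in auto)
  ultimately show ?case using S P by simp
next
  case (step i)
  let ?V = "gspan S (staircase_monomials z n (Suc i))" and ?B = "{z i ^ k | k. k \<le> i}"
  have V: "subring_set ?V" "S \<subseteq> ?V" "\<forall>l\<in>{Suc i..<n}. z l \<in> ?V" "\<forall>k. Polynomial.coeff (\<Prod>l<Suc i. [:- z l, 1:]) k \<in> ?V"
    using step.IH by auto
  have eq: "gspan S (staircase_monomials z n i) = gspan ?V ?B"
  proof (intro subset_antisym subsetI)
    fix u assume "u \<in> gspan S (staircase_monomials z n i)"
    then show "u \<in> gspan ?V ?B"
    proof (rule gspan_subset)
      fix s b assume s: "s \<in> S" and "b \<in> staircase_monomials z n i"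
      then obtain t k where t: "t \<in> staircase_monomials z n (Suc i)" "k \<le> i" "b = t * z i ^ k"
        unfolding staircase_step[OF step.hyps(2)] by blast
      have "s * t * z i ^ k \<in> gspan ?V ?B" using s t by (intro gspan_scaled) auto
      then show "s * b \<in> gspan ?V ?B" by (simp add: t mult.assoc)
    qed
  next
    fix u assume "u \<in> gspan ?V ?B"
    then show "u \<in> gspan S (staircase_monomials z n i)"
    proof (rule gspan_subset)
      fix r b assume r: "r \<in> ?V" and "b \<in> ?B"
      then obtain k where k: "k \<le> i" "b = z i ^ k" by blast
      from r show "r * b \<in> gspan S (staircase_monomials z n i)"
      proof (rule gspan_mult_right)
        fix s t assume "s \<in> S" "t \<in> staircase_monomials z n (Suc i)"
        then have "s * (t * b) \<in> gspan S (staircase_monomials z n i)"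
          unfolding staircase_step[OF step.hyps(2)] using k by (intro gspan_scaled) auto
        then show "s * t * b \<in> gspan S (staircase_monomials z n i)" by (simp add: mult.assoc)
      qed
    qed
  qed
  let ?W = "gspan ?V ?B"
  let ?D = "\<Prod>l<Suc i. [:- z l, 1:]" and ?E = "\<Prod>l<i. [:- z l, 1:]"
  have deg: "Polynomial.degree (\<Prod>l<j. [:- z l, 1:]) \<le> j" for j
  proof (induction j)
    case (Suc j)
    have "Polynomial.degree ((\<Prod>l<j. [:- z l, 1:]) * [:- z j, 1:]) \<le> Polynomial.degree (\<Prod>l<j. [:- z l, 1:]) + Polynomial.degree [:- z j, 1:]"
      by (rule Polynomial.degree_mult_le)
    then show ?case using Suc unfolding prod.lessThan_Suc by auto
  qed simp
  have lead: "Polynomial.coeff (\<Prod>l<j. [:- z l, 1:]) j = 1" for j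
  proof (induction j)
    case (Suc j)
    then show ?case using Polynomial.coeff_eq_0[of "\<Prod>l<j. [:- z l, 1:]" "Suc j"] deg[of j]
      by (simp add: mult.commute[of _ "[:- z j, 1:]"])
  qed simp
  have oneB: "1 \<in> ?B" by (intro CollectI exI[of _ 0]) simp
  have one: "1 \<in> ?W" using gspan_scaled[OF subring_setD(2)[OF V(1)] oneB] by simp
  have V_sub: "r \<in> ?W" if "r \<in> ?V" for r using gspan_scaled[OF that oneB] by simp
  have scale: "r * u \<in> ?W" if "r \<in> ?V" "u \<in> ?W" for r u
    by (rule gspan_mult) (use that subring_setD[OF V(1)] in auto)
  \<comment> \<open>the equation of \<open>z i\<close> reduces the first power that exceeds the staircase\<close>
  have top: "z i ^ Suc i \<in> ?W"
  proof -
    have "poly ?D (z i) = 0" by (simp add: poly_prod)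
    then have "(\<Sum>k\<le>Suc i. Polynomial.coeff ?D k * z i ^ k) = 0"
    proof -
      have "(\<Sum>k\<le>Polynomial.degree ?D. Polynomial.coeff ?D k * z i ^ k) = (\<Sum>k\<le>Suc i. Polynomial.coeff ?D k * z i ^ k)"
      proof (rule sum.mono_neutral_left)
        show "{..Polynomial.degree ?D} \<subseteq> {..Suc i}" using deg[of "Suc i"] by (simp only: atMost_subset_iff)
      qed (auto simp: not_le Polynomial.coeff_eq_0 simp del: prod.lessThan_Suc)
      with \<open>poly ?D (z i) = 0\<close> show ?thesis by (simp only: poly_altdef)
    qed
    then have "z i ^ Suc i + (\<Sum>k\<le>i. Polynomial.coeff ?D k * z i ^ k) = 0" using lead[of "Suc i"] by (simp add: add.commute)
    then have "z i ^ Suc i = (\<Sum>k\<le>i. (- Polynomial.coeff ?D k) * z i ^ k)" by (simp only: eq_neg_iff_add_eq_0[symmetric] sum_negf mult_minus_left)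
    also have "\<dots> \<in> ?W" by (intro gspan_sum gspan_scaled subring_setD(5)[OF V(1)]) (use V(4) in auto)
    finally show ?thesis .
  qed
  have z: "u * z i \<in> ?W" if "u \<in> ?W" for u
    using that
  proof (rule gspan_mult_right)
    fix s b assume "s \<in> ?V" "b \<in> ?B"
    then obtain k where k: "k \<le> i" "b = z i ^ k" by blast
    have "z i ^ Suc k \<in> ?W"
    proof (cases "k = i")
      case False
      then have "z i ^ Suc k \<in> ?B" using k by (intro CollectI exI[of _ "Suc k"]) simp
      then show ?thesis by (rule gspan_base[OF subring_setD(2)[OF V(1)]])
    qed (use top in simp)
    from scale[OF \<open>s \<in> ?V\<close> this] show "s * b * z i \<in> ?W" by (simp add: k ac_simps)
  qed
  have zk: "u * z i ^ k \<in> ?W" if "u \<in> ?W" for u k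
    by (induction k) (use that z in \<open>auto simp: power_commutes[symmetric] mult.assoc[symmetric] simp del: power_Suc simp: power_Suc2\<close>)
  have mult: "u * v \<in> ?W" if "u \<in> ?W" "v \<in> ?W" for u v
  proof -
    have "v * u \<in> ?W" using that(2)
    proof (rule gspan_mult_right)
      fix s b assume "s \<in> ?V" "b \<in> ?B"
      then show "s * b * u \<in> ?W" using scale[OF \<open>s \<in> ?V\<close> zk[OF that(1)]] by (auto simp: ac_simps)
    qed
    then show ?thesis by (simp add: mult.commute)
  qed
  have minus: "- u \<in> ?W" if "u \<in> ?W" for u
    using scale[OF _ that, of "- 1"] subring_setD(5)[OF V(1) subring_setD(2)[OF V(1)]] by simp
  have W: "subring_set ?W" unfolding subring_set_def using one mult minus gspan_zero gspan_add by blast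
  \<comment> \<open>division by the linear factor, from the highest coefficient downwards\<close>
  have coefs: "Polynomial.coeff ?E k \<in> ?W" for k
  proof (induction "Suc i - k" arbitrary: k)
    case 0
    then have "Polynomial.coeff ?E k = 0" using deg[of i] by (intro Polynomial.coeff_eq_0) simp
    then show ?case by (simp only: gspan.gspan_zero)
  next
    case (Suc j)
    then have IH: "Polynomial.coeff ?E (Suc k) \<in> ?W" by simp
    have "?D = [:- z i, 1:] * ?E" by (simp add: mult.commute)
    then have "Polynomial.coeff ?D (Suc k) = Polynomial.coeff ?E k - z i * Polynomial.coeff ?E (Suc k)" by simp
    then have "Polynomial.coeff ?E k = Polynomial.coeff ?D (Suc k) + Polynomial.coeff ?E (Suc k) * z i"
      by (simp only: diff_add_cancel mult.commute)
    moreover have "\<dots> \<in> ?W" by (intro gspan_add z[OF IH] V_sub) (use V(4) in blast)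
    ultimately show ?case by (simp only:)
  qed
  have "z i \<in> ?W" using z[OF one] by simp
  moreover have "l = i \<or> l \<in> {Suc i..<n}" if "l \<in> {i..<n}" for l using that by auto
  ultimately have "\<forall>l\<in>{i..<n}. z l \<in> ?W" using V(3) V_sub by blast
  moreover have "S \<subseteq> ?W" using V(2) V_sub by blast
  ultimately show ?case unfolding eq using W coefs by (intro conjI allI)
qed

text \<open>The case of all roots adjoined, in the form in which it is used: a subring that contains \<open>S\<close> and all roots
  contains every polynomial in the roots.\<close>

lemma staircase_span:
  fixes z :: "nat \<Rightarrow> 'r::comm_ring_1"
  assumes "subring_set S" "\<And>k. Polynomial.coeff (\<Prod>i<n. [:- z i, 1:]) k \<in> S"
  shows "subring_set (gspan S (staircase_monomials z n 0))" "S \<subseteq> gspan S (staircase_monomials z n 0)"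
    "l < n \<Longrightarrow> z l \<in> gspan S (staircase_monomials z n 0)"
  using staircase_span_subring[of S z n 0] assms by auto

definition staircase :: "nat \<Rightarrow> nat \<Rightarrow> (nat \<Rightarrow> nat) set" where
  "staircase n i = (\<Pi>\<^sub>E l\<in>{i..<n}. {..l})"

lemma finite_staircase [simp]: "finite (staircase n i)"
  by (simp add: staircase_def finite_PiE)

lemma sum_staircase_step:
  assumes "i < n"
  shows "(\<Sum>b\<in>staircase n i. f b) = (\<Sum>k\<le>i. \<Sum>b\<in>staircase n (Suc i). f (b(i := k)))"
proof -
  have iv: "{i..<n} = insert i {Suc i..<n}" using assms by auto
  have "staircase n i = (\<lambda>(k, b). b(i := k)) ` ({..i} \<times> staircase n (Suc i))"
    unfolding staircase_def iv PiE_insert_eq ..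
  moreover have "inj_on (\<lambda>(k, b). b(i := k)) ({..i} \<times> staircase n (Suc i))"
    unfolding staircase_def by (rule inj_combinator) simp
  ultimately show ?thesis by (simp add: sum.reindex sum.cartesian_product split_def)
qed

text \<open>The staircase monomials are independent over invariants: the conjugates of a relation of degree at
  most \<open>i\<close> for \<open>z\<^sub>i\<close> give the same polynomial \<open>i + 1\<close> roots.\<close>

lemma staircase_independent:
  fixes z :: "nat \<Rightarrow> 'r::idom"
  assumes inj: "inj_on z {..<n}"
    and \<tau>: "\<And>l i. l < i \<Longrightarrow> i < n \<Longrightarrow> \<exists>\<tau>. (\<forall>x y. \<tau> (x + y) = \<tau> x + \<tau> y \<and> \<tau> (x * y) = \<tau> x * \<tau> y) \<and> \<tau> 1 = 1 \<and> \<tau> 0 = 0 \<and>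
      (\<forall>x\<in>S. \<tau> x = x) \<and> \<tau> (z i) = z l \<and> (\<forall>j\<in>{Suc i..<n}. \<tau> (z j) = z j)"
    and "i \<le> n" and S: "\<And>b. c b \<in> S" and zero: "(\<Sum>b\<in>staircase n i. c b * (\<Prod>l\<in>{i..<n}. z l ^ b l)) = 0"
    and "b \<in> staircase n i"
  shows "c b = 0"
  using assms(3) S zero assms(6)
proof (induction i arbitrary: c b rule: inc_induct)
  case base
  then show ?case by (simp add: staircase_def)
next
  case (step i)
  have iv: "{i..<n} = insert i {Suc i..<n}" using step.hyps by auto
  define C where "C k = (\<Sum>b\<in>staircase n (Suc i). c (b(i := k)) * (\<Prod>l\<in>{Suc i..<n}. z l ^ b l))" for k
  have "0 = (\<Sum>k\<le>i. \<Sum>b\<in>staircase n (Suc i). c (b(i := k)) * (\<Prod>l\<in>{i..<n}. z l ^ (b(i := k)) l))"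
    using step.prems(2) by (simp add: sum_staircase_step[OF step.hyps(2)])
  also have "\<dots> = (\<Sum>k\<le>i. C k * z i ^ k)"
    unfolding C_def sum_distrib_right
  proof (intro sum.cong refl)
    fix k b
    have "(\<Prod>l\<in>{Suc i..<n}. z l ^ (b(i := k)) l) = (\<Prod>l\<in>{Suc i..<n}. z l ^ b l)" by (rule prod.cong) auto
    then show "c (b(i := k)) * (\<Prod>l\<in>{i..<n}. z l ^ (b(i := k)) l) =
        c (b(i := k)) * (\<Prod>l\<in>{Suc i..<n}. z l ^ b l) * z i ^ k"
      unfolding iv by (simp add: ac_simps)
  qed
  finally have rel: "(\<Sum>k\<le>i. C k * z i ^ k) = 0" by simp
  define P where "P = (\<Sum>k\<le>i. Polynomial.monom (C k) k)"
  have poly_P: "poly P x = (\<Sum>k\<le>i. C k * x ^ k)" for x by (simp add: P_def poly_sum Polynomial.poly_monom)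
  have roots: "poly P (z l) = 0" if "l \<le> i" for l
  proof (cases "l = i")
    case False
    with that have "l < i" by simp
    from \<tau>[OF this step.hyps(2)] obtain t where t: "\<And>x y. t (x + y) = t x + t y" "\<And>x y. t (x * y) = t x * t y"
      "t 1 = 1" "t 0 = 0" "\<And>x. x \<in> S \<Longrightarrow> t x = x" "t (z i) = z l" "\<And>j. j \<in> {Suc i..<n} \<Longrightarrow> t (z j) = z j" by blast
    have t_pow: "t (x ^ k) = t x ^ k" for x k by (induction k) (auto simp: t)
    have t_sum: "t (sum f I) = (\<Sum>i\<in>I. t (f i))" for f and I :: "'b set"
      by (induction I rule: infinite_finite_induct) (auto simp: t)
    have t_prod: "t (prod f I) = (\<Prod>i\<in>I. t (f i))" for f and I :: "nat set"
      by (induction I rule: infinite_finite_induct) (auto simp: t)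
    have "t (C k) = C k" for k
    proof -
      have "t (\<Prod>l\<in>{Suc i..<n}. z l ^ b l) = (\<Prod>l\<in>{Suc i..<n}. z l ^ b l)" for b :: "nat \<Rightarrow> nat"
        unfolding t_prod by (intro prod.cong refl) (simp add: t_pow t(7))
      then show ?thesis unfolding C_def t_sum by (simp only: t(2) t(5)[OF step.prems(1)])
    qed
    moreover have "t (\<Sum>k\<le>i. C k * z i ^ k) = (\<Sum>k\<le>i. t (C k) * t (z i) ^ k)"
      by (simp add: t(2) t_pow t_sum)
    ultimately show ?thesis unfolding poly_P using rel t by simp
  qed (use rel in \<open>simp add: poly_P\<close>)
  have "P = 0"
  proof (rule ccontr)
    assume "P \<noteq> 0"
    have "Polynomial.degree P \<le> i" unfolding P_def
      by (intro Polynomial.degree_sum_le) (auto intro: order_trans[OF Polynomial.degree_monom_le])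
    moreover have "card (z ` {..i}) \<le> card {x. poly P x = 0}"
      by (rule card_mono[OF poly_roots_finite[OF \<open>P \<noteq> 0\<close>]]) (use roots in auto)
    moreover have "card (z ` {..i}) = Suc i"
  proof -
    have "{..i} \<subseteq> {..<n}" using step.hyps(2) by auto
    then show ?thesis using card_image[OF inj_on_subset[OF inj]] by simp
  qed
    ultimately show False using card_poly_roots_bound[OF \<open>P \<noteq> 0\<close>] by simp
  qed
  have "C k = 0" if "k \<le> i" for k
  proof -
    have "Polynomial.coeff P k = C k" using that by (simp add: P_def Polynomial.coeff_sum)
    then show ?thesis using \<open>P = 0\<close> by simp
  qed
  then have "c (b'(i := k)) = 0" if "k \<le> i" "b' \<in> staircase n (Suc i)" for k b'
    using step.IH[of "\<lambda>b. c (b(i := k))" b'] that step.prems(1) by (auto simp: C_def)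
  moreover obtain k b' where "k \<le> i" "b' \<in> staircase n (Suc i)" "b = b'(i := k)"
    using step.prems(3) unfolding staircase_def iv PiE_insert_eq by auto
  ultimately show ?case by metis
qed

lemma staircase_monomials_eq:
  "staircase_monomials z n 0 = (\<lambda>b. \<Prod>l\<in>{0..<n}. z l ^ b l) ` staircase n 0"
proof (intro subset_antisym subsetI)
  fix x assume "x \<in> staircase_monomials z n 0"
  then obtain b where "\<forall>l. b l \<le> l" "x = (\<Prod>l\<in>{0..<n}. z l ^ b l)" by (auto simp: staircase_monomials_def)
  then show "x \<in> (\<lambda>b. \<Prod>l\<in>{0..<n}. z l ^ b l) ` staircase n 0"
    by (intro image_eqI[of _ _ "restrict b {0..<n}"]) (auto simp: staircase_def intro!: prod.cong)
next
  fix x assume "x \<in> (\<lambda>b. \<Prod>l\<in>{0..<n}. z l ^ b l) ` staircase n 0"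
  then obtain b where "b \<in> staircase n 0" "x = (\<Prod>l\<in>{0..<n}. z l ^ b l)" by auto
  then show "x \<in> staircase_monomials z n 0"
    unfolding staircase_monomials_def staircase_def
    by (intro CollectI exI[of _ "\<lambda>l. if l < n then b l else 0"]) (auto intro!: prod.cong simp: PiE_iff)
qed

lemma gspan_image_sum:
  assumes "u \<in> gspan S (e ` I)" "finite I" "subring_set S"
  shows "\<exists>c. (\<forall>i. c i \<in> S) \<and> u = (\<Sum>i\<in>I. c i * e i)"
  using assms(1)
proof induction
  case gspan_zero
  show ?case using subring_setD(1)[OF assms(3)] by (intro exI[of _ "\<lambda>_. 0"]) simp
next
  case (gspan_step s b u)
  then obtain c i where c: "\<forall>i. c i \<in> S" "u = (\<Sum>i\<in>I. c i * e i)" "i \<in> I" "b = e i" by blast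
  have "s * b + u = (\<Sum>j\<in>I. (c j + (if j = i then s else 0)) * e j)"
    using c assms(2) by (simp add: distrib_right sum.distrib if_distrib[of "\<lambda>t. t * _"] cong: if_cong)
  then show ?case using c gspan_step subring_setD[OF assms(3)]
    by (intro exI[of _ "\<lambda>j. c j + (if j = i then s else 0)"]) auto
qed

section \<open>The group and its action\<close>

text \<open>Extended by \<open>1\<close>, because the first entry of a group element is undefined outside \<open>{..<n}\<close>, while substitutions
  act on all variables.\<close>

definition gcoef :: "nat \<Rightarrow> (nat \<Rightarrow> 'k::field) \<times> (nat \<Rightarrow> nat) \<Rightarrow> nat \<Rightarrow> 'k" where
  "gcoef n h i = (if i < n then fst h i else 1)"

definition poly_act :: "nat \<Rightarrow> (nat \<Rightarrow> 'k) \<times> (nat \<Rightarrow> nat) \<Rightarrow> 'k::field mpoly \<Rightarrow> 'k mpoly" where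
  "poly_act n h = msub (gcoef n h) (snd h)"

definition qact :: "nat \<Rightarrow> (nat \<Rightarrow> 'k) \<times> (nat \<Rightarrow> nat) \<Rightarrow> 'k::field qspace \<Rightarrow> 'k qspace" where
  "qact n h = tsub (gcoef n h) (snd h)"

text \<open>The group law in the order in which the actions compose: \<open>h\<close> acts first.\<close>

definition gmul :: "nat \<Rightarrow> (nat \<Rightarrow> 'k::field) \<times> (nat \<Rightarrow> nat) \<Rightarrow> (nat \<Rightarrow> 'k) \<times> (nat \<Rightarrow> nat) \<Rightarrow>
    (nat \<Rightarrow> 'k) \<times> (nat \<Rightarrow> nat)" where
  "gmul n h' h = ((\<lambda>i\<in>{..<n}. fst h i * fst h' (snd h i)), snd h' \<circ> snd h)"

locale gmpn =
  fixes q :: "'k::{alg_closed_field, field_char_0}" and m p n :: nat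
  assumes q0: "q \<noteq> 0" and q_order: "\<And>j::nat. j > 0 \<Longrightarrow> q ^ j \<noteq> 1"
    and n1: "n \<ge> 1" and m1: "m \<ge> 1" and p0: "p > 0" and pm: "p dvd m"
begin

abbreviation "G \<equiv> G_group m p n :: ((nat \<Rightarrow> 'k) \<times> (nat \<Rightarrow> nat)) set"
abbreviation "A \<equiv> A_group m p n :: (nat \<Rightarrow> 'k) set"
abbreviation "QA \<equiv> quantum_affine_space q n"
abbreviation "pact \<equiv> poly_act n :: (nat \<Rightarrow> 'k) \<times> (nat \<Rightarrow> nat) \<Rightarrow> 'k mpoly \<Rightarrow> 'k mpoly"
abbreviation "tact \<equiv> qact n :: (nat \<Rightarrow> 'k) \<times> (nat \<Rightarrow> nat) \<Rightarrow> 'k qspace \<Rightarrow> 'k qspace"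

lemma G_cases:
  assumes "h \<in> G"
  shows "fst h \<in> A" "snd h permutes {..<n}" "bij (snd h)" "snd h ` {..<n} \<subseteq> {..<n}" "gcoef n h i \<noteq> 0"
    "snd h i < n \<longleftrightarrow> i < n"
proof -
  show A: "fst h \<in> A" and p: "snd h permutes {..<n}" using assms by (auto simp: G_group_def)
  show "bij (snd h)" using p by (rule permutes_bij)
  show "snd h ` {..<n} \<subseteq> {..<n}" using permutes_image[OF p] by simp
  have "fst h i ^ m = 1" if "i < n" using A that by (auto simp: A_group_def)
  then show "gcoef n h i \<noteq> 0" using m1 by (cases "fst h i = 0") (auto simp: gcoef_def power_0_left)
  show "snd h i < n \<longleftrightarrow> i < n" using permutes_in_image[OF p] by simp
qed

lemma A_I: "(\<And>i. i < n \<Longrightarrow> g i ^ m = 1) \<Longrightarrow> (\<Prod>i<n. g i) ^ (m div p) = 1 \<Longrightarrow> restrict g {..<n} \<in> A"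
  by (auto simp: A_group_def)

lemma A_D: "g \<in> A \<Longrightarrow> i < n \<Longrightarrow> g i ^ m = 1" "g \<in> A \<Longrightarrow> (\<Prod>i<n. g i) ^ (m div p) = 1"
  by (auto simp: A_group_def)

lemma A_ext: "g \<in> A \<Longrightarrow> g \<in> extensional {..<n}"
  unfolding A_group_def PiE_def by blast

lemma gmul_closed: assumes "h' \<in> G" "h \<in> G" shows "gmul n h' h \<in> G"
proof -
  have p: "snd h permutes {..<n}" using G_cases[OF assms(2)] by simp
  have "(\<Prod>i<n. fst h' (snd h i)) = (\<Prod>i<n. fst h' i)" by (rule prod.permute[OF p, symmetric, unfolded o_def])
  then have "(\<lambda>i\<in>{..<n}. fst h i * fst h' (snd h i)) \<in> A"
    using A_D[OF G_cases(1)[OF assms(1)]] A_D[OF G_cases(1)[OF assms(2)]] G_cases(6)[OF assms(2)]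
    by (intro A_I) (auto simp: power_mult_distrib prod.distrib)
  moreover have "snd h' \<circ> snd h permutes {..<n}"
    using G_cases(2)[OF assms(1)] p by (rule permutes_compose[rotated])
  ultimately show ?thesis by (simp add: G_group_def gmul_def)
qed

lemma gcoef_gmul: assumes "h' \<in> G" "h \<in> G" shows "gcoef n (gmul n h' h) = (\<lambda>i. gcoef n h i * gcoef n h' (snd h i))"
  using G_cases(6)[OF assms(2)] by (auto simp: gcoef_def gmul_def fun_eq_iff)

lemma pact_comp: "h' \<in> G \<Longrightarrow> h \<in> G \<Longrightarrow> pact h' (pact h f) = pact (gmul n h' h) f"
  by (simp add: poly_act_def msub_comp G_cases(3) gcoef_gmul) (simp add: gmul_def)

lemma tact_comp: "h' \<in> G \<Longrightarrow> h \<in> G \<Longrightarrow> tact h' (tact h u) = tact (gmul n h' h) u"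
  by (simp add: qact_def tsub_comp G_cases(3) gcoef_gmul) (simp add: gmul_def)

definition gone :: "(nat \<Rightarrow> 'k) \<times> (nat \<Rightarrow> nat)" where "gone = (\<lambda>i\<in>{..<n}. 1, id)"

lemma gone_closed: "gone \<in> G"
  using A_I[of "\<lambda>_. 1"] by (auto simp: gone_def G_group_def permutes_id)

lemma act_one [simp]: "pact gone f = f" "tact gone u = u"
proof -
  have "gcoef n gone = (\<lambda>_. 1)" by (auto simp: gcoef_def gone_def)
  then show "pact gone f = f" "tact gone u = u" by (simp_all add: poly_act_def qact_def gone_def)
qed

lemma finite_roots: "k \<ge> 1 \<Longrightarrow> finite {z::'a::{idom}. z ^ k = 1}"
proof -
  assume "k \<ge> 1"
  then have "Polynomial.monom 1 k - 1 \<noteq> (0 :: 'a poly)"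
    by (metis Polynomial.degree_1 Polynomial.degree_monom_eq eq_iff_diff_eq_0 not_one_le_zero zero_neq_one)
  moreover have "{z::'a. z ^ k = 1} = {z. poly (Polynomial.monom 1 k - 1) z = 0}"
    by (simp add: poly_monom)
  ultimately show ?thesis using poly_roots_finite by metis
qed

lemma finite_G [simp]: "finite G"
proof -
  have "A \<subseteq> {..<n} \<rightarrow>\<^sub>E {z. z ^ m = 1}" by (auto simp: A_group_def)
  then have "finite A" by (rule finite_subset) (intro finite_PiE finite_roots m1 finite_lessThan)
  then show ?thesis unfolding G_group_def by (intro finite_cartesian_product finite_permutations) auto
qed

lemma gmul_inj: assumes "h \<in> G" shows "inj_on (gmul n h) G"
proof (rule inj_onI)
  fix x y assume x: "x \<in> G" and y: "y \<in> G" and eq: "gmul n h x = gmul n h y"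
  have s: "snd x = snd y"
  proof
    fix i
    have "snd h (snd x i) = snd h (snd y i)"
      using arg_cong[OF eq, of "\<lambda>t. snd t i"] by (simp add: gmul_def)
    then show "snd x i = snd y i" by (rule injD[OF bij_is_inj[OF G_cases(3)[OF assms]]])
  qed
  have "fst x i = fst y i" for i
  proof (cases "i < n")
    case True
    have "fst x i * fst h (snd x i) = fst y i * fst h (snd x i)"
      using arg_cong[OF eq, of "\<lambda>t. fst t i"] True s by (simp add: gmul_def)
    moreover have "fst h (snd x i) \<noteq> 0"
      using G_cases(5)[OF assms, of "snd x i"] G_cases(6)[OF x] True by (simp add: gcoef_def)
    ultimately show ?thesis by simp
  next
    case False
    moreover have "fst x \<in> extensional {..<n}" "fst y \<in> extensional {..<n}"
      by (rule A_ext[OF G_cases(1)[OF x]], rule A_ext[OF G_cases(1)[OF y]])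
    ultimately show ?thesis using extensional_arb[of "fst x" "{..<n}" i] extensional_arb[of "fst y" "{..<n}" i] by simp
  qed
  then have "fst x = fst y" by (rule ext)
  then show "x = y" using s by (rule prod_eqI)
qed

lemma gmul_bij: "h \<in> G \<Longrightarrow> bij_betw (gmul n h) G G"
  unfolding bij_betw_def using gmul_inj[of h] endo_inj_surj[OF finite_G _ gmul_inj[of h]] gmul_closed by blast

lemma ginv: assumes "h \<in> G" obtains h' where "h' \<in> G" "\<And>f. pact h (pact h' f) = f" "\<And>f. pact h' (pact h f) = f"
  "\<And>f. tact h (tact h' f) = f" "\<And>f. tact h' (tact h f) = f"
proof -
  obtain h' where h': "h' \<in> G" "gmul n h h' = gone"
    using bij_betw_imp_surj_on[OF gmul_bij[OF assms]] gone_closed by (metis imageE)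
  obtain h'' where h'': "h'' \<in> G" "gmul n h' h'' = gone"
    using bij_betw_imp_surj_on[OF gmul_bij[OF h'(1)]] gone_closed by (metis imageE)
  have "pact h (pact h' f) = f" "pact h' (pact h'' f) = f" "tact h (tact h' u) = u" "tact h' (tact h'' u) = u" for f u
    using assms h' h'' by (simp_all add: pact_comp tact_comp)
  then show ?thesis using that[OF h'(1)] by metis
qed

lemma pact_simps:
  assumes "h \<in> G"
  shows "pact h (f + g) = pact h f + pact h g" "pact h (f * g) = pact h f * pact h g" "pact h (mon 0 c) = mon 0 c"
    "pact h 0 = 0" "pact h 1 = 1" "pact h (- f) = - pact h f" "pact h (sum F I) = (\<Sum>i\<in>I. pact h (F i))"
    "pact h (prod F I) = (\<Prod>i\<in>I. pact h (F i))" "pact h (f ^ k) = pact h f ^ k"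
  using G_cases(3)[OF assms]
  by (simp_all add: poly_act_def msub_add msub_mult msub_minus msub_sum msub_prod msub_power)

lemma tact_simps:
  assumes "h \<in> G"
  shows "tact h (u + v) = tact h u + tact h v" "tact h (u * v) = tact h u * tact h v"
    "tact h (qmul q u v) = qmul q (tact h u) (tact h v)" "tact h 0 = 0" "tact h 1 = 1"
    "tact h (sum F I) = (\<Sum>i\<in>I. tact h (F i))" "tact h (mon 0 f) = mon 0 (pact h f)" "tact h (cst c) = cst c"
    "tact h (mon \<beta> f) = mon (relabel (snd h) \<beta>) (pact h f)"
    "coef (tact h u) (relabel (snd h) \<beta>) = pact h (coef u \<beta>)"
  using G_cases(3)[OF assms]
  by (simp_all add: qact_def poly_act_def tsub_add tsub_mult tsub_qmul tsub_sum tsub_mon cst_def coef_tsub)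

lemma tact_on: "h \<in> G \<Longrightarrow> u \<in> qspace_on {..<n} \<Longrightarrow> tact h u \<in> qspace_on {..<n}"
  unfolding qact_def by (intro qspace_on_tsub G_cases)

lemma pact_on: "h \<in> G \<Longrightarrow> f \<in> mpoly_on {..<n} \<Longrightarrow> pact h f \<in> mpoly_on {..<n}"
  unfolding poly_act_def by (intro mpoly_on_msub G_cases)

lemma tact_gens: "h \<in> G \<Longrightarrow> i < n \<Longrightarrow> tact h (xgen i) = cst (fst h i) * xgen (snd h i)"
  "h \<in> G \<Longrightarrow> i < n \<Longrightarrow> tact h (ygen i) = ygen (snd h i)"
  using G_cases(3)[of h]
  by (simp_all add: xgen_def ygen_def tact_simps poly_act_def msub_mon relabel_mon gcoef_def cst_def mult_single
    flip: single_one)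

subsection \<open>The action on quantum affine space\<close>

lemma algebra_autsD:
  assumes "\<phi> \<in> algebra_auts QA"
  shows "\<phi> \<in> extensional (carrier QA)" "\<phi> \<in> ring_hom QA QA" "\<And>c a. a \<in> carrier QA \<Longrightarrow> \<phi> (c \<odot>\<^bsub>QA\<^esub> a) = c \<odot>\<^bsub>QA\<^esub> \<phi> a"
  using assms by (auto simp: algebra_auts_def Bij_def)

lemma smult_closed: "a \<in> carrier QA \<Longrightarrow> c \<odot>\<^bsub>QA\<^esub> a \<in> carrier QA"
  unfolding qas_eq by (rule qas.smult_closed_Q)

definition lifted_act :: "(nat \<Rightarrow> 'k) \<times> (nat \<Rightarrow> nat) \<Rightarrow> 'k quantum_elt \<Rightarrow> 'k quantum_elt" where
  "lifted_act h = (\<lambda>u\<in>carrier QA. qas_of q n (tact h (qas_eval q n u)))"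

lemma qas_eval_inj: "u \<in> carrier QA \<Longrightarrow> v \<in> carrier QA \<Longrightarrow> qas_eval q n u = qas_eval q n v \<Longrightarrow> u = v"
  by (metis qas_of_eval)

lemma qas_eval_lifted: "h \<in> G \<Longrightarrow> u \<in> carrier QA \<Longrightarrow> qas_eval q n (lifted_act h u) = tact h (qas_eval q n u)"
  by (simp add: lifted_act_def qas_eval_of tact_on qas_eval_on)

lemma lifted_closed: "u \<in> carrier QA \<Longrightarrow> lifted_act h u \<in> carrier QA"
  by (simp add: lifted_act_def qas_of_closed)

lemma lifted_act_aut: assumes "h \<in> G" shows "lifted_act h \<in> algebra_auts QA"
proof -
  obtain h' where h': "h' \<in> G" "\<And>f. tact h (tact h' f) = f" "\<And>f. tact h' (tact h f) = f"
    using ginv[OF assms] by metis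
  have "bij_betw (lifted_act h) (carrier QA) (carrier QA)"
  proof (rule bij_betw_byWitness[where f' = "lifted_act h'"])
    show "\<forall>u\<in>carrier QA. lifted_act h' (lifted_act h u) = u" "\<forall>u\<in>carrier QA. lifted_act h (lifted_act h' u) = u"
      by (intro ballI, rule qas_eval_inj; simp add: lifted_closed qas_eval_lifted h' assms)+
  qed (auto simp: lifted_closed)
  moreover have "lifted_act h \<in> ring_hom QA QA"
    by (rule ring_hom_memI; (rule qas_eval_inj)?)
      (simp_all add: assms lifted_closed qas_eval_lifted qas_eval_mult qas_eval_add
        qas_eval_one tact_simps qas.m_closed qas.a_closed qas.one_closed)
  moreover have "lifted_act h (c \<odot>\<^bsub>QA\<^esub> a) = c \<odot>\<^bsub>QA\<^esub> lifted_act h a" if "a \<in> carrier QA" for c a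
    using that assms
    by (intro qas_eval_inj) (simp_all add: smult_closed lifted_closed qas_eval_lifted qas_eval_smult tact_simps)
  moreover have "lifted_act h \<in> extensional (carrier QA)" by (simp add: lifted_act_def)
  ultimately show ?thesis unfolding algebra_auts_def Bij_def by blast
qed

text \<open>An algebra automorphism is determined by its values on the variables, so the description by \<open>THE\<close> has the
  transported action as its only solution.\<close>

lemma G_act_eq: assumes "h \<in> G" shows "G_act q n h = lifted_act h"
proof -
  obtain g \<pi> where h: "h = (g, \<pi>)" by (cases h)
  let ?P = "\<lambda>\<phi>. \<phi> \<in> algebra_auts QA \<and> (\<forall>i<n. \<phi> (xvar q n i) = g i \<odot>\<^bsub>QA\<^esub> xvar q n (\<pi> i) \<and> \<phi> (yvar q n i) = yvar q n (\<pi> i))"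
  have P: "?P (lifted_act h)"
  proof (intro conjI allI impI lifted_act_aut assms)
    fix i assume i: "i < n"
    then have pi: "\<pi> i < n" using G_cases(6)[OF assms] h by simp
    have "qas_eval q n (lifted_act h (xvar q n i)) = qas_eval q n (g i \<odot>\<^bsub>QA\<^esub> xvar q n (\<pi> i))"
      using tact_gens(1)[OF assms i] i pi by (simp add: qas_eval_lifted[OF assms] xvar_closed qas_eval_xvar qas_eval_smult) (simp add: h)
    then show "lifted_act h (xvar q n i) = g i \<odot>\<^bsub>QA\<^esub> xvar q n (\<pi> i)"
      by (rule qas_eval_inj[rotated 2]) (simp_all add: lifted_closed smult_closed xvar_closed)
    have "qas_eval q n (lifted_act h (yvar q n i)) = qas_eval q n (yvar q n (\<pi> i))"
      using tact_gens(2)[OF assms i] i pi by (simp add: qas_eval_lifted[OF assms] yvar_closed qas_eval_yvar) (simp add: h)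
    then show "lifted_act h (yvar q n i) = yvar q n (\<pi> i)"
      by (rule qas_eval_inj[rotated 2]) (simp_all add: lifted_closed yvar_closed)
  qed
  have unique: "\<phi> = lifted_act h" if "?P \<phi>" for \<phi>
  proof
    fix u
    have \<phi>: "\<phi> \<in> algebra_auts QA" and l: "lifted_act h \<in> algebra_auts QA" using that P by auto
    note D = algebra_autsD[OF \<phi>] and L = algebra_autsD[OF l]
    show "\<phi> u = lifted_act h u"
    proof (cases "u \<in> carrier QA")
      case True
      then show ?thesis
      proof (induction u rule: qas_generated)
        case (scalar c)
        show ?case
          by (simp only: D(3)[OF qas.one_closed] L(3)[OF qas.one_closed] ring_hom_one[OF D(2)] ring_hom_one[OF L(2)])
      next
        case (add u v)
        then show ?case by (simp only: ring_hom_add[OF D(2)] ring_hom_add[OF L(2)])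
      next
        case (mult u v)
        then show ?case by (simp only: ring_hom_mult[OF D(2)] ring_hom_mult[OF L(2)])
      next
        case (xvar i)
        then show ?case using that P by metis
      next
        case (yvar i)
        then show ?case using that P by metis
      qed
    next
      case False
      then show ?thesis using extensional_arb[OF D(1)] extensional_arb[OF L(1)] by simp
    qed
  qed
  have "(THE \<phi>. ?P \<phi>) = lifted_act h" by (rule the_equality[of ?P, OF P unique])
  then show ?thesis unfolding h G_act_def prod.case .
qed

lemma invariants_eq:
  assumes "S \<subseteq> carrier QA"
  shows "invariants q m p n S = {u \<in> S. \<forall>h\<in>G. tact h (qas_eval q n u) = qas_eval q n u}"
proof -
  have "G_act q n h u = u \<longleftrightarrow> tact h (qas_eval q n u) = qas_eval q n u" if "h \<in> G" "u \<in> carrier QA" for h u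
    unfolding G_act_eq[OF that(1)] qas_eval_lifted[OF that, symmetric]
    using qas_eval_inj[OF lifted_closed[OF that(2), of h] that(2)] by metis
  then show ?thesis unfolding invariants_def using assms by blast
qed

definition qinv :: "'k qspace set" where
  "qinv = {u \<in> qspace_on {..<n}. \<forall>h\<in>G. tact h u = u}"

definition pinv :: "'k mpoly set" where
  "pinv = {f \<in> mpoly_on {..<n}. \<forall>h\<in>G. pact h f = f}"

lemma scalars_eq: "scalars QA = {u \<in> carrier QA. \<exists>c. qas_eval q n u = cst c}"
proof (intro subset_antisym subsetI)
  fix u assume "u \<in> {u \<in> carrier QA. \<exists>c. qas_eval q n u = cst c}"
  then obtain c where u: "u \<in> carrier QA" "qas_eval q n u = cst c" by blast
  then have "u = c \<odot>\<^bsub>QA\<^esub> \<one>\<^bsub>QA\<^esub>"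
    by (intro qas_eval_inj) (auto simp: qas_eval_smult qas_eval_one smult_closed qas.one_closed)
  then show "u \<in> scalars QA" by (auto simp: scalars_def)
qed (auto simp: scalars_def smult_closed qas.one_closed qas_eval_smult qas_eval_one)

lemma qas_eval_zero: "qas_eval q n \<zero>\<^bsub>QA\<^esub> = 0"
  using qas_eval_add[OF qas.zero_closed qas.zero_closed, of q n] by simp

lemma qas_eval_minus: "u \<in> carrier QA \<Longrightarrow> qas_eval q n (\<ominus>\<^bsub>QA\<^esub> u) = - qas_eval q n u"
  using qas_eval_add[of u q n "\<ominus>\<^bsub>QA\<^esub> u"]
  by (simp add: qas.r_neg qas_eval_zero qas.a_inv_closed) (metis add_eq_0_iff)

text \<open>The elements with values in \<open>P\<close> form a subring containing the generators; conversely such an element is a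
  combination of monomials in the \<open>x\<^sub>i\<close>.\<close>

lemma polynomial_subalgebra:
  "subalgebra_generated QA (xvar q n ` {..<n}) = {u \<in> carrier QA. \<exists>f\<in>mpoly_on {..<n}. qas_eval q n u = mon 0 f}"
  (is "?L = ?R")
proof (intro subset_antisym subsetI)
  fix u assume "u \<in> ?L"
  then show "u \<in> ?R" unfolding subalgebra_generated_def
  proof (induction u rule: generate_ring.induct)
    case one
    show ?case by (auto simp: qas.one_closed qas_eval_one intro!: bexI[of _ 1])
  next
    case (incl h)
    then show ?case
    proof
      assume "h \<in> scalars QA"
      then obtain c where "h \<in> carrier QA" "qas_eval q n h = cst c" by (auto simp: scalars_eq)
      then show ?thesis by (auto simp: cst_def intro!: bexI[of _ "mon 0 c"] mpoly_on_mon)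
    next
      assume "h \<in> xvar q n ` {..<n}"
      then obtain i where "i < n" "h = xvar q n i" by auto
      then show ?thesis
        by (auto simp: xvar_closed qas_eval_xvar xgen_def intro!: bexI[of _ "mon (mon i 1) 1"] mpoly_on_mon exps_on_mon)
    qed
  next
    case (a_inv h)
    then obtain f where "h \<in> carrier QA" "f \<in> mpoly_on {..<n}" "qas_eval q n h = mon 0 f" by auto
    then show ?case
      by (auto simp: qas_eval_minus qas.a_inv_closed single_uminus intro!: bexI[of _ "- f"] mpoly_on_minus)
  next
    case (eng_add h1 h2)
    then obtain f g where "h1 \<in> carrier QA" "f \<in> mpoly_on {..<n}" "qas_eval q n h1 = mon 0 f"
      "h2 \<in> carrier QA" "g \<in> mpoly_on {..<n}" "qas_eval q n h2 = mon 0 g" by auto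
    then show ?case by (auto simp: qas_eval_add qas.a_closed single_add intro!: bexI[of _ "f + g"] mpoly_on_add)
  next
    case (eng_mult h1 h2)
    then obtain f g where "h1 \<in> carrier QA" "f \<in> mpoly_on {..<n}" "qas_eval q n h1 = mon 0 f"
      "h2 \<in> carrier QA" "g \<in> mpoly_on {..<n}" "qas_eval q n h2 = mon 0 g" by auto
    then show ?case
      by (auto simp: qas_eval_mult qas.m_closed qmul_x_left mult_single intro!: bexI[of _ "f * g"] mpoly_on_mult)
  qed
next
  let ?g = "generate_ring QA (scalars QA \<union> xvar q n ` {..<n})"
  have g_carrier: "u \<in> carrier QA" if "u \<in> ?g" for u
    using that by (induction u rule: generate_ring.induct) (auto simp: scalars_eq xvar_closed qas.one_closed)
  have scal: "qas_of q n (cst c) \<in> ?g" for c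
    by (rule generate_ring.incl) (auto simp: scalars_eq qas_of_closed qas_eval_of)
  have mult: "qas_of q n (mon 0 (f * g)) \<in> ?g"
    if "qas_of q n (mon 0 f) \<in> ?g" "qas_of q n (mon 0 g) \<in> ?g" "f \<in> mpoly_on {..<n}" for f g
  proof -
    have "qas_of q n (mon 0 f) \<otimes>\<^bsub>QA\<^esub> qas_of q n (mon 0 g) = qas_of q n (mon 0 (f * g))"
      using that(3) by (subst qas_mult_of)
        (auto simp: qas_of_closed qas_eval_of qspace_on_mon qmul_x_left mult_single)
    then show ?thesis using generate_ring.eng_mult[OF that(1,2)] by simp
  qed
  have x: "qas_of q n (mon 0 (mon (mon i 1) 1)) \<in> ?g" if "i < n" for i
    using that qas_of_eval[OF xvar_closed, of q n i] qas_eval_xvar[OF that, of q]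
    by (auto simp: xgen_def intro!: generate_ring.incl)
  have xd: "qas_of q n (mon 0 (mon (mon i d) 1)) \<in> ?g" if "i < n" for i d
  proof (induction d)
    case 0
    show ?case using scal[of 1] by simp
  next
    case (Suc d)
    have "mon (mon i (Suc d)) 1 = mon (mon i 1) 1 * mon (mon i d) (1::'k)"
      by (simp add: mult_single single_add[symmetric])
    then show ?case using mult[OF x[OF that] Suc] that by (simp add: mpoly_on_mon exps_on_mon)
  qed
  have monomial: "qas_of q n (mon 0 (mon a 1)) \<in> ?g" if "a \<in> exps_on {..<n}" for a
  proof -
    have "qas_of q n (mon 0 (\<Prod>i<k. mon (mon i (coef a i)) 1)) \<in> ?g" if "k \<le> n" for k
      using that
    proof (induction k)
      case 0
      show ?case using scal[of 1] by simp
    next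
      case (Suc k)
      then show ?case
        by (simp only: prod.lessThan_Suc, intro mult xd)
          (auto intro!: mpoly_on_prod mpoly_on_mon exps_on_mon)
    qed
    from this[of n] show ?thesis by (simp add: prod_mon sum_mon_exps[OF that])
  qed
  fix u assume "u \<in> ?R"
  then obtain f where u: "u \<in> carrier QA" "f \<in> mpoly_on {..<n}" "qas_eval q n u = mon 0 f" by blast
  from u(2) have "qas_of q n (mon 0 f) \<in> ?g"
  proof (induction f rule: mpoly_on_induct)
    case (mon a x)
    have "mon a x = mon 0 x * mon a 1" by (simp add: mult_single)
    then show ?case using mult[of "mon 0 x" "mon a 1"] scal[of x] monomial[OF mon] by (simp add: cst_def mpoly_on_mon)
  next
    case (add f g)
    then show ?case using generate_ring.eng_add by (fastforce simp: single_add qas_of_add)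
  qed
  then show "u \<in> ?L" using qas_of_eval[OF u(1)] u(3) by (simp add: subalgebra_generated_def)
qed

lemma mon_eq_iff: "mon a x = mon a y \<longleftrightarrow> x = y"
  by (metis lookup_single_eq)

lemma polynomial_invariants_eq:
  "polynomial_invariants q m p n = {u \<in> carrier QA. \<exists>f\<in>pinv. qas_eval q n u = mon 0 f}"
proof -
  have "subalgebra_generated QA (xvar q n ` {..<n}) \<subseteq> carrier QA" by (auto simp: polynomial_subalgebra)
  then have "polynomial_invariants q m p n =
      {u \<in> subalgebra_generated QA (xvar q n ` {..<n}). \<forall>h\<in>G. tact h (qas_eval q n u) = qas_eval q n u}"
    unfolding polynomial_invariants_def by (rule invariants_eq)
  then have *: "polynomial_invariants q m p n = {u \<in> carrier QA. (\<exists>f\<in>mpoly_on {..<n}. qas_eval q n u = mon 0 f) \<and>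
      (\<forall>h\<in>G. tact h (qas_eval q n u) = qas_eval q n u)}"
    unfolding polynomial_subalgebra by blast
  have fixed: "(\<forall>h\<in>G. tact h (mon 0 f) = mon 0 f) \<longleftrightarrow> (\<forall>h\<in>G. pact h f = f)" for f
    by (intro ball_cong refl) (simp only: tact_simps(7) mon_eq_iff)
  show ?thesis unfolding *
  proof (rule Collect_cong, rule conj_cong[OF refl], rule iffI)
    fix u assume u: "(\<exists>f\<in>mpoly_on {..<n}. qas_eval q n u = mon 0 f) \<and> (\<forall>h\<in>G. tact h (qas_eval q n u) = qas_eval q n u)"
    then obtain f where f: "f \<in> mpoly_on {..<n}" "qas_eval q n u = mon 0 f" by blast
    have "\<forall>h\<in>G. pact h f = f" using conjunct2[OF u] unfolding f(2) fixed .
    with f show "\<exists>f\<in>pinv. qas_eval q n u = mon 0 f" unfolding pinv_def by blast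
  next
    fix u assume "\<exists>f\<in>pinv. qas_eval q n u = mon 0 f"
    then obtain f where f: "f \<in> mpoly_on {..<n}" "\<forall>h\<in>G. pact h f = f" "qas_eval q n u = mon 0 f"
      unfolding pinv_def by blast
    then have "\<forall>h\<in>G. tact h (qas_eval q n u) = qas_eval q n u" by (simp only: fixed)
    with f show "(\<exists>f\<in>mpoly_on {..<n}. qas_eval q n u = mon 0 f) \<and> (\<forall>h\<in>G. tact h (qas_eval q n u) = qas_eval q n u)"
      by blast
  qed
qed

lemma quantum_invariants_eq: "carrier (quantum_invariant_ring q m p n) = {u \<in> carrier QA. qas_eval q n u \<in> qinv}"
  by (auto simp: quantum_invariant_ring_def invariants_eq qinv_def qas_eval_on)

subsection \<open>The Reynolds operator\<close>

definition reynolds :: "'k qspace \<Rightarrow> 'k qspace" where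
  "reynolds u = cst (1 / of_nat (card G)) * (\<Sum>h\<in>G. tact h u)"

definition preynolds :: "'k mpoly \<Rightarrow> 'k mpoly" where
  "preynolds f = mon 0 (1 / of_nat (card G)) * (\<Sum>h\<in>G. pact h f)"

lemma card_G: "of_nat (card G) \<noteq> (0::'k)"
  using gone_closed by auto

lemma reynolds_add: "reynolds (u + v) = reynolds u + reynolds v"
  by (simp add: reynolds_def tact_simps(1) sum.distrib distrib_left)

lemma reynolds_sum: "reynolds (sum f I) = (\<Sum>i\<in>I. reynolds (f i))"
  by (rule additive.sum) (simp add: additive_def reynolds_add)

lemma reynolds_id: assumes "u \<in> qinv" shows "reynolds u = u"
proof -
  have "(\<Sum>h\<in>G. tact h u) = of_nat (card G) * u" using assms by (simp add: qinv_def)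
  moreover have "cst (1 / of_nat (card G)) * of_nat (card G) = (1 :: 'k qspace)"
    using card_G by (simp add: cst_def of_nat_single[symmetric] mult_single flip: single_of_nat)
  ultimately show ?thesis by (simp add: reynolds_def mult.assoc[symmetric])
qed

lemma reynolds_closed: assumes "u \<in> qspace_on {..<n}" shows "reynolds u \<in> qinv"
proof -
  have "reynolds u \<in> qspace_on {..<n}" unfolding reynolds_def
    by (intro qspace_on_mult qspace_on_sum tact_on assms) auto
  moreover have "tact h (reynolds u) = reynolds u" if "h \<in> G" for h
  proof -
    have "(\<Sum>k\<in>G. tact h (tact k u)) = (\<Sum>k\<in>G. tact (gmul n h k) u)"
      by (rule sum.cong) (use that in \<open>auto simp: tact_comp\<close>)
    also have "\<dots> = (\<Sum>k\<in>G. tact k u)" by (rule sum.reindex_bij_betw[OF gmul_bij[OF that]])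
    finally show ?thesis using that by (simp add: reynolds_def tact_simps)
  qed
  ultimately show ?thesis by (simp add: qinv_def)
qed

lemma preynolds_closed: assumes "f \<in> mpoly_on {..<n}" shows "preynolds f \<in> pinv"
proof -
  have "preynolds f \<in> mpoly_on {..<n}" unfolding preynolds_def
    by (intro mpoly_on_mult mpoly_on_sum pact_on assms mpoly_on_mon) auto
  moreover have "pact h (preynolds f) = preynolds f" if "h \<in> G" for h
  proof -
    have "(\<Sum>k\<in>G. pact h (pact k f)) = (\<Sum>k\<in>G. pact (gmul n h k) f)"
      by (rule sum.cong) (use that in \<open>auto simp: pact_comp\<close>)
    also have "\<dots> = (\<Sum>k\<in>G. pact k f)" by (rule sum.reindex_bij_betw[OF gmul_bij[OF that]])
    finally show ?thesis using that by (simp add: preynolds_def pact_simps)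
  qed
  ultimately show ?thesis by (simp add: pinv_def)
qed

text \<open>The product here is the commutative one, for which \<open>G\<close> acts by automorphisms as well. The statement is used for
  coefficients from \<open>\<Gamma>\<close> and, with the roles of the factors exchanged, to average coefficients from \<open>P\<close>.\<close>

lemma reynolds_mult: assumes "\<And>h. h \<in> G \<Longrightarrow> tact h u = u" shows "reynolds (u * v) = u * reynolds v"
proof -
  have "(\<Sum>h\<in>G. tact h (u * v)) = (\<Sum>h\<in>G. u * tact h v)"
    by (rule sum.cong) (auto simp: tact_simps assms)
  then show ?thesis by (simp add: reynolds_def sum_distrib_left[symmetric] ac_simps)
qed

lemma reynolds_poly_mult: assumes "v \<in> qinv" shows "reynolds (mon 0 f * v) = mon 0 (preynolds f) * v"
proof -
  have v: "tact h v = v" if "h \<in> G" for h using assms that by (simp add: qinv_def)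
  have "(\<Sum>h\<in>G. mon (0::exps) (pact h f)) = mon 0 (\<Sum>h\<in>G. pact h f)"
    by (rule additive.sum[symmetric]) (simp add: additive_def single_add)
  then have "reynolds (mon 0 f) = mon 0 (preynolds f)"
    by (simp add: reynolds_def preynolds_def cst_def mult_single tact_simps(7))
  then show ?thesis using reynolds_mult[of v "mon 0 f"] v by (simp add: mult.commute)
qed

lemma subring_pinv: "subring_set pinv"
  unfolding subring_set_def pinv_def
  by (intro conjI ballI CollectI; (elim CollectE conjE)?)
    (simp_all add: pact_simps mpoly_on_add mpoly_on_mult mpoly_on_minus)

lemma tact_minus: "tact h (- u) = - tact h u"
  unfolding qact_def by (rule additive.minus[OF additive_tsub])

lemma subring_qinv: "subring_set qinv"
  unfolding subring_set_def qinv_def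
  by (intro conjI ballI CollectI; (elim CollectE conjE)?)
    (simp_all add: tact_simps tact_minus qspace_on_add qspace_on_mult qspace_on_minus)

lemma qinv_qmul: "u \<in> qinv \<Longrightarrow> v \<in> qinv \<Longrightarrow> qmul q u v \<in> qinv"
  by (auto simp: qinv_def tact_simps intro: qspace_on_qmul)

lemma mon_pinv: "f \<in> pinv \<Longrightarrow> mon 0 f \<in> qinv"
  by (auto simp: qinv_def pinv_def tact_simps intro: qspace_on_mon)

lemma const_pinv: "mon 0 c \<in> pinv"
  by (auto simp: pinv_def pact_simps mpoly_on_mon)

end

section \<open>Roots of unity\<close>

text \<open>In characteristic \<open>0\<close> the polynomial \<open>X\<^sup>r - 1\<close> is prime to its derivative, so its \<open>r\<close> roots are distinct.\<close>

lemma card_roots_unity: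
  assumes r: "r \<ge> 1"
  shows "card {z :: 'k::{alg_closed_field, field_char_0}. z ^ r = 1} = r"
proof (rule antisym)
  let ?P = "Polynomial.monom 1 r - 1 :: 'k poly"
  have nz: "?P \<noteq> 0" and deg: "Polynomial.degree ?P = r"
  proof -
    have "Polynomial.degree (1 :: 'k poly) < Polynomial.degree (Polynomial.monom 1 r :: 'k poly)"
      using r by (simp add: Polynomial.degree_monom_eq)
    from Polynomial.degree_add_eq_left[of "- 1", unfolded degree_minus, OF this]
    show "Polynomial.degree ?P = r" by (simp add: Polynomial.degree_monom_eq)
    then show "?P \<noteq> 0" using r by auto
  qed
  have roots: "{z. poly ?P z = 0} = {z. z ^ r = 1}" by (auto simp: Polynomial.poly_monom)
  show "card {z::'k. z ^ r = 1} \<le> r" using card_poly_roots_bound[OF nz] deg roots by simp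
  obtain A where A: "size A = r" "?P = Polynomial.smult (Polynomial.lead_coeff ?P) (\<Prod>x\<in>#A. [:- x, 1:])"
    using alg_closed_imp_factorization[OF nz] unfolding deg by blast
  have root: "z ^ r = 1" if "z \<in># A" for z
  proof -
    from that obtain B where "A = add_mset z B" by (metis multi_member_split)
    then have "poly ?P z = 0" by (subst A(2)) simp
    then show ?thesis by (simp add: Polynomial.poly_monom)
  qed
  have simple: "count A z \<le> 1" for z
  proof (rule ccontr)
    assume "\<not> count A z \<le> 1"
    then have c: "count A z \<ge> 2" by simp
    then have "z \<in># A" by (metis count_eq_zero_iff not_numeral_le_zero)
    then obtain A' where A': "A = add_mset z A'" by (metis multi_member_split)
    with c have "z \<in># A'" by (simp flip: count_greater_zero_iff)
    then obtain B where B: "A' = add_mset z B" by (metis multi_member_split)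
    define Q where "Q = Polynomial.smult (Polynomial.lead_coeff ?P) (\<Prod>x\<in>#B. [:- x, 1:])"
    have "?P = [:- z, 1:] * ([:- z, 1:] * Q)"
      by (subst A(2)) (simp only: A' B image_mset_add_mset prod_mset.add_mset Q_def mult_smult_right)
    then have "poly (pderiv ?P) z = 0" by (simp only: pderiv_mult) simp
    moreover have "pderiv ?P = Polynomial.monom (of_nat r) (r - 1)"
      by (simp add: pderiv_diff pderiv_monom)
    ultimately have "of_nat r * z ^ (r - 1) = 0" by (simp add: Polynomial.poly_monom)
    then have "z = 0" using r by simp
    then show False using root[OF \<open>z \<in># A\<close>] r by (simp add: power_0_left)
  qed
  have "r = (\<Sum>z\<in>set_mset A. count A z)" using A(1) by (simp add: size_multiset_overloaded_eq)
  also have "\<dots> \<le> card (set_mset A)" using sum_mono[of "set_mset A" "count A" "\<lambda>_. 1"] simple by simp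
  also have "\<dots> \<le> card {z::'k. z ^ r = 1}"
    using poly_roots_finite[OF nz] root unfolding roots by (intro card_mono) auto
  finally show "r \<le> card {z::'k. z ^ r = 1}" .
qed

lemma finite_roots_unity: "r \<ge> 1 \<Longrightarrow> finite {z :: 'k::{alg_closed_field, field_char_0}. z ^ r = 1}"
  using card_roots_unity[of r] by (metis card.infinite not_one_le_zero)

text \<open>Otherwise all \<open>r\<close> solutions of \<open>z\<^sup>r = 1\<close> would satisfy an equation of the smaller degree \<open>a mod r\<close>.\<close>

lemma dvd_if_roots_unity:
  assumes r: "r \<ge> 1" and a: "\<And>z :: 'k::{alg_closed_field, field_char_0}. z ^ r = 1 \<Longrightarrow> z ^ a = 1"
  shows "r dvd a"
proof (rule ccontr)
  assume "\<not> r dvd a"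
  then have d: "a mod r \<ge> 1" by (simp add: dvd_eq_mod_eq_0)
  have "z ^ (a mod r) = 1" if "z ^ r = 1" for z :: 'k
  proof -
    have "z ^ a = (z ^ r) ^ (a div r) * z ^ (a mod r)"
      by (simp add: power_mult[symmetric] power_add[symmetric])
    then show ?thesis using that a[OF that] by simp
  qed
  then have "card {z :: 'k. z ^ r = 1} \<le> card {z :: 'k. z ^ (a mod r) = 1}"
    by (intro card_mono finite_roots_unity d) auto
  moreover have "a mod r < r" using r by simp
  ultimately show False using card_roots_unity[OF r, where 'k = 'k] card_roots_unity[OF d, where 'k = 'k] by linarith
qed

section \<open>Total degree in the \<open>x\<^sub>i\<close>\<close>

definition tdeg :: "exps \<Rightarrow> nat" where "tdeg a = (\<Sum>i\<in>supp a. coef a i)"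

lemma tdeg_superset: "finite A \<Longrightarrow> supp a \<subseteq> A \<Longrightarrow> tdeg a = (\<Sum>i\<in>A. coef a i)"
  unfolding tdeg_def by (rule sum.mono_neutral_left) (auto simp: in_keys_iff)

lemma tdeg_add: "tdeg (a + b) = tdeg a + tdeg b"
proof -
  let ?A = "supp a \<union> supp b"
  have "tdeg x = (\<Sum>i\<in>?A. coef x i)" if "supp x \<subseteq> ?A" for x by (rule tdeg_superset) (use that in auto)
  with keys_add[of a b] show ?thesis by (simp add: lookup_add sum.distrib)
qed

lemma tdeg_eq_0: "tdeg a = 0 \<longleftrightarrow> a = 0"
  by (auto simp: tdeg_def in_keys_iff intro!: poly_mapping_eqI)

lemma tdeg_relabel: "bij \<pi> \<Longrightarrow> tdeg (relabel \<pi> a) = tdeg a"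
  unfolding tdeg_def by (simp add: supp_relabel sum.reindex inj_on_subset[OF bij_is_inj])

definition pcomp :: "nat \<Rightarrow> 'k::field mpoly \<Rightarrow> 'k mpoly" where
  "pcomp d = lin_ext (\<lambda>a x. if tdeg a = d then mon a x else 0)"

definition qcomp :: "nat \<Rightarrow> 'k::field qspace \<Rightarrow> 'k qspace" where
  "qcomp d = lin_ext (\<lambda>\<beta> f. mon \<beta> (pcomp d f))"

lemma additive_pcomp: "additive (pcomp d)"
  unfolding pcomp_def by (rule additive_lin_ext) (auto simp: additive_def single_add)

lemmas pcomp_add = additive.add[OF additive_pcomp] and pcomp_zero [simp] = additive.zero[OF additive_pcomp]

lemma additive_qcomp: "additive (qcomp d)"
  unfolding qcomp_def by (rule additive_lin_ext) (auto simp: additive_def single_add pcomp_add)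

lemmas qcomp_add = additive.add[OF additive_qcomp] and qcomp_zero [simp] = additive.zero[OF additive_qcomp]
  and qcomp_sum = additive.sum[OF additive_qcomp]

lemma pcomp_mon: "pcomp d (mon a x) = (if tdeg a = d then mon a x else 0)"
  by (simp add: pcomp_def lin_ext_mon)

lemma qcomp_mon: "qcomp d (mon \<beta> f) = mon \<beta> (pcomp d f)"
  by (simp add: qcomp_def lin_ext_mon)

lemma coef_pcomp: "coef (pcomp d f) a = (if tdeg a = d then coef f a else 0)"
  by (induction f rule: pm_induct_all) (auto simp: pcomp_mon pcomp_add lookup_add lookup_single when_def)

lemma coef_qcomp: "coef (qcomp d u) \<beta> = pcomp d (coef u \<beta>)"
  by (induction u rule: pm_induct_all) (auto simp: qcomp_mon qcomp_add pcomp_add lookup_add lookup_single when_def)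

lemma pcomp_0: "pcomp 0 f = mon 0 (coef f 0)"
  by (rule poly_mapping_eqI) (auto simp: coef_pcomp tdeg_eq_0 lookup_single when_def)

lemma pcomp_mult: "pcomp d (f * g) = (\<Sum>e\<le>d. pcomp e f * pcomp (d - e) g)"
proof (induction f rule: pm_induct_all)
  case (mon a x)
  show ?case
  proof (induction g rule: pm_induct_all)
    case (mon b y)
    have "(\<Sum>e\<le>d. pcomp e (mon a x) * pcomp (d - e) (mon b y)) =
        (\<Sum>e\<le>d. if e = tdeg a then mon a x * pcomp (d - tdeg a) (mon b y) else 0)"
      by (rule sum.cong) (auto simp: pcomp_mon)
    also have "\<dots> = pcomp d (mon a x * mon b y)"
      by (auto simp: pcomp_mon mult_single tdeg_add)
    finally show ?case by simp
  qed (simp add: distrib_left pcomp_add sum.distrib)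
qed (simp add: distrib_right pcomp_add sum.distrib)

lemma qcomp_mult: "qcomp d (mon 0 f * u) = (\<Sum>e\<le>d. mon 0 (pcomp e f) * qcomp (d - e) u)"
proof (induction u rule: pm_induct_all)
  case (mon \<beta> g)
  have "mon \<beta> (\<Sum>e\<le>d. h e) = (\<Sum>e\<le>d. mon \<beta> (h e))" for h :: "nat \<Rightarrow> 'a mpoly"
    by (rule additive.sum) (simp add: additive_def single_add)
  then show ?case by (simp add: mult_single qcomp_mon pcomp_mult)
qed (simp add: distrib_left qcomp_add sum.distrib)

lemma pcomp_msub: "bij \<pi> \<Longrightarrow> pcomp d (msub c \<pi> f) = msub c \<pi> (pcomp d f)"
  by (induction f rule: pm_induct_all) (auto simp: msub_mon msub_add pcomp_mon pcomp_add tdeg_relabel)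

lemma qcomp_tsub: "bij \<pi> \<Longrightarrow> qcomp d (tsub c \<pi> u) = tsub c \<pi> (qcomp d u)"
  by (induction u rule: pm_induct_all) (auto simp: tsub_mon tsub_add qcomp_mon qcomp_add pcomp_msub)

lemma pcomp_on: "f \<in> mpoly_on A \<Longrightarrow> pcomp d f \<in> mpoly_on A"
  by (induction f rule: mpoly_on_induct) (auto simp: pcomp_mon pcomp_add intro: mpoly_on_mon mpoly_on_add)

lemma qcomp_on: "u \<in> qspace_on A \<Longrightarrow> qcomp d u \<in> qspace_on A"
  by (induction u rule: qspace_on_induct_poly)
    (auto simp: qcomp_mon qcomp_add intro: qspace_on_mon qspace_on_add pcomp_on)

lemma qcomp_qcomp: "qcomp d (qcomp e u) = (if d = e then qcomp d u else 0)"
  by (rule poly_mapping_eqI, rule poly_mapping_eqI) (auto simp: coef_qcomp coef_pcomp)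

lemma qcomp_expand: "\<exists>D. u = (\<Sum>d\<le>D. qcomp d u)"
proof -
  let ?S = "\<Union>\<beta>\<in>supp u. tdeg ` supp (coef u \<beta>)"
  have fin: "finite ?S" by auto
  have "coef (coef u \<beta>) a = coef (coef (\<Sum>d\<le>Max ?S. qcomp d u) \<beta>) a" for \<beta> a
  proof -
    have le: "tdeg a \<le> Max ?S" if "coef (coef u \<beta>) a \<noteq> 0"
    proof (rule Max_ge[OF fin])
      have "coef u \<beta> \<noteq> 0" using that by auto
      then show "tdeg a \<in> ?S" using that by (auto simp: in_keys_iff intro!: bexI[of _ \<beta>])
    qed
    have "coef (coef (\<Sum>d\<le>Max ?S. qcomp d u) \<beta>) a = (\<Sum>d\<le>Max ?S. if tdeg a = d then coef (coef u \<beta>) a else 0)"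
      by (simp add: lookup_sum coef_qcomp coef_pcomp)
    then show ?thesis using le by auto
  qed
  then have "u = (\<Sum>d\<le>Max ?S. qcomp d u)" by (intro poly_mapping_eqI)
  then show ?thesis ..
qed

text \<open>If \<open>f\<close> has no terms below the degree of \<open>t\<close>, only the constant term of \<open>g\<close> can contribute to the coefficient at \<open>t\<close>.\<close>

lemma coef_mult_lowest:
  fixes f :: "'k::field mpoly"
  assumes "\<And>a. a \<in> supp f \<Longrightarrow> tdeg t \<le> tdeg a"
  shows "coef (f * g) t = coef f t * coef g 0"
proof -
  have "supp f \<subseteq> {a. tdeg t \<le> tdeg a}" using assms by auto
  then show ?thesis
  proof (induction f rule: pm_induct)
    case (mon a x)
    show ?case
    proof (induction g rule: pm_induct_all)
      case (mon b y)
      have "a + b = t \<longleftrightarrow> a = t \<and> b = 0"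
      proof
        assume "a + b = t"
        then have "tdeg a + tdeg b = tdeg t" by (simp flip: tdeg_add)
        with \<open>a \<in> _\<close> have "b = 0" by (simp flip: tdeg_eq_0)
        with \<open>a + b = t\<close> show "a = t \<and> b = 0" by simp
      qed simp
      then show ?case by (auto simp: mult_single lookup_single when_def)
    qed (simp add: distrib_left lookup_add)
  qed (simp_all add: distrib_right lookup_add)
qed

section \<open>Coefficients of a product of linear factors\<close>

lemma hom_coeff_linear_factors:
  fixes t :: "'r::comm_ring_1 \<Rightarrow> 's::comm_ring_1"
  assumes t: "\<And>x y. t (x + y) = t x + t y" "\<And>x y. t (x * y) = t x * t y" "t 1 = 1" "t 0 = 0"
  shows "t (Polynomial.coeff (\<Prod>i\<in>I. [:- z i, 1:]) k) = Polynomial.coeff (\<Prod>i\<in>I. [:- t (z i), 1:]) k"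
proof (induction I arbitrary: k rule: infinite_finite_induct)
  case (insert i I)
  have minus: "t (- x) = - t x" for x using t(1)[of x "- x"] t(4) by (simp add: add_eq_0_iff)
  show ?case using insert
    by (cases k) (simp_all add: t minus diff_conv_add_uminus del: add_uminus_conv_diff)
qed (simp_all add: Polynomial.coeff_1 t)

context gmpn
begin

section \<open>The invariants of the abelian subgroup\<close>

text \<open>The powers \<open>x\<^sub>i\<^sup>m\<close> are permuted by \<open>G\<close>, and \<open>wv\<close>, the product of all \<open>x\<^sub>i\<close> to the power \<open>m / p\<close>, is
  invariant. The monomials fixed by \<open>A\<close> are exactly the products of these.\<close>

definition zv :: "nat \<Rightarrow> 'k mpoly" where "zv i = mon (mon i m) 1"

definition wv :: "'k mpoly" where "wv = mon (\<Sum>i<n. mon i (m div p)) 1"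

definition ainv :: "'k mpoly set" where
  "ainv = {f \<in> mpoly_on {..<n}. \<forall>g\<in>A. pact (g, id) f = f}"

lemma mp: "p * (m div p) = m" "m div p \<ge> 1"
proof -
  show "p * (m div p) = m" using pm by simp
  then show "m div p \<ge> 1" using m1 by (metis One_nat_def Suc_leI mult_0_right neq0_conv not_one_le_zero)
qed

lemma diag_G: "g \<in> A \<Longrightarrow> (g, id) \<in> G"
  by (simp add: G_group_def permutes_id)

lemma perm_G: "\<pi> permutes {..<n} \<Longrightarrow> (\<lambda>i\<in>{..<n}. 1, \<pi>) \<in> G"
  using A_I[of "\<lambda>_. 1"] by (simp add: G_group_def)

lemma weight_gcoef: "a \<in> exps_on {..<n} \<Longrightarrow> weight (gcoef n h) a = (\<Prod>i<n. fst h i ^ coef a i)"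
  by (subst weight_superset[of "{..<n}"]) (auto simp: exps_on_def gcoef_def)

lemma pact_zv: "h \<in> G \<Longrightarrow> i < n \<Longrightarrow> pact h (zv i) = zv (snd h i)"
  using G_cases(1,3)[of h] A_D(1)[of "fst h" i]
  by (simp add: poly_act_def zv_def msub_mon relabel_mon gcoef_def)

lemma zv_on: "i < n \<Longrightarrow> zv i \<in> mpoly_on {..<n}"
  by (simp add: zv_def mpoly_on_mon exps_on_mon)

lemma wv_pinv: "wv \<in> pinv"
proof -
  let ?a = "\<Sum>i<n. mon i (m div p)"
  have on: "?a \<in> exps_on {..<n}"
  proof -
    have "(\<Sum>i\<in>I. mon i (m div p)) \<in> exps_on {..<n}" if "I \<subseteq> {..<n}" for I
      using finite_subset[OF that finite_lessThan] that
      by (induction I rule: finite_induct) (auto intro: exps_on_add exps_on_mon)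
    then show ?thesis by simp
  qed
  have "pact h wv = wv" if h: "h \<in> G" for h
  proof -
    have "relabel (snd h) (\<Sum>i\<in>I. mon i (m div p)) = (\<Sum>i\<in>I. mon (snd h i) (m div p))" for I
      by (induction I rule: infinite_finite_induct) (simp_all add: relabel_add relabel_mon G_cases(3)[OF h])
    then have "relabel (snd h) ?a = (\<Sum>i<n. mon (snd h i) (m div p))" .
    also have "\<dots> = ?a"
      using sum.permute[OF G_cases(2)[OF h], of "\<lambda>i. mon i (m div p)"] by (simp add: o_def)
    finally have "relabel (snd h) ?a = ?a" .
    moreover have "weight (gcoef n h) ?a = (\<Prod>i<n. fst h i ^ (m div p))"
      unfolding weight_gcoef[OF on]
      by (rule prod.cong) (auto simp: lookup_sum lookup_single when_def)
    ultimately show ?thesis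
      using A_D(2)[OF G_cases(1)[OF h]] by (simp add: wv_def poly_act_def msub_mon prod_power_distrib)
  qed
  then show ?thesis using on by (simp add: pinv_def wv_def mpoly_on_mon)
qed

text \<open>Scaling \<open>x\<^sub>i\<close> by a root of unity and \<open>x\<^sub>0\<close> by its inverse shows that all exponents agree modulo \<open>m\<close>; scaling
  \<open>x\<^sub>0\<close> alone by an \<open>(m / p)\<close>-th root of unity shows that they are divisible by \<open>m / p\<close>. So \<open>c\<close> is read
  off from the common residue.\<close>

lemma ainv_monomial:
  assumes a: "a \<in> exps_on {..<n}" and w: "\<And>g. g \<in> A \<Longrightarrow> (\<Prod>i<n. g i ^ coef a i) = 1"
  shows "\<exists>c e. \<forall>i<n. coef a i = c * (m div p) + m * e i"
proof -
  have cong: "coef a i mod m = coef a 0 mod m" if "i < n" "i \<noteq> 0" for i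
  proof -
    have "z ^ (coef a i + (m - 1) * coef a 0) = 1" if z: "z ^ m = 1" for z :: 'k
    proof -
      \<comment> \<open>lies in \<open>A\<close> because the product of its entries is \<open>z ^ m = 1\<close>\<close>
      let ?g = "\<lambda>j. if j = i then z else if j = 0 then z ^ (m - 1) else 1"
      have sub: "{0, i} \<subseteq> {..<n}" using \<open>i < n\<close> by auto
      have "(\<Prod>j<n. ?g j) = (\<Prod>j\<in>{0, i}. ?g j)"
        by (rule prod.mono_neutral_right) (use sub in auto)
      also have "\<dots> = z ^ m" using \<open>i \<noteq> 0\<close> m1 by (cases m) auto
      finally have g1: "(\<Prod>j<n. ?g j) = 1" using z by simp
      have "restrict ?g {..<n} \<in> A"
      proof (rule A_I)
        fix j
        have "(z ^ (m - 1)) ^ m = 1" using z by (metis power_mult mult.commute power_one)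
        then show "?g j ^ m = 1" using z by simp
        show "(\<Prod>j<n. ?g j) ^ (m div p) = 1" by (simp only: g1 power_one)
      qed
      from w[OF this] have "(\<Prod>j<n. restrict ?g {..<n} j ^ coef a j) = 1" .
      moreover have "(\<Prod>j<n. restrict ?g {..<n} j ^ coef a j) = (\<Prod>j<n. ?g j ^ coef a j)"
        by (rule prod.cong) auto
      moreover have "(\<Prod>j<n. ?g j ^ coef a j) = (\<Prod>j\<in>{0, i}. ?g j ^ coef a j)"
        by (rule prod.mono_neutral_right) (use sub in auto)
      ultimately have "(z ^ (m - 1)) ^ coef a 0 * z ^ coef a i = 1" using \<open>i \<noteq> 0\<close> by (simp add: mult.commute)
      then show ?thesis by (simp only: power_mult[symmetric] power_add[symmetric] add.commute)
    qed
    then have "m dvd coef a i + (m - 1) * coef a 0" by (rule dvd_if_roots_unity[OF m1])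
    moreover have "coef a i + (m - 1) * coef a 0 + coef a 0 = coef a i + m * coef a 0"
      using m1 by (cases m) auto
    ultimately show ?thesis
      by (metis add.commute add.left_neutral mod_add_left_eq mod_mult_self2 dvd_eq_mod_eq_0)
  qed
  have "(m div p) dvd coef a 0"
  proof (rule dvd_if_roots_unity[OF mp(2)])
    fix z :: 'k assume z: "z ^ (m div p) = 1"
    let ?g = "\<lambda>j::nat. if j = 0 then z else (1::'k)"
    have sub: "{0} \<subseteq> {..<n}" using n1 by auto
    have "(\<Prod>j<n. ?g j) = (\<Prod>j\<in>{0}. ?g j)"
      by (rule prod.mono_neutral_right) (use sub in auto)
    then have g1: "(\<Prod>j<n. ?g j) = z" by simp
    have "z ^ m = (z ^ (m div p)) ^ p" by (simp only: power_mult[symmetric] mult.commute[of "m div p"] mp(1))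
    then have "z ^ m = 1" using z by simp
    then have "restrict ?g {..<n} \<in> A" using z by (intro A_I) (auto simp only: g1 split: if_splits intro: power_one)
    from w[OF this] have "(\<Prod>j<n. restrict ?g {..<n} j ^ coef a j) = 1" .
    moreover have "(\<Prod>j<n. restrict ?g {..<n} j ^ coef a j) = (\<Prod>j<n. ?g j ^ coef a j)"
      by (rule prod.cong) auto
    moreover have "(\<Prod>j<n. ?g j ^ coef a j) = (\<Prod>j\<in>{0}. ?g j ^ coef a j)"
      by (rule prod.mono_neutral_right) (use sub in auto)
    ultimately show "z ^ coef a 0 = 1" by simp
  qed
  moreover have "(m div p) dvd m" using mp(1) dvd_triv_right[of "m div p" p] by (simp only:)
  ultimately have "(m div p) dvd (coef a 0 mod m)" by (simp add: dvd_mod)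
  then obtain c where c: "coef a 0 mod m = c * (m div p)" by (auto simp: dvd_def mult.commute)
  show ?thesis
  proof (intro exI[of _ c] exI[of _ "\<lambda>i. coef a i div m"] allI impI)
    fix i assume "i < n"
    then have "coef a i mod m = c * (m div p)" using cong[of i] c by (cases "i = 0") simp_all
    moreover have "coef a i = coef a i mod m + m * (coef a i div m)" by simp
    ultimately show "coef a i = c * (m div p) + m * (coef a i div m)" by linarith
  qed
qed

lemma coeff_zv_pinv: "Polynomial.coeff (\<Prod>i<n. [:- zv i, 1:]) k \<in> pinv"
proof -
  have on: "Polynomial.coeff (\<Prod>i\<in>I. [:- zv i, 1:]) k \<in> mpoly_on {..<n}" if "I \<subseteq> {..<n}" for I k
    using finite_subset[OF that finite_lessThan] that
  proof (induction I arbitrary: k rule: finite_induct)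
    case empty
    show ?case by (cases "k = 0") (simp_all add: Polynomial.coeff_1)
  next
    case (insert i I)
    then show ?case
      by (cases k) (auto simp: diff_conv_add_uminus simp del: add_uminus_conv_diff
          intro!: mpoly_on_add mpoly_on_mult mpoly_on_minus zv_on)
  qed
  have "pact h (Polynomial.coeff (\<Prod>i<n. [:- zv i, 1:]) k) = Polynomial.coeff (\<Prod>i<n. [:- zv i, 1:]) k" if h: "h \<in> G" for h
  proof -
    have "pact h (Polynomial.coeff (\<Prod>i<n. [:- zv i, 1:]) k) = Polynomial.coeff (\<Prod>i<n. [:- pact h (zv i), 1:]) k"
      by (rule hom_coeff_linear_factors) (simp_all add: pact_simps[OF h])
    also have "(\<Prod>i<n. [:- pact h (zv i), 1:]) = (\<Prod>i<n. [:- zv (snd h i), 1:])"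
      by (rule prod.cong) (simp_all add: pact_zv[OF h])
    also have "\<dots> = (\<Prod>i<n. [:- zv i, 1:])"
      using prod.permute[OF G_cases(2)[OF h], of "\<lambda>i. [:- zv i, 1:]"] by (simp add: o_def)
    finally show ?thesis .
  qed
  then show ?thesis using on by (simp add: pinv_def)
qed

definition zmon :: "(nat \<Rightarrow> nat) \<Rightarrow> 'k mpoly" where "zmon b = (\<Prod>l\<in>{0..<n}. zv l ^ b l)"

lemma zmon_on: "zmon b \<in> mpoly_on {..<n}"
  unfolding zmon_def by (intro mpoly_on_prod mpoly_on_power zv_on) auto

lemmas zspan = staircase_span[OF subring_pinv coeff_zv_pinv]

text \<open>Each monomial of an \<open>A\<close>-invariant polynomial is \<open>A\<close>-invariant, hence a power of \<open>wv\<close> times a polynomial in the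
  \<open>x\<^sub>i\<^sup>m\<close>; the latter are spanned over \<open>\<Gamma>\<close> by the staircase.\<close>

lemma ainv_span: assumes f: "f \<in> ainv" shows "f \<in> gspan pinv (staircase_monomials zv n 0)"
proof -
  let ?V = "gspan pinv (staircase_monomials zv n 0)"
  have "mon a (coef f a) \<in> ?V" if a: "a \<in> supp f" for a
  proof -
    have on: "a \<in> exps_on {..<n}" using f a by (auto simp: ainv_def mpoly_on_def)
    have "(\<Prod>i<n. g i ^ coef a i) = 1" if g: "g \<in> A" for g
    proof -
      have "msub (gcoef n (g, id)) id f = f" using f g by (simp add: ainv_def poly_act_def)
      then have "coef f a * weight (gcoef n (g, id)) a = coef f a"
        using coef_msub[of id "gcoef n (g, id)" f a] by simp
      then show ?thesis using a weight_gcoef[OF on, of "(g, id)"] by (simp add: in_keys_iff)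
    qed
    from ainv_monomial[OF on this] obtain c e where e: "\<And>i. i < n \<Longrightarrow> coef a i = c * (m div p) + m * e i" by blast
    have pow: "mon x (1::'k) ^ c = mon (of_nat c * x) 1" for x :: exps and c
      by (induction c) (auto simp: mult_single distrib_right)
    have mult_nat: "coef (of_nat c * x) i = c * coef x i" for x :: exps and c i
      by (induction c) (auto simp: lookup_add distrib_right)
    have "wv ^ c * (\<Prod>l<n. zv l ^ e l) = mon (of_nat c * (\<Sum>i<n. mon i (m div p)) + (\<Sum>l<n. of_nat (e l) * mon l m)) 1"
      by (simp add: wv_def zv_def pow prod_mon mult_single)
    also have "of_nat c * (\<Sum>i<n. mon i (m div p)) + (\<Sum>l<n. of_nat (e l) * mon l m) = a"
    proof (rule poly_mapping_eqI)
      fix i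
      show "coef (of_nat c * (\<Sum>i<n. mon i (m div p)) + (\<Sum>l<n. of_nat (e l) * mon l m)) i = coef a i"
        using e[of i] on
        by (cases "i < n") (auto simp: lookup_add mult_nat lookup_sum lookup_single when_def exps_on_def in_keys_iff
            if_distrib[of "\<lambda>t. _ * t"] cong: if_cong)
    qed
    finally have "mon a (coef f a) = mon 0 (coef f a) * (wv ^ c * (\<Prod>l<n. zv l ^ e l))" by (simp add: mult_single)
    moreover have "\<dots> \<in> ?V"
      using zspan(2) const_pinv wv_pinv zspan(3)
      by (intro subring_setD(4,6,8)[OF zspan(1)]) auto
    ultimately show ?thesis by simp
  qed
  then have "(\<Sum>a\<in>supp f. mon a (coef f a)) \<in> ?V" by (rule gspan_sum)
  then show ?thesis by (simp flip: pm_expand)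
qed

lemma zmon_coordinates:
  assumes "f \<in> ainv"
  obtains c where "\<And>b. c b \<in> pinv" "f = (\<Sum>b\<in>staircase n 0. c b * zmon b)"
proof -
  have "f \<in> gspan pinv (zmon ` staircase n 0)"
    using ainv_span[OF assms] unfolding staircase_monomials_eq zmon_def .
  then show ?thesis using gspan_image_sum[OF _ finite_staircase subring_pinv, of f zmon n 0] that by blast
qed

text \<open>The conjugations needed to vary the root \<open>x\<^sub>i\<^sup>m\<close> are the transpositions in \<open>G\<close>.\<close>

lemma zmon_independent:
  assumes c: "\<And>b. c b \<in> pinv" and zero: "(\<Sum>b\<in>staircase n 0. c b * zmon b) = 0" and b: "b \<in> staircase n 0"
  shows "c b = 0"
proof (rule staircase_independent[where z = zv and S = pinv and i = 0, OF _ _ _ c zero[unfolded zmon_def] b])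
  show "inj_on zv {..<n}"
  proof (rule inj_onI)
    fix i j assume "zv i = zv j"
    then have "supp (zv i) = supp (zv j)" by simp
    then have "mon i m = (mon j m :: exps)" by (simp add: zv_def)
    then have "supp (mon i m) = supp (mon j m)" by simp
    then show "i = j" using m1 by simp
  qed
  fix l i assume li: "l < i" "i < n"
  let ?h = "(\<lambda>i\<in>{..<n}. 1 :: 'k, transpose l i)"
  have h: "?h \<in> G" by (rule perm_G) (use li in \<open>auto intro: permutes_swap_id\<close>)
  show "\<exists>\<tau>. (\<forall>x y. \<tau> (x + y) = \<tau> x + \<tau> y \<and> \<tau> (x * y) = \<tau> x * \<tau> y) \<and> \<tau> 1 = 1 \<and> \<tau> 0 = 0 \<and>
      (\<forall>x\<in>pinv. \<tau> x = x) \<and> \<tau> (zv i) = zv l \<and> (\<forall>j\<in>{Suc i..<n}. \<tau> (zv j) = zv j)"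
    by (rule exI[of _ "pact ?h"]) (use h li pact_zv[OF h] pact_simps[OF h] in \<open>auto simp: pinv_def\<close>)
qed simp

text \<open>The diagonal group \<open>A\<close> fixes the \<open>y\<^sub>i\<close>, so it acts on each coefficient separately.\<close>

lemma qinv_coef_ainv: assumes "u \<in> qinv" shows "coef u \<beta> \<in> ainv"
proof -
  have "pact (g, id) (coef u \<beta>) = coef u \<beta>" if g: "g \<in> A" for g
    using tact_simps(10)[OF diag_G[OF g], of u \<beta>] assms diag_G[OF g] by (simp add: qinv_def)
  then show ?thesis using assms by (simp add: ainv_def qinv_def qspace_on_def)
qed

end

section \<open>Freeness over the polynomial invariants\<close>

lemma vector_space_qspace: "vector_space (\<lambda>c u. cst c * u :: 'k::field qspace)"
  by unfold_locales (auto simp: cst_add cst_mult algebra_simps)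

interpretation vs: vector_space "\<lambda>c u. cst c * u :: 'k::field qspace"
  by (rule vector_space_qspace)

lemma qcomp_cst: "qcomp d (cst c * u) = cst c * qcomp d u"
proof -
  have "qcomp d (cst c * u) = (\<Sum>e\<le>d. mon 0 (pcomp e (mon 0 c)) * qcomp (d - e) u)"
    unfolding cst_def by (rule qcomp_mult)
  also have "\<dots> = (\<Sum>e\<le>d. if e = 0 then cst c * qcomp d u else 0)"
    by (rule sum.cong) (auto simp: pcomp_mon tdeg_def cst_def)
  finally show ?thesis by simp
qed

context gmpn
begin

lemma qcomp_qinv: assumes "u \<in> qinv" shows "qcomp d u \<in> qinv"
proof -
  have "tact h (qcomp d u) = qcomp d u" if "h \<in> G" for h
    using qcomp_tsub[OF G_cases(3)[OF that], of d "gcoef n h" u] assms that by (simp add: qinv_def qact_def)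
  then show ?thesis using assms by (simp add: qinv_def qcomp_on)
qed

lemma pcomp_pinv: assumes "f \<in> pinv" shows "pcomp d f \<in> pinv"
proof -
  have "pact h (pcomp d f) = pcomp d f" if "h \<in> G" for h
    using pcomp_msub[OF G_cases(3)[OF that], of d "gcoef n h" f] assms that by (simp add: pinv_def poly_act_def)
  then show ?thesis using assms by (simp add: pinv_def pcomp_on)
qed

definition hinv :: "'k qspace set" where "hinv = {u \<in> qinv. \<exists>d. qcomp d u = u}"

text \<open>The subspace \<open>\<Gamma>\<^sub>+ U\<close>: a basis of the invariants over \<open>\<Gamma>\<close> will be a vector space basis modulo it.\<close>

definition aug :: "'k qspace set" where
  "aug = vs.span {mon 0 \<gamma> * u | \<gamma> u. \<gamma> \<in> pinv \<and> coef \<gamma> 0 = 0 \<and> u \<in> qinv}"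

abbreviation "\<Gamma>0 \<equiv> (\<lambda>f. mon 0 f :: 'k qspace) ` pinv"

lemma subring_\<Gamma>0: "subring_set \<Gamma>0"
  unfolding subring_set_def
proof (intro conjI ballI)
  fix a b assume "a \<in> \<Gamma>0" "b \<in> \<Gamma>0"
  then obtain f g where fg: "f \<in> pinv" "g \<in> pinv" "a = mon 0 f" "b = mon 0 g" by blast
  show "a + b \<in> \<Gamma>0" using fg subring_setD(3)[OF subring_pinv, of f g] by (auto simp flip: single_add)
  show "a * b \<in> \<Gamma>0" using fg subring_setD(4)[OF subring_pinv, of f g] by (auto simp: mult_single)
  show "- a \<in> \<Gamma>0" using fg subring_setD(5)[OF subring_pinv, of f] by (auto simp flip: single_uminus)
qed (use subring_setD(1,2)[OF subring_pinv] in \<open>auto intro: image_eqI[of _ _ 0] image_eqI[of _ _ 1]\<close>)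

lemma cst_\<Gamma>0: "cst c \<in> \<Gamma>0"
  using const_pinv by (auto simp: cst_def)

lemma \<Gamma>0_gspan: "s \<in> \<Gamma>0 \<Longrightarrow> u \<in> gspan \<Gamma>0 B \<Longrightarrow> s * u \<in> gspan \<Gamma>0 B"
  by (rule gspan_mult) (use subring_setD(4)[OF subring_\<Gamma>0] in auto)

text \<open>A basis \<open>C\<close> of \<open>\<Gamma>\<^sub>+ U\<close> is extended by homogeneous invariants. Keeping \<open>C\<close> explicit avoids quotient spaces.\<close>

lemma basis_mod_aug:
  obtains B C where "B \<subseteq> hinv" "C \<subseteq> aug" "aug \<subseteq> vs.span C" "B \<inter> C = {}" "\<not> vs.dependent (B \<union> C)"
    "hinv \<subseteq> vs.span (B \<union> C)"
proof -
  obtain C where C: "C \<subseteq> aug" "\<not> vs.dependent C" "aug \<subseteq> vs.span C"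
    using vs.maximal_independent_subset[of aug] by metis
  obtain B' where B': "C \<subseteq> B'" "B' \<subseteq> C \<union> hinv" "\<not> vs.dependent B'" "C \<union> hinv \<subseteq> vs.span B'"
    using vs.maximal_independent_subset_extend[of C "C \<union> hinv"] C(2) by (metis Un_upper1)
  have "(B' - C) \<union> C = B'" using B'(1) by auto
  show ?thesis
  proof (rule that[of "B' - C" C])
    show "\<not> vs.dependent (B' - C \<union> C)" "hinv \<subseteq> vs.span (B' - C \<union> C)"
      unfolding \<open>B' - C \<union> C = B'\<close> using B' by blast+
  qed (use C B' in blast)+
qed

text \<open>The graded Nakayama lemma: modulo the span of \<open>B\<close>, an element of degree \<open>d\<close> is a sum of products
  \<open>\<gamma> v\<close> with \<open>\<gamma>\<close> of positive degree, so that induction applies to \<open>v\<close>.\<close>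

lemma basis_spans:
  assumes B: "B \<subseteq> hinv" and C: "C \<subseteq> aug" and span: "hinv \<subseteq> vs.span (B \<union> C)" and u: "u \<in> qinv"
  shows "u \<in> gspan \<Gamma>0 B"
proof -
  have hom: "u \<in> gspan \<Gamma>0 B" if "u \<in> qinv" "qcomp d u = u" for u d
    using that
  proof (induction d arbitrary: u rule: less_induct)
    case (less d)
    have aug: "qcomp d x \<in> gspan \<Gamma>0 B" if "x \<in> aug" for x
      using that unfolding aug_def
    proof (induction x rule: vs.span_induct_alt)
      case base
      show ?case by (simp add: gspan.gspan_zero)
    next
      case (step c x y)
      then obtain \<gamma> v where x: "x = mon 0 \<gamma> * v" "\<gamma> \<in> pinv" "coef \<gamma> 0 = 0" "v \<in> qinv" by blast
      have "qcomp d x = (\<Sum>e\<le>d. mon 0 (pcomp e \<gamma>) * qcomp (d - e) v)" unfolding x by (rule qcomp_mult)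
      also have "\<dots> \<in> gspan \<Gamma>0 B"
      proof (rule gspan_sum)
        fix e assume "e \<in> {..d}"
        show "mon 0 (pcomp e \<gamma>) * qcomp (d - e) v \<in> gspan \<Gamma>0 B"
        proof (cases "e = 0")
          case True
          then show ?thesis using x(3) by (simp add: pcomp_0 gspan.gspan_zero)
        next
          case False
          then have "d - e < d" using \<open>e \<in> {..d}\<close> by auto
          then have "qcomp (d - e) v \<in> gspan \<Gamma>0 B"
            by (rule less.IH) (simp_all add: qcomp_qinv x(4) qcomp_qcomp)
          then show ?thesis using pcomp_pinv[OF x(2)] by (intro \<Gamma>0_gspan) auto
        qed
      qed
      finally have "cst c * qcomp d x \<in> gspan \<Gamma>0 B" by (intro \<Gamma>0_gspan cst_\<Gamma>0)
      then show ?case using step.IH by (simp add: qcomp_add qcomp_cst gspan_add)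
    qed
    have "qcomp d x \<in> gspan \<Gamma>0 B" if "x \<in> vs.span (B \<union> C)" for x
      using that
    proof (induction x rule: vs.span_induct_alt)
      case base
      show ?case by (simp add: gspan.gspan_zero)
    next
      case (step c x y)
      have "qcomp d x \<in> gspan \<Gamma>0 B"
      proof (cases "x \<in> B")
        case True
        then obtain e where "qcomp e x = x" using B by (auto simp: hinv_def)
        then have "qcomp d x = x \<or> qcomp d x = 0" using qcomp_qcomp[of d e x] by metis
        then show ?thesis using gspan_base[OF subring_setD(2)[OF subring_\<Gamma>0] True] gspan.gspan_zero by metis
      qed (use step C aug in auto)
      then have "cst c * qcomp d x \<in> gspan \<Gamma>0 B" by (intro \<Gamma>0_gspan cst_\<Gamma>0)
      then show ?case using step.IH by (simp add: qcomp_add qcomp_cst gspan_add)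
    qed
    moreover have "u \<in> vs.span (B \<union> C)" using less.prems span by (auto simp: hinv_def)
    ultimately show ?case using less.prems(2) by metis
  qed
  obtain D where "u = (\<Sum>d\<le>D. qcomp d u)" using qcomp_expand by blast
  moreover have "(\<Sum>d\<le>D. qcomp d u) \<in> gspan \<Gamma>0 B"
    by (intro gspan_sum hom) (auto simp: qcomp_qinv u qcomp_qcomp)
  ultimately show ?thesis by metis
qed

lemma reynolds_aug:
  assumes "\<gamma> \<in> pinv" "coef \<gamma> 0 = 0" "v \<in> qspace_on {..<n}"
  shows "reynolds (mon 0 \<gamma> * v) \<in> aug"
proof -
  have "tact h (mon 0 \<gamma>) = mon 0 \<gamma>" if "h \<in> G" for h
    using assms(1) that by (simp add: tact_simps(7) pinv_def)
  then have "reynolds (mon 0 \<gamma> * v) = mon 0 \<gamma> * reynolds v" by (rule reynolds_mult)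
  then show ?thesis using assms reynolds_closed unfolding aug_def by (intro vs.span_base) blast
qed

text \<open>Let \<open>t\<close> be a monomial of least degree among all coefficients \<open>l b\<close>. Written in the staircase basis of the
  \<open>A\<close>-invariants, the relation holds for each basis vector separately; its coefficient at \<open>t\<close> says that
  \<open>\<Sum> coef (l b) t * b\<close> has staircase coordinates without constant term. This sum is an invariant, so averaging
  puts it into \<open>aug\<close>, although some scalar \<open>coef (l b) t\<close> is nonzero.\<close>

lemma basis_independent:
  assumes B: "B \<subseteq> hinv" and C: "aug \<subseteq> vs.span C" "B \<inter> C = {}" "\<not> vs.dependent (B \<union> C)"
    and B0: "finite B0" "B0 \<subseteq> B" and l: "\<And>b. b \<in> B0 \<Longrightarrow> l b \<in> pinv"
    and rel: "(\<Sum>b\<in>B0. mon 0 (l b) * b) = 0" and b: "b \<in> B0"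
  shows "l b = 0"
proof (rule ccontr)
  assume nz: "l b \<noteq> 0"
  let ?M = "\<lambda>t. \<exists>b\<in>B0. t \<in> supp (l b)"
  obtain t where "?M t" using b nz by (metis keys_eq_empty all_not_in_conv)
  then obtain t where t: "?M t" "\<And>t'. ?M t' \<Longrightarrow> tdeg t \<le> tdeg t'"
    using ex_has_least_nat[of ?M t tdeg] by blast
  \<comment> \<open>an index at which the monomial \<open>t\<close> occurs; it is removed from the basis at the end\<close>
  then obtain b1 where b1: "b1 \<in> B0" "t \<in> supp (l b1)" by blast
  define s where "s b = coef (l b) t" for b
  have s1: "s b1 \<noteq> 0" using b1 by (simp add: s_def in_keys_iff)
  have B0_inv: "b \<in> qinv" if "b \<in> B0" for b using that B0 B by (auto simp: hinv_def)
  define v where "v = (\<Sum>b\<in>B0. cst (s b) * b)"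
  have v_inv: "v \<in> qinv" unfolding v_def
    using subring_setD[OF subring_qinv] B0_inv mon_pinv[OF const_pinv] by (auto simp: cst_def intro!: subring_setD(7)[OF subring_qinv])
  have "\<exists>\<gamma>. (\<forall>e. \<gamma> e \<in> pinv \<and> coef (\<gamma> e) 0 = 0) \<and> coef v \<beta> = (\<Sum>e\<in>staircase n 0. \<gamma> e * zmon e)" for \<beta>
  proof -
    have "\<exists>c. (\<forall>e. c e \<in> pinv) \<and> coef b \<beta> = (\<Sum>e\<in>staircase n 0. c e * zmon e)" if "b \<in> B0" for b
      using zmon_coordinates[OF qinv_coef_ainv[OF B0_inv[OF that]], of \<beta>] by metis
    then obtain c where c: "\<And>b e. b \<in> B0 \<Longrightarrow> c b e \<in> pinv"
      "\<And>b. b \<in> B0 \<Longrightarrow> coef b \<beta> = (\<Sum>e\<in>staircase n 0. c b e * zmon e)" by metis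
    have coef_mult: "coef (mon 0 f * u) \<beta> = f * coef u \<beta>" for f and u :: "'k qspace"
      by (induction u rule: pm_induct_all) (auto simp: mult_single lookup_add lookup_single when_def distrib_left)
    \<comment> \<open>the coordinate of the relation at the staircase monomial \<open>e\<close>\<close>
    define L where "L e = (\<Sum>b\<in>B0. l b * c b e)" for e
    have "0 = coef (\<Sum>b\<in>B0. mon 0 (l b) * b) \<beta>" by (simp add: rel)
    also have "\<dots> = (\<Sum>b\<in>B0. l b * (\<Sum>e\<in>staircase n 0. c b e * zmon e))"
      by (simp add: lookup_sum coef_mult c(2))
    also have "\<dots> = (\<Sum>b\<in>B0. \<Sum>e\<in>staircase n 0. l b * c b e * zmon e)"
      by (simp add: sum_distrib_left mult.assoc)
    also have "\<dots> = (\<Sum>e\<in>staircase n 0. L e * zmon e)"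
      by (subst sum.swap) (simp add: L_def sum_distrib_right)
    finally have "(\<Sum>e\<in>staircase n 0. L e * zmon e) = 0" by simp
    moreover have "L e \<in> pinv" for e
      unfolding L_def by (intro subring_setD(7,4)[OF subring_pinv] l c)
    ultimately have L0: "L e = 0" if "e \<in> staircase n 0" for e
      using zmon_independent[of L e] that by blast
    define \<gamma> where "\<gamma> e = (if e \<in> staircase n 0 then \<Sum>b\<in>B0. mon 0 (s b) * c b e else 0)" for e
    have "\<gamma> e \<in> pinv" for e
      unfolding \<gamma>_def using subring_setD(1)[OF subring_pinv]
      by (auto intro!: subring_setD(7,4)[OF subring_pinv] const_pinv c)
    moreover have "coef (\<gamma> e) 0 = 0" for e
    proof (cases "e \<in> staircase n 0")
      case True
      have "coef (mon 0 x * f) 0 = x * coef f 0" for x and f :: "'k mpoly"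
        by (induction f rule: pm_induct_all) (auto simp: mult_single lookup_add lookup_single when_def distrib_left)
      then have "coef (\<gamma> e) 0 = (\<Sum>b\<in>B0. s b * coef (c b e) 0)" using True by (simp add: \<gamma>_def lookup_sum)
      also have "\<dots> = (\<Sum>b\<in>B0. coef (l b * c b e) t)"
      proof (rule sum.cong[OF refl])
        fix b assume "b \<in> B0"
        show "s b * coef (c b e) 0 = coef (l b * c b e) t"
          unfolding s_def by (rule coef_mult_lowest[symmetric]) (use t(2) \<open>b \<in> B0\<close> in blast)
      qed
      also have "\<dots> = coef (L e) t" by (simp add: L_def lookup_sum)
      finally show ?thesis using L0[OF True] by simp
    qed (simp add: \<gamma>_def)
    moreover have "coef v \<beta> = (\<Sum>e\<in>staircase n 0. \<gamma> e * zmon e)"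
    proof -
      have "coef v \<beta> = (\<Sum>b\<in>B0. mon 0 (s b) * (\<Sum>e\<in>staircase n 0. c b e * zmon e))"
        by (simp add: v_def cst_def lookup_sum coef_mult c(2))
      also have "\<dots> = (\<Sum>b\<in>B0. \<Sum>e\<in>staircase n 0. mon 0 (s b) * c b e * zmon e)"
        by (simp add: sum_distrib_left mult.assoc)
      also have "\<dots> = (\<Sum>e\<in>staircase n 0. \<gamma> e * zmon e)"
        by (subst sum.swap) (simp add: \<gamma>_def sum_distrib_right)
      finally show ?thesis .
    qed
    ultimately show ?thesis by blast
  qed
  then have "\<forall>\<beta>. \<exists>\<gamma>. (\<forall>e. \<gamma> e \<in> pinv \<and> coef (\<gamma> e) 0 = 0) \<and> coef v \<beta> = (\<Sum>e\<in>staircase n 0. \<gamma> e * zmon e)" ..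
  from choice[OF this] obtain \<gamma> where
    "\<forall>\<beta>. (\<forall>e. \<gamma> \<beta> e \<in> pinv \<and> coef (\<gamma> \<beta> e) 0 = 0) \<and> coef v \<beta> = (\<Sum>e\<in>staircase n 0. \<gamma> \<beta> e * zmon e)" ..
  then have \<gamma>: "\<And>\<beta> e. \<gamma> \<beta> e \<in> pinv" "\<And>\<beta> e. coef (\<gamma> \<beta> e) 0 = 0"
    "\<And>\<beta>. coef v \<beta> = (\<Sum>e\<in>staircase n 0. \<gamma> \<beta> e * zmon e)" by blast+
  have "v = (\<Sum>\<beta>\<in>supp v. mon \<beta> (coef v \<beta>))" by (rule pm_expand)
  also have "\<dots> = (\<Sum>\<beta>\<in>supp v. \<Sum>e\<in>staircase n 0. mon 0 (\<gamma> \<beta> e) * mon \<beta> (zmon e))"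
  proof (rule sum.cong[OF refl])
    fix \<beta>
    have "mon \<beta> (\<Sum>e\<in>staircase n 0. \<gamma> \<beta> e * zmon e) = (\<Sum>e\<in>staircase n 0. mon \<beta> (\<gamma> \<beta> e * zmon e))"
      by (rule additive.sum) (simp add: additive_def single_add)
    then show "mon \<beta> (coef v \<beta>) = (\<Sum>e\<in>staircase n 0. mon 0 (\<gamma> \<beta> e) * mon \<beta> (zmon e))"
      by (simp add: \<gamma>(3) mult_single)
  qed
  finally have v_eq: "v = (\<Sum>\<beta>\<in>supp v. \<Sum>e\<in>staircase n 0. mon 0 (\<gamma> \<beta> e) * mon \<beta> (zmon e))" .
  have "reynolds (mon 0 (\<gamma> \<beta> e) * mon \<beta> (zmon e)) \<in> aug" if "\<beta> \<in> supp v" for \<beta> e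
    by (rule reynolds_aug[OF \<gamma>(1,2)], rule qspace_on_mon[OF _ zmon_on])
      (use that v_inv in \<open>auto simp: qinv_def qspace_on_def\<close>)
  then have "(\<Sum>\<beta>\<in>supp v. \<Sum>e\<in>staircase n 0. reynolds (mon 0 (\<gamma> \<beta> e) * mon \<beta> (zmon e))) \<in> aug"
    unfolding aug_def by (intro vs.span_sum)
  moreover have "v = (\<Sum>\<beta>\<in>supp v. \<Sum>e\<in>staircase n 0. reynolds (mon 0 (\<gamma> \<beta> e) * mon \<beta> (zmon e)))"
  proof -
    have "reynolds v = reynolds (\<Sum>\<beta>\<in>supp v. \<Sum>e\<in>staircase n 0. mon 0 (\<gamma> \<beta> e) * mon \<beta> (zmon e))"
      using v_eq by (rule arg_cong)
    then have "reynolds v = (\<Sum>\<beta>\<in>supp v. \<Sum>e\<in>staircase n 0. reynolds (mon 0 (\<gamma> \<beta> e) * mon \<beta> (zmon e)))"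
      by (simp only: reynolds_sum)
    then show ?thesis by (simp only: reynolds_id[OF v_inv])
  qed
  ultimately have "v \<in> aug" by (simp only:)
  let ?S = "B \<union> C - {b1}"
  have "C \<subseteq> ?S" using C(2) b1 B0 by auto
  then have "v \<in> vs.span ?S" using \<open>v \<in> aug\<close> C(1) vs.span_mono[of C ?S] by blast
  moreover have "(\<Sum>b\<in>B0 - {b1}. cst (s b) * b) \<in> vs.span ?S"
    by (intro vs.span_sum vs.span_scale vs.span_base) (use B0 in auto)
  ultimately have "v - (\<Sum>b\<in>B0 - {b1}. cst (s b) * b) \<in> vs.span ?S" by (rule vs.span_diff)
  then have "cst (s b1) * b1 \<in> vs.span ?S"
    unfolding v_def using sum.remove[OF B0(1) b1(1), of "\<lambda>b. cst (s b) * b"] by simp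
  then have "cst (1 / s b1) * (cst (s b1) * b1) \<in> vs.span ?S" by (rule vs.span_scale)
  moreover have "cst (1 / s b1) * (cst (s b1) * b1) = b1"
    using s1 by (simp add: mult.assoc[symmetric] flip: cst_mult)
  ultimately have "b1 \<in> vs.span ?S" by (simp only:)
  then have "vs.dependent (B \<union> C)" unfolding vs.dependent_def using b1 B0 by blast
  with C(3) show False by blast
qed

text \<open>The product in this statement is the commutative one, which for a left factor from \<open>\<Gamma>\<close> is also the quantum product.\<close>

theorem qinv_free:
  obtains B where "B \<subseteq> qinv" "\<And>u. u \<in> qinv \<Longrightarrow> u \<in> gspan \<Gamma>0 B"
    "\<And>B0 l b. finite B0 \<Longrightarrow> B0 \<subseteq> B \<Longrightarrow> (\<And>b. b \<in> B0 \<Longrightarrow> l b \<in> pinv) \<Longrightarrow> (\<Sum>b\<in>B0. mon 0 (l b) * b) = 0 \<Longrightarrow>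
      b \<in> B0 \<Longrightarrow> l b = 0"
proof -
  obtain B C where BC: "B \<subseteq> hinv" "C \<subseteq> aug" "aug \<subseteq> vs.span C" "B \<inter> C = {}" "\<not> vs.dependent (B \<union> C)"
    "hinv \<subseteq> vs.span (B \<union> C)" by (rule basis_mod_aug)
  show ?thesis
  proof (rule that[of B])
    show "B \<subseteq> qinv" using BC(1) by (auto simp: hinv_def)
    show "u \<in> gspan \<Gamma>0 B" if "u \<in> qinv" for u by (rule basis_spans[OF BC(1,2,6) that])
    show "l b = 0" if "finite B0" "B0 \<subseteq> B" "\<And>b. b \<in> B0 \<Longrightarrow> l b \<in> pinv" "(\<Sum>b\<in>B0. mon 0 (l b) * b) = 0" "b \<in> B0"
      for B0 l b
      by (rule basis_independent[OF BC(1,3,4,5) that])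
  qed
qed

end

section \<open>Finite generation of modules of polynomial vectors\<close>

lemma nat_mono_subseq:
  fixes s :: "nat \<Rightarrow> nat"
  shows "\<exists>r :: nat \<Rightarrow> nat. strict_mono r \<and> mono (\<lambda>i. s (r i))"
proof -
  obtain f where f: "strict_mono f" "monoseq (\<lambda>i. s (f i))" using seq_monosub by blast
  show ?thesis
  proof (cases "\<forall>i. \<forall>j\<ge>i. s (f i) \<le> s (f j)")
    case True
    then show ?thesis using f by (intro exI[of _ f]) (auto simp: mono_def)
  next
    case False
    then have dec: "s (f j) \<le> s (f i)" if "i \<le> j" for i j using f(2) that by (auto simp: monoseq_def)
    obtain N where N: "\<And>i. s (f N) \<le> s (f i)" using ex_has_least_nat[of "\<lambda>_. True" _ "\<lambda>i. s (f i)"] by blast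
    have "s (f (i + N)) = s (f N)" for i using dec[of N "i + N"] N[of "i + N"] by simp
    then show ?thesis using f(1) by (intro exI[of _ "\<lambda>i. f (i + N)"]) (auto simp: mono_def strict_mono_def)
  qed
qed

lemma dickson_subseq:
  fixes f :: "'b \<Rightarrow> nat \<Rightarrow> nat"
  assumes "finite K"
  shows "\<exists>r :: nat \<Rightarrow> nat. strict_mono r \<and> (\<forall>k\<in>K. mono (\<lambda>i. f k (r i)))"
  using assms
proof (induction K rule: finite_induct)
  case empty
  show ?case by (intro exI[of _ id]) (auto simp: strict_mono_def)
next
  case (insert k K)
  then obtain r :: "nat \<Rightarrow> nat" where r: "strict_mono r" "\<forall>k\<in>K. mono (\<lambda>i. f k (r i))" by blast
  obtain r' :: "nat \<Rightarrow> nat" where r': "strict_mono r'" "mono (\<lambda>i. f k (r (r' i)))"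
    using nat_mono_subseq[of "\<lambda>i. f k (r i)"] by blast
  have "strict_mono (\<lambda>i. r (r' i))" using r(1) r'(1) by (auto simp: strict_mono_def)
  moreover have "mono (\<lambda>i. f k' (r (r' i)))" if "k' \<in> K" for k'
    using r(2) that strict_mono_mono[OF r'(1)] by (auto simp: mono_def)
  ultimately show ?case using r'(2) by (intro exI[of _ "\<lambda>i. r (r' i)"]) auto
qed

text \<open>Dickson's lemma for monomial vectors: in any sequence some term is divisible by an earlier one with the same
  position.\<close>

lemma dickson_pair:
  fixes s :: "nat \<Rightarrow> exps \<times> exps"
  assumes F: "finite F" and s: "\<And>i. fst (s i) \<in> F" "\<And>i. snd (s i) \<in> exps_on {..<n}"
  obtains i j e where "i < j" "fst (s j) = fst (s i)" "e \<in> exps_on {..<n}" "snd (s j) = snd (s i) + e"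
proof -
  have "finite ((\<lambda>i. fst (s i)) ` UNIV)" by (rule finite_subset[OF _ F]) (use s(1) in blast)
  then obtain i0 where "infinite {i. fst (s i) = fst (s i0)}"
    using pigeonhole_infinite[of "UNIV :: nat set" "\<lambda>i. fst (s i)"] by auto
  from infinite_enumerate[OF this] obtain r :: "nat \<Rightarrow> nat" where "strict_mono r" "\<forall>i. r i \<in> {i. fst (s i) = fst (s i0)}" by blast
  then have r: "strict_mono r" "\<And>i. fst (s (r i)) = fst (s i0)" by simp_all
  obtain r' :: "nat \<Rightarrow> nat" where r': "strict_mono r'" "\<forall>k\<in>{..<n}. mono (\<lambda>i. coef (snd (s (r (r' i)))) k)"
    using dickson_subseq[of "{..<n}" "\<lambda>k i. coef (snd (s (r i))) k"] by blast
  let ?a = "snd (s (r (r' 0)))" and ?b = "snd (s (r (r' 1)))"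
  have "coef ?a k \<le> coef ?b k" for k
  proof (cases "k < n")
    case True
    then show ?thesis using r'(2) by (auto simp: mono_def)
  next
    case False
    then have "coef ?a k = 0" using s(2)[of "r (r' 0)"] by (auto simp: exps_on_def in_keys_iff)
    then show ?thesis by simp
  qed
  then have "?b = ?a + (?b - ?a)" by (intro poly_mapping_eqI) (simp add: lookup_add lookup_minus)
  moreover have "?b - ?a \<in> exps_on {..<n}"
  proof -
    have "supp (?b - ?a) \<subseteq> supp ?b" by (auto simp: in_keys_iff lookup_minus)
    then show ?thesis using s(2)[of "r (r' 1)"] by (simp add: exps_on_def)
  qed
  moreover have "r (r' 0) < r (r' 1)" using r(1) r'(1) by (simp add: strict_mono_def)
  ultimately show ?thesis using that[of "r (r' 0)" "r (r' 1)" "?b - ?a"] r(2) by simp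
qed

lemma exps_zero_le: "0 \<le> (a :: exps)"
proof (rule ccontr)
  assume "\<not> 0 \<le> a"
  then have "a < 0" by simp
  then show False by (simp add: less_poly_mapping.rep_eq less_fun_def)
qed

text \<open>The monomials \<open>x\<^sup>a y\<^sup>\<beta>\<close> as pairs \<open>(\<beta>, a)\<close>. The lexicographic order on pairs is a term order: multiplying by a
  monomial in the \<open>x\<^sub>i\<close> is strictly monotone.\<close>

definition terms :: "'k::field qspace \<Rightarrow> (exps \<times> exps) set" where
  "terms u = {(\<beta>, a). coef (coef u \<beta>) a \<noteq> 0}"

lemma finite_terms [simp]: "finite (terms u)"
proof (rule finite_subset)
  show "terms u \<subseteq> (SIGMA \<beta>:supp u. supp (coef u \<beta>))"
    by (auto simp: terms_def in_keys_iff)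
qed auto

lemma terms_empty: "terms u = {} \<longleftrightarrow> u = 0"
  by (auto simp: terms_def intro!: poly_mapping_eqI)

lemma coef_mult_monomial:
  "coef (coef (mon 0 (mon e c) * u) \<beta>) (e + a) = c * coef (coef u \<beta>) (a :: exps)" for u :: "'k::field qspace"
  by (induction u rule: qspace_induct) (auto simp: mult_single lookup_add lookup_single when_def distrib_left)

lemma terms_mult_monomial: "terms (mon 0 (mon e c) * u) \<subseteq> (\<lambda>(\<beta>, a). (\<beta>, e + a)) ` terms u"
proof (induction u rule: pm_induct_all)
  case (mon \<beta> f)
  have "coef (mon e c * f) a \<noteq> 0 \<Longrightarrow> \<exists>b. a = e + b \<and> coef f b \<noteq> 0" for a
  proof -
    assume "coef (mon e c * f) a \<noteq> 0"
    then have "a \<in> supp (mon e c * f)" by (simp add: in_keys_iff)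
    with keys_mult[of "mon e c" f] show ?thesis by (auto simp: in_keys_iff lookup_single when_def split: if_splits)
  qed
  then have "(\<beta>, a) \<in> (\<lambda>(\<beta>, a). (\<beta>, e + a)) ` terms (mon \<beta> f)" if "coef (mon e c * f) a \<noteq> 0" for a
    using that by (fastforce simp: terms_def)
  then show ?case by (auto simp: terms_def mult_single lookup_single when_def split: if_splits)
next
  case (add u v)
  show ?case
  proof
    fix x assume x: "x \<in> terms (mon 0 (mon e c) * (u + v))"
    then obtain \<beta> a where [simp]: "x = (\<beta>, a)" by (cases x)
    from x have "(\<beta>, a) \<in> terms (mon 0 (mon e c) * u) \<union> terms (mon 0 (mon e c) * v)"
      by (auto simp: terms_def distrib_left lookup_add)
    with add obtain b where b: "a = e + b" by auto
    with x have "c * coef (coef (u + v) \<beta>) b \<noteq> 0" using coef_mult_monomial[of e c "u + v" \<beta> b] by (simp add: terms_def)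
    then show "x \<in> (\<lambda>(\<beta>, a). (\<beta>, e + a)) ` terms (u + v)" using b by (auto simp: terms_def)
  qed
qed

text \<open>Hilbert's basis theorem with generators chosen inside \<open>N\<close>. If \<open>N\<close> is not finitely generated, a sequence of
  elements of \<open>N\<close> generates strictly increasing modules \<open>S\<^sub>0 \<subset> S\<^sub>1 \<subset> \<dots>\<close>. Choose \<open>v\<^sub>i\<close> in \<open>S\<^sub>i\<^sub>+\<^sub>1\<close> outside
  \<open>S\<^sub>i\<close> with least leading term. By Dickson's lemma some leading term is a multiple of an earlier one, and
  subtracting that multiple lowers it, which contradicts minimality.\<close>

lemma polynomial_vectors_noetherian:
  fixes N :: "'k::field qspace set"
  assumes F: "finite F" and N: "\<And>u. u \<in> N \<Longrightarrow> u \<in> qspace_on {..<n} \<and> supp u \<subseteq> F"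
  obtains B where "finite B" "B \<subseteq> N" "N \<subseteq> gspan (mon 0 ` mpoly_on {..<n}) B"
proof (rule ccontr)
  assume "\<not> thesis"
  then have no: "\<exists>u\<in>N. u \<notin> gspan (mon 0 ` mpoly_on {..<n}) B" if "finite B" "B \<subseteq> N" for B
    using that \<open>\<And>B. finite B \<Longrightarrow> B \<subseteq> N \<Longrightarrow> N \<subseteq> gspan (mon 0 ` mpoly_on {..<n}) B \<Longrightarrow> thesis\<close> by blast
  let ?P = "mon 0 ` mpoly_on {..<n} :: 'k qspace set"
  let ?M = "{t :: exps \<times> exps. fst t \<in> F \<and> snd t \<in> exps_on {..<n}}"
  define ch where "ch B = (SOME u. u \<in> N \<and> u \<notin> gspan ?P B)" for B
  have ch: "ch B \<in> N" "ch B \<notin> gspan ?P B" if "finite B" "B \<subseteq> N" for B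
    using someI_ex[of "\<lambda>u. u \<in> N \<and> u \<notin> gspan ?P B"] no[OF that] unfolding ch_def by blast+
  \<comment> \<open>the first \<open>i\<close> members of the sequence\<close>
  define Bs where "Bs = rec_nat {} (\<lambda>_ B. insert (ch B) B)"
  have Bs0: "Bs 0 = {}" and BsS: "Bs (Suc i) = insert (ch (Bs i)) (Bs i)" for i by (simp_all add: Bs_def)
  have Bs: "finite (Bs i) \<and> Bs i \<subseteq> N" for i by (induction i) (auto simp: Bs0 BsS ch)
  have Bs_mono: "Bs i \<subseteq> Bs j" if "i \<le> j" for i j
    using that by (induction rule: dec_induct) (auto simp: BsS)
  let ?S = "\<lambda>i. gspan ?P (Bs i)"
  have P1: "1 \<in> ?P" by (intro image_eqI[of _ _ 1]) auto
  have P_mult: "a * b \<in> ?P" if "a \<in> ?P" "b \<in> ?P" for a b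
    using that by (auto simp: mult_single intro!: imageI mpoly_on_mult)
  have S_mono: "?S i \<subseteq> ?S j" if "i \<le> j" for i j
    using gspan_subset[of _ ?P "Bs i" ?P "Bs j"] Bs_mono[OF that] by (blast intro: gspan_scaled)
  have S_scale: "c * u \<in> ?S i" if "c \<in> ?P" "u \<in> ?S i" for c u i
    by (rule gspan_mult[OF P_mult that])
  have S_minus: "- u \<in> ?S i" if "u \<in> ?S i" for u i
  proof -
    have "- 1 \<in> ?P" by (intro image_eqI[of _ _ "- 1"] mpoly_on_minus) (simp_all add: single_uminus)
    from S_scale[OF this that] show ?thesis by simp
  qed
  have S_on: "terms u \<subseteq> ?M" if "u \<in> ?S i" for u i
  proof -
    have "u \<in> qspace_on {..<n} \<and> supp u \<subseteq> F" using that
    proof induction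
      case (gspan_step s b u)
      then obtain f where f: "f \<in> mpoly_on {..<n}" "s = mon 0 f" by blast
      have b: "b \<in> qspace_on {..<n}" "supp b \<subseteq> F" using N Bs gspan_step by blast+
      have "supp (mon 0 f * b) \<subseteq> F" using b(2) keys_mult[of "mon 0 f" b] by (auto split: if_splits)
      then show ?case unfolding f(2)
        using gspan_step b(1) f(1) by (intro conjI qspace_on_add qspace_on_mult qspace_on_mon supp_add_subset) auto
    qed simp
    moreover have "\<beta> \<in> supp u \<and> a \<in> supp (coef u \<beta>)" if "(\<beta>, a) \<in> terms u" for \<beta> a
      using that by (auto simp: terms_def in_keys_iff)
    ultimately show ?thesis unfolding qspace_on_def mpoly_on_def by fastforce
  qed
  have wf: "wf {(x, y). x < y \<and> x \<in> ?M \<and> y \<in> ?M}"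
  proof (rule ccontr)
    assume "\<not> ?thesis"
    then obtain s where s: "\<And>i. (s (Suc i), s i) \<in> {(x, y). x < y \<and> x \<in> ?M \<and> y \<in> ?M}"
      unfolding wf_iff_no_infinite_down_chain by blast
    have less: "s j < s i" if "i < j" for i j
      using that by (induction rule: strict_inc_induct) (use s in \<open>auto intro: less_trans\<close>)
    obtain i j e where ij: "i < j" "fst (s j) = fst (s i)" "snd (s j) = snd (s i) + e"
      by (rule dickson_pair[of F s n]) (use F s in auto)
    have "snd (s i) + 0 \<le> snd (s i) + e" by (rule add_left_mono[OF exps_zero_le])
    then have "s i \<le> s j" using ij by (simp add: less_eq_prod_def)
    with less[OF ij(1)] show False by simp
  qed
  have "\<exists>v. v \<in> ?S (Suc i) \<and> v \<notin> ?S i \<and> (\<forall>w. w \<in> ?S (Suc i) \<and> w \<notin> ?S i \<longrightarrow> \<not> Max (terms w) < Max (terms v))" for i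
  proof -
    let ?Q = "{Max (terms w) | w. w \<in> ?S (Suc i) \<and> w \<notin> ?S i}"
    have "ch (Bs i) \<in> ?S (Suc i)" by (rule gspan_base[OF P1]) (simp add: BsS)
    then have "Max (terms (ch (Bs i))) \<in> ?Q" using ch Bs by blast
    from wfE_min[OF wf this] obtain t where t: "t \<in> ?Q"
      "\<And>y. (y, t) \<in> {(x, y). x < y \<and> x \<in> ?M \<and> y \<in> ?M} \<Longrightarrow> y \<notin> ?Q" by blast
    then obtain v where v: "v \<in> ?S (Suc i)" "v \<notin> ?S i" "t = Max (terms v)" by blast
    have inM: "Max (terms w) \<in> ?M" if "w \<in> ?S (Suc i)" "w \<notin> ?S i" for w
    proof -
      have "w \<noteq> 0" using that gspan.gspan_zero by metis
      then have "Max (terms w) \<in> terms w" by (intro Max_in) (simp_all add: terms_empty)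
      then show ?thesis using S_on[OF that(1)] by blast
    qed
    show ?thesis using v t(2) inM by blast
  qed
  then obtain v where v: "\<And>i. v i \<in> ?S (Suc i)" "\<And>i. v i \<notin> ?S i"
    "\<And>i w. w \<in> ?S (Suc i) \<Longrightarrow> w \<notin> ?S i \<Longrightarrow> \<not> Max (terms w) < Max (terms (v i))" by metis
  define s where "s i = Max (terms (v i))" for i
  have v0: "v i \<noteq> 0" for i using v(2) gspan.gspan_zero by metis
  have s_in: "s i \<in> terms (v i)" for i
    unfolding s_def by (rule Max_in) (simp_all add: terms_empty v0)
  have s_ge: "t \<le> s i" if "t \<in> terms (v i)" for i t
    unfolding s_def by (rule Max_ge) (simp_all add: that)
  have sM: "s i \<in> ?M" for i using s_in S_on[OF v(1)] by blast
  obtain i j e where ij: "i < j" "fst (s j) = fst (s i)" "e \<in> exps_on {..<n}" "snd (s j) = snd (s i) + e"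
    by (rule dickson_pair[of F s n]) (use F sM in auto)
  define \<beta> a where "\<beta> = fst (s i)" and "a = snd (s i)"
  have si: "s i = (\<beta>, a)" and sj: "s j = (\<beta>, e + a)"
    using ij by (simp_all add: \<beta>_def a_def prod_eq_iff add.commute)
  define x where "x = coef (coef (v j) \<beta>) (e + a) / coef (coef (v i) \<beta>) a"
  \<comment> \<open>the leading terms cancel\<close>
  define w where "w = v j - mon 0 (mon e x) * v i"
  have vi: "v i \<in> ?S j" using v(1)[of i] S_mono[of "Suc i" j] ij(1) by auto
  have P: "mon 0 (mon e x) \<in> ?P" using ij(3) by (intro imageI mpoly_on_mon)
  have sub: "mon 0 (mon e x) * v i \<in> ?S j" by (rule S_scale[OF P vi])
  have "w \<in> ?S (Suc j)"
    unfolding w_def diff_conv_add_uminus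
    by (intro gspan_add v(1) S_minus) (use sub S_mono[of j "Suc j"] in auto)
  moreover have "w \<notin> ?S j"
  proof
    assume "w \<in> ?S j"
    then have "w + mon 0 (mon e x) * v i \<in> ?S j" using sub by (rule gspan_add)
    then show False using v(2)[of j] by (simp add: w_def)
  qed
  moreover have "Max (terms w) < Max (terms (v j))"
  proof -
    have "w \<noteq> 0" using \<open>w \<notin> ?S j\<close> gspan.gspan_zero by metis
    then have "Max (terms w) \<in> terms w" by (intro Max_in) (simp_all add: terms_empty)
    moreover have "t < s j" if t: "t \<in> terms w" for t
    proof -
      have le: "t \<le> s j"
      proof (cases "t \<in> terms (v j)")
        case False
        then have "t \<in> terms (mon 0 (mon e x) * v i)"
          using t by (auto simp: terms_def w_def lookup_minus)
        then obtain \<delta> b where b: "t = (\<delta>, e + b)" "(\<delta>, b) \<in> terms (v i)" using terms_mult_monomial by fastforce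
        then have "(\<delta>, b) \<le> (\<beta>, a)" using s_ge[of "(\<delta>, b)" i] si by simp
        then show ?thesis unfolding b sj by (auto simp: less_eq_prod_def)
      qed (rule s_ge)
      have "t \<noteq> s j"
      proof
        assume "t = s j"
        then have "coef (coef w \<beta>) (e + a) \<noteq> 0" using t sj by (simp add: terms_def)
        moreover have "coef (coef (v i) \<beta>) a \<noteq> 0" using s_in[of i] si by (simp add: terms_def)
        ultimately show False by (simp add: w_def lookup_minus coef_mult_monomial x_def)
      qed
      with le show ?thesis by simp
    qed
    ultimately show ?thesis by (simp add: s_def)
  qed
  ultimately show False using v(3) by blast
qed

section \<open>The twist exchanging left and right coefficients\<close>

definition twist :: "'k \<Rightarrow> 'k::field qspace \<Rightarrow> 'k qspace" where
  "twist r = lin_ext (\<lambda>\<beta> f. mon \<beta> (qshift r \<beta> f))"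

lemma additive_twist: "additive (twist r)"
  unfolding twist_def by (rule additive_lin_ext) (auto simp: additive_def single_add msub_add)

lemmas twist_add = additive.add[OF additive_twist] and twist_zero [simp] = additive.zero[OF additive_twist]
  and twist_sum = additive.sum[OF additive_twist]

lemma twist_mon: "twist r (mon \<beta> f) = mon \<beta> (qshift r \<beta> f)"
  by (simp add: twist_def lin_ext_mon)

lemma coef_twist: "coef (twist r u) \<beta> = qshift r \<beta> (coef u \<beta>)"
  by (induction u rule: pm_induct_all) (auto simp: twist_mon twist_add msub_add lookup_add lookup_single when_def id_def)

lemma supp_twist: "supp (twist r u) \<subseteq> supp u"
  by (auto simp: in_keys_iff coef_twist)

lemma twist_twist: "r * s = 1 \<Longrightarrow> twist r (twist s u) = u"
proof (induction u rule: pm_induct_all)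
  case (mon \<beta> f)
  have "s ^ k * r ^ k = 1" for k using mon by (simp add: power_mult_distrib[symmetric] mult.commute)
  then show ?case by (simp add: twist_mon msub_comp)
qed (simp add: twist_add)

lemma twist_on: "u \<in> qspace_on A \<Longrightarrow> twist r u \<in> qspace_on A"
  by (induction u rule: qspace_on_induct_poly)
    (auto simp: twist_mon twist_add intro!: qspace_on_mon qspace_on_add mpoly_on_msub)

lemma twist_tsub: "bij \<pi> \<Longrightarrow> twist r (tsub c \<pi> u) = tsub c \<pi> (twist r u)"
  by (induction u rule: pm_induct_all) (auto simp: twist_mon twist_add tsub_mon tsub_add msub_qshift)

text \<open>Moving \<open>f\<close> from the right of \<open>y\<^sup>\<beta>\<close> to the left dilates it by \<open>\<beta>\<close>, and the twist by the inverse of \<open>q\<close>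
  undoes exactly this dilation.\<close>

lemma twist_qmul_right: "q \<noteq> 0 \<Longrightarrow> twist (inverse q) (qmul q u (mon 0 f)) = mon 0 f * twist (inverse q) u"
proof (induction u rule: pm_induct_all)
  case (mon \<beta> g)
  have "q ^ k * inverse q ^ k = 1" for k using mon by (simp add: power_mult_distrib[symmetric])
  then show ?case by (simp add: qmul_mon twist_mon mult_single msub_mult msub_comp mult.commute)
qed (simp add: qmul_add_left twist_add distrib_left)

context gmpn
begin

lemma twist_qinv: "u \<in> qinv \<Longrightarrow> twist r u \<in> qinv"
proof -
  assume u: "u \<in> qinv"
  have "tact h (twist r u) = twist r u" if "h \<in> G" for h
    using twist_tsub[OF G_cases(3)[OF that], of r "gcoef n h" u] u that by (simp add: qinv_def qact_def)
  then show ?thesis using u by (simp add: qinv_def twist_on)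
qed

lemma twist_inverse [simp]: "twist q (twist (inverse q) u) = u" "twist (inverse q) (twist q u) = u"
  using q0 by (auto intro: twist_twist)

text \<open>A combination \<open>\<Sum> f\<^sub>b b\<close> of invariants with coefficients from \<open>P\<close> that is itself invariant equals its average
  \<open>\<Sum> R(f\<^sub>b) b\<close>. Hence generators over \<open>P\<close> that lie in \<open>N\<close> are generators over \<open>\<Gamma>\<close>.\<close>

lemma qinv_noetherian:
  assumes F: "finite F" and N: "N \<subseteq> qinv" "\<And>u. u \<in> N \<Longrightarrow> supp u \<subseteq> F"
  obtains B where "finite B" "B \<subseteq> N" "N \<subseteq> gspan \<Gamma>0 B"
proof -
  obtain B where B: "finite B" "B \<subseteq> N" "N \<subseteq> gspan (mon 0 ` mpoly_on {..<n}) B"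
    by (rule polynomial_vectors_noetherian[OF F, of N n]) (use N in \<open>auto simp: qinv_def\<close>)
  have rey: "reynolds u \<in> gspan \<Gamma>0 B" if "u \<in> gspan (mon 0 ` mpoly_on {..<n}) B" for u
    using that
  proof induction
    case gspan_zero
    have "reynolds 0 = 0" using reynolds_add[of 0 0] by simp
    then show ?case by (simp add: gspan.gspan_zero)
  next
    case (gspan_step s b u)
    then obtain f where f: "f \<in> mpoly_on {..<n}" "s = mon 0 f" by blast
    have "reynolds (s * b) = mon 0 (preynolds f) * b"
      unfolding f(2) by (rule reynolds_poly_mult) (use gspan_step B N in auto)
    then show ?case
      using gspan_step preynolds_closed[OF f(1)] by (auto simp: reynolds_add intro!: gspan.gspan_step)
  qed
  have "u \<in> gspan \<Gamma>0 B" if "u \<in> N" for u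
    using rey[OF subsetD[OF B(3) that]] reynolds_id[OF subsetD[OF N(1) that]] by (simp only:)
  then have "N \<subseteq> gspan \<Gamma>0 B" by blast
  then show ?thesis using that B by blast
qed

end

section \<open>Subfields of a field type as rings\<close>

definition subfield_set :: "'f::field set \<Rightarrow> bool" where
  "subfield_set S \<longleftrightarrow> subring_set S \<and> (\<forall>a\<in>S. inverse a \<in> S)"

definition ring_of :: "'f::field set \<Rightarrow> 'f ring" where
  "ring_of S = \<lparr>carrier = S, monoid.mult = (*), monoid.one = 1, ring.zero = 0, ring.add = (+)\<rparr>"

lemma ring_of_simps [simp]:
  "carrier (ring_of S) = S" "a \<otimes>\<^bsub>ring_of S\<^esub> b = a * b" "\<one>\<^bsub>ring_of S\<^esub> = 1" "\<zero>\<^bsub>ring_of S\<^esub> = 0"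
  "a \<oplus>\<^bsub>ring_of S\<^esub> b = a + b"
  by (simp_all add: ring_of_def)

lemma field_ring_of:
  assumes S: "subfield_set S" shows "Ring.field (ring_of S)"
proof -
  have sub: "subring_set S" and inv: "\<And>a. a \<in> S \<Longrightarrow> inverse a \<in> S" using S by (auto simp: subfield_set_def)
  note D = subring_setD[OF sub]
  have "cring (ring_of S)"
  proof (intro cringI abelian_groupI comm_monoidI)
    fix x assume "x \<in> carrier (ring_of S)"
    then show "\<exists>y\<in>carrier (ring_of S). y \<oplus>\<^bsub>ring_of S\<^esub> x = \<zero>\<^bsub>ring_of S\<^esub>"
      using D(5) by (auto intro!: bexI[of _ "- x"])
  qed (use D in \<open>auto simp: algebra_simps\<close>)
  then show ?thesis
  proof (rule cring.cring_fieldI)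
    show "Units (ring_of S) = carrier (ring_of S) - {\<zero>\<^bsub>ring_of S\<^esub>}"
    proof (intro subset_antisym subsetI)
      fix x assume "x \<in> carrier (ring_of S) - {\<zero>\<^bsub>ring_of S\<^esub>}"
      then have x: "x \<in> S" "x \<noteq> 0" by auto
      then show "x \<in> Units (ring_of S)"
        unfolding Units_def using inv[OF x(1)] by (auto intro!: bexI[of _ "inverse x"])
    qed (auto simp: Units_def)
  qed
qed

lemma ring_of_inv:
  assumes "subfield_set S" "x \<in> S" "x \<noteq> 0" shows "inv\<^bsub>ring_of S\<^esub> x = inverse x"
proof -
  interpret Ring.field "ring_of S" by (rule field_ring_of[OF assms(1)])
  show ?thesis
    by (rule comm_inv_char) (use assms in \<open>auto simp: subfield_set_def\<close>)
qed

lemma ring_of_minus: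
  assumes "subfield_set S" "x \<in> S" shows "\<ominus>\<^bsub>ring_of S\<^esub> x = - x"
proof -
  interpret Ring.field "ring_of S" by (rule field_ring_of[OF assms(1)])
  show ?thesis
    by (rule minus_equality) (use assms subring_setD(5)[of S x] in \<open>auto simp: subfield_set_def\<close>)
qed

lemma subring_ring_of:
  assumes S: "subfield_set S" and T: "subring_set T" "T \<subseteq> S" shows "subring T (ring_of S)"
proof -
  interpret Ring.field "ring_of S" by (rule field_ring_of[OF S])
  show ?thesis
    by (rule subringI) (use T subring_setD[OF T(1)] ring_of_minus[OF S] in auto)
qed

lemma subdomain_ring_of:
  assumes S: "subfield_set S" and T: "subring_set T" "T \<subseteq> S" shows "subdomain T (ring_of S)"
proof -
  interpret Ring.field "ring_of S" by (rule field_ring_of[OF S])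
  show ?thesis by (rule subdomainI'[OF subring_ring_of[OF assms]])
qed

lemma subfield_ring_of:
  assumes S: "subfield_set S" and T: "subfield_set T" "T \<subseteq> S" shows "subfield T (ring_of S)"
proof -
  interpret Ring.field "ring_of S" by (rule field_ring_of[OF S])
  show ?thesis
    by (rule subfieldI'[OF subring_ring_of[OF S _ T(2)]])
      (use T in \<open>auto simp: subfield_set_def ring_of_inv[OF S]\<close>)
qed

section \<open>Rational functions\<close>

definition emb :: "'a::idom \<Rightarrow> 'a fract" where "emb a = Fraction_Field.Fract a 1"

lemma emb_simps:
  "emb (a + b) = emb a + emb b" "emb (a * b) = emb a * emb b" "emb (- a) = - emb a" "emb 0 = 0" "emb 1 = 1"
  "emb a = emb b \<longleftrightarrow> a = b"
  by (simp_all add: emb_def Zero_fract_def One_fract_def eq_fract)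

lemma emb_power: "emb (a ^ k) = emb a ^ k"
  by (induction k) (simp_all add: emb_simps)

lemma emb_sum: "emb (sum f I) = (\<Sum>i\<in>I. emb (f i))"
  by (induction I rule: infinite_finite_induct) (simp_all add: emb_simps)

lemma emb_prod: "emb (prod f I) = (\<Prod>i\<in>I. emb (f i))"
  by (induction I rule: infinite_finite_induct) (simp_all add: emb_simps)

definition fract_map :: "('a::idom \<Rightarrow> 'b::idom) \<Rightarrow> 'a fract \<Rightarrow> 'b fract" where
  "fract_map \<phi> x = (SOME y. \<exists>a b. b \<noteq> 0 \<and> x = Fraction_Field.Fract a b \<and> y = Fraction_Field.Fract (\<phi> a) (\<phi> b))"

locale inj_ring_hom =
  fixes \<phi> :: "'a::idom \<Rightarrow> 'b::idom"
  assumes add: "\<phi> (x + y) = \<phi> x + \<phi> y" and mult: "\<phi> (x * y) = \<phi> x * \<phi> y" and one: "\<phi> 1 = 1"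
    and nonzero: "x \<noteq> 0 \<Longrightarrow> \<phi> x \<noteq> 0"
begin

lemma zero: "\<phi> 0 = 0"
proof -
  have "\<phi> 0 = \<phi> 0 + \<phi> 0" using add[of 0 0] by (simp only: add_0)
  then show ?thesis by (simp only: add_cancel_right_right)
qed

lemma fract_map_Fract: "b \<noteq> 0 \<Longrightarrow> fract_map \<phi> (Fraction_Field.Fract a b) = Fraction_Field.Fract (\<phi> a) (\<phi> b)"
  unfolding fract_map_def
proof (rule some_equality)
  fix y assume b: "b \<noteq> 0" and "\<exists>a' b'. b' \<noteq> 0 \<and> Fraction_Field.Fract a b = Fraction_Field.Fract a' b' \<and> y = Fraction_Field.Fract (\<phi> a') (\<phi> b')"
  then obtain a' b' where y: "b' \<noteq> 0" "Fraction_Field.Fract a b = Fraction_Field.Fract a' b'"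
    "y = Fraction_Field.Fract (\<phi> a') (\<phi> b')" by blast
  then have "\<phi> (a * b') = \<phi> (a' * b)" using b by (simp add: eq_fract)
  then show "y = Fraction_Field.Fract (\<phi> a) (\<phi> b)" using y b by (simp add: eq_fract mult nonzero)
qed blast

lemma fract_map_emb: "fract_map \<phi> (emb a) = emb (\<phi> a)"
  using fract_map_Fract[of 1 a] by (simp add: one emb_def)

lemma fract_map_add: "fract_map \<phi> (x + y) = fract_map \<phi> x + fract_map \<phi> y"
  by (cases x; cases y) (simp add: fract_map_Fract nonzero add mult)

lemma fract_map_mult: "fract_map \<phi> (x * y) = fract_map \<phi> x * fract_map \<phi> y"
  by (cases x; cases y) (simp add: fract_map_Fract nonzero mult)

lemma fract_map_one: "fract_map \<phi> 1 = 1" and fract_map_zero: "fract_map \<phi> 0 = 0"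
  using fract_map_emb[of 1] fract_map_emb[of 0] by (simp_all add: one zero emb_simps)

lemma fract_map_inverse: "fract_map \<phi> (inverse x) = inverse (fract_map \<phi> x)"
proof (cases "x = 0")
  case False
  then have "fract_map \<phi> x * fract_map \<phi> (inverse x) = 1" by (simp add: fract_map_mult[symmetric] fract_map_one)
  then show ?thesis by (simp add: inverse_unique)
qed (simp add: fract_map_zero)

end

definition rat_on :: "nat set \<Rightarrow> 'k::field mpoly fract set" where
  "rat_on A = {Fraction_Field.Fract a b | a b. a \<in> mpoly_on A \<and> b \<in> mpoly_on A \<and> b \<noteq> 0}"

lemma rat_onI: "a \<in> mpoly_on A \<Longrightarrow> b \<in> mpoly_on A \<Longrightarrow> b \<noteq> 0 \<Longrightarrow> Fraction_Field.Fract a b \<in> rat_on A"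
  unfolding rat_on_def by blast

lemma emb_rat_on: "a \<in> mpoly_on A \<Longrightarrow> emb a \<in> rat_on A"
  unfolding emb_def by (rule rat_onI) auto

lemma subfield_rat_on: "subfield_set (rat_on A :: 'k::field mpoly fract set)"
  unfolding subfield_set_def subring_set_def
proof (intro conjI ballI)
  fix x y :: "'k mpoly fract" assume "x \<in> rat_on A" "y \<in> rat_on A"
  then obtain a b c d where *: "x = Fraction_Field.Fract a b" "y = Fraction_Field.Fract c d" "b \<noteq> 0" "d \<noteq> 0"
    "a \<in> mpoly_on A" "b \<in> mpoly_on A" "c \<in> mpoly_on A" "d \<in> mpoly_on A"
    unfolding rat_on_def by blast
  show "x + y \<in> rat_on A" "x * y \<in> rat_on A" "- x \<in> rat_on A"
    using * by (auto intro!: rat_onI mpoly_on_add mpoly_on_mult mpoly_on_minus)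
  show "inverse x \<in> rat_on A"
  proof (cases "a = 0")
    case True
    then have "x = 0" using *(1,3) by (simp add: fract_collapse)
    then show ?thesis using emb_rat_on[of 0 A] by (simp add: emb_simps)
  qed (use * in \<open>auto intro!: rat_onI\<close>)
qed (use emb_rat_on[of 0 A] emb_rat_on[of 1 A] in \<open>auto simp: emb_simps\<close>)

lemma inj_ring_hom_msub: "bij \<pi> \<Longrightarrow> (\<And>i. c i \<noteq> 0) \<Longrightarrow> inj_ring_hom (msub c \<pi> :: 'k::field mpoly \<Rightarrow> _)"
  by unfold_locales (auto simp: msub_add msub_mult dest: inj_msub[THEN iffD1, of \<pi> c _ 0])

definition rsub :: "(nat \<Rightarrow> 'k) \<Rightarrow> (nat \<Rightarrow> nat) \<Rightarrow> 'k::field mpoly fract \<Rightarrow> 'k mpoly fract" where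
  "rsub c \<pi> = fract_map (msub c \<pi>)"

text \<open>The substitutions that restrict to automorphisms of the field of rational functions in the variables
  below \<open>n\<close>.\<close>

definition subst_pair :: "nat \<Rightarrow> (nat \<Rightarrow> 'k::field) \<Rightarrow> (nat \<Rightarrow> nat) \<Rightarrow> bool" where
  "subst_pair n c \<pi> \<longleftrightarrow> \<pi> permutes {..<n} \<and> (\<forall>i. c i \<noteq> 0)"

lemma subst_pair_hom: "subst_pair n c \<pi> \<Longrightarrow> inj_ring_hom (msub c \<pi>)"
  by (rule inj_ring_hom_msub) (auto simp: subst_pair_def permutes_bij)

lemma rsub_simps:
  assumes "subst_pair n c \<pi>"
  shows "rsub c \<pi> (emb f) = emb (msub c \<pi> f)" "rsub c \<pi> (x + y) = rsub c \<pi> x + rsub c \<pi> y"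
    "rsub c \<pi> (x * y) = rsub c \<pi> x * rsub c \<pi> y" "rsub c \<pi> 1 = 1" "rsub c \<pi> 0 = 0"
    "rsub c \<pi> (inverse x) = inverse (rsub c \<pi> x)"
proof -
  interpret inj_ring_hom "msub c \<pi>" by (rule subst_pair_hom[OF assms])
  show "rsub c \<pi> (emb f) = emb (msub c \<pi> f)" "rsub c \<pi> (x + y) = rsub c \<pi> x + rsub c \<pi> y"
    "rsub c \<pi> (x * y) = rsub c \<pi> x * rsub c \<pi> y" "rsub c \<pi> 1 = 1" "rsub c \<pi> 0 = 0"
    "rsub c \<pi> (inverse x) = inverse (rsub c \<pi> x)"
    unfolding rsub_def by (fact fract_map_emb fract_map_add fract_map_mult fract_map_one fract_map_zero fract_map_inverse)+
qed

lemma rsub_Fract: "subst_pair n c \<pi> \<Longrightarrow> b \<noteq> 0 \<Longrightarrow>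
    rsub c \<pi> (Fraction_Field.Fract a b) = Fraction_Field.Fract (msub c \<pi> a) (msub c \<pi> b)"
  unfolding rsub_def by (rule inj_ring_hom.fract_map_Fract[OF subst_pair_hom])

lemma rsub_comp:
  assumes "subst_pair n c \<pi>" "subst_pair n d \<rho>"
  shows "rsub d \<rho> (rsub c \<pi> x) = rsub (\<lambda>i. c i * d (\<pi> i)) (\<rho> \<circ> \<pi>) x"
    "subst_pair n (\<lambda>i. c i * d (\<pi> i)) (\<rho> \<circ> \<pi>)"
proof -
  show s: "subst_pair n (\<lambda>i. c i * d (\<pi> i)) (\<rho> \<circ> \<pi>)"
    using assms by (auto simp: subst_pair_def intro: permutes_compose)
  obtain a b where x: "x = Fraction_Field.Fract a b" "b \<noteq> 0" by (cases x) auto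
  have "msub c \<pi> b \<noteq> 0" using x(2) subst_pair_hom[OF assms(1)] by (rule inj_ring_hom.nonzero[rotated])
  moreover have "bij \<pi>" "bij \<rho>" using assms by (auto simp: subst_pair_def permutes_bij)
  ultimately show "rsub d \<rho> (rsub c \<pi> x) = rsub (\<lambda>i. c i * d (\<pi> i)) (\<rho> \<circ> \<pi>) x"
    unfolding x(1) using x(2) by (simp add: rsub_Fract[OF assms(1)] rsub_Fract[OF assms(2)] rsub_Fract[OF s] msub_comp)
qed

lemma rsub_id: "rsub (\<lambda>_. 1) id x = x"
proof -
  obtain a b where x: "x = Fraction_Field.Fract a b" "b \<noteq> 0" by (cases x) auto
  have "subst_pair 0 (\<lambda>_. 1 :: 'a) id" by (simp add: subst_pair_def permutes_id)
  then show ?thesis using x by (simp add: rsub_Fract)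
qed

lemma rsub_closed:
  assumes "subst_pair n c \<pi>" "x \<in> rat_on {..<n}" shows "rsub c \<pi> x \<in> rat_on {..<n}"
proof -
  obtain a b where x: "x = Fraction_Field.Fract a b" "b \<noteq> 0" "a \<in> mpoly_on {..<n}" "b \<in> mpoly_on {..<n}"
    using assms(2) unfolding rat_on_def by blast
  have "\<pi> ` {..<n} \<subseteq> {..<n}" "bij \<pi>"
    using assms(1) by (auto simp: subst_pair_def permutes_image permutes_bij permutes_in_image)
  moreover have "msub c \<pi> b \<noteq> 0" using x(2) by (rule inj_ring_hom.nonzero[OF subst_pair_hom[OF assms(1)]])
  ultimately show ?thesis using x rsub_Fract[OF assms(1) x(2), of a]
    by (simp add: rat_onI mpoly_on_msub)
qed

text \<open>Restricted to an extensional function, as the elements of \<open>BijGroup\<close> are.\<close>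

definition raut :: "nat \<Rightarrow> (nat \<Rightarrow> 'k) \<Rightarrow> (nat \<Rightarrow> nat) \<Rightarrow> 'k::field mpoly fract \<Rightarrow> 'k mpoly fract" where
  "raut n c \<pi> = restrict (rsub c \<pi>) (rat_on {..<n})"

lemma subst_pair_inverse:
  assumes "subst_pair n c \<pi>"
  shows "\<exists>d \<rho>. subst_pair n d \<rho> \<and> (\<forall>x. rsub d \<rho> (rsub c \<pi> x) = x) \<and> (\<forall>x. rsub c \<pi> (rsub d \<rho> x) = x)"
proof -
  let ?\<rho> = "inv_into UNIV \<pi>" and ?d = "\<lambda>i. inverse (c (inv_into UNIV \<pi> i))"
  have p: "\<pi> permutes {..<n}" "\<And>i. c i \<noteq> 0" using assms by (auto simp: subst_pair_def)
  have s: "subst_pair n ?d ?\<rho>" using p by (simp add: subst_pair_def permutes_inv)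
  have "rsub ?d ?\<rho> (rsub c \<pi> x) = x" "rsub c \<pi> (rsub ?d ?\<rho> x) = x" for x
    unfolding rsub_comp(1)[OF assms s] rsub_comp(1)[OF s assms]
    using p rsub_id[of x] by (simp_all add: permutes_inverses permutes_inv_o)
  with s show ?thesis by blast
qed

lemma raut_Bij: "subst_pair n c \<pi> \<Longrightarrow> raut n c \<pi> \<in> Bij (rat_on {..<n})"
proof -
  assume s: "subst_pair n c \<pi>"
  from subst_pair_inverse[OF s] obtain d \<rho>
    where "subst_pair n d \<rho> \<and> (\<forall>x. rsub d \<rho> (rsub c \<pi> x) = x) \<and> (\<forall>x. rsub c \<pi> (rsub d \<rho> x) = x)" by (elim exE)
  then have d: "subst_pair n d \<rho>" "\<And>x. rsub d \<rho> (rsub c \<pi> x) = x" "\<And>x. rsub c \<pi> (rsub d \<rho> x) = x" by simp_all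
  have "bij_betw (rsub c \<pi>) (rat_on {..<n}) (rat_on {..<n})"
    by (rule bij_betw_byWitness[where f' = "rsub d \<rho>"]) (auto simp: d(2,3) rsub_closed[OF s] rsub_closed[OF d(1)])
  then show ?thesis unfolding raut_def Bij_def by (simp add: bij_betw_restrict_eq)
qed

lemma raut_apply: "x \<in> rat_on {..<n} \<Longrightarrow> raut n c \<pi> x = rsub c \<pi> x"
  by (simp add: raut_def)

lemma raut_comp:
  assumes "subst_pair n c \<pi>" "subst_pair n d \<rho>"
  shows "raut n d \<rho> \<otimes>\<^bsub>BijGroup (rat_on {..<n})\<^esub> raut n c \<pi> = raut n (\<lambda>i. c i * d (\<pi> i)) (\<rho> \<circ> \<pi>)"
  using raut_Bij[OF assms(1)] raut_Bij[OF assms(2)] rsub_comp[OF assms] rsub_closed[OF assms(1)]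
  by (auto simp: BijGroup_def compose_def raut_def fun_eq_iff)

lemma raut_id: "\<one>\<^bsub>BijGroup (rat_on {..<n})\<^esub> = raut n (\<lambda>_. 1) id"
  by (auto simp: BijGroup_def raut_def rsub_id fun_eq_iff restrict_def)

lemma raut_hom: "subst_pair n c \<pi> \<Longrightarrow> raut n c \<pi> \<in> ring_hom (ring_of (rat_on {..<n})) (ring_of (rat_on {..<n}))"
  using subfield_rat_on[of "{..<n}"]
  by (intro ring_hom_memI)
    (auto simp: raut_apply rsub_simps rsub_closed subfield_set_def subring_set_def)

context gmpn
begin

section \<open>The Galois extension\<close>

abbreviation "LC \<equiv> rat_on {..<n} :: 'k mpoly fract set"
abbreviation "L \<equiv> ring_of LC"
abbreviation "ract h \<equiv> rsub (gcoef n h) (snd h) :: 'k mpoly fract \<Rightarrow> 'k mpoly fract"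
abbreviation "gaut h \<equiv> raut n (gcoef n h) (snd h) :: 'k mpoly fract \<Rightarrow> 'k mpoly fract"
abbreviation "\<Gamma>L \<equiv> emb ` pinv :: 'k mpoly fract set"
abbreviation "K \<equiv> fraction_subfield L \<Gamma>L"

lemma subfield_LC: "subfield_set LC" by (rule subfield_rat_on)
lemma subring_LC: "subring_set LC" using subfield_LC by (simp add: subfield_set_def)
lemmas LCD = subring_setD[OF subring_LC]
lemma LC_inverse: "x \<in> LC \<Longrightarrow> inverse x \<in> LC" using subfield_LC by (simp add: subfield_set_def)

lemma G_subst: "h \<in> G \<Longrightarrow> subst_pair n (gcoef n h) (snd h)"
  using G_cases by (auto simp: subst_pair_def)

lemma ract_simps:
  assumes "h \<in> G"
  shows "ract h (emb f) = emb (pact h f)" "ract h (x + y) = ract h x + ract h y" "ract h (x * y) = ract h x * ract h y"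
    "ract h 1 = 1" "ract h 0 = 0" "ract h (inverse x) = inverse (ract h x)"
  using rsub_simps[OF G_subst[OF assms]] by (simp_all add: poly_act_def)

lemma ract_minus: "h \<in> G \<Longrightarrow> ract h (- x) = - ract h x"
  by (rule additive.minus) (simp add: additive_def ract_simps)

lemma emb_nonzero: "emb f = 0 \<longleftrightarrow> f = (0 :: 'k mpoly)"
  using emb_simps(6)[of f 0] by (simp add: emb_simps(4))

lemma pinv_on: "f \<in> pinv \<Longrightarrow> f \<in> mpoly_on {..<n}"
  by (simp add: pinv_def)

lemma \<Gamma>_LC: "\<Gamma>L \<subseteq> LC"
  by (auto intro: emb_rat_on pinv_on)

lemma subring_\<Gamma>: "subring_set \<Gamma>L"
  unfolding subring_set_def
proof (intro conjI ballI)
  fix a b assume "a \<in> \<Gamma>L" "b \<in> \<Gamma>L"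
  then obtain f g where fg: "f \<in> pinv" "g \<in> pinv" "a = emb f" "b = emb g" by blast
  note D = subring_setD[OF subring_pinv]
  show "a + b \<in> \<Gamma>L" unfolding fg by (intro image_eqI[of _ _ "f + g"]) (auto simp: emb_simps D fg)
  show "a * b \<in> \<Gamma>L" unfolding fg by (intro image_eqI[of _ _ "f * g"]) (auto simp: emb_simps D fg)
  show "- a \<in> \<Gamma>L" unfolding fg by (intro image_eqI[of _ _ "- f"]) (auto simp: emb_simps D fg)
next
  show "0 \<in> \<Gamma>L" using imageI[OF subring_setD(1)[OF subring_pinv], of emb] by (simp only: emb_simps)
  show "1 \<in> \<Gamma>L" using imageI[OF subring_setD(2)[OF subring_pinv], of emb] by (simp only: emb_simps)
qed

text \<open>Multiplying by the conjugates makes a denominator invariant.\<close>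

lemma invariant_multiple:
  assumes b: "b \<in> mpoly_on {..<n}" "b \<noteq> 0"
  obtains r where "r \<in> mpoly_on {..<n}" "b * r \<in> pinv" "b * r \<noteq> 0"
proof -
  let ?N = "\<Prod>h\<in>G. pact h b" and ?r = "\<Prod>h\<in>G - {gone}. pact h b"
  have N: "?N = b * ?r" using prod.remove[OF finite_G gone_closed, of "\<lambda>h. pact h b"] by simp
  have "pact k ?N = ?N" if "k \<in> G" for k
  proof -
    have "pact k ?N = (\<Prod>h\<in>G. pact (gmul n k h) b)"
      using that by (auto simp: pact_simps pact_comp intro!: prod.cong)
    also have "\<dots> = ?N" by (rule prod.reindex_bij_betw[OF gmul_bij[OF that]])
    finally show ?thesis .
  qed
  moreover have "?N \<in> mpoly_on {..<n}" "?r \<in> mpoly_on {..<n}"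
    by (auto intro!: mpoly_on_prod pact_on b)
  moreover have "pact h b \<noteq> 0" if "h \<in> G" for h
    using inj_ring_hom.nonzero[OF subst_pair_hom[OF G_subst[OF that]] b(2)] by (simp add: poly_act_def)
  then have "?N \<noteq> 0" by simp
  ultimately show ?thesis using that[of ?r] N by (simp add: pinv_def)
qed

lemma invariant_denominator:
  assumes "x \<in> LC"
  obtains a d where "a \<in> mpoly_on {..<n}" "d \<in> pinv" "d \<noteq> 0" "x * emb d = emb a"
proof -
  obtain a b where x: "x = Fraction_Field.Fract a b" "b \<noteq> 0" "a \<in> mpoly_on {..<n}" "b \<in> mpoly_on {..<n}"
    using assms unfolding rat_on_def by blast
  obtain r where r: "r \<in> mpoly_on {..<n}" "b * r \<in> pinv" "b * r \<noteq> 0"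
    by (rule invariant_multiple[OF x(4,2)])
  have "x * emb (b * r) = emb (a * r)" using x(2) by (simp add: x(1) emb_def eq_fract)
  then show ?thesis using that[of "a * r" "b * r"] r x by (simp add: mpoly_on_mult)
qed

lemma K_frac: "K = {emb a * inverse (emb d) | a d. a \<in> pinv \<and> d \<in> pinv \<and> d \<noteq> 0}"
proof -
  have "inv\<^bsub>L\<^esub> (emb d) = inverse (emb d)" if "d \<in> pinv" "d \<noteq> 0" for d
    using that by (intro ring_of_inv subfield_LC) (auto simp: emb_nonzero intro: emb_rat_on pinv_on)
  note inv = this
  show ?thesis
  proof (intro subset_antisym subsetI)
    fix x assume "x \<in> K"
    then obtain a d where *: "a \<in> pinv" "d \<in> pinv" "emb d \<noteq> 0" "x = emb a \<otimes>\<^bsub>L\<^esub> inv\<^bsub>L\<^esub> (emb d)"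
      unfolding fraction_subfield_def by auto
    then have d: "d \<noteq> 0" by (simp only: emb_nonzero not_False_eq_True)
    have "x = emb a * inverse (emb d)" unfolding *(4) inv[OF *(2) d] by simp
    then show "x \<in> {emb a * inverse (emb d) | a d. a \<in> pinv \<and> d \<in> pinv \<and> d \<noteq> 0}" using * d by blast
  next
    fix x assume "x \<in> {emb a * inverse (emb d) | a d. a \<in> pinv \<and> d \<in> pinv \<and> d \<noteq> 0}"
    then obtain a d where *: "a \<in> pinv" "d \<in> pinv" "d \<noteq> 0" "x = emb a * inverse (emb d)" by blast
    have "x = emb a \<otimes>\<^bsub>L\<^esub> inv\<^bsub>L\<^esub> (emb d)" unfolding inv[OF *(2,3)] by (simp only: *(4) ring_of_simps)
    moreover have "emb d \<in> \<Gamma>L - {\<zero>\<^bsub>L\<^esub>}" using *(2,3) by (simp only: ring_of_simps Diff_iff singleton_iff emb_nonzero) blast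
    ultimately show "x \<in> K" unfolding fraction_subfield_def using *(1) by blast
  qed
qed

text \<open>An invariant fraction has an invariant denominator, so its numerator is invariant too.\<close>

lemma K_fixed: "K = {x \<in> LC. \<forall>h\<in>G. ract h x = x}"
proof (intro subset_antisym subsetI)
  fix x assume "x \<in> K"
  then obtain a d where x: "x = emb a * inverse (emb d)" "a \<in> pinv" "d \<in> pinv" unfolding K_frac by blast
  have "ract h x = x" if "h \<in> G" for h
    using x that by (simp add: ract_simps[OF that] pinv_def)
  moreover have "x \<in> LC" using x by (auto intro!: LCD LC_inverse emb_rat_on pinv_on)
  ultimately show "x \<in> {x \<in> LC. \<forall>h\<in>G. ract h x = x}" by blast
next
  fix x assume x: "x \<in> {x \<in> LC. \<forall>h\<in>G. ract h x = x}"
  then obtain a d where ad: "a \<in> mpoly_on {..<n}" "d \<in> pinv" "d \<noteq> 0" "x * emb d = emb a"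
    using invariant_denominator[of x] by blast
  have "pact h a = a" if "h \<in> G" for h
  proof -
    have "ract h x = x" "pact h d = d" using x ad(2) that by (auto simp: pinv_def)
    then have "ract h (emb a) = emb a" using ract_simps(1,3)[OF that] by (simp only: ad(4)[symmetric])
    then have "emb (pact h a) = emb a" by (simp only: ract_simps(1)[OF that])
    then show ?thesis by (simp only: emb_simps(6))
  qed
  then have "a \<in> pinv" using ad(1) by (simp add: pinv_def)
  moreover have "x = emb a * inverse (emb d)" using ad(3) emb_nonzero by (simp add: ad(4)[symmetric])
  ultimately show "x \<in> K" unfolding K_frac using ad by blast
qed

lemma K_LC: "K \<subseteq> LC" by (auto simp: K_fixed)

lemma subfield_K: "subfield_set K"
  unfolding subfield_set_def subring_set_def K_fixed
  by (intro conjI ballI CollectI; (elim CollectE conjE)?)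
    (simp_all add: ract_simps LCD LC_inverse ract_minus)

lemma \<Gamma>_K: "\<Gamma>L \<subseteq> K"
proof
  fix x assume "x \<in> \<Gamma>L"
  then obtain f where f: "f \<in> pinv" "x = emb f" by blast
  then have "ract h x = x" if "h \<in> G" for h using that by (simp add: ract_simps pinv_def)
  then show "x \<in> K" unfolding K_fixed using f by (simp add: emb_rat_on pinv_on)
qed

subsection \<open>The Galois group\<close>

lemma gaut_field_aut: assumes "h \<in> G" shows "gaut h \<in> field_auts L K"
  using raut_Bij[OF G_subst[OF assms]] raut_hom[OF G_subst[OF assms]] assms
  unfolding field_auts_def by (simp add: K_fixed raut_apply)

text \<open>The constants already provide \<open>m\<close> roots of \<open>X\<^sup>m - 1\<close>, and a field has no more.\<close>

lemma roots_unity_L: "{z :: 'k mpoly fract. z ^ m = 1} = (\<lambda>c. emb (mon 0 c)) ` {c. c ^ m = 1}"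
proof -
  let ?e = "\<lambda>c :: 'k. emb (mon 0 c) :: 'k mpoly fract"
  have pow: "?e c ^ k = ?e (c ^ k)" for c k
  proof -
    have "mon (0::exps) c ^ k = mon 0 (c ^ k)" by (induction k) (simp_all add: mult_single)
    then show ?thesis by (simp flip: emb_power)
  qed
  have inj: "inj_on ?e S" for S by (rule inj_onI) (simp add: emb_simps mon_eq_iff)
  have sub: "?e ` {c. c ^ m = 1} \<subseteq> {z. z ^ m = 1}" by (auto simp: pow emb_simps)
  have fin: "finite {z :: 'k mpoly fract. z ^ m = 1}" by (rule finite_roots[OF m1])
  have "card {z :: 'k mpoly fract. z ^ m = 1} \<le> m"
  proof -
    let ?P = "Polynomial.monom 1 m - 1 :: 'k mpoly fract poly"
    have "Polynomial.degree (1 :: 'k mpoly fract poly) < Polynomial.degree (Polynomial.monom 1 m :: 'k mpoly fract poly)"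
      using m1 by (simp add: Polynomial.degree_monom_eq)
    from Polynomial.degree_add_eq_left[of "- 1", unfolded degree_minus, OF this]
    have deg: "Polynomial.degree ?P = m" by (simp add: Polynomial.degree_monom_eq)
    then have "?P \<noteq> 0" using m1 by auto
    from card_poly_roots_bound[OF this] show ?thesis by (simp add: deg Polynomial.poly_monom)
  qed
  also have "m = card (?e ` {c. c ^ m = 1})"
    using card_roots_unity[OF m1, where 'k = 'k] by (simp add: card_image[OF inj])
  finally show ?thesis by (intro card_seteq[symmetric] sub fin)
qed

text \<open>The polynomial with the roots \<open>x\<^sub>i\<^sup>m\<close> has coefficients in \<open>K\<close>, so an automorphism \<open>\<sigma>\<close> over \<open>K\<close> permutes these
  roots by some \<open>\<pi>\<close>. Then \<open>\<sigma>(x\<^sub>i)\<close> and \<open>x\<^bsub>\<pi>(i)\<^esub>\<close> have the same \<open>m\<close>-th power and differ by a root of unity \<open>c\<^sub>i\<close>.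
  As \<open>\<sigma>\<close> fixes \<open>wv\<close>, the \<open>c\<^sub>i\<close> satisfy the equation defining \<open>A\<close>.\<close>

lemma field_auts_K: "field_auts L K = gaut ` G"
proof (intro subset_antisym subsetI)
  fix \<sigma> assume \<sigma>: "\<sigma> \<in> field_auts L K"
  then have bij: "bij_betw \<sigma> LC LC" and ext: "\<sigma> \<in> extensional LC" and hom: "\<sigma> \<in> ring_hom L L" and \<sigma>_K: "\<And>x. x \<in> K \<Longrightarrow> \<sigma> x = x"
    by (auto simp: field_auts_def Bij_def)
  have \<sigma>_in: "\<sigma> x \<in> LC" if "x \<in> LC" for x using bij that by (auto simp: bij_betw_def)
  have \<sigma>_add: "\<sigma> (x + y) = \<sigma> x + \<sigma> y" and \<sigma>_mult: "\<sigma> (x * y) = \<sigma> x * \<sigma> y" if "x \<in> LC" "y \<in> LC" for x y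
    using ring_hom_add[OF hom, of x y] ring_hom_mult[OF hom, of x y] that by simp_all
  have \<sigma>1: "\<sigma> 1 = 1" using ring_hom_one[OF hom] by simp
  have "\<sigma> 0 = \<sigma> 0 + \<sigma> 0" using \<sigma>_add[OF LCD(1) LCD(1)] by (simp only: add_0)
  then have \<sigma>0: "\<sigma> 0 = 0" by (simp only: add_cancel_right_right)
  have \<sigma>_pow: "\<sigma> (x ^ k) = \<sigma> x ^ k" if "x \<in> LC" for x k
    using that by (induction k) (auto simp: \<sigma>1 \<sigma>_mult LCD)
  have \<sigma>_sum: "\<sigma> (sum f I) = (\<Sum>i\<in>I. \<sigma> (f i))" if "\<And>i. i \<in> I \<Longrightarrow> f i \<in> LC" for f and I :: "nat set"
    using that by (induction I rule: infinite_finite_induct) (auto simp: \<sigma>0 \<sigma>_add LCD)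
  have \<sigma>_prod: "\<sigma> (prod f I) = (\<Prod>i\<in>I. \<sigma> (f i))" if "\<And>i. i \<in> I \<Longrightarrow> f i \<in> LC" for f and I :: "nat set"
    using that by (induction I rule: infinite_finite_induct) (auto simp: \<sigma>1 \<sigma>_mult LCD)
  \<comment> \<open>the variables, and the polynomial whose roots are their \<open>m\<close>-th powers\<close>
  define x where "x i = (emb (mon (mon i 1) 1) :: 'k mpoly fract)" for i
  let ?z = "\<lambda>i. emb (zv i)" and ?P = "\<Prod>j<n. [:- zv j, 1:]"
  have xL: "x i \<in> LC" if "i < n" for i unfolding x_def using that by (intro emb_rat_on mpoly_on_mon exps_on_mon) auto
  have mon_pow: "mon (mon i 1) (1::'k) ^ k = mon (mon i k) 1" for i :: nat and k :: nat
    by (induction k) (auto simp: mult_single single_add[symmetric])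
  have z: "?z i = x i ^ m" for i unfolding x_def zv_def by (simp only: emb_power[symmetric] mon_pow)
  have zL: "?z i \<in> LC" if "i < n" for i by (intro emb_rat_on zv_on that)
  have coefK: "emb (Polynomial.coeff ?P k) \<in> K" for k using \<Gamma>_K coeff_zv_pinv by blast
  have coefE: "emb (Polynomial.coeff ?P k) = Polynomial.coeff (\<Prod>j<n. [:- ?z j, 1:]) k" for k
    by (rule hom_coeff_linear_factors) (simp_all add: emb_simps)
  have root: "\<exists>j<n. \<sigma> (?z i) = ?z j" if i: "i < n" for i
  proof -
    let ?Q = "\<Prod>j<n. [:- ?z j, 1:]"
    have poly: "poly ?Q y = (\<Sum>k\<le>Polynomial.degree ?Q. emb (Polynomial.coeff ?P k) * y ^ k)" for y
      unfolding poly_altdef coefE ..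
    have "poly ?Q (?z i) = 0" using i by (auto simp: poly_prod)
    then have "\<sigma> (\<Sum>k\<le>Polynomial.degree ?Q. emb (Polynomial.coeff ?P k) * ?z i ^ k) = 0"
      unfolding poly[symmetric] by (simp only: \<sigma>0)
    moreover have "\<sigma> (\<Sum>k\<le>Polynomial.degree ?Q. emb (Polynomial.coeff ?P k) * ?z i ^ k) =
        (\<Sum>k\<le>Polynomial.degree ?Q. \<sigma> (emb (Polynomial.coeff ?P k) * ?z i ^ k))"
      by (rule \<sigma>_sum) (intro LCD(4,6) zL i subsetD[OF K_LC coefK])
    moreover have "\<sigma> (emb (Polynomial.coeff ?P k) * ?z i ^ k) = emb (Polynomial.coeff ?P k) * \<sigma> (?z i) ^ k" for k
      by (simp only: \<sigma>_mult[OF subsetD[OF K_LC coefK] LCD(6)[OF zL[OF i]]] \<sigma>_K[OF coefK] \<sigma>_pow[OF zL[OF i]])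
    ultimately have "poly ?Q (\<sigma> (?z i)) = 0" unfolding poly by (simp only:)
    then show ?thesis by (auto simp: poly_prod)
  qed
  then obtain \<pi>0 where \<pi>0: "\<And>i. i < n \<Longrightarrow> \<pi>0 i < n \<and> \<sigma> (?z i) = ?z (\<pi>0 i)" by metis
  define \<pi> where "\<pi> i = (if i < n then \<pi>0 i else i)" for i
  have \<pi>: "\<pi> i < n" "\<sigma> (?z i) = ?z (\<pi> i)" if "i < n" for i using \<pi>0 that by (auto simp: \<pi>_def)
  have zv_inj: "i = j" if "zv i = zv j" for i j
  proof -
    have "supp (zv i) = supp (zv j)" using that by simp
    then have "mon i m = (mon j m :: exps)" by (simp add: zv_def)
    then have "supp (mon i m) = supp (mon j m)" by simp
    then show "i = j" using m1 by simp
  qed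
  have "inj_on \<pi> {..<n}"
  proof (rule inj_onI)
    fix i j assume ij: "i \<in> {..<n}" "j \<in> {..<n}" "\<pi> i = \<pi> j"
    then have "\<sigma> (?z i) = \<sigma> (?z j)" using \<pi>(2) by simp
    then have "?z i = ?z j" using bij zL ij by (auto simp: bij_betw_def dest!: inj_onD)
    then show "i = j" using zv_inj by (simp only: emb_simps(6))
  qed
  then have "bij_betw \<pi> {..<n} {..<n}"
    using \<pi>(1) endo_inj_surj[of "{..<n}" \<pi>] by (auto simp: bij_betw_def)
  then have perm: "\<pi> permutes {..<n}" by (rule bij_imp_permutes) (simp add: \<pi>_def)
  have "\<exists>c. c ^ m = 1 \<and> \<sigma> (x i) = emb (mon 0 c) * x (\<pi> i)" if i: "i < n" for i
  proof -
    have x0: "x (\<pi> i) \<noteq> 0" unfolding x_def emb_nonzero by (metis lookup_single_eq lookup_zero one_neq_zero)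
    have "\<sigma> (x i) ^ m = x (\<pi> i) ^ m" using \<pi>(2)[OF i] unfolding z \<sigma>_pow[OF xL[OF i], symmetric] .
    then have "(\<sigma> (x i) / x (\<pi> i)) ^ m = 1" using x0 by (simp add: power_divide)
    then have "\<sigma> (x i) / x (\<pi> i) \<in> (\<lambda>c. emb (mon 0 c)) ` {c. c ^ m = 1}" unfolding roots_unity_L[symmetric] by simp
    then obtain c where c: "c ^ m = 1" "\<sigma> (x i) / x (\<pi> i) = emb (mon 0 c)" by auto
    have "\<sigma> (x i) = (\<sigma> (x i) / x (\<pi> i)) * x (\<pi> i)" using x0 by simp
    then show ?thesis using c by metis
  qed
  then obtain c where c: "\<And>i. i < n \<Longrightarrow> c i ^ m = 1 \<and> \<sigma> (x i) = emb (mon 0 (c i)) * x (\<pi> i)" by metis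
  have wv: "emb wv = (\<Prod>i<n. x i ^ (m div p))"
    unfolding x_def emb_power[symmetric] emb_prod[symmetric] mon_pow
    by (simp add: wv_def prod_mon)
  have const_prod: "(\<Prod>i<k. mon (0::exps) (f i)) = mon 0 (\<Prod>i<k. f i :: 'k)" for f and k :: nat
    by (induction k) (auto simp: mult_single)
  have const_pow: "mon (0::exps) a ^ k = mon 0 (a ^ k :: 'k)" for a k
    by (induction k) (auto simp: mult_single)
  \<comment> \<open>compare both sides of \<open>\<sigma>(wv) = wv\<close> to obtain the condition on the product of the \<open>c\<^sub>i\<close>\<close>
  have "emb wv = \<sigma> (emb wv)" using \<sigma>_K[OF subsetD[OF \<Gamma>_K imageI[OF wv_pinv]]] by simp
  also have "\<dots> = (\<Prod>i<n. \<sigma> (x i) ^ (m div p))"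
    unfolding wv by (subst \<sigma>_prod) (auto intro!: prod.cong LCD(6) xL \<sigma>_pow)
  also have "\<dots> = (\<Prod>i<n. emb (mon 0 (c i)) ^ (m div p) * x (\<pi> i) ^ (m div p))"
    by (rule prod.cong) (simp_all add: c power_mult_distrib)
  also have "\<dots> = emb (mon 0 ((\<Prod>i<n. c i) ^ (m div p))) * (\<Prod>i<n. x (\<pi> i) ^ (m div p))"
    unfolding prod.distrib prod_power_distrib[symmetric]
    by (simp only: emb_prod[symmetric] emb_power[symmetric] const_prod const_pow)
  also have "(\<Prod>i<n. x (\<pi> i) ^ (m div p)) = emb wv"
    unfolding wv using prod.permute[OF perm, of "\<lambda>i. x i ^ (m div p)"] by (simp add: o_def)
  finally have "emb (mon 0 ((\<Prod>i<n. c i) ^ (m div p))) * emb wv = 1 * emb wv" by simp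
  moreover have "emb wv \<noteq> 0"
    unfolding emb_nonzero wv_def by (metis lookup_single_eq lookup_zero one_neq_zero)
  ultimately have "emb (mon (0::exps) ((\<Prod>i<n. c i) ^ (m div p))) = emb 1"
    by (simp only: mult_cancel_right emb_simps) simp
  then have "mon (0::exps) ((\<Prod>i<n. c i) ^ (m div p)) = mon 0 1" by (simp only: emb_simps(6) single_one)
  then have c_prod: "(\<Prod>i<n. c i) ^ (m div p) = 1" by (simp only: mon_eq_iff)
  let ?h = "(restrict c {..<n}, \<pi>)"
  have h: "?h \<in> G" using A_I[of c] c c_prod perm by (simp add: G_group_def)
  have on_poly: "\<sigma> (emb f) = emb (pact ?h f)" if "f \<in> mpoly_on {..<n}" for f
    using that
  proof (induction f rule: mpoly_on_induct)
    case (mon a y)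
    have eq: "mon a y = mon 0 y * (\<Prod>i<n. mon (mon i 1) 1 ^ coef a i)"
      unfolding mon_pow by (simp add: prod_mon sum_mon_exps[OF mon] mult_single)
    have E: "emb (mon a y) = emb (mon 0 y) * (\<Prod>i<n. x i ^ coef a i)"
      unfolding eq x_def emb_simps(2) emb_prod emb_power ..
    have y: "emb (mon 0 y) \<in> K" using \<Gamma>_K const_pinv by blast
    have "\<sigma> (emb (mon a y)) = emb (mon 0 y) * (\<Prod>i<n. \<sigma> (x i) ^ coef a i)"
    proof -
      have pw: "x i ^ coef a i \<in> LC" if "i \<in> {..<n}" for i using that by (intro LCD(6) xL) simp
      have "\<sigma> (\<Prod>i<n. x i ^ coef a i) = (\<Prod>i<n. \<sigma> (x i ^ coef a i))"
        by (rule \<sigma>_prod) (rule pw)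
      also have "\<dots> = (\<Prod>i<n. \<sigma> (x i) ^ coef a i)"
        by (rule prod.cong) (simp_all add: \<sigma>_pow xL)
      finally have P: "\<sigma> (\<Prod>i<n. x i ^ coef a i) = (\<Prod>i<n. \<sigma> (x i) ^ coef a i)" .
      have "(\<Prod>i<n. x i ^ coef a i) \<in> LC" by (rule LCD(8)) (rule pw)
      then show ?thesis
        unfolding E by (simp only: \<sigma>_mult[OF subsetD[OF K_LC y]] \<sigma>_K[OF y] P)
    qed
    also have "\<dots> = emb (pact ?h (mon a y))"
    proof -
      have "\<sigma> (x i) = ract ?h (x i)" if "i < n" for i
      proof -
        have "ract ?h (x i) = emb (pact ?h (mon (mon i 1) 1))" unfolding x_def by (rule ract_simps(1)[OF h])
        also have "pact ?h (mon (mon i 1) 1) = mon 0 (c i) * mon (mon (\<pi> i) 1) 1"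
          using that permutes_bij[OF perm] by (simp add: poly_act_def msub_mon relabel_mon gcoef_def mult_single)
        finally show ?thesis using c[OF that] by (simp only: emb_simps(2) x_def)
      qed
      then have "emb (mon 0 y) * (\<Prod>i<n. \<sigma> (x i) ^ coef a i) = emb (mon 0 y) * (\<Prod>i<n. ract ?h (x i) ^ coef a i)"
        by simp
      also have "\<dots> = emb (pact ?h (mon a y))"
        unfolding eq x_def pact_simps(2,3,8,9)[OF h] emb_simps(2) emb_prod emb_power ract_simps(1)[OF h] ..
      finally show ?thesis .
    qed
    finally show ?case .
  next
    case (add f g)
    then show ?case by (simp only: emb_simps(1) pact_simps(1)[OF h] \<sigma>_add[OF emb_rat_on emb_rat_on])
  qed
  have "\<sigma> y = gaut ?h y" for y
  proof (cases "y \<in> LC")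
    case True
    then obtain a b where y: "y = Fraction_Field.Fract a b" "b \<noteq> 0" "a \<in> mpoly_on {..<n}" "b \<in> mpoly_on {..<n}"
      unfolding rat_on_def by blast
    have yb: "y * emb b = emb a" using y(2) by (simp add: y(1) emb_def eq_fract)
    have "\<sigma> y * emb (pact ?h b) = emb (pact ?h a)"
      using \<sigma>_mult[OF True emb_rat_on[OF y(4)]] on_poly y(3,4) by (simp only: yb)
    moreover have "ract ?h y * emb (pact ?h b) = emb (pact ?h a)"
      using ract_simps(1,3)[OF h] yb by metis
    moreover have "emb (pact ?h b) \<noteq> 0"
      using inj_ring_hom.nonzero[OF subst_pair_hom[OF G_subst[OF h]] y(2)] by (simp add: poly_act_def emb_nonzero)
    ultimately have "\<sigma> y = ract ?h y" by (metis mult_right_cancel)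
    then show ?thesis using True by (simp add: raut_apply)
  next
    case False
    then show ?thesis using extensional_arb[OF ext False] by (simp add: raut_def)
  qed
  then have "\<sigma> = gaut ?h" by (intro HOL.ext)
  then show "\<sigma> \<in> gaut ` G" using h by blast
qed (use gaut_field_aut in blast)

subsection \<open>Finiteness\<close>

text \<open>Module generators of \<open>P\<close> over \<open>\<Gamma>\<close>: monomials with exponents below \<open>m\<close> reduce \<open>P\<close> to polynomials in the \<open>x\<^sub>i\<^sup>m\<close>,
  and these are spanned by the staircase.\<close>

definition mbasis :: "'k mpoly set" where
  "mbasis = (\<lambda>(a, b). (\<Prod>i<n. mon (mon i (a i)) 1) * zmon b) ` (({..<n} \<rightarrow>\<^sub>E {..<m}) \<times> staircase n 0)"

lemma finite_mbasis: "finite mbasis"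
  unfolding mbasis_def by (intro finite_imageI finite_cartesian_product finite_PiE finite_staircase) auto

lemma mbasis_on: "b \<in> mbasis \<Longrightarrow> b \<in> mpoly_on {..<n}"
  unfolding mbasis_def by (auto intro!: mpoly_on_mult mpoly_on_prod zmon_on mpoly_on_mon exps_on_mon)

lemma mbasis_span: assumes "f \<in> mpoly_on {..<n}" shows "f \<in> gspan pinv mbasis"
  using assms
proof (induction f rule: mpoly_on_induct)
  case (mon a x)
  define A' where "A' = (\<lambda>i\<in>{..<n}. coef a i mod m)"
  let ?M = "\<Prod>i<n. mon (mon i (A' i)) (1::'k)"
  have A': "A' \<in> {..<n} \<rightarrow>\<^sub>E {..<m}" using m1 by (auto simp: A'_def)
  have "(\<Prod>i<n. zv i ^ (coef a i div m)) \<in> gspan pinv (staircase_monomials zv n 0)"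
    using zspan(3) by (intro subring_setD(6,8)[OF zspan(1)]) auto
  then have "(\<Prod>i<n. zv i ^ (coef a i div m)) * (mon 0 x * ?M) \<in> gspan pinv mbasis"
  proof (rule gspan_mult_right)
    fix s b assume s: "s \<in> pinv" "b \<in> staircase_monomials zv n 0"
    then obtain e where e: "e \<in> staircase n 0" "b = zmon e" unfolding staircase_monomials_eq zmon_def by blast
    have "(s * mon 0 x) * (?M * zmon e) \<in> gspan pinv mbasis"
      using A' e s(1) const_pinv[of x] subring_setD(4)[OF subring_pinv]
      by (intro gspan_scaled) (auto simp: mbasis_def intro!: image_eqI[of _ _ "(A', e)"])
    then show "s * b * (mon 0 x * ?M) \<in> gspan pinv mbasis" unfolding e by (simp only: ac_simps)
  qed
  moreover have "(\<Prod>i<n. zv i ^ (coef a i div m)) * (mon 0 x * ?M) = mon a x"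
  proof -
    have "zv i ^ k = mon (mon i (k * m)) 1" for i k
      by (induction k) (auto simp: zv_def mult_single single_add[symmetric])
    then have "(\<Prod>i<n. zv i ^ (coef a i div m)) * (mon 0 x * ?M) =
        mon ((\<Sum>i<n. mon i (coef a i div m * m)) + (\<Sum>i<n. mon i (A' i))) x"
      by (simp add: prod_mon mult_single)
    also have "(\<Sum>i<n. mon i (coef a i div m * m)) + (\<Sum>i<n. mon i (A' i)) = (\<Sum>i<n. mon i (coef a i))"
      unfolding sum.distrib[symmetric] by (rule sum.cong) (auto simp: A'_def single_add[symmetric])
    finally show ?thesis by (simp add: sum_mon_exps[OF mon])
  qed
  ultimately show ?case by simp
qed (rule gspan_add)

text \<open>Generators of \<open>P\<close> over \<open>\<Gamma>\<close> span \<open>L\<close> over \<open>K\<close> because denominators can be chosen in \<open>\<Gamma>\<close>.\<close>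

lemma galois_extension: "finite_galois_extension L K"
  unfolding finite_galois_extension_def
proof (intro conjI)
  show field: "Ring.field L" by (rule field_ring_of[OF subfield_LC])
  show K: "subfield K L" by (rule subfield_ring_of[OF subfield_LC subfield_K K_LC])
  interpret Ring.field L by (rule field)
  from finite_list[OF finite_imageI[OF finite_mbasis, of emb]] obtain Us where Us: "set Us = emb ` mbasis" by (elim exE)
  have Us_L: "set Us \<subseteq> carrier L" unfolding Us using mbasis_on by (auto intro: emb_rat_on)
  have "x \<in> Span K Us" if x: "x \<in> LC" for x
  proof -
    obtain a d where ad: "a \<in> mpoly_on {..<n}" "d \<in> pinv" "d \<noteq> 0" "x * emb d = emb a"
      by (rule invariant_denominator[OF x])
    have "emb a \<in> Span K Us" using mbasis_span[OF ad(1)]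
    proof induction
      case gspan_zero
      show ?case using Span_subgroup_props(2)[OF K Us_L] by (simp add: emb_simps)
    next
      case (gspan_step s b u)
      have "emb b \<in> Span K Us" using Span_base_incl[OF K Us_L] gspan_step(2) unfolding Us by blast
      then have "emb s \<otimes>\<^bsub>L\<^esub> emb b \<in> Span K Us"
        using \<Gamma>_K gspan_step(1) by (intro Span_smult_closed[OF K Us_L]) auto
      then have "(emb s \<otimes>\<^bsub>L\<^esub> emb b) \<oplus>\<^bsub>L\<^esub> emb u \<in> Span K Us"
        using gspan_step.IH by (intro Span_subgroup_props(3)[OF K Us_L])
      then show ?case by (simp add: emb_simps)
    qed
    moreover have "inverse (emb d) \<in> K"
      using subfield_K \<Gamma>_K ad(2) unfolding subfield_set_def by blast
    ultimately have "inverse (emb d) \<otimes>\<^bsub>L\<^esub> emb a \<in> Span K Us" by (intro Span_smult_closed[OF K Us_L])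
    moreover have "inverse (emb d) * emb a = x" using ad(3) by (simp add: ad(4)[symmetric] emb_nonzero)
    ultimately show ?thesis by simp
  qed
  then have "Span K Us = carrier L" using Span_subgroup_props(1)[OF K Us_L] by auto
  then show "finite_dimension K (carrier L)" using Span_finite_dimension[OF K Us_L] by simp
  show "{x \<in> carrier L. \<forall>\<sigma>\<in>field_auts L K. \<sigma> x = x} = K"
    unfolding field_auts_K by (auto simp: K_fixed raut_apply)
qed

end

lemma finsum_ring_of:
  assumes S: "subfield_set S" and f: "\<And>i. i \<in> I \<Longrightarrow> f i \<in> S" and "finite I"
  shows "finsum (ring_of S) f I = sum f I"
proof -
  interpret Ring.field "ring_of S" by (rule field_ring_of[OF S])
  show ?thesis using assms(3) f
  proof (induction I rule: finite_induct)
    case (insert i I)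
    then have "finsum (ring_of S) f (insert i I) = f i \<oplus>\<^bsub>ring_of S\<^esub> finsum (ring_of S) f I"
      by (intro finsum_insert) auto
    then show ?case using insert by simp
  qed simp
qed

context gmpn
begin

section \<open>The monoid of \<open>q\<close>-dilations\<close>

abbreviation "E \<equiv> exps_on {..<n}"
abbreviation "dil \<beta> \<equiv> raut n (\<lambda>i. q ^ coef \<beta> i) id :: 'k mpoly fract \<Rightarrow> 'k mpoly fract"
abbreviation "rdil \<beta> \<equiv> rsub (\<lambda>i. q ^ coef \<beta> i) id :: 'k mpoly fract \<Rightarrow> 'k mpoly fract"
abbreviation "M \<equiv> dil ` E"
abbreviation "BG \<equiv> BijGroup LC"

lemma dil_subst: "subst_pair n (\<lambda>i. q ^ coef \<beta> i) id"
  using q0 by (simp add: subst_pair_def permutes_id)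

lemmas rdil_simps = rsub_simps[OF dil_subst]

interpretation BG: group BG by (rule group_BijGroup)

lemma carrier_BG: "carrier BG = Bij LC" by (simp add: BijGroup_def)

lemma dil_BG: "dil \<beta> \<in> carrier BG" unfolding carrier_BG by (rule raut_Bij[OF dil_subst])
lemma gaut_BG: "h \<in> G \<Longrightarrow> gaut h \<in> carrier BG" unfolding carrier_BG by (rule raut_Bij[OF G_subst])

lemma dil_mult: "dil \<alpha> \<otimes>\<^bsub>BG\<^esub> dil \<beta> = dil (\<alpha> + \<beta>)"
  unfolding raut_comp[OF dil_subst dil_subst] by (simp add: lookup_add power_add mult.commute)

lemma dil_zero: "dil 0 = \<one>\<^bsub>BG\<^esub>"
  by (simp add: raut_id id_def)

lemma q_pow_inj: "q ^ a = q ^ b \<Longrightarrow> a = b"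
proof (induction a b rule: linorder_wlog)
  case (le a b)
  have "q ^ b = q ^ a * q ^ (b - a)" using le(1) by (simp flip: power_add)
  then have "q ^ (b - a) = 1" using le(2) q0 by simp
  then show ?case using q_order[of "b - a"] le(1) by (cases "b - a = 0") auto
qed auto

text \<open>The power sum \<open>\<Sum> x\<^sub>i\<^sup>m\<close> is invariant and distinguishes the dilations.\<close>

lemma dil_separated:
  assumes "\<alpha> \<in> E" "\<beta> \<in> E" "\<And>x. x \<in> K \<Longrightarrow> dil \<alpha> x = dil \<beta> x" shows "\<alpha> = \<beta>"
proof (rule poly_mapping_eqI)
  fix i
  let ?P = "\<Sum>i<n. zv i"
  have "pact h ?P = ?P" if "h \<in> G" for h
  proof -
    have "pact h ?P = (\<Sum>i<n. zv (snd h i))" using that by (simp add: pact_simps pact_zv)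
    then show ?thesis using sum.permute[OF G_cases(2)[OF that], of zv] by (simp add: o_def)
  qed
  then have "?P \<in> pinv" by (auto simp: pinv_def intro!: mpoly_on_sum zv_on)
  then have P: "emb ?P \<in> K" using \<Gamma>_K by blast
  have "rdil \<alpha> (emb ?P) = rdil \<beta> (emb ?P)" using assms(3)[OF P] subsetD[OF K_LC P] by (simp add: raut_apply)
  then have "qshift q \<alpha> ?P = qshift q \<beta> ?P" by (simp only: rdil_simps(1) emb_simps(6))
  moreover have "qshift q \<gamma> ?P = (\<Sum>i<n. mon (mon i m) ((q ^ coef \<gamma> i) ^ m))" for \<gamma>
    by (simp add: msub_sum zv_def msub_mon)
  ultimately have eq: "(\<Sum>i<n. mon (mon i m) ((q ^ coef \<alpha> i) ^ m)) = (\<Sum>i<n. mon (mon i m) ((q ^ coef \<beta> i) ^ m))" by simp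
  have inj: "mon j m = (mon k m :: exps) \<longleftrightarrow> j = k" for j k
  proof
    assume "mon j m = (mon k m :: exps)"
    then have "supp (mon j m) = supp (mon k m)" by simp
    then show "j = k" using m1 by simp
  qed simp
  show "coef \<alpha> i = coef \<beta> i"
  proof (cases "i < n")
    case True
    have "coef (\<Sum>j<n. mon (mon j m) (f j)) (mon i m) = f i" for f :: "nat \<Rightarrow> 'k"
      using True by (simp add: lookup_sum lookup_single inj when_def)
    from this[of "\<lambda>j. (q ^ coef \<alpha> j) ^ m"] this[of "\<lambda>j. (q ^ coef \<beta> j) ^ m"]
    have "q ^ (coef \<alpha> i * m) = q ^ (coef \<beta> i * m)" by (simp add: eq power_mult)
    then have "coef \<alpha> i * m = coef \<beta> i * m" by (rule q_pow_inj)
    then show ?thesis using m1 by simp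
  next
    case False
    then have "i \<notin> supp \<alpha>" "i \<notin> supp \<beta>" using assms(1,2) by (auto simp: exps_on_def)
    then show ?thesis by (simp add: in_keys_iff)
  qed
qed

lemma dil_inj: "\<alpha> \<in> E \<Longrightarrow> \<beta> \<in> E \<Longrightarrow> dil \<alpha> = dil \<beta> \<Longrightarrow> \<alpha> = \<beta>"
  by (rule dil_separated) auto

lemma inj_on_dil: "inj_on dil E"
  by (rule inj_onI) (rule dil_inj)

lemma relabel_E: "h \<in> G \<Longrightarrow> \<beta> \<in> E \<Longrightarrow> relabel (snd h) \<beta> \<in> E"
  by (intro exps_on_relabel G_cases)

lemma relabel_surj: assumes "h \<in> G" "\<beta> \<in> E" obtains \<alpha> where "\<alpha> \<in> E" "\<beta> = relabel (snd h) \<alpha>"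
proof -
  let ?\<rho> = "inv_into UNIV (snd h)"
  have p: "?\<rho> permutes {..<n}" using permutes_inv[OF G_cases(2)[OF assms(1)]] .
  have "relabel ?\<rho> \<beta> \<in> E"
    by (rule exps_on_relabel[OF permutes_bij[OF p] _ assms(2)]) (simp add: permutes_image[OF p])
  moreover have "\<beta> = relabel (snd h) (relabel ?\<rho> \<beta>)"
    using relabel_comp[OF G_cases(3)[OF assms(1)] permutes_bij[OF p], of \<beta>] permutes_inv_o(1)[OF G_cases(2)[OF assms(1)]]
    by simp
  ultimately show ?thesis by (rule that)
qed

lemma gaut_dil: "h \<in> G \<Longrightarrow> gaut h \<otimes>\<^bsub>BG\<^esub> dil \<beta> = dil (relabel (snd h) \<beta>) \<otimes>\<^bsub>BG\<^esub> gaut h"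
  unfolding raut_comp[OF dil_subst G_subst] raut_comp[OF G_subst dil_subst]
  using G_cases(3)[of h] by (simp add: mult.commute)

text \<open>Conjugation by a group element permutes the exponents of a dilation; the roots of unity cancel.\<close>

lemma aut_conj_dil: "h \<in> G \<Longrightarrow> aut_conj L (gaut h) (dil \<beta>) = dil (relabel (snd h) \<beta>)"
  unfolding aut_conj_def ring_of_simps(1)
  by (simp only: gaut_dil BG.m_assoc dil_BG gaut_BG BG.inv_closed BG.r_inv BG.r_one)

lemma aut_conj_inv_dil:
  assumes "h \<in> G" shows "aut_conj L (inv\<^bsub>BG\<^esub> (gaut h)) (dil (relabel (snd h) \<beta>)) = dil \<beta>"
proof -
  have "inv\<^bsub>BG\<^esub> (gaut h) \<otimes>\<^bsub>BG\<^esub> dil (relabel (snd h) \<beta>) \<otimes>\<^bsub>BG\<^esub> gaut h = inv\<^bsub>BG\<^esub> (gaut h) \<otimes>\<^bsub>BG\<^esub> (gaut h \<otimes>\<^bsub>BG\<^esub> dil \<beta>)"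
    by (simp only: gaut_dil[OF assms] BG.m_assoc dil_BG gaut_BG[OF assms] BG.inv_closed)
  also have "\<dots> = dil \<beta>"
    by (simp only: BG.m_assoc[symmetric] dil_BG gaut_BG[OF assms] BG.inv_closed BG.l_inv BG.l_one)
  finally show ?thesis unfolding aut_conj_def ring_of_simps(1) by (simp only: BG.inv_inv[OF gaut_BG[OF assms]])
qed

lemma galois_setting_L: "galois_setting L (range (\<lambda>c. emb (mon 0 c))) \<Gamma>L M"
  unfolding galois_setting_def
proof (intro conjI ballI impI)
  let ?F = "range (\<lambda>c. emb (mon 0 c) :: 'k mpoly fract)"
  show F\<Gamma>: "?F \<subseteq> \<Gamma>L" using const_pinv by auto
  have F: "subfield_set ?F"
    unfolding subfield_set_def subring_set_def
  proof (intro conjI ballI)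
    fix a b assume "a \<in> ?F" "b \<in> ?F"
    then obtain c d where cd: "a = emb (mon 0 c)" "b = emb (mon 0 d)" by blast
    show "a + b \<in> ?F" "a * b \<in> ?F" "- a \<in> ?F"
      unfolding cd by (auto simp: emb_simps(1-3)[symmetric] mult_single single_add[symmetric] single_uminus[symmetric])
    have "inverse a = emb (mon 0 (inverse c))"
    proof (cases "c = 0")
      case False
      have "a * emb (mon 0 (inverse c)) = 1"
        using False by (simp add: cd emb_simps(2)[symmetric] mult_single emb_simps(5))
      then show ?thesis by (rule inverse_unique)
    qed (simp add: cd emb_simps)
    then show "inverse a \<in> ?F" by blast
  next
    show "0 \<in> ?F" by (rule range_eqI[of _ _ 0]) (simp add: emb_simps)
    show "1 \<in> ?F" by (rule range_eqI[of _ _ 1]) (simp add: emb_simps)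
  qed
  show "Ring.field L" by (rule field_ring_of[OF subfield_LC])
  show "subfield ?F L" by (rule subfield_ring_of[OF subfield_LC F]) (use F\<Gamma> \<Gamma>_LC in blast)
  show "subdomain \<Gamma>L L" by (rule subdomain_ring_of[OF subfield_LC subring_\<Gamma> \<Gamma>_LC])
  show "finite_galois_extension L K" by (rule galois_extension)
  show "submonoid M (BijGroup (carrier L))"
  proof
    show "M \<subseteq> carrier (BijGroup (carrier L))" using dil_BG by auto
    show "x \<otimes>\<^bsub>BijGroup (carrier L)\<^esub> y \<in> M" if "x \<in> M" "y \<in> M" for x y
      using that by (auto simp: dil_mult intro: exps_on_add)
    have "dil 0 \<in> M" by (rule imageI) simp
    then show "\<one>\<^bsub>BijGroup (carrier L)\<^esub> \<in> M" by (simp only: dil_zero ring_of_simps)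
  qed
  show "M \<subseteq> field_auts L ?F"
  proof
    fix a assume "a \<in> M"
    then obtain \<beta> where a: "a = dil \<beta>" by blast
    have "a x = x" if "x \<in> ?F" for x
      using that F\<Gamma> \<Gamma>_LC by (auto simp: a raut_apply emb_rat_on mpoly_on_mon rdil_simps)
    then show "a \<in> field_auts L ?F"
      unfolding field_auts_def using raut_Bij[OF dil_subst] raut_hom[OF dil_subst] by (simp add: a)
  qed
  show "a = b" if "a \<in> M" "b \<in> M" "\<forall>x\<in>K. a x = b x" for a b
    using that dil_separated by blast
  fix h a assume "h \<in> field_auts L K" "a \<in> M"
  show "aut_conj L h a \<in> M"
  proof -
    obtain k \<beta> where k: "k \<in> G" "h = gaut k" "\<beta> \<in> E" "a = dil \<beta>" using \<open>h \<in> _\<close> \<open>a \<in> M\<close> unfolding field_auts_K by blast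
    show ?thesis unfolding k(2,4) aut_conj_dil[OF k(1)] by (rule imageI) (rule relabel_E[OF k(1,3)])
  qed
qed

section \<open>The embedding into the skew monoid ring\<close>

abbreviation "R \<equiv> skew_monoid_ring L M"
abbreviation "\<K> \<equiv> skew_invariants L M (field_auts L K)"
abbreviation "sk \<equiv> skew_embed L"

lemma R_simps:
  "carrier R = {f. range f \<subseteq> LC \<and> finite {a. f a \<noteq> 0} \<and> {a. f a \<noteq> 0} \<subseteq> M}"
  "\<zero>\<^bsub>R\<^esub> = (\<lambda>_. 0)" "f \<oplus>\<^bsub>R\<^esub> g = (\<lambda>a. f a + g a)" "\<one>\<^bsub>R\<^esub> = sk 1"
  "f \<otimes>\<^bsub>R\<^esub> g = (\<lambda>c. finsum L (\<lambda>(a, b). f a * a (g b)) {(a, b). f a \<noteq> 0 \<and> g b \<noteq> 0 \<and> a \<otimes>\<^bsub>BG\<^esub> b = c})"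
  by (simp_all add: skew_monoid_ring_def skew_embed_def cong: if_cong)

lemma sk_apply: "sk x a = (if a = \<one>\<^bsub>BG\<^esub> then x else 0)"
  by (simp add: skew_embed_def)

lemma R_I: "(\<And>a. f a \<in> LC) \<Longrightarrow> finite {a. f a \<noteq> 0} \<Longrightarrow> (\<And>a. f a \<noteq> 0 \<Longrightarrow> a \<in> M) \<Longrightarrow> f \<in> carrier R"
  unfolding R_simps by auto

lemma R_D: "f \<in> carrier R \<Longrightarrow> f a \<in> LC" "f \<in> carrier R \<Longrightarrow> finite {a. f a \<noteq> 0}" "f \<in> carrier R \<Longrightarrow> f a \<noteq> 0 \<Longrightarrow> a \<in> M"
  unfolding R_simps by auto

lemma M_LC: "a \<in> M \<Longrightarrow> x \<in> LC \<Longrightarrow> a x \<in> LC"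
  by (auto simp: raut_apply rsub_closed[OF dil_subst])

lemma M_hom: "a \<in> M \<Longrightarrow> x \<in> LC \<Longrightarrow> y \<in> LC \<Longrightarrow> a (x * y) = a x * a y" "a \<in> M \<Longrightarrow> a 1 = 1"
  using LCD by (auto simp: raut_apply rdil_simps)

lemma M_BG: "a \<in> M \<Longrightarrow> a \<in> carrier BG" using dil_BG by auto

lemma sk_closed: "x \<in> LC \<Longrightarrow> sk x \<in> carrier R"
proof (rule R_I)
  show "finite {a. sk x a \<noteq> 0}" by (rule finite_subset[of _ "{\<one>\<^bsub>BG\<^esub>}"]) (auto simp: skew_embed_def)
  show "a \<in> M" if "sk x a \<noteq> 0" for a
  proof -
    have "a = dil 0" using that by (simp only: dil_zero sk_apply split: if_splits) simp
    then show ?thesis by (rule image_eqI) simp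
  qed
qed (auto simp: skew_embed_def intro: LCD)

lemma sk_left: "x \<in> LC \<Longrightarrow> f \<in> carrier R \<Longrightarrow> sk x \<otimes>\<^bsub>R\<^esub> f = (\<lambda>a. x * f a)"
proof
  fix c assume x: "x \<in> LC" and f: "f \<in> carrier R"
  have "\<one>\<^bsub>BG\<^esub> y = y" if "y \<in> LC" for y using that by (simp add: BijGroup_def)
  then have eval: "(\<lambda>(a, b). sk x a * a (f b)) (\<one>\<^bsub>BG\<^esub>, c) = x * f c"
    using R_D(1)[OF f] by (simp add: skew_embed_def)
  have "{(a, b). sk x a \<noteq> 0 \<and> f b \<noteq> 0 \<and> a \<otimes>\<^bsub>BG\<^esub> b = c} = (if x \<noteq> 0 \<and> f c \<noteq> 0 then {(\<one>\<^bsub>BG\<^esub>, c)} else {})"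
    using R_D(3)[OF f] M_BG by (auto simp: skew_embed_def split: if_splits)
  note set = this
  have "finsum L (\<lambda>(a, b). sk x a * a (f b)) {(a, b). sk x a \<noteq> 0 \<and> f b \<noteq> 0 \<and> a \<otimes>\<^bsub>BG\<^esub> b = c} =
      (\<Sum>(a, b)\<in>{(a, b). sk x a \<noteq> 0 \<and> f b \<noteq> 0 \<and> a \<otimes>\<^bsub>BG\<^esub> b = c}. sk x a * a (f b))"
  proof (rule finsum_ring_of[OF subfield_LC])
    fix y assume "y \<in> {(a, b). sk x a \<noteq> 0 \<and> f b \<noteq> 0 \<and> a \<otimes>\<^bsub>BG\<^esub> b = c}"
    then have "y = (\<one>\<^bsub>BG\<^esub>, c)" unfolding set by (simp split: if_splits)
    then show "(case y of (a, b) \<Rightarrow> sk x a * a (f b)) \<in> LC" using eval LCD(4)[OF x R_D(1)[OF f]] by simp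
  qed (simp add: set)
  then show "(sk x \<otimes>\<^bsub>R\<^esub> f) c = x * f c"
    unfolding R_simps set using eval by simp
qed

lemma sk_right: "x \<in> LC \<Longrightarrow> f \<in> carrier R \<Longrightarrow> f \<otimes>\<^bsub>R\<^esub> sk x = (\<lambda>a. f a * a x)"
proof
  fix c assume x: "x \<in> LC" and f: "f \<in> carrier R"
  have eval: "(\<lambda>(a, b). f a * a (sk x b)) (c, \<one>\<^bsub>BG\<^esub>) = f c * c x"
    by (simp add: skew_embed_def)
  have a0: "c 0 = 0" if "c \<in> M" using that LCD by (auto simp: raut_apply rdil_simps)
  have "{(a, b). f a \<noteq> 0 \<and> sk x b \<noteq> 0 \<and> a \<otimes>\<^bsub>BG\<^esub> b = c} = (if x \<noteq> 0 \<and> f c \<noteq> 0 then {(c, \<one>\<^bsub>BG\<^esub>)} else {})"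
    using R_D(3)[OF f] M_BG by (auto simp: skew_embed_def split: if_splits)
  note set = this
  have "finsum L (\<lambda>(a, b). f a * a (sk x b)) {(a, b). f a \<noteq> 0 \<and> sk x b \<noteq> 0 \<and> a \<otimes>\<^bsub>BG\<^esub> b = c} =
      (\<Sum>(a, b)\<in>{(a, b). f a \<noteq> 0 \<and> sk x b \<noteq> 0 \<and> a \<otimes>\<^bsub>BG\<^esub> b = c}. f a * a (sk x b))"
  proof (rule finsum_ring_of[OF subfield_LC])
    fix y assume "y \<in> {(a, b). f a \<noteq> 0 \<and> sk x b \<noteq> 0 \<and> a \<otimes>\<^bsub>BG\<^esub> b = c}"
    then have y: "y = (c, \<one>\<^bsub>BG\<^esub>)" "f c \<noteq> 0" unfolding set by (simp_all split: if_splits)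
    then have "f c * c x \<in> LC" by (intro LCD(4) R_D(1)[OF f] M_LC[OF R_D(3)[OF f] x])
    then show "(case y of (a, b) \<Rightarrow> f a * a (sk x b)) \<in> LC" using eval y by simp
  qed (simp add: set)
  moreover have "f c * c x = 0" if "x = 0" using that a0 R_D(3)[OF f, of c] by (cases "f c = 0") auto
  ultimately show "(f \<otimes>\<^bsub>R\<^esub> sk x) c = f c * c x"
    unfolding R_simps set using eval by auto
qed

lemma R_add_closed: "f \<in> carrier R \<Longrightarrow> g \<in> carrier R \<Longrightarrow> f \<oplus>\<^bsub>R\<^esub> g \<in> carrier R"
proof (rule R_I)
  assume f: "f \<in> carrier R" and g: "g \<in> carrier R"
  show "finite {a. (f \<oplus>\<^bsub>R\<^esub> g) a \<noteq> 0}"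
    by (rule finite_subset[of _ "{a. f a \<noteq> 0} \<union> {a. g a \<noteq> 0}"]) (use R_D(2) f g in \<open>auto simp: R_simps(3)\<close>)
  show "a \<in> M" if "(f \<oplus>\<^bsub>R\<^esub> g) a \<noteq> 0" for a
    using that R_D(3)[OF f, of a] R_D(3)[OF g, of a] by (cases "f a = 0") (auto simp: R_simps(3))
qed (auto simp: R_simps(3) intro: LCD R_D)

lemma R_minus_closed: "f \<in> carrier R \<Longrightarrow> (\<lambda>a. - f a) \<in> carrier R"
  by (rule R_I) (use R_D in \<open>auto intro: LCD\<close>)

lemma group_R: "comm_group (add_monoid R)"
proof (rule comm_groupI)
  fix f assume "f \<in> carrier (add_monoid R)"
  then show "\<exists>g\<in>carrier (add_monoid R). g \<otimes>\<^bsub>add_monoid R\<^esub> f = \<one>\<^bsub>add_monoid R\<^esub>"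
    by (intro bexI[of _ "\<lambda>a. - f a"]) (simp_all add: R_simps(2,3) R_minus_closed)
next
  show "\<one>\<^bsub>add_monoid R\<^esub> \<in> carrier (add_monoid R)"
    using R_I[of "\<lambda>_. 0"] LCD(1) by (simp add: R_simps(2))
qed (use R_add_closed in \<open>auto simp: R_simps(2,3) ac_simps\<close>)

lemma R_minus: assumes "f \<in> carrier R" shows "\<ominus>\<^bsub>R\<^esub> f = (\<lambda>a. - f a)"
proof -
  interpret comm_group "add_monoid R" by (rule group_R)
  show ?thesis unfolding a_inv_def
    by (rule inv_equality) (simp_all add: R_simps(2,3) assms R_minus_closed)
qed

text \<open>The map \<open>f y\<^sup>\<beta> \<mapsto> f \<sigma>\<^sub>\<beta>\<close>. Distinct exponents give distinct dilations, so a dilation determines the coefficient.\<close>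

definition phi :: "'k qspace \<Rightarrow> ('k mpoly fract \<Rightarrow> 'k mpoly fract) \<Rightarrow> 'k mpoly fract" where
  "phi u a = (if a \<in> M then emb (coef u (inv_into E dil a)) else 0)"

lemma phi_dil: "\<beta> \<in> E \<Longrightarrow> phi u (dil \<beta>) = emb (coef u \<beta>)"
  using inv_into_f_f[OF inj_on_dil] by (simp add: phi_def)

lemma phi_outside: "a \<notin> M \<Longrightarrow> phi u a = 0"
  unfolding phi_def by (simp only: if_False)

lemma R_ext: assumes "f \<in> carrier R" "g \<in> carrier R" "\<And>\<beta>. \<beta> \<in> E \<Longrightarrow> f (dil \<beta>) = g (dil \<beta>)" shows "f = g"
proof
  fix a show "f a = g a"
  proof (cases "a \<in> M")
    case False
    then show ?thesis using R_D(3)[OF assms(1), of a] R_D(3)[OF assms(2), of a] by metis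
  qed (use assms(3) in auto)
qed

lemma phi_support: "u \<in> qspace_on {..<n} \<Longrightarrow> {a. phi u a \<noteq> 0} = dil ` supp u"
proof (intro subset_antisym subsetI)
  fix a assume u: "u \<in> qspace_on {..<n}" and "a \<in> {a. phi u a \<noteq> 0}"
  then have "a \<in> M" "phi u a \<noteq> 0" using phi_outside by blast+
  then show "a \<in> dil ` supp u" by (auto simp: phi_dil emb_nonzero in_keys_iff)
next
  fix a assume u: "u \<in> qspace_on {..<n}" and "a \<in> dil ` supp u"
  then obtain \<beta> where "\<beta> \<in> supp u" "\<beta> \<in> E" "a = dil \<beta>" by (auto simp: qspace_on_def)
  then show "a \<in> {a. phi u a \<noteq> 0}" by (simp add: phi_dil emb_nonzero in_keys_iff)
qed

lemma phi_closed: assumes "u \<in> qspace_on {..<n}" shows "phi u \<in> carrier R"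
proof (rule R_I)
  show "phi u a \<in> LC" for a
    using assms LCD(1) by (auto simp: phi_def qspace_on_def intro: emb_rat_on)
  show "finite {a. phi u a \<noteq> 0}" unfolding phi_support[OF assms] by simp
  show "a \<in> M" if "phi u a \<noteq> 0" for a using that phi_outside by metis
qed

lemma phi_add: "phi (u + v) = phi u \<oplus>\<^bsub>R\<^esub> phi v"
  by (auto simp: phi_def R_simps(3) lookup_add emb_simps)

lemma phi_minus: "phi (- u) = (\<lambda>a. - phi u a)"
  by (auto simp: phi_def emb_simps)

lemma phi_zero: "phi 0 = \<zero>\<^bsub>R\<^esub>"
  by (auto simp: phi_def R_simps(2) emb_simps)

lemma phi_inj: assumes "u \<in> qspace_on {..<n}" "v \<in> qspace_on {..<n}" "phi u = phi v" shows "u = v"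
proof (rule poly_mapping_eqI)
  fix \<beta>
  show "coef u \<beta> = coef v \<beta>"
  proof (cases "\<beta> \<in> E")
    case True
    then show ?thesis using fun_cong[OF assms(3), of "dil \<beta>"] by (simp add: phi_dil emb_simps(6))
  next
    case False
    then have "\<beta> \<notin> supp u" "\<beta> \<notin> supp v" using assms by (auto simp: qspace_on_def)
    then show ?thesis by (simp add: in_keys_iff)
  qed
qed

lemma phi_poly: assumes "f \<in> mpoly_on {..<n}" shows "phi (mon 0 f) = sk (emb f)"
proof (rule R_ext[OF phi_closed sk_closed])
  fix \<beta> assume "\<beta> \<in> E"
  moreover have "dil \<beta> = \<one>\<^bsub>BG\<^esub> \<longleftrightarrow> \<beta> = 0"
    using dil_inj[OF \<open>\<beta> \<in> E\<close> exps_on_zero] dil_zero by metis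
  ultimately show "phi (mon 0 f) (dil \<beta>) = sk (emb f) (dil \<beta>)"
    by (auto simp: phi_dil skew_embed_def lookup_single when_def emb_simps)
qed (use assms in \<open>auto intro: qspace_on_mon emb_rat_on\<close>)

lemma phi_one: "phi 1 = \<one>\<^bsub>R\<^esub>"
  using phi_poly[of 1] by (simp add: R_simps(4) emb_simps(5))

text \<open>Both products move a coefficient past the \<open>\<beta>\<close>-th power of the variables by the same dilation, and exponents add.\<close>

lemma phi_mult:
  assumes u: "u \<in> qspace_on {..<n}" and v: "v \<in> qspace_on {..<n}"
  shows "phi (qmul q u v) = phi u \<otimes>\<^bsub>R\<^esub> phi v"
proof
  fix c
  let ?S = "{(\<alpha>, \<beta>). \<alpha> \<in> supp u \<and> \<beta> \<in> supp v \<and> dil (\<alpha> + \<beta>) = c}"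
  have supp_E: "\<alpha> \<in> E" if "\<alpha> \<in> supp u \<or> \<alpha> \<in> supp v" for \<alpha> using that u v by (auto simp: qspace_on_def)
  have set: "{(a, b). phi u a \<noteq> 0 \<and> phi v b \<noteq> 0 \<and> a \<otimes>\<^bsub>BG\<^esub> b = c} = (\<lambda>(\<alpha>, \<beta>). (dil \<alpha>, dil \<beta>)) ` ?S"
  proof (intro subset_antisym subsetI)
    fix x assume "x \<in> {(a, b). phi u a \<noteq> 0 \<and> phi v b \<noteq> 0 \<and> a \<otimes>\<^bsub>BG\<^esub> b = c}"
    then obtain a b where x: "x = (a, b)" "a \<in> {a. phi u a \<noteq> 0}" "b \<in> {b. phi v b \<noteq> 0}" "a \<otimes>\<^bsub>BG\<^esub> b = c" by auto
    then obtain \<alpha> \<beta> where "\<alpha> \<in> supp u" "\<beta> \<in> supp v" "a = dil \<alpha>" "b = dil \<beta>"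
      unfolding phi_support[OF u] phi_support[OF v] by blast
    then show "x \<in> (\<lambda>(\<alpha>, \<beta>). (dil \<alpha>, dil \<beta>)) ` ?S" using x(1,4) by (auto simp: dil_mult intro!: image_eqI[of _ _ "(\<alpha>, \<beta>)"])
  next
    fix x assume "x \<in> (\<lambda>(\<alpha>, \<beta>). (dil \<alpha>, dil \<beta>)) ` ?S"
    then obtain \<alpha> \<beta> where *: "\<alpha> \<in> supp u" "\<beta> \<in> supp v" "dil (\<alpha> + \<beta>) = c" "x = (dil \<alpha>, dil \<beta>)" by auto
    then have "dil \<alpha> \<in> {a. phi u a \<noteq> 0}" "dil \<beta> \<in> {a. phi v a \<noteq> 0}"
      unfolding phi_support[OF u] phi_support[OF v] by blast+
    then show "x \<in> {(a, b). phi u a \<noteq> 0 \<and> phi v b \<noteq> 0 \<and> a \<otimes>\<^bsub>BG\<^esub> b = c}" using * by (simp add: dil_mult)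
  qed
  have fin: "finite ?S" by (rule finite_subset[of _ "supp u \<times> supp v"]) auto
  have inj: "inj_on (\<lambda>(\<alpha>, \<beta>). (dil \<alpha>, dil \<beta>)) ?S"
    by (rule inj_onI) (auto dest!: dil_inj[rotated 2] intro: supp_E)
  have product: "phi u (dil \<alpha>) * dil \<alpha> (phi v (dil \<beta>)) = emb (coef u \<alpha> * qshift q \<alpha> (coef v \<beta>))"
    if "\<alpha> \<in> E" "\<beta> \<in> E" for \<alpha> \<beta>
    using that v by (simp add: phi_dil raut_apply emb_rat_on qspace_on_def rdil_simps emb_simps)
  have on: "coef u \<alpha> * qshift q \<alpha> (coef v \<beta>) \<in> mpoly_on {..<n}" for \<alpha> \<beta>
    using u v by (intro mpoly_on_mult mpoly_on_msub) (auto simp: qspace_on_def)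
  have "(phi u \<otimes>\<^bsub>R\<^esub> phi v) c = (\<Sum>(a, b)\<in>(\<lambda>(\<alpha>, \<beta>). (dil \<alpha>, dil \<beta>)) ` ?S. phi u a * a (phi v b))"
    unfolding R_simps(5) set
  proof (rule finsum_ring_of[OF subfield_LC])
    fix x assume "x \<in> (\<lambda>(\<alpha>, \<beta>). (dil \<alpha>, dil \<beta>)) ` ?S"
    then obtain \<alpha> \<beta> where x: "\<alpha> \<in> E" "\<beta> \<in> E" "x = (dil \<alpha>, dil \<beta>)" using supp_E by auto
    show "(case x of (a, b) \<Rightarrow> phi u a * a (phi v b)) \<in> LC"
      unfolding x(3) prod.case product[OF x(1,2)] by (rule emb_rat_on[OF on])
  qed (use fin in simp)
  also have "\<dots> = (\<Sum>(\<alpha>, \<beta>)\<in>?S. emb (coef u \<alpha> * qshift q \<alpha> (coef v \<beta>)))"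
    unfolding sum.reindex[OF inj] o_def
  proof (rule sum.cong[OF refl])
    fix x assume "x \<in> ?S"
    then obtain \<alpha> \<beta> where x: "\<alpha> \<in> E" "\<beta> \<in> E" "x = (\<alpha>, \<beta>)" using supp_E by auto
    show "(case case x of (\<alpha>, \<beta>) \<Rightarrow> (dil \<alpha>, dil \<beta>) of (a, b) \<Rightarrow> phi u a * a (phi v b)) =
        (case x of (\<alpha>, \<beta>) \<Rightarrow> emb (coef u \<alpha> * qshift q \<alpha> (coef v \<beta>)))"
      unfolding x(3) prod.case by (rule product[OF x(1,2)])
  qed
  finally have rhs: "(phi u \<otimes>\<^bsub>R\<^esub> phi v) c = emb (\<Sum>(\<alpha>, \<beta>)\<in>?S. coef u \<alpha> * qshift q \<alpha> (coef v \<beta>))"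
    by (simp add: emb_sum case_prod_beta)
  show "phi (qmul q u v) c = (phi u \<otimes>\<^bsub>R\<^esub> phi v) c"
  proof (cases "c \<in> M")
    case True
    then obtain \<gamma> where \<gamma>: "\<gamma> \<in> E" "c = dil \<gamma>" by blast
    have "coef (qmul q u v) \<gamma> = (\<Sum>\<alpha>\<in>supp u. \<Sum>\<beta>\<in>supp v. if \<alpha> + \<beta> = \<gamma> then coef u \<alpha> * qshift q \<alpha> (coef v \<beta>) else 0)"
      by (simp add: qmul_def conv_def lin_ext_def lookup_sum lookup_single when_def)
    also have "\<dots> = (\<Sum>(\<alpha>, \<beta>)\<in>supp u \<times> supp v. if \<alpha> + \<beta> = \<gamma> then coef u \<alpha> * qshift q \<alpha> (coef v \<beta>) else 0)"
      by (simp add: sum.cartesian_product)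
    also have "\<dots> = (\<Sum>(\<alpha>, \<beta>)\<in>?S. coef u \<alpha> * qshift q \<alpha> (coef v \<beta>))"
    proof (rule sum.mono_neutral_cong_right)
      have eq: "dil (\<alpha> + \<beta>) = c \<longleftrightarrow> \<alpha> + \<beta> = \<gamma>" if "\<alpha> \<in> supp u" "\<beta> \<in> supp v" for \<alpha> \<beta>
        using dil_inj[of "\<alpha> + \<beta>" \<gamma>] that supp_E \<gamma> by (auto intro: exps_on_add)
      show "\<forall>x\<in>supp u \<times> supp v - ?S. (case x of (\<alpha>, \<beta>) \<Rightarrow> if \<alpha> + \<beta> = \<gamma> then coef u \<alpha> * qshift q \<alpha> (coef v \<beta>) else 0) = 0"
        using eq by (auto split: if_splits)
      show "(case x of (\<alpha>, \<beta>) \<Rightarrow> if \<alpha> + \<beta> = \<gamma> then coef u \<alpha> * qshift q \<alpha> (coef v \<beta>) else 0) =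
          (case x of (\<alpha>, \<beta>) \<Rightarrow> coef u \<alpha> * qshift q \<alpha> (coef v \<beta>))" if "x \<in> ?S" for x
      proof -
        from that obtain \<alpha> \<beta> where x: "x = (\<alpha>, \<beta>)" "\<alpha> \<in> supp u" "\<beta> \<in> supp v" "dil (\<alpha> + \<beta>) = c" by auto
        then have "\<alpha> + \<beta> = \<gamma>" using eq[OF x(2,3)] by blast
        then show ?thesis by (simp add: x(1))
      qed
    qed auto
    finally show ?thesis using rhs \<gamma> by (simp add: phi_dil)
  next
    case False
    then have S: "?S = {}" using supp_E by (auto intro: exps_on_add)
    show ?thesis using rhs unfolding S phi_outside[OF False] by (simp add: emb_simps)
  qed
qed

subsection \<open>Invariant elements of the skew monoid ring\<close>

lemma skew_act_dil:
  assumes "h \<in> G" "\<beta> \<in> E" shows "skew_act L M (gaut h) f (dil (relabel (snd h) \<beta>)) = gaut h (f (dil \<beta>))"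
  using aut_conj_inv_dil[OF assms(1)] relabel_E[OF assms] by (simp add: skew_act_def)

text \<open>The action of \<open>h\<close> moves the coefficient at the dilation by \<open>\<beta>\<close> to the relabelled exponent, exactly as it
  does for the coefficient of \<open>y\<^sup>\<beta>\<close>.\<close>

lemma \<K>_iff: "f \<in> \<K> \<longleftrightarrow> f \<in> carrier R \<and> (\<forall>h\<in>G. \<forall>\<beta>\<in>E. f (dil (relabel (snd h) \<beta>)) = ract h (f (dil \<beta>)))"
proof -
  have "skew_act L M (gaut h) f = f \<longleftrightarrow> (\<forall>\<beta>\<in>E. f (dil (relabel (snd h) \<beta>)) = ract h (f (dil \<beta>)))"
    if f: "f \<in> carrier R" and h: "h \<in> G" for h
  proof
    assume "skew_act L M (gaut h) f = f"
    then show "\<forall>\<beta>\<in>E. f (dil (relabel (snd h) \<beta>)) = ract h (f (dil \<beta>))"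
      using skew_act_dil[OF h, of _ f] R_D(1)[OF f] by (simp add: raut_apply)
  next
    assume *: "\<forall>\<beta>\<in>E. f (dil (relabel (snd h) \<beta>)) = ract h (f (dil \<beta>))"
    show "skew_act L M (gaut h) f = f"
    proof
      fix a show "skew_act L M (gaut h) f a = f a"
      proof (cases "a \<in> M")
        case True
        then obtain \<alpha> where \<alpha>: "\<alpha> \<in> E" "a = dil \<alpha>" by blast
        obtain \<beta> where \<beta>: "\<beta> \<in> E" "\<alpha> = relabel (snd h) \<beta>" by (rule relabel_surj[OF h \<alpha>(1)])
        show ?thesis unfolding \<alpha>(2) \<beta>(2) skew_act_dil[OF h \<beta>(1)]
          using * \<beta>(1) R_D(1)[OF f] by (simp add: raut_apply)
      next
        case False
        then have "f a = 0" using R_D(3)[OF f] by blast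
        then show ?thesis using False unfolding skew_act_def by (simp only: if_False ring_of_simps)
      qed
    qed
  qed
  then show ?thesis unfolding skew_invariants_def field_auts_K by (simp only: ball_simps mem_Collect_eq) blast
qed

lemma phi_\<K>: assumes "u \<in> qinv" shows "phi u \<in> \<K>"
  unfolding \<K>_iff
proof (intro conjI ballI)
  show "phi u \<in> carrier R" using assms by (intro phi_closed) (simp add: qinv_def)
  fix h \<beta> assume h: "h \<in> G" and \<beta>: "\<beta> \<in> E"
  have "coef u (relabel (snd h) \<beta>) = pact h (coef u \<beta>)"
    using tact_simps(10)[OF h, of u \<beta>] assms h by (simp add: qinv_def)
  then show "phi u (dil (relabel (snd h) \<beta>)) = ract h (phi u (dil \<beta>))"
    by (simp add: phi_dil relabel_E[OF h \<beta>] \<beta> ract_simps[OF h])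
qed

text \<open>The coefficients define an element of the twisted polynomial ring, and invariance can be read off from either side.\<close>

lemma phi_surj:
  assumes f: "f \<in> \<K>" and poly: "\<And>\<beta>. \<beta> \<in> E \<Longrightarrow> \<exists>a\<in>mpoly_on {..<n}. f (dil \<beta>) = emb a"
  obtains u where "u \<in> qinv" "f = phi u"
proof -
  have fR: "f \<in> carrier R" using f by (simp add: \<K>_iff)
  obtain a where a: "\<And>\<beta>. \<beta> \<in> E \<Longrightarrow> a \<beta> \<in> mpoly_on {..<n} \<and> f (dil \<beta>) = emb (a \<beta>)" using poly by metis
  let ?S = "{\<beta> \<in> E. f (dil \<beta>) \<noteq> 0}"
  have "finite (dil ` ?S)" by (rule finite_subset[OF _ R_D(2)[OF fR]]) auto
  then have fin: "finite ?S" by (rule finite_imageD) (rule inj_on_subset[OF inj_on_dil], auto)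
  define u where "u = (\<Sum>\<beta>\<in>?S. mon \<beta> (a \<beta>))"
  have u: "u \<in> qspace_on {..<n}" unfolding u_def using a by (intro qspace_on_sum qspace_on_mon) auto
  have coef_u: "coef u \<beta> = a \<beta>" if "\<beta> \<in> E" for \<beta>
  proof -
    have "coef u \<beta> = (if \<beta> \<in> ?S then a \<beta> else 0)"
      unfolding u_def lookup_sum lookup_single when_def using fin by (simp cong: if_cong)
    then show ?thesis using a[OF that] that by (auto simp: emb_nonzero)
  qed
  have eq: "f = phi u" by (rule R_ext[OF fR phi_closed[OF u]]) (simp add: phi_dil coef_u a)
  have "tact h u = u" if h: "h \<in> G" for h
  proof (rule poly_mapping_eqI)
    fix \<alpha>
    show "coef (tact h u) \<alpha> = coef u \<alpha>"
    proof (cases "\<alpha> \<in> E")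
      case True
      obtain \<beta> where \<beta>: "\<beta> \<in> E" "\<alpha> = relabel (snd h) \<beta>" by (rule relabel_surj[OF h True])
      have "phi u (dil (relabel (snd h) \<beta>)) = ract h (phi u (dil \<beta>))" using f h \<beta>(1) unfolding \<K>_iff eq by blast
      then show ?thesis
        unfolding \<beta>(2) tact_simps(10)[OF h] phi_dil[OF relabel_E[OF h \<beta>(1)]] phi_dil[OF \<beta>(1)] ract_simps(1)[OF h] emb_simps(6) by (rule sym)
    next
      case False
      then have "\<alpha> \<notin> supp u" "\<alpha> \<notin> supp (tact h u)" using u tact_on[OF h u] by (auto simp: qspace_on_def)
      then show ?thesis by (simp add: in_keys_iff)
    qed
  qed
  then have "u \<in> qinv" using u by (simp add: qinv_def)
  then show ?thesis using that eq by blast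
qed

end

lemma add_generate_subset:
  assumes "H \<subseteq> T" "\<zero>\<^bsub>R\<^esub> \<in> T" "\<And>x y. x \<in> T \<Longrightarrow> y \<in> T \<Longrightarrow> x \<oplus>\<^bsub>R\<^esub> y \<in> T" "\<And>x. x \<in> T \<Longrightarrow> \<ominus>\<^bsub>R\<^esub> x \<in> T"
  shows "generate (add_monoid R) H \<subseteq> T"
proof
  fix x assume "x \<in> generate (add_monoid R) H"
  then show "x \<in> T"
  proof induction
    case one
    show ?case using assms(2) by simp
  next
    case (incl h)
    then show ?case using assms(1) by blast
  next
    case (inv h)
    then show ?case using assms(1,4) by (simp add: a_inv_def subset_iff)
  next
    case (eng h1 h2)
    then show ?case using assms(3) by simp
  qed
qed

lemma add_generate_closed:
  "\<zero>\<^bsub>R\<^esub> \<in> generate (add_monoid R) H" "h \<in> H \<Longrightarrow> h \<in> generate (add_monoid R) H"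
  "x \<in> generate (add_monoid R) H \<Longrightarrow> y \<in> generate (add_monoid R) H \<Longrightarrow> x \<oplus>\<^bsub>R\<^esub> y \<in> generate (add_monoid R) H"
  using generate.one[of "add_monoid R" H] generate.eng[of x "add_monoid R" H y] by (auto intro: generate.incl)

lemma set_mult_I: "a \<in> A \<Longrightarrow> b \<in> B \<Longrightarrow> a \<otimes>\<^bsub>R\<^esub> b \<in> A <#>\<^bsub>R\<^esub> B"
  unfolding set_mult_def by blast

lemma set_mult_E: "x \<in> A <#>\<^bsub>R\<^esub> B \<Longrightarrow> (\<And>a b. a \<in> A \<Longrightarrow> b \<in> B \<Longrightarrow> x = a \<otimes>\<^bsub>R\<^esub> b \<Longrightarrow> P) \<Longrightarrow> P"
  unfolding set_mult_def by blast

context gmpn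
begin

section \<open>The invariants as a Galois order\<close>

abbreviation "U \<equiv> phi ` qinv"

lemma \<K>_R: "f \<in> \<K> \<Longrightarrow> f \<in> carrier R" by (simp add: \<K>_iff)

lemma qinv_on: "u \<in> qinv \<Longrightarrow> u \<in> qspace_on {..<n}" by (simp add: qinv_def)

lemma K_ract: "k \<in> K \<Longrightarrow> h \<in> G \<Longrightarrow> ract h k = k" by (simp add: K_fixed)

lemma \<K>_closed:
  "f \<in> \<K> \<Longrightarrow> g \<in> \<K> \<Longrightarrow> f \<oplus>\<^bsub>R\<^esub> g \<in> \<K>" "f \<in> \<K> \<Longrightarrow> \<ominus>\<^bsub>R\<^esub> f \<in> \<K>" "\<zero>\<^bsub>R\<^esub> \<in> \<K>"
proof -
  show "f \<in> \<K> \<Longrightarrow> g \<in> \<K> \<Longrightarrow> f \<oplus>\<^bsub>R\<^esub> g \<in> \<K>"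
  proof -
    assume f: "f \<in> \<K>" and g: "g \<in> \<K>"
    show "f \<oplus>\<^bsub>R\<^esub> g \<in> \<K>" unfolding \<K>_iff
    proof (intro conjI ballI)
      show "f \<oplus>\<^bsub>R\<^esub> g \<in> carrier R" by (rule R_add_closed[OF \<K>_R[OF f] \<K>_R[OF g]])
      fix h \<beta> assume h: "h \<in> G" and \<beta>: "\<beta> \<in> E"
      have "f (dil (relabel (snd h) \<beta>)) = ract h (f (dil \<beta>))" "g (dil (relabel (snd h) \<beta>)) = ract h (g (dil \<beta>))"
        using f g h \<beta> unfolding \<K>_iff by blast+
      then show "(f \<oplus>\<^bsub>R\<^esub> g) (dil (relabel (snd h) \<beta>)) = ract h ((f \<oplus>\<^bsub>R\<^esub> g) (dil \<beta>))"
        unfolding R_simps(3) by (simp only: ract_simps(2)[OF h])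
    qed
  qed
  show "f \<in> \<K> \<Longrightarrow> \<ominus>\<^bsub>R\<^esub> f \<in> \<K>"
  proof -
    assume f: "f \<in> \<K>"
    show "\<ominus>\<^bsub>R\<^esub> f \<in> \<K>" using f unfolding R_minus[OF \<K>_R[OF f]] \<K>_iff
      by (simp add: R_minus_closed ract_minus)
  qed
  show "\<zero>\<^bsub>R\<^esub> \<in> \<K>"
    using phi_\<K>[of 0] subring_setD(1)[OF subring_qinv] by (simp add: phi_zero)
qed

lemma left_mult_closed: "x \<in> LC \<Longrightarrow> f \<in> carrier R \<Longrightarrow> sk x \<otimes>\<^bsub>R\<^esub> f \<in> carrier R"
  unfolding sk_left
proof (rule R_I)
  assume x: "x \<in> LC" and f: "f \<in> carrier R"
  show "x * f a \<in> LC" for a using x R_D(1)[OF f] by (rule LCD(4))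
  show "finite {a. x * f a \<noteq> 0}" by (rule finite_subset[OF _ R_D(2)[OF f]]) auto
  show "a \<in> M" if "x * f a \<noteq> 0" for a using that R_D(3)[OF f, of a] by (metis mult_zero_right)
qed

lemma right_mult_closed: "x \<in> LC \<Longrightarrow> f \<in> carrier R \<Longrightarrow> f \<otimes>\<^bsub>R\<^esub> sk x \<in> carrier R"
  unfolding sk_right
proof (rule R_I)
  assume x: "x \<in> LC" and f: "f \<in> carrier R"
  show "f a * a x \<in> LC" for a
    using x R_D(1,3)[OF f, of a] M_LC[of a x] LCD(1,4) by (cases "f a = 0") auto
  show "finite {a. f a * a x \<noteq> 0}" by (rule finite_subset[OF _ R_D(2)[OF f]]) auto
  show "a \<in> M" if "f a * a x \<noteq> 0" for a using that R_D(3)[OF f, of a] by (metis mult_zero_left)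
qed

lemma \<K>_left: assumes "k \<in> K" "f \<in> \<K>" shows "sk k \<otimes>\<^bsub>R\<^esub> f \<in> \<K>"
  unfolding \<K>_iff
proof (intro conjI ballI)
  have k: "k \<in> LC" using assms(1) K_LC by blast
  note f = \<K>_R[OF assms(2)]
  show "sk k \<otimes>\<^bsub>R\<^esub> f \<in> carrier R" by (rule left_mult_closed[OF k f])
  fix h \<beta> assume "h \<in> G" "\<beta> \<in> E"
  then show "(sk k \<otimes>\<^bsub>R\<^esub> f) (dil (relabel (snd h) \<beta>)) = ract h ((sk k \<otimes>\<^bsub>R\<^esub> f) (dil \<beta>))"
    using assms K_ract[OF assms(1)] unfolding sk_left[OF k f] \<K>_iff by (simp add: ract_simps)
qed

lemma ract_rdil: "h \<in> G \<Longrightarrow> ract h (rdil \<beta> x) = rdil (relabel (snd h) \<beta>) (ract h x)"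
  unfolding rsub_comp(1)[OF dil_subst G_subst] rsub_comp(1)[OF G_subst dil_subst]
  using G_cases(3)[of h] by (simp add: mult.commute)

lemma \<K>_right: assumes "k \<in> K" "f \<in> \<K>" shows "f \<otimes>\<^bsub>R\<^esub> sk k \<in> \<K>"
  unfolding \<K>_iff
proof (intro conjI ballI)
  have k: "k \<in> LC" using assms(1) K_LC by blast
  note f = \<K>_R[OF assms(2)]
  show "f \<otimes>\<^bsub>R\<^esub> sk k \<in> carrier R" by (rule right_mult_closed[OF k f])
  fix h \<beta> assume h: "h \<in> G" and \<beta>: "\<beta> \<in> E"
  have "f (dil (relabel (snd h) \<beta>)) = ract h (f (dil \<beta>))" using assms(2) h \<beta> unfolding \<K>_iff by blast
  moreover have "rdil (relabel (snd h) \<beta>) k = ract h (rdil \<beta> k)"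
    using ract_rdil[OF h, of \<beta> k] K_ract[OF assms(1) h] by simp
  ultimately show "(f \<otimes>\<^bsub>R\<^esub> sk k) (dil (relabel (snd h) \<beta>)) = ract h ((f \<otimes>\<^bsub>R\<^esub> sk k) (dil \<beta>))"
    unfolding sk_right[OF k f] raut_apply[OF k] by (simp only: ract_simps(3)[OF h])
qed

lemma phi_left: "f \<in> mpoly_on {..<n} \<Longrightarrow> u \<in> qspace_on {..<n} \<Longrightarrow> sk (emb f) \<otimes>\<^bsub>R\<^esub> phi u = phi (mon 0 f * u)"
  by (simp add: phi_poly[symmetric] phi_mult[symmetric] qspace_on_mon qmul_x_left)

lemma phi_right: "f \<in> mpoly_on {..<n} \<Longrightarrow> u \<in> qspace_on {..<n} \<Longrightarrow> phi u \<otimes>\<^bsub>R\<^esub> sk (emb f) = phi (qmul q u (mon 0 f))"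
  by (simp add: phi_poly[symmetric] phi_mult[symmetric] qspace_on_mon)

lemma phi_a_inv: "u \<in> qspace_on {..<n} \<Longrightarrow> \<ominus>\<^bsub>R\<^esub> phi u = phi (- u)"
  by (simp add: R_minus phi_closed phi_minus)

lemma qinv_closed: "u \<in> qinv \<Longrightarrow> v \<in> qinv \<Longrightarrow> u + v \<in> qinv" "u \<in> qinv \<Longrightarrow> - u \<in> qinv" "0 \<in> qinv" "1 \<in> qinv"
  using subring_setD[OF subring_qinv] by auto

lemma subring_U: "subring U R"
proof (intro subring.intro subgroup.intro submonoid.intro)
  interpret comm_group "add_monoid R" by (rule group_R)
  show "U \<subseteq> carrier (add_monoid R)" "U \<subseteq> carrier R" by (auto intro: phi_closed qinv_on)
  show "x \<otimes>\<^bsub>add_monoid R\<^esub> y \<in> U" if xy: "x \<in> U" "y \<in> U" for x y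
  proof -
    obtain u v where "u \<in> qinv" "v \<in> qinv" "x = phi u" "y = phi v" using xy by blast
    then show ?thesis using qinv_closed(1)[of u v] by (simp add: phi_add[symmetric])
  qed
  show "\<one>\<^bsub>add_monoid R\<^esub> \<in> U" using qinv_closed(3) by (auto simp: phi_zero[symmetric])
  show "inv\<^bsub>add_monoid R\<^esub> x \<in> U" if x: "x \<in> U" for x
  proof -
    obtain u where "u \<in> qinv" "x = phi u" using x by blast
    then show ?thesis using phi_a_inv[OF qinv_on, of u] qinv_closed(2)[of u] by (simp add: a_inv_def)
  qed
  show "x \<otimes>\<^bsub>R\<^esub> y \<in> U" if xy: "x \<in> U" "y \<in> U" for x y
  proof -
    obtain u v where "u \<in> qinv" "v \<in> qinv" "x = phi u" "y = phi v" using xy by blast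
    then show ?thesis using qinv_qmul[of u v] by (simp add: phi_mult[OF qinv_on qinv_on, symmetric])
  qed
  show "\<one>\<^bsub>R\<^esub> \<in> U" using qinv_closed(4) by (auto simp: phi_one[symmetric])
qed

lemma \<Gamma>_U: "sk ` \<Gamma>L \<subseteq> U"
  using mon_pinv pinv_on by (auto simp: phi_poly[symmetric])

subsection \<open>Spans over \<open>K\<close>\<close>

lemma common_denominator:
  assumes "finite S" "\<And>s. s \<in> S \<Longrightarrow> y s \<in> LC"
  shows "\<exists>d\<in>pinv. d \<noteq> 0 \<and> (\<forall>s\<in>S. \<exists>a\<in>mpoly_on {..<n}. y s * emb d = emb a)"
  using assms
proof (induction S rule: finite_induct)
  case empty
  show ?case by (rule bexI[of _ 1]) (use subring_setD(2)[OF subring_pinv] in auto)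
next
  case (insert s S)
  then obtain d where d: "d \<in> pinv" "d \<noteq> 0" "\<And>s. s \<in> S \<Longrightarrow> \<exists>a\<in>mpoly_on {..<n}. y s * emb d = emb a" by blast
  obtain a e where e: "a \<in> mpoly_on {..<n}" "e \<in> pinv" "e \<noteq> 0" "y s * emb e = emb a"
    using invariant_denominator[of "y s"] insert.prems by blast
  have "\<exists>a\<in>mpoly_on {..<n}. y t * emb (d * e) = emb a" if t: "t \<in> insert s S" for t
  proof (cases "t = s")
    case True
    have "y t * emb (d * e) = emb (a * d)" using e(4) by (simp add: True emb_simps ac_simps)
    then show ?thesis using e(1) d(1) by (intro bexI[of _ "a * d"]) (auto intro: mpoly_on_mult pinv_on)
  next
    case False
    then obtain b where b: "b \<in> mpoly_on {..<n}" "y t * emb d = emb b" using d(3) t by blast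
    have "y t * emb (d * e) = emb (b * e)" by (simp add: emb_simps b(2)[symmetric] ac_simps)
    then show ?thesis using b(1) e(2) by (intro bexI[of _ "b * e"]) (auto intro: mpoly_on_mult pinv_on)
  qed
  then show ?case using d e subring_setD(4)[OF subring_pinv, of d e] by (intro bexI[of _ "d * e"]) auto
qed

lemma inverse_K: "d \<in> pinv \<Longrightarrow> inverse (emb d) \<in> K"
  using subfield_K \<Gamma>_K unfolding subfield_set_def by blast

text \<open>Left multiplication by \<open>d \<in> \<Gamma>\<close> keeps invariance and clears the denominators of the finitely many coefficients.\<close>

lemma \<K>_clear_left:
  assumes f: "f \<in> \<K>" obtains d u where "d \<in> pinv" "d \<noteq> 0" "u \<in> qinv" "f = sk (inverse (emb d)) \<otimes>\<^bsub>R\<^esub> phi u"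
proof -
  note fR = \<K>_R[OF f]
  obtain d where d: "d \<in> pinv" "d \<noteq> 0" "\<And>a. f a \<noteq> 0 \<Longrightarrow> \<exists>b\<in>mpoly_on {..<n}. f a * emb d = emb b"
    using common_denominator[OF R_D(2)[OF fR], of f] R_D(1)[OF fR] by blast
  have dK: "emb d \<in> K" using \<Gamma>_K d(1) by blast
  then have dL: "emb d \<in> LC" using K_LC by blast
  have iL: "inverse (emb d) \<in> LC" using LC_inverse[OF dL] .
  have "\<exists>b\<in>mpoly_on {..<n}. (sk (emb d) \<otimes>\<^bsub>R\<^esub> f) (dil \<beta>) = emb b" for \<beta>
  proof (cases "f (dil \<beta>) = 0")
    case True
    then show ?thesis unfolding sk_left[OF dL fR] by (intro bexI[of _ 0]) (auto simp: emb_simps)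
  next
    case False
    then show ?thesis using d(3)[of "dil \<beta>"] unfolding sk_left[OF dL fR] by (simp add: mult.commute)
  qed
  then obtain u where u: "u \<in> qinv" "sk (emb d) \<otimes>\<^bsub>R\<^esub> f = phi u" by (rule phi_surj[OF \<K>_left[OF dK f]])
  have "f = sk (inverse (emb d)) \<otimes>\<^bsub>R\<^esub> phi u"
    unfolding u(2)[symmetric] sk_left[OF iL left_mult_closed[OF dL fR]] unfolding sk_left[OF dL fR]
    using d(2) by (simp add: emb_nonzero mult.assoc[symmetric])
  then show ?thesis using that d u by blast
qed

text \<open>On the right, the factor \<open>d\<close> meets the coefficient at \<open>a\<close> only after \<open>a\<close> has been applied to it. So the
  denominators to be cleared are those of the preimages of the coefficients under their dilations.\<close>

lemma \<K>_clear_right: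
  assumes f: "f \<in> \<K>" obtains d u where "d \<in> pinv" "d \<noteq> 0" "u \<in> qinv" "f = phi u \<otimes>\<^bsub>R\<^esub> sk (inverse (emb d))"
proof -
  note fR = \<K>_R[OF f]
  have "\<exists>y. y \<in> LC \<and> a y = f a" if "a \<in> M" for a
  proof -
    have "bij_betw a LC LC" using M_BG[OF that] unfolding carrier_BG Bij_def by blast
    then have "f a \<in> a ` LC" using R_D(1)[OF fR] by (simp add: bij_betw_def)
    then show ?thesis by auto
  qed
  \<comment> \<open>the coefficients written on the right of the dilations: \<open>f a \<cdot> a = a \<cdot> y a\<close>\<close>
  then obtain y where y: "\<And>a. a \<in> M \<Longrightarrow> y a \<in> LC \<and> a (y a) = f a" by metis
  obtain d where d: "d \<in> pinv" "d \<noteq> 0" "\<And>a. f a \<noteq> 0 \<Longrightarrow> \<exists>b\<in>mpoly_on {..<n}. y a * emb d = emb b"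
    using common_denominator[OF R_D(2)[OF fR], of y] R_D(3)[OF fR] y by blast
  have dK: "emb d \<in> K" using \<Gamma>_K d(1) by blast
  then have dL: "emb d \<in> LC" using K_LC by blast
  have iL: "inverse (emb d) \<in> LC" using LC_inverse[OF dL] .
  have "\<exists>b\<in>mpoly_on {..<n}. (f \<otimes>\<^bsub>R\<^esub> sk (emb d)) (dil \<beta>) = emb b" if \<beta>: "\<beta> \<in> E" for \<beta>
  proof (cases "f (dil \<beta>) = 0")
    case True
    then show ?thesis unfolding sk_right[OF dL fR] by (intro bexI[of _ 0]) (auto simp: emb_simps)
  next
    case False
    then obtain b where b: "b \<in> mpoly_on {..<n}" "y (dil \<beta>) * emb d = emb b" using d(3) by blast
    have m: "dil \<beta> \<in> M" using \<beta> by blast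
    have "f (dil \<beta>) * dil \<beta> (emb d) = dil \<beta> (y (dil \<beta>)) * dil \<beta> (emb d)" using y[OF m] by simp
    also have "\<dots> = dil \<beta> (emb b)" unfolding b(2)[symmetric] using M_hom(1)[OF m _ dL] y[OF m] by simp
    also have "\<dots> = emb (qshift q \<beta> b)" using b(1) by (simp add: raut_apply emb_rat_on rdil_simps)
    finally show ?thesis unfolding sk_right[OF dL fR]
      by (intro bexI[of _ "qshift q \<beta> b"]) (auto intro: mpoly_on_msub b(1))
  qed
  then obtain u where u: "u \<in> qinv" "f \<otimes>\<^bsub>R\<^esub> sk (emb d) = phi u" by (rule phi_surj[OF \<K>_right[OF dK f]])
  have "f a * a (emb d) * a (inverse (emb d)) = f a" for a
  proof (cases "f a = 0")
    case False
    then have m: "a \<in> M" using R_D(3)[OF fR] by blast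
    have "a (emb d) * a (inverse (emb d)) = 1"
      using M_hom[OF m] dL iL d(2) by (simp add: emb_nonzero flip: M_hom(1)[OF m dL iL])
    then show ?thesis by (simp add: mult.assoc)
  qed simp
  note eq = this
  have "f = phi u \<otimes>\<^bsub>R\<^esub> sk (inverse (emb d))"
    unfolding u(2)[symmetric] sk_right[OF iL right_mult_closed[OF dL fR]]
    unfolding sk_right[OF dL fR] by (intro HOL.ext eq[symmetric])
  then show ?thesis using that d u by blast
qed

lemma span_left: "left_span R (sk ` K) U = \<K>"
proof (intro subset_antisym subsetI)
  fix x assume x: "x \<in> left_span R (sk ` K) U"
  have "generate (add_monoid R) (sk ` K <#>\<^bsub>R\<^esub> U) \<subseteq> \<K>"
    by (rule add_generate_subset) (auto elim!: set_mult_E simp del: ring_of_simps intro: \<K>_closed \<K>_left phi_\<K>)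
  with x show "x \<in> \<K>" unfolding left_span_def by blast
next
  fix f assume "f \<in> \<K>"
  then obtain d u where f: "d \<in> pinv" "d \<noteq> 0" "u \<in> qinv" "f = sk (inverse (emb d)) \<otimes>\<^bsub>R\<^esub> phi u" by (rule \<K>_clear_left)
  show "f \<in> left_span R (sk ` K) U"
    unfolding left_span_def f(4) by (intro add_generate_closed(2) set_mult_I imageI inverse_K f)
qed

lemma span_right: "right_span R (sk ` K) U = \<K>"
proof (intro subset_antisym subsetI)
  fix x assume x: "x \<in> right_span R (sk ` K) U"
  have "generate (add_monoid R) (U <#>\<^bsub>R\<^esub> sk ` K) \<subseteq> \<K>"
    by (rule add_generate_subset) (auto elim!: set_mult_E simp del: ring_of_simps intro: \<K>_closed \<K>_right phi_\<K>)
  with x show "x \<in> \<K>" unfolding right_span_def by blast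
next
  fix f assume "f \<in> \<K>"
  then obtain d u where f: "d \<in> pinv" "d \<noteq> 0" "u \<in> qinv" "f = phi u \<otimes>\<^bsub>R\<^esub> sk (inverse (emb d))" by (rule \<K>_clear_right)
  show "f \<in> right_span R (sk ` K) U"
    unfolding right_span_def f(4) by (intro add_generate_closed(2) set_mult_I imageI inverse_K f)
qed

subsection \<open>Intersections with finite-dimensional subspaces\<close>

lemma support_of_span:
  assumes H: "\<And>h. h \<in> H \<Longrightarrow> h \<in> carrier R \<and> {a. h a \<noteq> 0} \<subseteq> S" and w: "w \<in> generate (add_monoid R) H"
  shows "w \<in> carrier R \<and> {a. w a \<noteq> 0} \<subseteq> S"
proof -
  have "generate (add_monoid R) H \<subseteq> {w \<in> carrier R. {a. w a \<noteq> 0} \<subseteq> S}"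
  proof (rule add_generate_subset)
    show "\<zero>\<^bsub>R\<^esub> \<in> {w \<in> carrier R. {a. w a \<noteq> 0} \<subseteq> S}"
      using \<K>_R[OF \<K>_closed(3)] by (simp add: R_simps(2))
    show "x \<oplus>\<^bsub>R\<^esub> y \<in> {w \<in> carrier R. {a. w a \<noteq> 0} \<subseteq> S}"
      if xy: "x \<in> {w \<in> carrier R. {a. w a \<noteq> 0} \<subseteq> S}" "y \<in> {w \<in> carrier R. {a. w a \<noteq> 0} \<subseteq> S}" for x y
    proof -
      have "x a \<noteq> 0 \<or> y a \<noteq> 0" if "(x \<oplus>\<^bsub>R\<^esub> y) a \<noteq> 0" for a using that by (auto simp: R_simps(3))
      then show ?thesis using xy R_add_closed by blast
    qed
    show "\<ominus>\<^bsub>R\<^esub> x \<in> {w \<in> carrier R. {a. w a \<noteq> 0} \<subseteq> S}" if "x \<in> {w \<in> carrier R. {a. w a \<noteq> 0} \<subseteq> S}" for x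
      using that R_minus_closed[of x] by (simp add: R_minus)
  qed (use H in blast)
  with w show ?thesis by blast
qed

lemma finite_exponents: "finite S \<Longrightarrow> finite {\<beta> \<in> E. dil \<beta> \<in> S}"
proof (rule finite_imageD)
  show "finite S \<Longrightarrow> finite (dil ` {\<beta> \<in> E. dil \<beta> \<in> S})" by (rule finite_subset[of _ S]) auto
qed (rule inj_on_subset[OF inj_on_dil], auto)

lemma phi_supp: "u \<in> qspace_on {..<n} \<Longrightarrow> {a. phi u a \<noteq> 0} \<subseteq> S \<Longrightarrow> supp u \<subseteq> {\<beta> \<in> E. dil \<beta> \<in> S}"
  unfolding phi_support by (auto simp: qspace_on_def)

text \<open>Left and right multiplication by \<open>K\<close> are treated together: \<open>act k\<close> is one of them, and \<open>T\<close>, with inverse \<open>T'\<close>,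
  is the coordinate change of the invariants that turns it into coefficientwise multiplication. The elements of
  \<open>W\<close> are supported on the dilations that occur in a finite spanning set, so the invariants that map to \<open>W\<close> have
  bounded support and finitely many of them generate the rest over \<open>\<Gamma>\<close>.\<close>

lemma fin_gen_intersection:
  fixes T T' :: "'k qspace \<Rightarrow> 'k qspace"
  assumes act: "\<And>k f. k \<in> LC \<Longrightarrow> f \<in> carrier R \<Longrightarrow> act k f \<in> carrier R"
      "\<And>k f a. k \<in> LC \<Longrightarrow> f \<in> carrier R \<Longrightarrow> act k f a \<noteq> 0 \<Longrightarrow> f a \<noteq> 0"
      "\<And>k l f. k \<in> LC \<Longrightarrow> l \<in> LC \<Longrightarrow> f \<in> carrier R \<Longrightarrow> act l (act k f) = act (l * k) f"
      "\<And>k f g. k \<in> LC \<Longrightarrow> f \<in> carrier R \<Longrightarrow> g \<in> carrier R \<Longrightarrow> act k (f \<oplus>\<^bsub>R\<^esub> g) = act k f \<oplus>\<^bsub>R\<^esub> act k g"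
      "\<And>k. k \<in> LC \<Longrightarrow> act k \<zero>\<^bsub>R\<^esub> = \<zero>\<^bsub>R\<^esub>"
      "\<And>k f. k \<in> LC \<Longrightarrow> f \<in> carrier R \<Longrightarrow> act k (\<ominus>\<^bsub>R\<^esub> f) = act (- k) f" "\<And>f. f \<in> carrier R \<Longrightarrow> act 1 f = f"
    and phi_act: "\<And>f u. f \<in> pinv \<Longrightarrow> u \<in> qinv \<Longrightarrow> act (emb f) (phi u) = phi (T' (mon 0 f * T u))"
    and T: "\<And>u v. T (u + v) = T u + T v" "\<And>u v. T' (u + v) = T' u + T' v" "\<And>u. T' (T u) = u" "\<And>u. T (T' u) = u"
      "\<And>u. u \<in> qinv \<Longrightarrow> T u \<in> qinv" "\<And>u. u \<in> qinv \<Longrightarrow> T' u \<in> qinv" "\<And>u. supp (T u) \<subseteq> supp u"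
    and W: "W \<subseteq> \<K>" "finite B" "B \<subseteq> W" and W_gen: "W = generate (add_monoid R) {act k b | k b. k \<in> K \<and> b \<in> B}"
  shows "\<exists>B'. finite B' \<and> B' \<subseteq> W \<inter> U \<and> W \<inter> U = generate (add_monoid R) {act k b | k b. k \<in> \<Gamma>L \<and> b \<in> B'}"
proof -
  have BR: "b \<in> carrier R" if "b \<in> B" for b using that W \<K>_R by blast
  have KL: "k \<in> LC" if "k \<in> K" for k using that K_LC by blast
  let ?S = "\<Union>b\<in>B. {a. b a \<noteq> 0}"
  have base: "act k b \<in> carrier R \<and> {a. act k b a \<noteq> 0} \<subseteq> ?S" if "k \<in> K" "b \<in> B" for k b
    using act(1,2)[OF KL BR] that by blast
  have supp_W: "w \<in> carrier R \<and> {a. w a \<noteq> 0} \<subseteq> ?S" if "w \<in> W" for w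
  proof (rule support_of_span)
    show "h \<in> carrier R \<and> {a. h a \<noteq> 0} \<subseteq> ?S" if "h \<in> {act k b | k b. k \<in> K \<and> b \<in> B}" for h
      using that base by blast
  qed (use that W_gen in blast)
  have W_add: "x \<oplus>\<^bsub>R\<^esub> y \<in> W" if "x \<in> W" "y \<in> W" for x y
    using that unfolding W_gen by (rule add_generate_closed(3))
  have W_zero: "\<zero>\<^bsub>R\<^esub> \<in> W" unfolding W_gen by (rule add_generate_closed(1))
  have W_K: "act k w \<in> W" if "k \<in> K" "w \<in> W" for k w
  proof -
    let ?X = "{w \<in> carrier R. \<forall>k\<in>K. act k w \<in> W}"
    have "generate (add_monoid R) {act k b | k b. k \<in> K \<and> b \<in> B} \<subseteq> ?X"
    proof (rule add_generate_subset)
      show "{act k b | k b. k \<in> K \<and> b \<in> B} \<subseteq> ?X"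
      proof
        fix x assume "x \<in> {act k b | k b. k \<in> K \<and> b \<in> B}"
        then obtain k b where k: "k \<in> K" "b \<in> B" "x = act k b" by blast
        have "act l x \<in> W" if l: "l \<in> K" for l
        proof -
          have lk: "l * k \<in> K" using subfield_K l k(1) unfolding subfield_set_def subring_set_def by blast
          show ?thesis unfolding k(3) act(3)[OF KL[OF k(1)] KL[OF l] BR[OF k(2)]] W_gen
            using lk k(2) by (intro add_generate_closed(2)) blast
        qed
        then show "x \<in> ?X" using base[OF k(1,2)] k(3) by blast
      qed
      show "\<zero>\<^bsub>R\<^esub> \<in> ?X" using \<K>_R[OF \<K>_closed(3)] act(5)[OF KL] W_zero by simp
      show "x \<oplus>\<^bsub>R\<^esub> y \<in> ?X" if xy: "x \<in> ?X" "y \<in> ?X" for x y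
        using xy act(4)[OF KL, of _ x y] W_add R_add_closed[of x y] by simp
      show "\<ominus>\<^bsub>R\<^esub> x \<in> ?X" if x: "x \<in> ?X" for x
      proof -
        have c: "x \<in> carrier R" using x by blast
        have mk: "- k \<in> K" if "k \<in> K" for k using subfield_K that unfolding subfield_set_def subring_set_def by blast
        have "act k (\<ominus>\<^bsub>R\<^esub> x) \<in> W" if k: "k \<in> K" for k
          unfolding act(6)[OF KL[OF k] c] using x mk[OF k] by blast
        then show ?thesis using R_minus_closed[OF c] by (simp add: R_minus[OF c])
      qed
    qed
    then show ?thesis using that W_gen by blast
  qed
  have W_minus: "\<ominus>\<^bsub>R\<^esub> w \<in> W" if w: "w \<in> W" for w
  proof -
    have m1: "- 1 \<in> K" and one: "1 \<in> K" using subfield_K unfolding subfield_set_def subring_set_def by blast+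
    have c: "w \<in> carrier R" using supp_W[OF w] by blast
    have "\<ominus>\<^bsub>R\<^esub> w = act 1 (\<ominus>\<^bsub>R\<^esub> w)" using act(7)[of "\<ominus>\<^bsub>R\<^esub> w"] R_minus_closed[OF c] by (simp add: R_minus[OF c])
    also have "\<dots> = act (- 1) w" by (rule act(6)[OF KL[OF one] c])
    finally show ?thesis using W_K[OF m1 w] by (simp only:)
  qed
  \<comment> \<open>the invariants corresponding to \<open>W \<inter> U\<close>\<close>
  define N where "N = {u \<in> qinv. phi u \<in> W}"
  have WU: "W \<inter> U = phi ` N" unfolding N_def by blast
  have finS: "finite ?S" using W(2) R_D(2)[OF BR] by blast
  have TN: "T ` N \<subseteq> qinv" unfolding N_def using T(5) by blast
  have supp_N: "supp v \<subseteq> {\<beta> \<in> E. dil \<beta> \<in> ?S}" if v: "v \<in> T ` N" for v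
  proof -
    obtain u where u: "u \<in> qinv" "phi u \<in> W" "v = T u" using v unfolding N_def by blast
    have "supp u \<subseteq> {\<beta> \<in> E. dil \<beta> \<in> ?S}" by (rule phi_supp[OF qinv_on[OF u(1)]]) (use supp_W[OF u(2)] in blast)
    then show ?thesis unfolding u(3) using T(7) by blast
  qed
  \<comment> \<open>finite generation is available after the change of coordinates\<close>
  obtain B1 where B1: "finite B1" "B1 \<subseteq> T ` N" "T ` N \<subseteq> gspan \<Gamma>0 B1"
    by (rule qinv_noetherian[OF finite_exponents[OF finS] TN supp_N])
  define B' where "B' = T' ` B1"
  have B'N: "B' \<subseteq> N" unfolding B'_def using B1(2) T(3) by auto
  have B'_qinv: "B' \<subseteq> qinv" using B'N N_def by blast
  let ?H = "{act k b | k b. k \<in> \<Gamma>L \<and> b \<in> phi ` B'}"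
  have "W \<inter> U = generate (add_monoid R) ?H"
  proof (intro subset_antisym subsetI)
    fix x assume "x \<in> W \<inter> U"
    then obtain u where u: "u \<in> N" "x = phi u" unfolding WU by blast
    then have "T u \<in> gspan \<Gamma>0 B1" using B1(3) by blast
    then have "phi (T' (T u)) \<in> generate (add_monoid R) ?H"
    proof induction
      case gspan_zero
      have "T' 0 = 0 + T' 0" "T' 0 = T' 0 + T' 0" using T(2)[of 0 0] by (simp_all only: add_0)
      then have "T' 0 = 0" by (simp only: add_cancel_right_right)
      then show ?case by (simp only: phi_zero add_generate_closed(1))
    next
      case (gspan_step s b w)
      then obtain f where f: "f \<in> pinv" "s = mon 0 f" by blast
      have b': "T' b \<in> B'" unfolding B'_def using gspan_step(2) by blast
      have "act (emb f) (phi (T' b)) = phi (T' (s * b))"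
        unfolding f(2) using phi_act[OF f(1) subsetD[OF B'_qinv b']] by (simp only: T(4))
      moreover have "act (emb f) (phi (T' b)) \<in> generate (add_monoid R) ?H"
        using f(1) b' by (intro add_generate_closed(2)) blast
      ultimately have "phi (T' (s * b)) \<in> generate (add_monoid R) ?H" by (simp only:)
      then show ?case unfolding T(2) phi_add using gspan_step.IH by (rule add_generate_closed(3))
    qed
    then show "x \<in> generate (add_monoid R) ?H" unfolding T(3) u(2) .
  next
    have "generate (add_monoid R) ?H \<subseteq> phi ` N"
    proof (rule add_generate_subset)
      show "?H \<subseteq> phi ` N"
      proof
        fix x assume "x \<in> ?H"
        then obtain f b where fb: "f \<in> pinv" "b \<in> B'" "x = act (emb f) (phi b)" by blast
        have bq: "b \<in> qinv" and bW: "phi b \<in> W" using fb(2) B'N unfolding N_def by blast+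
        have "x \<in> W" unfolding fb(3) using fb(1) \<Gamma>_K bW by (intro W_K) blast
        moreover have "x \<in> U" unfolding fb(3) phi_act[OF fb(1) bq]
          by (intro imageI T(5,6) subring_setD(4)[OF subring_qinv] mon_pinv fb(1) bq)
        ultimately show "x \<in> phi ` N" using WU by blast
      qed
      show "\<zero>\<^bsub>R\<^esub> \<in> phi ` N" using W_zero qinv_closed(3) unfolding N_def phi_zero[symmetric] by blast
      show "x \<oplus>\<^bsub>R\<^esub> y \<in> phi ` N" if xy: "x \<in> phi ` N" "y \<in> phi ` N" for x y
        using xy W_add subring.axioms(1)[OF subring_U] unfolding WU[symmetric]
        using subgroup.m_closed[of U "add_monoid R" x y] by simp
      show "\<ominus>\<^bsub>R\<^esub> x \<in> phi ` N" if x: "x \<in> phi ` N" for x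
        using x W_minus subgroup.m_inv_closed[OF subring.axioms(1)[OF subring_U], of x] unfolding WU[symmetric]
        by (simp add: a_inv_def)
    qed
    then show "x \<in> W \<inter> U" if "x \<in> generate (add_monoid R) ?H" for x using that unfolding WU by blast
  qed
  moreover have "finite (phi ` B')" "phi ` B' \<subseteq> W \<inter> U" using B1(1) B'N WU unfolding B'_def by auto
  ultimately show ?thesis by blast
qed

lemma left_order:
  assumes W: "W \<subseteq> \<K>" "fin_gen_left R (sk ` K) W"
  shows "fin_gen_left R (sk ` \<Gamma>L) (W \<inter> U)"
proof -
  have span: "left_span R (sk ` Z) B = generate (add_monoid R) {sk k \<otimes>\<^bsub>R\<^esub> b | k b. k \<in> Z \<and> b \<in> B}" for Z B
    unfolding left_span_def set_mult_def by (rule arg_cong[of _ _ "generate (add_monoid R)"]) blast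
  obtain B where B: "finite B" "B \<subseteq> W" "W = left_span R (sk ` K) B" using W(2) unfolding fin_gen_left_def by blast
  show ?thesis unfolding fin_gen_left_def span
  proof (rule fin_gen_intersection[where T = "\<lambda>u. u" and T' = "\<lambda>u. u" and act = "\<lambda>k f. sk k \<otimes>\<^bsub>R\<^esub> f", OF _ _ _ _ _ _ _ _ _ _ _ _ _ _ _ W(1) B(1,2)])
    fix k l f g a assume k: "k \<in> LC" and f: "f \<in> carrier R"
    show kf: "sk k \<otimes>\<^bsub>R\<^esub> f \<in> carrier R" by (rule left_mult_closed[OF k f])
    show "f a \<noteq> 0" if "(sk k \<otimes>\<^bsub>R\<^esub> f) a \<noteq> 0" using that unfolding sk_left[OF k f] by auto
    show "sk l \<otimes>\<^bsub>R\<^esub> (sk k \<otimes>\<^bsub>R\<^esub> f) = sk (l * k) \<otimes>\<^bsub>R\<^esub> f" if l: "l \<in> LC"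
      unfolding sk_left[OF l kf] sk_left[OF LCD(4)[OF l k] f] unfolding sk_left[OF k f] by (simp add: mult.assoc)
    show "sk k \<otimes>\<^bsub>R\<^esub> (f \<oplus>\<^bsub>R\<^esub> g) = sk k \<otimes>\<^bsub>R\<^esub> f \<oplus>\<^bsub>R\<^esub> sk k \<otimes>\<^bsub>R\<^esub> g" if g: "g \<in> carrier R"
      unfolding sk_left[OF k R_add_closed[OF f g]] sk_left[OF k f] sk_left[OF k g] unfolding R_simps(3) by (simp add: distrib_left)
    show "sk k \<otimes>\<^bsub>R\<^esub> (\<ominus>\<^bsub>R\<^esub> f) = sk (- k) \<otimes>\<^bsub>R\<^esub> f"
      unfolding R_minus[OF f] sk_left[OF k R_minus_closed[OF f]] sk_left[OF LCD(5)[OF k] f] by simp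
  next
    fix f assume f: "f \<in> carrier R"
    show "sk 1 \<otimes>\<^bsub>R\<^esub> f = f" unfolding sk_left[OF LCD(2) f] by simp
  next
    fix k assume k: "k \<in> LC"
    show "sk k \<otimes>\<^bsub>R\<^esub> \<zero>\<^bsub>R\<^esub> = \<zero>\<^bsub>R\<^esub>"
      unfolding sk_left[OF k \<K>_R[OF \<K>_closed(3)]] unfolding R_simps(2) by simp
  next
    fix f u assume "f \<in> pinv" "u \<in> qinv"
    then show "sk (emb f) \<otimes>\<^bsub>R\<^esub> phi u = phi (mon 0 f * u)" by (intro phi_left pinv_on qinv_on)
  qed (auto simp only: B(3) span)
qed

lemma right_order:
  assumes W: "W \<subseteq> \<K>" "fin_gen_right R (sk ` K) W"
  shows "fin_gen_right R (sk ` \<Gamma>L) (W \<inter> U)"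
proof -
  have span: "right_span R (sk ` Z) B = generate (add_monoid R) {b \<otimes>\<^bsub>R\<^esub> sk k | k b. k \<in> Z \<and> b \<in> B}" for Z B
    unfolding right_span_def set_mult_def by (rule arg_cong[of _ _ "generate (add_monoid R)"]) blast
  obtain B where B: "finite B" "B \<subseteq> W" "W = right_span R (sk ` K) B" using W(2) unfolding fin_gen_right_def by blast
  have cases: "f a * x = f a * y" if "f \<in> carrier R" "a \<in> M \<Longrightarrow> x = y" for f a x y
    using that R_D(3)[OF that(1), of a] by (cases "f a = 0") auto
  have M_add: "a (- k) = - a k" if a: "a \<in> M" and k: "k \<in> LC" for a k
  proof -
    obtain \<beta> where "a = dil \<beta>" using a by blast
    moreover have "rdil \<beta> (- k) = - rdil \<beta> k" by (rule additive.minus) (simp only: additive_def rsub_simps(2)[OF dil_subst] simp_thms)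
    ultimately show ?thesis using k LCD(5) by (simp add: raut_apply)
  qed
  show ?thesis unfolding fin_gen_right_def span
  proof (rule fin_gen_intersection[where T = "twist (inverse q)" and T' = "twist q" and act = "\<lambda>k f. f \<otimes>\<^bsub>R\<^esub> sk k", OF _ _ _ _ _ _ _ _ _ _ _ _ _ _ _ W(1) B(1,2)])
    fix k l f g a assume k: "k \<in> LC" and f: "f \<in> carrier R"
    show kf: "f \<otimes>\<^bsub>R\<^esub> sk k \<in> carrier R" by (rule right_mult_closed[OF k f])
    show "f a \<noteq> 0" if "(f \<otimes>\<^bsub>R\<^esub> sk k) a \<noteq> 0" using that unfolding sk_right[OF k f] by auto
    show "f \<otimes>\<^bsub>R\<^esub> sk k \<otimes>\<^bsub>R\<^esub> sk l = f \<otimes>\<^bsub>R\<^esub> sk (l * k)" if l: "l \<in> LC"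
      unfolding sk_right[OF l kf] sk_right[OF LCD(4)[OF l k] f] unfolding sk_right[OF k f]
    proof
      fix a
      have "f a * (a k * a l) = f a * a (l * k)"
        by (rule cases[OF f]) (subst M_hom(1)[OF _ l k], assumption, rule mult.commute)
      then show "f a * a k * a l = f a * a (l * k)" by (simp only: mult.assoc)
    qed
    show "(f \<oplus>\<^bsub>R\<^esub> g) \<otimes>\<^bsub>R\<^esub> sk k = f \<otimes>\<^bsub>R\<^esub> sk k \<oplus>\<^bsub>R\<^esub> g \<otimes>\<^bsub>R\<^esub> sk k" if g: "g \<in> carrier R"
      unfolding sk_right[OF k R_add_closed[OF f g]] sk_right[OF k f] sk_right[OF k g] unfolding R_simps(3) by (simp add: distrib_right)
    show "(\<ominus>\<^bsub>R\<^esub> f) \<otimes>\<^bsub>R\<^esub> sk k = f \<otimes>\<^bsub>R\<^esub> sk (- k)"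
      unfolding R_minus[OF f] sk_right[OF k R_minus_closed[OF f]] sk_right[OF LCD(5)[OF k] f]
    proof
      fix a
      have "f a * - a k = f a * a (- k)" by (rule cases[OF f]) (rule M_add[OF _ k, symmetric])
      then show "- f a * a k = f a * a (- k)" by (simp only: mult_minus_left mult_minus_right)
    qed
  next
    fix f assume f: "f \<in> carrier R"
    show "f \<otimes>\<^bsub>R\<^esub> sk 1 = f" unfolding sk_right[OF LCD(2) f]
    proof
      fix a show "f a * a 1 = f a" using cases[OF f, of a "a 1" 1] M_hom(2)[of a] by simp
    qed
  next
    fix k assume k: "k \<in> LC"
    show "\<zero>\<^bsub>R\<^esub> \<otimes>\<^bsub>R\<^esub> sk k = \<zero>\<^bsub>R\<^esub>"
      unfolding sk_right[OF k \<K>_R[OF \<K>_closed(3)]] unfolding R_simps(2) by simp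
  next
    fix f u assume fu: "f \<in> pinv" "u \<in> qinv"
    have "qmul q u (mon 0 f) = twist q (mon 0 f * twist (inverse q) u)"
      using twist_qmul_right[OF q0, of u f] twist_inverse(1) by metis
    then show "phi u \<otimes>\<^bsub>R\<^esub> sk (emb f) = phi (twist q (mon 0 f * twist (inverse q) u))"
      using phi_right[OF pinv_on qinv_on] fu by (simp only:)
  qed (auto simp only: B(3) span twist_add twist_inverse twist_qinv intro: subsetD[OF supp_twist])
qed

end

subsection \<open>Finite generation\<close>

lemma linear_factors_coeff_mem:
  assumes "subring_set S" "\<And>i. i \<in> I \<Longrightarrow> z i \<in> S"
  shows "Polynomial.coeff (\<Prod>i\<in>I. [:- z i, 1:]) k \<in> S"
  using assms(2)
proof (induction I arbitrary: k rule: infinite_finite_induct)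
  case (insert i I)
  have IH: "Polynomial.coeff (\<Prod>i\<in>I. [:- z i, 1:]) k \<in> S" for k using insert by blast
  have diff: "a \<in> S \<Longrightarrow> b \<in> S \<Longrightarrow> a - b \<in> S" for a b
    using subring_setD(3)[OF assms(1), of a "- b"] subring_setD(5)[OF assms(1), of b] by simp
  have "(\<Prod>i\<in>insert i I. [:- z i, 1:]) = [:- z i, 1:] * (\<Prod>i\<in>I. [:- z i, 1:])" using insert by simp
  then show ?case using IH insert.prems[of i] subring_setD(1,2,3,4,5)[OF assms(1)] diff
    by (auto simp: mult_pCons_left coeff_pCons split: nat.splits)
qed (auto simp: coeff_1 intro: subring_setD(1,2)[OF assms(1)])

text \<open>The polynomials in the \<open>y\<^sub>i\<close> with scalar coefficients; on the right of a product they are not affected by the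
  twist.\<close>

definition ypolys :: "'k::field qspace set" where
  "ypolys = {v. \<forall>\<beta>. \<exists>c. coef v \<beta> = mon 0 c}"

lemma ypolysD: "v \<in> ypolys \<Longrightarrow> qmul q u v = u * v"
  unfolding ypolys_def by (rule qmul_y_right) blast

lemma ypolys_mon [simp]: "mon \<beta> (mon 0 c) \<in> ypolys"
  by (auto simp: ypolys_def lookup_single when_def intro: exI[of _ 0])

lemma ypolys_add: "u \<in> ypolys \<Longrightarrow> v \<in> ypolys \<Longrightarrow> u + v \<in> ypolys"
  unfolding ypolys_def by (simp add: lookup_add) (metis single_add)

lemma ypolys_zero [simp]: "0 \<in> ypolys"
  by (auto simp: ypolys_def intro: exI[of _ 0])

lemma ypolys_sum: "(\<And>i. i \<in> I \<Longrightarrow> f i \<in> ypolys) \<Longrightarrow> sum f I \<in> ypolys"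
  by (induction I rule: infinite_finite_induct) (simp_all add: ypolys_add)

lemma subring_ypolys: "subring_set (ypolys :: 'k::field qspace set)"
  unfolding subring_set_def
proof (intro conjI ballI)
  show "(1 :: 'k qspace) \<in> ypolys" using ypolys_mon[of 0 "1::'k"] by simp
  fix u v :: "'k qspace" assume u: "u \<in> ypolys"
  show "- u \<in> ypolys" using u unfolding ypolys_def by (simp add: lookup_uminus) (metis single_uminus)
  assume v: "v \<in> ypolys"
  have "mon \<beta> (coef u \<beta>) * mon \<gamma> (coef v \<gamma>) \<in> ypolys" for \<beta> \<gamma>
  proof -
    obtain c d where "coef u \<beta> = mon 0 c" "coef v \<gamma> = mon 0 d" using u v unfolding ypolys_def by blast
    then show ?thesis by (simp add: mult_single)
  qed
  then have "(\<Sum>\<beta>\<in>supp u. \<Sum>\<gamma>\<in>supp v. mon \<beta> (coef u \<beta>) * mon \<gamma> (coef v \<gamma>)) \<in> ypolys"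
    by (intro ypolys_sum)
  then show "u * v \<in> ypolys" by (subst pm_expand[of u], subst pm_expand[of v]) (simp add: sum_product)
qed (simp_all add: ypolys_add)

lemma subring_qspace_on: "subring_set (qspace_on A :: 'k::field qspace set)"
  unfolding subring_set_def by (auto intro: qspace_on_add qspace_on_mult qspace_on_minus)

lemma ygen_ypolys: "ygen i \<in> ypolys"
  using ypolys_mon[of "mon i 1" 1] by (simp add: ygen_def)

lemma mon_ygen: "\<beta> \<in> exps_on {..<n} \<Longrightarrow> mon \<beta> (1 :: 'k::field mpoly) = (\<Prod>i<n. ygen i ^ coef \<beta> i)"
proof -
  assume \<beta>: "\<beta> \<in> exps_on {..<n}"
  have "ygen i ^ c = mon (mon i c) (1 :: 'k mpoly)" for i c
    by (induction c) (simp_all add: ygen_def mult_single single_add[symmetric])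
  then show ?thesis using sum_mon_exps[OF \<beta>] by (simp add: prod_mon)
qed

context gmpn
begin

abbreviation "ystairs \<equiv> staircase_monomials ygen n 0 :: 'k qspace set"

abbreviation "elementary \<equiv> range (Polynomial.coeff (\<Prod>i<n. [:- ygen i, 1 :: 'k qspace:]))"

abbreviation "gens \<equiv> {reynolds (mon 0 b * y) | b y. b \<in> mbasis \<and> y \<in> ystairs} \<union> elementary"

abbreviation "GR \<equiv> generate_ring R (sk ` \<Gamma>L \<union> phi ` gens)"

lemma elementary_ypolys: "e \<in> elementary \<Longrightarrow> e \<in> ypolys"
  using linear_factors_coeff_mem[OF subring_ypolys, of "{..<n}" ygen] ygen_ypolys by blast

lemma elementary_qinv: assumes "e \<in> elementary" shows "e \<in> qinv"
proof -
  obtain k where k: "e = Polynomial.coeff (\<Prod>i<n. [:- ygen i, 1:]) k" using assms by blast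
  have "e \<in> qspace_on {..<n}" unfolding k
    by (rule linear_factors_coeff_mem[OF subring_qspace_on]) (simp add: xygen_on)
  moreover have "tact h e = e" if h: "h \<in> G" for h
  proof -
    have "tact h e = Polynomial.coeff (\<Prod>i<n. [:- tact h (ygen i), 1:]) k" unfolding k
      by (rule hom_coeff_linear_factors) (simp_all add: tact_simps[OF h])
    also have "(\<Prod>i<n. [:- tact h (ygen i), 1:]) = (\<Prod>i<n. [:- ygen (snd h i), 1:])"
      by (rule prod.cong) (simp_all add: tact_gens[OF h])
    also have "\<dots> = (\<Prod>i<n. [:- ygen i, 1:])"
      using prod.permute[OF G_cases(2)[OF h], of "\<lambda>i. [:- ygen i, 1 :: 'k qspace:]"] by (simp add: o_def)
    finally show ?thesis unfolding k .
  qed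
  ultimately show ?thesis by (simp add: qinv_def)
qed

lemma ystairs_on: "y \<in> ystairs \<Longrightarrow> y \<in> qspace_on {..<n}"
  unfolding staircase_monomials_def
  by (auto intro!: subring_setD(8)[OF subring_qspace_on] subring_setD(6)[OF subring_qspace_on] xygen_on)

lemma gens_qinv: "gens \<subseteq> qinv"
proof (intro Un_least subsetI)
  fix u assume "u \<in> {reynolds (mon 0 b * y) | b y. b \<in> mbasis \<and> y \<in> ystairs}"
  then obtain b y where u: "b \<in> mbasis" "y \<in> ystairs" "u = reynolds (mon 0 b * y)" by blast
  show "u \<in> qinv" unfolding u(3)
    by (intro reynolds_closed qspace_on_mult qspace_on_mon mbasis_on ystairs_on exps_on_zero u)
qed (rule elementary_qinv)

lemma finite_gens: "finite gens"
proof (rule finite_UnI)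
  have "finite ystairs" unfolding staircase_monomials_eq by simp
  then have "finite ((\<lambda>(b, y). reynolds (mon 0 b * y)) ` (mbasis \<times> ystairs))" using finite_mbasis by blast
  then show "finite {reynolds (mon 0 b * y) | b y. b \<in> mbasis \<and> y \<in> ystairs}"
    by (rule rev_finite_subset) auto
  let ?p = "\<Prod>i<n. [:- ygen i, 1 :: 'k qspace:]"
  have "elementary \<subseteq> insert 0 (Polynomial.coeff ?p ` {..Polynomial.degree ?p})"
    using coeff_eq_0[of ?p] by (auto simp: not_le[symmetric])
  then show "finite elementary" by (rule finite_subset) simp
qed

lemma GR_U: "GR \<subseteq> U"
proof
  fix x assume "x \<in> GR"
  then show "x \<in> U"
  proof induction
    case (incl h)
    then show ?case using \<Gamma>_U gens_qinv by blast
  qed (use subringE(3,5,6,7)[OF subring_U] in blast)+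
qed

text \<open>The invariants already known to be generated.\<close>

definition Z :: "'k qspace set" where "Z = {u \<in> qinv. phi u \<in> GR}"

lemma Z_closed:
  "u \<in> Z \<Longrightarrow> v \<in> Z \<Longrightarrow> u + v \<in> Z" "u \<in> Z \<Longrightarrow> - u \<in> Z" "u \<in> Z \<Longrightarrow> v \<in> Z \<Longrightarrow> qmul q u v \<in> Z"
  "1 \<in> Z" "0 \<in> Z" "f \<in> pinv \<Longrightarrow> mon 0 f \<in> Z" "u \<in> gens \<Longrightarrow> u \<in> Z"
proof -
  show add: "u \<in> Z \<Longrightarrow> v \<in> Z \<Longrightarrow> u + v \<in> Z" for u v
    unfolding Z_def by (simp add: phi_add qinv_closed(1) generate_ring.eng_add)
  show minus: "u \<in> Z \<Longrightarrow> - u \<in> Z" for u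
    unfolding Z_def using phi_a_inv[OF qinv_on, of u] generate_ring.a_inv[of "phi u" R] by (simp add: qinv_closed(2))
  show "u \<in> Z \<Longrightarrow> v \<in> Z \<Longrightarrow> qmul q u v \<in> Z"
    unfolding Z_def by (simp add: phi_mult qinv_on qinv_qmul generate_ring.eng_mult)
  show one: "1 \<in> Z" unfolding Z_def by (simp add: phi_one qinv_closed(4) generate_ring.one)
  show "0 \<in> Z" using add[OF one minus[OF one]] by simp
  show "f \<in> pinv \<Longrightarrow> mon 0 f \<in> Z"
    unfolding Z_def using generate_ring.incl[of "sk (emb f)" "sk ` \<Gamma>L \<union> phi ` gens" R]
    by (simp add: phi_poly pinv_on mon_pinv)
  show "u \<in> gens \<Longrightarrow> u \<in> Z"
    unfolding Z_def using gens_qinv generate_ring.incl[of "phi u" "sk ` \<Gamma>L \<union> phi ` gens" R] by blast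
qed

abbreviation "yZ \<equiv> Z \<inter> ypolys"

text \<open>On polynomials in the \<open>y\<^sub>i\<close> both products agree, so the part of \<open>Z\<close> inside \<open>ypolys\<close> is a subring of a
  commutative ring and the staircase applies to the roots \<open>y\<^sub>i\<close>.\<close>

lemma subring_yZ: "subring_set yZ"
  unfolding subring_set_def
proof (intro conjI ballI)
  fix u v assume uv: "u \<in> yZ" "v \<in> yZ"
  have "u * v = qmul q u v" using uv(2) by (simp add: ypolysD)
  then show "u * v \<in> yZ" using uv Z_closed(3)[of u v] subring_setD(4)[OF subring_ypolys, of u v] by simp
qed (auto intro: Z_closed subring_setD[OF subring_ypolys])

lemma mon_ystairs: assumes "\<beta> \<in> E" shows "mon \<beta> 1 \<in> gspan yZ ystairs"
proof -
  have e: "Polynomial.coeff (\<Prod>i<n. [:- ygen i, 1:]) k \<in> yZ" for k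
    using Z_closed(7) elementary_ypolys by blast
  note span = staircase_span[OF subring_yZ e]
  show ?thesis unfolding mon_ygen[OF assms]
    by (intro subring_setD(8)[OF span(1)] subring_setD(6)[OF span(1)] span(3)) simp
qed

lemma mon_mbasis: assumes "f \<in> mpoly_on {..<n}" shows "mon 0 f \<in> gspan \<Gamma>0 (mon 0 ` mbasis)"
  using mbasis_span[OF assms]
proof induction
  case (gspan_step s b u)
  have "mon 0 (s * b + u) = mon 0 s * mon (0::exps) b + mon 0 u" by (simp add: single_add mult_single)
  then show ?case using gspan_step by (auto intro!: gspan.gspan_step)
qed (simp add: gspan_zero)

text \<open>Averaging \<open>(\<gamma> b) (s y)\<close> with \<open>\<gamma> \<in> \<Gamma>\<close> and \<open>s\<close> an invariant polynomial in the \<open>y\<^sub>i\<close> gives \<open>\<gamma> R(b y) s\<close>. Here \<open>\<gamma>\<close>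
  stands on the left and \<open>s\<close> on the right, the positions in which the commutative and the quantum product agree, so
  the result is a quantum product of generated elements.\<close>

lemma reynolds_span:
  assumes "v \<in> gspan \<Gamma>0 (mon 0 ` mbasis)" "w \<in> gspan yZ ystairs" shows "reynolds (v * w) \<in> Z"
proof -
  have inv: "tact h u = u" if "u \<in> Z" "h \<in> G" for u h using that unfolding Z_def qinv_def by blast
  have zero: "reynolds 0 = 0" by (simp add: reynolds_def qact_def)
  have b: "reynolds (mon 0 b * w) \<in> Z" if b: "b \<in> mbasis" for b
    using assms(2)
  proof induction
    case gspan_zero
    show ?case by (simp add: zero Z_closed(5))
  next
    case (gspan_step s y w)
    have "reynolds (mon 0 b * (s * y)) = reynolds (s * (mon 0 b * y))" by (simp only: ac_simps)
    also have "\<dots> = s * reynolds (mon 0 b * y)" using gspan_step(1) inv by (intro reynolds_mult) blast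
    also have "\<dots> = qmul q (reynolds (mon 0 b * y)) s" using gspan_step(1) by (simp add: ypolysD mult.commute)
    also have "\<dots> \<in> Z" using gspan_step(1,2) b by (intro Z_closed(3)[OF Z_closed(7)]) blast+
    finally show ?case unfolding distrib_left reynolds_add using gspan_step.IH by (rule Z_closed(1))
  qed
  show ?thesis using assms(1)
  proof induction
    case gspan_zero
    show ?case by (simp add: zero Z_closed(5))
  next
    case (gspan_step s c v)
    then obtain f b where f: "f \<in> pinv" "s = mon 0 f" "b \<in> mbasis" "c = mon 0 b" by blast
    have sZ: "s \<in> Z" using f Z_closed(6) by blast
    have "reynolds (s * c * w) = s * reynolds (c * w)" unfolding mult.assoc by (rule reynolds_mult[OF inv[OF sZ]])
    also have "\<dots> = qmul q s (reynolds (c * w))" unfolding f(2) qmul_x_left ..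
    also have "\<dots> \<in> Z" using sZ b[OF f(3)] f(4) by (intro Z_closed(3)) simp_all
    finally show ?case unfolding distrib_right reynolds_add using gspan_step.IH by (rule Z_closed(1))
  qed
qed

lemma qinv_Z: "u \<in> qinv \<Longrightarrow> u \<in> Z"
proof -
  assume u: "u \<in> qinv"
  have "reynolds u \<in> Z" using qinv_on[OF u]
  proof (induction u rule: qspace_on_induct)
    case (mon \<beta> a x)
    have "mon \<beta> (mon a x) = mon 0 (mon a x) * mon \<beta> 1" by (simp add: mult_single)
    then show ?case using mon by (auto intro!: reynolds_span mon_mbasis mon_ystairs mpoly_on_mon)
  qed (simp add: reynolds_add Z_closed(1))
  then show "u \<in> Z" using reynolds_id[OF u] by simp
qed

lemma U_finitely_generated: "\<exists>S. finite S \<and> S \<subseteq> U \<and> U = generate_ring R (sk ` \<Gamma>L \<union> S)"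
proof (intro exI conjI)
  show "finite (phi ` gens)" using finite_gens by blast
  show "phi ` gens \<subseteq> U" using gens_qinv by blast
  show "U = GR" using GR_U qinv_Z unfolding Z_def by blast
qed


lemma embedded_galois_ring_U: "embedded_galois_ring L \<Gamma>L M U"
proof -
  have "U \<subseteq> \<K>" using phi_\<K> by blast
  then show ?thesis unfolding embedded_galois_ring_def Let_def
    using subring_U \<Gamma>_U U_finitely_generated span_left span_right by blast
qed

lemma embedded_galois_order_U: "embedded_left_galois_order L \<Gamma>L M U" "embedded_right_galois_order L \<Gamma>L M U"
  unfolding embedded_left_galois_order_def embedded_right_galois_order_def Let_def
  using embedded_galois_ring_U left_order right_order by blast+

section \<open>Transport to the quantum affine space\<close>

abbreviation "Q \<equiv> quantum_invariant_ring q m p n"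
abbreviation "\<Gamma>Q \<equiv> polynomial_invariants q m p n"
abbreviation "ev \<equiv> qas_eval q n"

lemma Q_simps:
  "x \<oplus>\<^bsub>Q\<^esub> y = x \<oplus>\<^bsub>QA\<^esub> y" "x \<otimes>\<^bsub>Q\<^esub> y = x \<otimes>\<^bsub>QA\<^esub> y" "\<one>\<^bsub>Q\<^esub> = \<one>\<^bsub>QA\<^esub>" "\<zero>\<^bsub>Q\<^esub> = \<zero>\<^bsub>QA\<^esub>"
  unfolding quantum_invariant_ring_def by simp_all

lemma Q_D: "u \<in> carrier Q \<Longrightarrow> u \<in> carrier QA" "u \<in> carrier Q \<Longrightarrow> ev u \<in> qinv"
  unfolding quantum_invariants_eq by blast+

text \<open>Both \<open>\<Gamma>\<close> and the base field, as subsets of the quantum space, are preimages under \<open>qas_eval\<close>.\<close>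

lemma subring_preimage:
  assumes S: "subring_set S" "\<And>u v. u \<in> S \<Longrightarrow> v \<in> S \<Longrightarrow> qmul q u v \<in> S"
  shows "subring {u \<in> carrier QA. ev u \<in> S} QA"
proof (rule qas.subringI)
  show "\<one>\<^bsub>QA\<^esub> \<in> {u \<in> carrier QA. ev u \<in> S}"
    using subring_setD(2)[OF S(1)] by (simp only: mem_Collect_eq qas_eval_one qas.one_closed)
  fix u v assume u: "u \<in> {u \<in> carrier QA. ev u \<in> S}"
  show "\<ominus>\<^bsub>QA\<^esub> u \<in> {u \<in> carrier QA. ev u \<in> S}"
    using u subring_setD(5)[OF S(1)] by (simp only: mem_Collect_eq qas_eval_minus qas.a_inv_closed)
  assume v: "v \<in> {u \<in> carrier QA. ev u \<in> S}"
  show "u \<otimes>\<^bsub>QA\<^esub> v \<in> {u \<in> carrier QA. ev u \<in> S}"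
    using u v S(2) by (simp only: mem_Collect_eq qas_eval_mult qas.m_closed)
  show "u \<oplus>\<^bsub>QA\<^esub> v \<in> {u \<in> carrier QA. ev u \<in> S}"
    using u v subring_setD(3)[OF S(1)] by (simp only: mem_Collect_eq qas_eval_add qas.add.m_closed)
qed blast

lemma ring_Q: "Ring.ring Q"
proof -
  have "Q = QA\<lparr>carrier := {u \<in> carrier QA. ev u \<in> qinv}\<rparr>"
    unfolding quantum_invariants_eq[symmetric] by (simp add: quantum_invariant_ring_def)
  then show ?thesis using qas.subring_is_ring[OF subring_preimage[OF subring_qinv qinv_qmul]] by simp
qed

interpretation Q: ring Q by (rule ring_Q)

lemma Q_minus: assumes u: "u \<in> carrier Q" shows "\<ominus>\<^bsub>Q\<^esub> u = \<ominus>\<^bsub>QA\<^esub> u"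
proof -
  have "\<ominus>\<^bsub>QA\<^esub> u \<in> carrier Q"
    using u subring_setD(5)[OF subring_qinv] unfolding quantum_invariants_eq
    by (simp only: mem_Collect_eq qas_eval_minus qas.a_inv_closed)
  moreover have "\<ominus>\<^bsub>QA\<^esub> u \<oplus>\<^bsub>Q\<^esub> u = \<zero>\<^bsub>Q\<^esub>" unfolding Q_simps by (rule qas.l_neg[OF Q_D(1)[OF u]])
  ultimately show ?thesis using u by (intro Q.minus_equality)
qed

lemma subring_Q:
  assumes S: "subring_set S" "\<And>u v. u \<in> S \<Longrightarrow> v \<in> S \<Longrightarrow> qmul q u v \<in> S" "S \<subseteq> qinv"
  shows "subring {u \<in> carrier QA. ev u \<in> S} Q"
proof -
  let ?P = "{u \<in> carrier QA. ev u \<in> S}"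
  have "subring ?P QA" by (rule subring_preimage[OF S(1)]) (rule S(2))
  note sub = subringE[OF this]
  have PQ: "?P \<subseteq> carrier Q" unfolding quantum_invariants_eq using S(3) by blast
  show ?thesis
  proof (rule Q.subringI[OF PQ])
    show "\<one>\<^bsub>Q\<^esub> \<in> ?P" unfolding Q_simps by (rule sub(3))
    fix u v assume u: "u \<in> ?P"
    show "\<ominus>\<^bsub>Q\<^esub> u \<in> ?P" unfolding Q_minus[OF subsetD[OF PQ u]] by (rule sub(5)[OF u])
    assume v: "v \<in> ?P"
    show "u \<otimes>\<^bsub>Q\<^esub> v \<in> ?P" unfolding Q_simps by (rule sub(6)[OF u v])
    show "u \<oplus>\<^bsub>Q\<^esub> v \<in> ?P" unfolding Q_simps by (rule sub(7)[OF u v])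
  qed
qed

lemma \<Gamma>0_qinv: "\<Gamma>0 \<subseteq> qinv" using mon_pinv by blast

lemma \<Gamma>Q_eq: "\<Gamma>Q = {u \<in> carrier QA. ev u \<in> \<Gamma>0}"
  unfolding polynomial_invariants_eq by blast

lemma \<Gamma>Q_D: assumes "u \<in> \<Gamma>Q" shows "u \<in> carrier QA" "u \<in> carrier Q"
    "\<exists>f\<in>pinv. ev u = mon 0 f \<and> coef (ev u) 0 = f"
proof -
  obtain f where f: "u \<in> carrier QA" "f \<in> pinv" "ev u = mon 0 f"
    using assms unfolding polynomial_invariants_eq by blast
  then show "u \<in> carrier QA" "u \<in> carrier Q" "\<exists>f\<in>pinv. ev u = mon 0 f \<and> coef (ev u) 0 = f"
    unfolding quantum_invariants_eq using mon_pinv by (simp_all add: lookup_single)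
qed

lemma scalars_eq': "scalars QA = {u \<in> carrier QA. ev u \<in> range cst}"
  unfolding scalars_eq by blast

lemma range_cst: "(range cst :: 'k qspace set) \<subseteq> \<Gamma>0"
  unfolding cst_def using const_pinv by blast

lemma subring_cst: "subring_set (range cst :: 'k qspace set)"
  unfolding subring_set_def
proof (intro conjI ballI)
  show "(0 :: 'k qspace) \<in> range cst" "(1 :: 'k qspace) \<in> range cst"
    using rangeI[of cst "0::'k"] rangeI[of cst "1::'k"] by (simp_all add: cst_def)
  fix u v :: "'k qspace" assume "u \<in> range cst"
  then obtain a where u: "u = cst a" by blast
  show "- u \<in> range cst" unfolding u by (rule range_eqI[of _ _ "- a"]) (simp add: cst_def single_uminus)
  assume "v \<in> range cst"
  then obtain b where v: "v = cst b" by blast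
  show "u + v \<in> range cst" unfolding u v by (rule range_eqI[of _ _ "a + b"]) (simp add: cst_def single_add)
  show "u * v \<in> range cst" unfolding u v by (rule range_eqI[of _ _ "a * b"]) (simp add: cst_def mult_single)
qed

lemma qmul_\<Gamma>0: "u \<in> \<Gamma>0 \<Longrightarrow> qmul q u v = u * v"
  by (elim imageE) (simp only: qmul_x_left)

lemma subring_base: "subring \<Gamma>Q Q" "subring (scalars QA) Q" "scalars QA \<subseteq> \<Gamma>Q"
proof -
  show "subring \<Gamma>Q Q" unfolding \<Gamma>Q_eq
    by (rule subring_Q[OF subring_\<Gamma>0 _ \<Gamma>0_qinv]) (simp only: qmul_\<Gamma>0 subring_setD(4)[OF subring_\<Gamma>0])
  show "subring (scalars QA) Q" unfolding scalars_eq'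
    by (rule subring_Q[OF subring_cst _ subset_trans[OF range_cst \<Gamma>0_qinv]])
      (simp only: qmul_\<Gamma>0[OF subsetD[OF range_cst]] subring_setD(4)[OF subring_cst])
  show "scalars QA \<subseteq> \<Gamma>Q" unfolding scalars_eq' \<Gamma>Q_eq using range_cst by blast
qed

lemma ev_image: "S \<subseteq> qspace_on {..<n} \<Longrightarrow> ev ` {u \<in> carrier QA. ev u \<in> S} = S"
proof (intro subset_antisym subsetI)
  fix v assume S: "S \<subseteq> qspace_on {..<n}" and v: "v \<in> S"
  have eq: "ev (qas_of q n v) = v" by (rule qas_eval_of[OF subsetD[OF S v]])
  show "v \<in> ev ` {u \<in> carrier QA. ev u \<in> S}"
    by (rule image_eqI[of _ _ "qas_of q n v"]) (simp_all only: eq mem_Collect_eq qas_of_closed v)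
qed blast

text \<open>Reads the polynomial off from its position as the constant term in the \<open>y\<^sub>i\<close>.\<close>

definition iota :: "'k quantum_elt \<Rightarrow> 'k mpoly fract" where "iota u = emb (coef (ev u) 0)"

lemma iota_image: "iota ` {u \<in> carrier QA. ev u \<in> (\<lambda>f. mon 0 f) ` F} = emb ` F" if "F \<subseteq> pinv"
proof -
  have "(\<lambda>f. mon 0 f) ` F \<subseteq> qspace_on {..<n}" using that mon_pinv qinv_on by blast
  from ev_image[OF this]
  have "(\<lambda>v. emb (coef v 0)) ` ev ` {u \<in> carrier QA. ev u \<in> (\<lambda>f. mon 0 f) ` F} = (\<lambda>v. emb (coef v 0)) ` (\<lambda>f. mon (0::exps) f) ` F"
    by (rule arg_cong)
  then show ?thesis unfolding image_image iota_def[symmetric] by (simp only: lookup_single_eq)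
qed

lemma iota_hom: "iota \<in> ring_hom (Q\<lparr>carrier := \<Gamma>Q\<rparr>) L"
proof (rule ring_hom_memI)
  fix u assume "u \<in> carrier (Q\<lparr>carrier := \<Gamma>Q\<rparr>)"
  then have u: "u \<in> \<Gamma>Q" by simp
  obtain f where f: "f \<in> pinv" "ev u = mon 0 f" "coef (ev u) 0 = f" using \<Gamma>Q_D(3)[OF u] by blast
  show "iota u \<in> carrier L" unfolding iota_def f(3) using emb_rat_on[OF pinv_on[OF f(1)]] by simp
  fix v assume "v \<in> carrier (Q\<lparr>carrier := \<Gamma>Q\<rparr>)"
  then have v: "v \<in> \<Gamma>Q" by simp
  obtain g where g: "g \<in> pinv" "ev v = mon 0 g" "coef (ev v) 0 = g" using \<Gamma>Q_D(3)[OF v] by blast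
  have "ev (u \<otimes>\<^bsub>QA\<^esub> v) = mon 0 (f * g)"
    unfolding qas_eval_mult[OF \<Gamma>Q_D(1)[OF u] \<Gamma>Q_D(1)[OF v]] f(2) g(2) qmul_x_left by (simp add: mult_single)
  then show "iota (u \<otimes>\<^bsub>Q\<lparr>carrier := \<Gamma>Q\<rparr>\<^esub> v) = iota u \<otimes>\<^bsub>L\<^esub> iota v"
    unfolding iota_def f(3) g(3) by (simp add: Q_simps emb_simps)
  show "iota (u \<oplus>\<^bsub>Q\<lparr>carrier := \<Gamma>Q\<rparr>\<^esub> v) = iota u \<oplus>\<^bsub>L\<^esub> iota v"
    unfolding iota_def by (simp add: Q_simps qas_eval_add \<Gamma>Q_D(1) u v lookup_add emb_simps)
next
  have "iota \<one>\<^bsub>QA\<^esub> = 1" unfolding iota_def qas_eval_one by (simp add: lookup_one emb_simps)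
  then show "iota \<one>\<^bsub>Q\<lparr>carrier := \<Gamma>Q\<rparr>\<^esub> = \<one>\<^bsub>L\<^esub>" by (simp add: Q_simps)
qed

lemma iota_inj: "inj_on iota \<Gamma>Q"
proof (rule inj_onI)
  fix u v assume u: "u \<in> \<Gamma>Q" and v: "v \<in> \<Gamma>Q" and eq: "iota u = iota v"
  have "coef (ev u) 0 = coef (ev v) 0" using eq unfolding iota_def emb_simps .
  then have "ev u = ev v" using \<Gamma>Q_D(3)[OF u] \<Gamma>Q_D(3)[OF v] by metis
  then show "u = v" by (rule qas_eval_inj[OF \<Gamma>Q_D(1)[OF u] \<Gamma>Q_D(1)[OF v]])
qed

lemma phi_ev_iso: "(\<lambda>u. phi (ev u)) \<in> ring_iso Q (R\<lparr>carrier := U\<rparr>)"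
  unfolding ring_iso_def
proof (intro CollectI conjI)
  show "(\<lambda>u. phi (ev u)) \<in> ring_hom Q (R\<lparr>carrier := U\<rparr>)"
  proof (rule ring_hom_memI)
    fix u assume u: "u \<in> carrier Q"
    show "phi (ev u) \<in> carrier (R\<lparr>carrier := U\<rparr>)" using Q_D(2)[OF u] by simp
    fix v assume v: "v \<in> carrier Q"
    show "phi (ev (u \<otimes>\<^bsub>Q\<^esub> v)) = phi (ev u) \<otimes>\<^bsub>R\<lparr>carrier := U\<rparr>\<^esub> phi (ev v)"
      by (simp add: Q_simps qas_eval_mult Q_D(1) u v phi_mult qinv_on[OF Q_D(2)])
    show "phi (ev (u \<oplus>\<^bsub>Q\<^esub> v)) = phi (ev u) \<oplus>\<^bsub>R\<lparr>carrier := U\<rparr>\<^esub> phi (ev v)"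
      by (simp add: Q_simps qas_eval_add Q_D(1) u v phi_add)
  next
    show "phi (ev \<one>\<^bsub>Q\<^esub>) = \<one>\<^bsub>R\<lparr>carrier := U\<rparr>\<^esub>" by (simp add: Q_simps qas_eval_one phi_one)
  qed
  have "ev ` carrier Q = qinv"
    unfolding quantum_invariants_eq by (rule ev_image) (use qinv_on in blast)
  then have "(\<lambda>u. phi (ev u)) ` carrier Q = U" unfolding image_image[symmetric] by (simp only:)
  moreover have "inj_on (\<lambda>u. phi (ev u)) (carrier Q)"
  proof (rule inj_onI)
    fix u v assume u: "u \<in> carrier Q" and v: "v \<in> carrier Q" and eq: "phi (ev u) = phi (ev v)"
    have "ev u = ev v" by (rule phi_inj[OF qinv_on[OF Q_D(2)[OF u]] qinv_on[OF Q_D(2)[OF v]] eq])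
    then show "u = v" by (rule qas_eval_inj[OF Q_D(1)[OF u] Q_D(1)[OF v]])
  qed
  ultimately show "bij_betw (\<lambda>u. phi (ev u)) (carrier Q) (carrier (R\<lparr>carrier := U\<rparr>))"
    unfolding bij_betw_def by simp
qed

theorem galois_order_invariants: "galois_order TYPE('k mpoly fract) (scalars QA) \<Gamma>Q Q"
proof -
  have \<Gamma>: "iota ` \<Gamma>Q = \<Gamma>L" unfolding \<Gamma>Q_eq by (rule iota_image) blast
  have "range cst = (\<lambda>f. mon 0 f :: 'k qspace) ` range (mon 0)" unfolding cst_def by blast
  then have F: "iota ` scalars QA = range (\<lambda>c. emb (mon 0 c))"
    using iota_image[of "range (mon 0)"] const_pinv unfolding scalars_eq' by (simp add: image_subset_iff image_image)
  have "\<forall>\<gamma>\<in>\<Gamma>Q. phi (ev \<gamma>) = sk (iota \<gamma>)"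
  proof
    fix u assume "u \<in> \<Gamma>Q"
    then obtain f where f: "f \<in> pinv" "ev u = mon 0 f" "coef (ev u) 0 = f" using \<Gamma>Q_D(3) by blast
    show "phi (ev u) = sk (iota u)" unfolding iota_def f(3) unfolding f(2) by (rule phi_poly[OF pinv_on[OF f(1)]])
  qed
  then have "iota \<in> ring_hom (Q\<lparr>carrier := \<Gamma>Q\<rparr>) L \<and> inj_on iota \<Gamma>Q \<and>
        galois_setting L (iota ` scalars QA) (iota ` \<Gamma>Q) M \<and>
        embedded_left_galois_order L (iota ` \<Gamma>Q) M U \<and> embedded_right_galois_order L (iota ` \<Gamma>Q) M U \<and>
        (\<lambda>u. phi (ev u)) \<in> ring_iso Q (R\<lparr>carrier := U\<rparr>) \<and>
        (\<forall>\<gamma>\<in>\<Gamma>Q. phi (ev \<gamma>) = sk (iota \<gamma>))"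
    unfolding \<Gamma> F by (intro conjI iota_hom iota_inj galois_setting_L embedded_galois_order_U phi_ev_iso)
  then show ?thesis unfolding galois_order_def
    by (intro conjI ring_Q subring_base exI[of _ L] exI[of _ M] exI[of _ U] exI[of _ iota] exI[of _ "\<lambda>u. phi (ev u)"])
      blast+
qed

subsection \<open>Freeness\<close>

text \<open>The basis of \<open>qinv_free\<close> is pulled back along \<open>T\<close>. Left freeness takes \<open>T\<close> to be the evaluation, right
  freeness its composite with the twist; \<open>act\<close> is multiplication on the respective side.\<close>

lemma free_transport:
  assumes T: "bij_betw T (carrier Q) qinv" "T ` \<Gamma>Q = \<Gamma>0"
      "\<And>u v. u \<in> carrier Q \<Longrightarrow> v \<in> carrier Q \<Longrightarrow> T (u \<oplus>\<^bsub>Q\<^esub> v) = T u + T v"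
    and act: "\<And>c b. c \<in> \<Gamma>Q \<Longrightarrow> b \<in> carrier Q \<Longrightarrow> act c b \<in> carrier Q"
      "\<And>c b. c \<in> \<Gamma>Q \<Longrightarrow> b \<in> carrier Q \<Longrightarrow> T (act c b) = T c * T b"
  shows "\<exists>B\<subseteq>carrier Q. \<forall>u\<in>carrier Q.
     \<exists>!c. c \<in> coefficients Q \<Gamma>Q B \<and> u = (\<Oplus>\<^bsub>Q\<^esub>b\<in>{b. c b \<noteq> \<zero>\<^bsub>Q\<^esub>}. act (c b) b)"
proof -
  obtain B0 where B0: "B0 \<subseteq> qinv" "\<And>u. u \<in> qinv \<Longrightarrow> u \<in> gspan \<Gamma>0 B0"
    and indep: "\<And>F l b. finite F \<Longrightarrow> F \<subseteq> B0 \<Longrightarrow> (\<And>b. b \<in> F \<Longrightarrow> l b \<in> pinv) \<Longrightarrow>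
      (\<Sum>b\<in>F. mon 0 (l b) * b) = 0 \<Longrightarrow> b \<in> F \<Longrightarrow> l b = 0" by (rule qinv_free) blast
  have inj: "inj_on T (carrier Q)" and im: "T ` carrier Q = qinv" using T(1) unfolding bij_betw_def by blast+
  define B where "B = {b \<in> carrier Q. T b \<in> B0}"
  have BQ: "B \<subseteq> carrier Q" unfolding B_def by blast
  have \<Gamma>Q: "\<Gamma>Q \<subseteq> carrier Q" using \<Gamma>Q_D(2) by blast
  have T0: "T \<zero>\<^bsub>Q\<^esub> = 0" using T(3)[OF Q.zero_closed Q.zero_closed] Q.l_zero[OF Q.zero_closed] by simp
  have T_sum: "T (\<Oplus>\<^bsub>Q\<^esub>b\<in>F. f b) = (\<Sum>b\<in>F. T (f b))" if "finite F" "\<And>b. b \<in> F \<Longrightarrow> f b \<in> carrier Q" for F f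
    using that
  proof (induction F rule: finite_induct)
    case empty
    show ?case by (simp only: Q.finsum_empty T0 sum.empty)
  next
    case (insert b F)
    have c: "f \<in> F \<rightarrow> carrier Q" "f b \<in> carrier Q" using insert.prems by blast+
    have "T (f b \<oplus>\<^bsub>Q\<^esub> (\<Oplus>\<^bsub>Q\<^esub>b\<in>F. f b)) = T (f b) + T (\<Oplus>\<^bsub>Q\<^esub>b\<in>F. f b)"
      by (rule T(3)[OF c(2) Q.finsum_closed[OF c(1)]])
    then show ?case unfolding Q.finsum_insert[OF insert.hyps c] sum.insert[OF insert.hyps]
      using insert.IH insert.prems by simp
  qed
  define comb where "comb c = (\<Oplus>\<^bsub>Q\<^esub>b\<in>{b. c b \<noteq> \<zero>\<^bsub>Q\<^esub>}. act (c b) b)" for c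
  have coefD: "{b. c b \<noteq> \<zero>\<^bsub>Q\<^esub>} \<subseteq> B" "finite {b. c b \<noteq> \<zero>\<^bsub>Q\<^esub>}" "\<And>b. b \<in> B \<Longrightarrow> c b \<in> \<Gamma>Q"
    if c: "c \<in> coefficients Q \<Gamma>Q B" for c using c unfolding coefficients_def by blast+
  have comb: "comb c \<in> carrier Q" "\<And>F. finite F \<Longrightarrow> {b. c b \<noteq> \<zero>\<^bsub>Q\<^esub>} \<subseteq> F \<Longrightarrow> F \<subseteq> B \<Longrightarrow> T (comb c) = (\<Sum>b\<in>F. T (c b) * T b)"
    if c: "c \<in> coefficients Q \<Gamma>Q B" for c
  proof -
    have closed: "act (c b) b \<in> carrier Q" "T (act (c b) b) = T (c b) * T b" if "b \<in> B" for b
      using act that coefD(3)[OF c that] BQ by blast+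
    show "comb c \<in> carrier Q" unfolding comb_def using closed(1) coefD(1)[OF c] by (intro Q.finsum_closed) blast
    fix F assume F: "finite F" "{b. c b \<noteq> \<zero>\<^bsub>Q\<^esub>} \<subseteq> F" "F \<subseteq> B"
    have "T (comb c) = (\<Sum>b\<in>{b. c b \<noteq> \<zero>\<^bsub>Q\<^esub>}. T (act (c b) b))" unfolding comb_def
      by (rule T_sum[OF coefD(2)[OF c]]) (use closed(1) coefD(1)[OF c] in blast)
    also have "\<dots> = (\<Sum>b\<in>{b. c b \<noteq> \<zero>\<^bsub>Q\<^esub>}. T (c b) * T b)"
      by (rule sum.cong[OF refl], rule closed(2)) (use coefD(1)[OF c] in blast)
    also have "\<dots> = (\<Sum>b\<in>F. T (c b) * T b)"
    proof (rule sum.mono_neutral_left[OF F(1,2)], rule ballI)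
      fix b assume "b \<in> F - {b. c b \<noteq> \<zero>\<^bsub>Q\<^esub>}"
      then have "c b = \<zero>\<^bsub>Q\<^esub>" by blast
      then show "T (c b) * T b = 0" by (simp only: T0 mult_zero_left)
    qed
    finally show "T (comb c) = (\<Sum>b\<in>F. T (c b) * T b)" .
  qed
  have "\<exists>!c. c \<in> coefficients Q \<Gamma>Q B \<and> u = comb c" if u: "u \<in> carrier Q" for u
  proof (rule ex_ex1I)
    have "T u \<in> qinv" unfolding im[symmetric] by (rule imageI[OF u])
    from gspan_finite[OF B0(2)[OF this] subring_\<Gamma>0]
    obtain F d where F: "finite F" "F \<subseteq> B0" "\<forall>b. d b \<in> \<Gamma>0" "T u = (\<Sum>b\<in>F. d b * b)"
      by (elim exE conjE)
    \<comment> \<open>the coefficients of \<open>T u\<close>, pulled back; zero off the finite set that occurs\<close>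
    define c where "c b = (if b \<in> B \<and> T b \<in> F then inv_into \<Gamma>Q T (d (T b)) else \<zero>\<^bsub>Q\<^esub>)" for b
    have inv: "inv_into \<Gamma>Q T (d b) \<in> \<Gamma>Q" "T (inv_into \<Gamma>Q T (d b)) = d b" for b
      using spec[OF F(3), of b] unfolding T(2)[symmetric] by (rule inv_into_into, rule f_inv_into_f)
    let ?F = "{b \<in> B. T b \<in> F}"
    have bij: "bij_betw T ?F F" unfolding bij_betw_def
    proof
      show "inj_on T ?F" by (rule inj_on_subset[OF inj]) (use BQ in blast)
      have "b \<in> T ` ?F" if "b \<in> F" for b
      proof -
        have "b \<in> T ` carrier Q" using that F(2) B0(1) im by blast
        then show ?thesis using that F(2) unfolding B_def by blast
      qed
      then show "T ` ?F = F" by blast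
    qed
    then have finF: "finite ?F" using F(1) bij_betw_finite by blast
    have supp: "{b. c b \<noteq> \<zero>\<^bsub>Q\<^esub>} \<subseteq> ?F"
    proof
      fix b assume "b \<in> {b. c b \<noteq> \<zero>\<^bsub>Q\<^esub>}"
      then have "c b \<noteq> \<zero>\<^bsub>Q\<^esub>" by blast
      then have "b \<in> B \<and> T b \<in> F" unfolding c_def by presburger
      then show "b \<in> ?F" by blast
    qed
    have z: "\<zero>\<^bsub>Q\<^esub> \<in> \<Gamma>Q" by (rule subringE(2)[OF subring_base(1)])
    have "c b \<in> \<Gamma>Q" for b unfolding c_def using inv(1)[of "T b"] z by presburger
    moreover have "c b = \<zero>\<^bsub>Q\<^esub>" if "b \<notin> B" for b unfolding c_def using that by presburger
    ultimately have c: "c \<in> coefficients Q \<Gamma>Q B"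
      unfolding coefficients_def using finite_subset[OF supp finF] by (intro CollectI conjI Pi_I allI impI)
    have "T (comb c) = (\<Sum>b\<in>?F. T (c b) * T b)" by (rule comb(2)[OF c finF supp]) blast
    also have "\<dots> = (\<Sum>b\<in>?F. d (T b) * T b)"
    proof (rule sum.cong[OF refl])
      fix b assume "b \<in> ?F"
      then have "c b = inv_into \<Gamma>Q T (d (T b))" unfolding c_def by simp
      then show "T (c b) * T b = d (T b) * T b" by (simp only: inv(2))
    qed
    also have "\<dots> = T u" unfolding F(4) by (rule sum.reindex_bij_betw[OF bij])
    finally have "u = comb c" using inj_onD[OF inj _ u comb(1)[OF c]] by simp
    with c show "\<exists>c. c \<in> coefficients Q \<Gamma>Q B \<and> u = comb c" by blast
  next
    fix c c' assume "c \<in> coefficients Q \<Gamma>Q B \<and> u = comb c" "c' \<in> coefficients Q \<Gamma>Q B \<and> u = comb c'"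
    then have c: "c \<in> coefficients Q \<Gamma>Q B" and c': "c' \<in> coefficients Q \<Gamma>Q B" and eq: "comb c = comb c'" by blast+
    let ?F = "{b. c b \<noteq> \<zero>\<^bsub>Q\<^esub>} \<union> {b. c' b \<noteq> \<zero>\<^bsub>Q\<^esub>}"
    have F: "finite ?F" "?F \<subseteq> B" using coefD(1,2)[OF c] coefD(1,2)[OF c'] by blast+
    have "\<exists>f\<in>pinv. T (c b) - T (c' b) = mon 0 f" if b: "b \<in> B" for b
    proof -
      have "T (c b) \<in> \<Gamma>0" "T (c' b) \<in> \<Gamma>0" using coefD(3)[OF c b] coefD(3)[OF c' b] T(2) by blast+
      then have "T (c b) + - T (c' b) \<in> \<Gamma>0" by (intro subring_setD(3,5)[OF subring_\<Gamma>0])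
      then show ?thesis by auto
    qed
    then obtain f where f: "\<And>b. b \<in> B \<Longrightarrow> f b \<in> pinv" "\<And>b. b \<in> B \<Longrightarrow> T (c b) - T (c' b) = mon 0 (f b)" by metis
    have injF: "inj_on T ?F" by (rule inj_on_subset[OF inj]) (use F(2) BQ in blast)
    \<comment> \<open>the differences of the coefficients, indexed by the images of the basis elements\<close>
    let ?l = "\<lambda>b. f (inv_into ?F T b)"
    have "(\<Sum>b\<in>T ` ?F. mon 0 (?l b) * b) = (\<Sum>b\<in>?F. mon 0 (f b) * T b)"
      unfolding sum.reindex[OF injF] by (rule sum.cong[OF refl]) (simp only: o_def inv_into_f_f[OF injF])
    also have "\<dots> = (\<Sum>b\<in>?F. T (c b) * T b) - (\<Sum>b\<in>?F. T (c' b) * T b)"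
      unfolding sum_subtractf[symmetric] left_diff_distrib[symmetric]
      by (rule sum.cong[OF refl]) (use f(2) F(2) in \<open>simp add: subset_iff\<close>)
    also have "\<dots> = 0" using comb(2)[OF c F(1) _ F(2)] comb(2)[OF c' F(1) _ F(2)] eq by simp
    finally have zero: "(\<Sum>b\<in>T ` ?F. mon 0 (?l b) * b) = 0" .
    have l0: "?l b = 0" if b: "b \<in> T ` ?F" for b
    proof (rule indep[OF finite_imageI[OF F(1)] _ _ zero b])
      show "T ` ?F \<subseteq> B0" using F(2) unfolding B_def by blast
      show "?l b \<in> pinv" if b: "b \<in> T ` ?F" for b
        by (rule f(1)[OF subsetD[OF F(2) inv_into_into[OF b]]])
    qed
    show "c = c'"
    proof (rule HOL.ext)
      fix b show "c b = c' b"
      proof (cases "b \<in> ?F")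
        case True
        have "f b = 0" using l0[OF imageI[OF True]] unfolding inv_into_f_f[OF injF True] .
        moreover have bB: "b \<in> B" using True F(2) by blast
        ultimately have "T (c b) = T (c' b)" using f(2)[OF bB] by simp
        then show ?thesis by (rule inj_onD[OF inj]) (use coefD(3)[OF c bB] coefD(3)[OF c' bB] \<Gamma>Q in blast)+
      next
        case False
        then have "c b = \<zero>\<^bsub>Q\<^esub>" "c' b = \<zero>\<^bsub>Q\<^esub>" by blast+
        then show ?thesis by (simp only:)
      qed
    qed
  qed
  then show ?thesis using BQ unfolding comb_def by blast
qed

lemma ev_bij: "bij_betw ev (carrier Q) qinv"
  unfolding bij_betw_def
proof
  show "inj_on ev (carrier Q)" by (rule inj_onI) (rule qas_eval_inj[OF Q_D(1) Q_D(1)])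
  show "ev ` carrier Q = qinv" unfolding quantum_invariants_eq by (rule ev_image) (use qinv_on in blast)
qed

lemma ev_\<Gamma>: "ev ` \<Gamma>Q = \<Gamma>0"
  unfolding \<Gamma>Q_eq by (rule ev_image) (use \<Gamma>0_qinv qinv_on in blast)

theorem left_free_invariants: "left_free Q \<Gamma>Q"
  unfolding left_free_def
proof (rule free_transport[OF ev_bij ev_\<Gamma>])
  show "ev (u \<oplus>\<^bsub>Q\<^esub> v) = ev u + ev v" if "u \<in> carrier Q" "v \<in> carrier Q" for u v
    unfolding Q_simps by (rule qas_eval_add[OF Q_D(1)[OF that(1)] Q_D(1)[OF that(2)]])
  fix c b assume c: "c \<in> \<Gamma>Q" and b: "b \<in> carrier Q"
  show "c \<otimes>\<^bsub>Q\<^esub> b \<in> carrier Q" by (rule Q.m_closed[OF \<Gamma>Q_D(2)[OF c] b])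
  have "ev c \<in> \<Gamma>0" using c unfolding \<Gamma>Q_eq by blast
  then show "ev (c \<otimes>\<^bsub>Q\<^esub> b) = ev c * ev b"
    unfolding Q_simps qas_eval_mult[OF \<Gamma>Q_D(1)[OF c] Q_D(1)[OF b]] by (rule qmul_\<Gamma>0)
qed

theorem right_free_invariants: "right_free Q \<Gamma>Q"
  unfolding right_free_def
proof (rule free_transport)
  let ?T = "twist (inverse q)"
  have "bij_betw ?T qinv qinv"
    by (rule bij_betw_byWitness[where f' = "twist q"]) (auto simp: twist_qinv)
  then have "bij_betw (?T \<circ> ev) (carrier Q) qinv" by (rule bij_betw_trans[OF ev_bij])
  then show "bij_betw (\<lambda>u. ?T (ev u)) (carrier Q) qinv" unfolding o_def .
  have T\<Gamma>: "?T u = u" if "u \<in> \<Gamma>0" for u using that by (auto simp: twist_mon)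
  have "?T ` ev ` \<Gamma>Q = \<Gamma>0" unfolding ev_\<Gamma> using T\<Gamma> by force
  then show "(\<lambda>u. ?T (ev u)) ` \<Gamma>Q = \<Gamma>0" unfolding image_image .
  show "?T (ev (u \<oplus>\<^bsub>Q\<^esub> v)) = ?T (ev u) + ?T (ev v)" if "u \<in> carrier Q" "v \<in> carrier Q" for u v
    unfolding Q_simps qas_eval_add[OF Q_D(1)[OF that(1)] Q_D(1)[OF that(2)]] by (rule twist_add)
  fix c b assume c: "c \<in> \<Gamma>Q" and b: "b \<in> carrier Q"
  show "b \<otimes>\<^bsub>Q\<^esub> c \<in> carrier Q" by (rule Q.m_closed[OF b \<Gamma>Q_D(2)[OF c]])
  obtain f where f: "f \<in> pinv" "ev c = mon 0 f" using \<Gamma>Q_D(3)[OF c] by blast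
  have "ev c \<in> \<Gamma>0" using c unfolding \<Gamma>Q_eq by blast
  then have "?T (ev c) = mon 0 f" unfolding f(2) by (rule T\<Gamma>)
  then show "?T (ev (b \<otimes>\<^bsub>Q\<^esub> c)) = ?T (ev c) * ?T (ev b)"
    unfolding Q_simps qas_eval_mult[OF Q_D(1)[OF b] \<Gamma>Q_D(1)[OF c]] f(2) by (simp only: twist_qmul_right[OF q0])
qed

end

theorem theorem5:
  fixes q :: "'k::{alg_closed_field, field_char_0}" and m p n :: nat
  assumes "q \<noteq> 0" and "\<And>j::nat. j > 0 \<Longrightarrow> q ^ j \<noteq> 1"
    and "n \<ge> 1" and "m \<ge> 1" and "p > 0" and "p dvd m"
  shows "galois_order TYPE(((nat \<Rightarrow>\<^sub>0 nat) \<Rightarrow>\<^sub>0 'k) fract)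
           (scalars (quantum_affine_space q n))
           (polynomial_invariants q m p n) (quantum_invariant_ring q m p n) \<and>
         left_free (quantum_invariant_ring q m p n) (polynomial_invariants q m p n) \<and>
         right_free (quantum_invariant_ring q m p n) (polynomial_invariants q m p n)"
proof -
  interpret gmpn q m p n by (rule gmpn.intro) (fact assms)+
  show ?thesis using galois_order_invariants left_free_invariants right_free_invariants by blast
qed

end
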